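(* Let $d\in\mathbb{N}$, $\rho>0$, $\vartheta_1\ge 1$, $\vartheta_2\ge 0$. Let $A=(a^{ij})_{i,j=1}^d:\mathbb{R}^d\to\mathbb{R}^{d\times d}$, $b:\mathbb{R}^d\to\mathbb{C}^d$, $c:\mathbb{R}^d\to\mathbb{C}$ satisfy Assumption $\mathcal{A}(\rho,\vartheta_1,\vartheta_2)$ (defined in the context), let $Lu=-\operatorname{div}(A\nabla u)+b^{\mathrm T}\nabla u+cu$, and let $$\mu>33\,d\,\vartheta_1^{11/2}\,\vartheta_2\,\rho .$$ Then there exist constants $\alpha_0=\alpha_0(d,\rho,\vartheta_1,\vartheta_2,\mu,\|b\|_\infty,\|c\|_\infty)$ and $C=C(d,\vartheta_1,\rho\vartheta_2,\mu)>0$, namely the ones given by the explicit formulas in the context, such that for all $\alpha\ge\alpha_0$ and all complex-valued $u\in W^{2,2}(\mathbb{R}^d)$ with support in $B_\rho\setminus\{0\}$ we have $$\int_{\mathbb{R}^d}\Bigl(\alpha\rho^2\, w_{\rho,\mu}^{1-2\alpha}\,\nabla u^{\mathrm T}A\,\overline{\nabla u}+\alpha^3\, w_{\rho,\mu}^{-1-2\alpha}\,|u|^2\Bigr)\,\mathrm{d}x\;\le\; C\rho^4\int_{\mathbb{R}^d} w_{\rho,\mu}^{2-2\alpha}\,|Lu|^2\,\mathrm{d}x .$$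
   Context: Notation. $B_\rho\subset\mathbb{R}^d$ is the open ball of radius $\rho$ centered at $0$; $|z|$ is the Euclidean norm of $z\in\mathbb{C}^d$; $\|M\|_\infty$ is the row sum norm $\max_i\sum_j|m_{ij}|$ of a matrix $M$. Derivatives are weak derivatives. $\|b\|_\infty$ and $\|c\|_\infty$ are the $L^\infty(B_\rho)$-norms of $|b|$ and $|c|$. The support of $u$ is a closed subset of $\mathbb{R}^d$ contained in $B_\rho\setminus\{0\}$; integrands are understood to be zero outside the support of $u$. Assumption $\mathcal{A}(\rho,\vartheta_1,\vartheta_2)$: $b,c\in L^\infty(B_\rho)$, $a^{ij}=a^{ji}$ for all $i,j\in\{1,\dots,d\}$, and for all $x,y\in B_\rho$ and all $\xi\in\mathbb{R}^d$, $$\vartheta_1^{-1}|\xi|^2\le\xi^{\mathrm T}A(x)\xi\le\vartheta_1|\xi|^2\quad\text{and}\quad\|A(x)-A(y)\|_\infty\le\vartheta_2|x-y|.$$ Weight function. Put $A_0=A(0)$, $\sigma(x)=(x^{\mathrm T}A_0^{-1}x)^{1/2}$ for $x\in\mathbb{R}^d$, and $$\varphi(r)=r\exp\Bigl(-\int_0^r\frac{1-\mathrm{e}^{-\mu t}}{t}\,\mathrm{d}t\Bigr)\quad(r\ge0),\qquad w_{\rho,\mu}(x)=\varphi(\sigma(x/\rho)).$$ Constants. Let $\mu_1=\mathrm{e}^{\sqrt{\vartheta_1}\mu}$ if $\sqrt{\vartheta_1}\mu\le1$ and $\mu_1=\mathrm{e}\sqrt{\vartheta_1}\mu$ if $\sqrt{\vartheta_1}\mu\ge1$.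 Define $$C_F'=3d\vartheta_1^{7/2}\rho\vartheta_2,\qquad C_M=11d\vartheta_1^{11/2}\rho\vartheta_2,\qquad C_\mu=\mu-3C_M,$$ $$C_F=\mathrm{e}^{\mu\sqrt{\vartheta_1}}\bigl(\sqrt{\vartheta_1}(C_F'+\mu)+|d-2|\bigr),\qquad C_\psi=\mu\,\mathrm{e}^{\mu\sqrt{\vartheta_1}}\vartheta_1^2\bigl(\sqrt{\vartheta_1}(C_F'+\mu)+d-1\bigr),$$ $$K=\max\bigl\{d\,C_\psi,\;6\mu\mu_1\mathrm{e}^{\mu\sqrt{\vartheta_1}}\vartheta_1^2\bigr\},\qquad t_1=\tfrac18K\vartheta_1^{5/2}\mu_1^2\,\mathrm{e}^{2\mu\sqrt{\vartheta_1}},$$ $$p=C_\mu\frac{\mathrm{e}^{-2\mu\sqrt{\vartheta_1}}}{(\vartheta_1\mu_1)^2},\qquad q=C_\mu C_F\frac{\mathrm{e}^{-2\mu\sqrt{\vartheta_1}}}{(\vartheta_1\mu_1)^2}+K\Bigl(t_1+\frac{\sqrt{\vartheta_1}}2\Bigr),\qquad r=K\Bigl(1+\frac{C_F^2\vartheta_1^2}{2}\Bigr),$$ $$\alpha_1=K\vartheta_1^{9/2}\mu_1^2\,\mathrm{e}^{2\mu\sqrt{\vartheta_1}},\qquad \alpha_2=\frac qp+\sqrt{\frac{q^2}{p^2}+\frac{2r}{p}},\qquad \tilde\alpha_0=\max\{\alpha_1,\alpha_2\},$$ $$K_1=\frac K2+(\vartheta_1\mu_1)^2\,\mathrm{e}^{2\mu\sqrt{\vartheta_1}},\qquad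 K_5=\frac12C_\mu\frac{\mathrm{e}^{-2\mu\sqrt{\vartheta_1}}}{(\vartheta_1\mu_1)^2},\qquad \tilde C=\frac{K_1}{K_5}.$$ The constants of the theorem are $$C=6\tilde C,\qquad \alpha_0=\max\Bigl\{\tilde\alpha_0,\;C\rho^2\|b\|_\infty^2\vartheta_1^{3/2},\;C^{1/3}\rho^{4/3}\|c\|_\infty^{2/3}\sqrt{\vartheta_1}\Bigr\}.$$ *)

theory Defs
  imports "HOL-Analysis.Analysis" "HOL-Probability.Essential_Supremum"
begin

section \<open>Weak derivatives and function spaces\<close>

text \<open>Lebesgue measurability (with respect to the completed measure \<^term>\<open>lebesgue\<close>) is used
  throughout, since weak derivatives are only determined almost everywhere.\<close>

definition partial_deriv :: "'n \<Rightarrow> (real^'n \<Rightarrow> real) \<Rightarrow> real^'n \<Rightarrow> real" where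
  "partial_deriv i \<phi> x = frechet_derivative \<phi> (at x) (axis i 1)"

primrec Ck :: "nat \<Rightarrow> (real^'n \<Rightarrow> real) \<Rightarrow> bool" where
  "Ck 0 \<phi> \<longleftrightarrow> continuous_on UNIV \<phi>"
| "Ck (Suc k) \<phi> \<longleftrightarrow> (\<forall>x. \<phi> differentiable (at x)) \<and> (\<forall>i. Ck k (partial_deriv i \<phi>))"

definition test_fun :: "(real^'n) set \<Rightarrow> (real^'n \<Rightarrow> real) \<Rightarrow> bool" where
  "test_fun \<Omega> \<phi> \<longleftrightarrow> (\<forall>k. Ck k \<phi>) \<and>
     compact (closure {x. \<phi> x \<noteq> 0}) \<and> closure {x. \<phi> x \<noteq> 0} \<subseteq> \<Omega>"

definition locally_integrable :: "(real^'n) set \<Rightarrow> (real^'n \<Rightarrow> complex) \<Rightarrow> bool" where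
  "locally_integrable \<Omega> f \<longleftrightarrow> (\<forall>S. compact S \<and> S \<subseteq> \<Omega> \<longrightarrow> set_integrable lebesgue S f)"

text \<open>Real-valued test functions suffice also for complex-valued functions, by linearity.\<close>

definition has_weak_partial ::
    "(real^'n) set \<Rightarrow> 'n \<Rightarrow> (real^'n \<Rightarrow> complex) \<Rightarrow> (real^'n \<Rightarrow> complex) \<Rightarrow> bool" where
  "has_weak_partial \<Omega> i f g \<longleftrightarrow> locally_integrable \<Omega> f \<and> locally_integrable \<Omega> g \<and>
     (\<forall>\<phi>. test_fun \<Omega> \<phi> \<longrightarrow>
        (LINT x:\<Omega>|lebesgue. partial_deriv i \<phi> x *\<^sub>R f x) =
        - (LINT x:\<Omega>|lebesgue. \<phi> x *\<^sub>R g x))"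

text \<open>A representative; it is determined up to null sets whenever the weak derivative exists.\<close>

definition weak_partial :: "(real^'n) set \<Rightarrow> 'n \<Rightarrow> (real^'n \<Rightarrow> complex) \<Rightarrow> real^'n \<Rightarrow> complex" where
  "weak_partial \<Omega> i f = (SOME g. has_weak_partial \<Omega> i f g)"

definition weak_grad :: "(real^'n) set \<Rightarrow> (real^'n \<Rightarrow> complex) \<Rightarrow> real^'n \<Rightarrow> complex^'n" where
  "weak_grad \<Omega> f x = (\<chi> i. weak_partial \<Omega> i f x)"

definition weak_div :: "(real^'n) set \<Rightarrow> (real^'n \<Rightarrow> complex^'n) \<Rightarrow> real^'n \<Rightarrow> complex" where
  "weak_div \<Omega> F x = (\<Sum>i\<in>UNIV. weak_partial \<Omega> i (\<lambda>y. F y $ i) x)"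

definition in_L2 :: "(real^'n \<Rightarrow> complex) \<Rightarrow> bool" where
  "in_L2 f \<longleftrightarrow> f \<in> borel_measurable lebesgue \<and> integrable lebesgue (\<lambda>x. (norm (f x))\<^sup>2)"

definition in_W22 :: "(real^'n \<Rightarrow> complex) \<Rightarrow> bool" where
  "in_W22 u \<longleftrightarrow> in_L2 u \<and>
     (\<exists>g h. (\<forall>i. has_weak_partial UNIV i u (g i) \<and> in_L2 (g i)) \<and>
            (\<forall>i j. has_weak_partial UNIV j (g i) (h i j) \<and> in_L2 (h i j)))"

text \<open>The support of a function that is only given almost everywhere: the complement of the largest
  open set on which it vanishes almost everywhere.\<close>

definition ess_support :: "(real^'n \<Rightarrow> complex) \<Rightarrow> (real^'n) set" where
  "ess_support u = - \<Union>{U. open U \<and> (AE x in lebesgue. x \<in> U \<longrightarrow> u x = 0)}"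

text \<open>\<^const>\<open>esssup\<close> is \<^term>\<open>\<infinity>\<close> for functions that are not measurable.\<close>

definition ess_norm :: "(real^'n) set \<Rightarrow> (real^'n \<Rightarrow> 'b::real_normed_vector) \<Rightarrow> ereal" where
  "ess_norm \<Omega> f = esssup (lebesgue_on \<Omega>) (\<lambda>x. ereal (norm (f x)))"

definition in_Linfty :: "(real^'n) set \<Rightarrow> (real^'n \<Rightarrow> 'b::real_normed_vector) \<Rightarrow> bool" where
  "in_Linfty \<Omega> f \<longleftrightarrow> f \<in> borel_measurable (lebesgue_on \<Omega>) \<and> ess_norm \<Omega> f < \<infinity>"

definition Linfty_norm :: "(real^'n) set \<Rightarrow> (real^'n \<Rightarrow> 'b::real_normed_vector) \<Rightarrow> real" where
  "Linfty_norm \<Omega> f = real_of_ereal (ess_norm \<Omega> f)"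

section \<open>The operator and its coefficients\<close>

definition row_sum_norm :: "real^'n^'n \<Rightarrow> real" where
  "row_sum_norm M = Max (range (\<lambda>i. \<Sum>j\<in>UNIV. \<bar>M $ i $ j\<bar>))"

definition assumption_A ::
    "real \<Rightarrow> real \<Rightarrow> real \<Rightarrow> (real^'n \<Rightarrow> real^'n^'n) \<Rightarrow> (real^'n \<Rightarrow> complex^'n) \<Rightarrow> (real^'n \<Rightarrow> complex) \<Rightarrow> bool" where
  "assumption_A \<rho> \<theta>1 \<theta>2 A b c \<longleftrightarrow>
     in_Linfty (ball 0 \<rho>) b \<and> in_Linfty (ball 0 \<rho>) c \<and>
     (\<forall>x i j. A x $ i $ j = A x $ j $ i) \<and>
     (\<forall>x\<in>ball 0 \<rho>. \<forall>\<xi>. inverse \<theta>1 * (norm \<xi>)\<^sup>2 \<le> \<xi> \<bullet> (A x *v \<xi>) \<and> \<xi> \<bullet> (A x *v \<xi>) \<le> \<theta>1 * (norm \<xi>)\<^sup>2) \<and>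
     (\<forall>x\<in>ball 0 \<rho>. \<forall>y\<in>ball 0 \<rho>. row_sum_norm (A x - A y) \<le> \<theta>2 * norm (x - y))"

text \<open>The divergence is taken in the ball of radius \<open>\<rho>\<close>, outside of which nothing is assumed on the
  regularity of \<open>A\<close>.\<close>

definition L_op ::
    "real \<Rightarrow> (real^'n \<Rightarrow> real^'n^'n) \<Rightarrow> (real^'n \<Rightarrow> complex^'n) \<Rightarrow> (real^'n \<Rightarrow> complex) \<Rightarrow>
     (real^'n \<Rightarrow> complex) \<Rightarrow> real^'n \<Rightarrow> complex" where
  "L_op \<rho> A b c u x =
     - weak_div (ball 0 \<rho>) (\<lambda>y. map_matrix complex_of_real (A y) *v weak_grad UNIV u y) x
     + (\<Sum>i\<in>UNIV. b x $ i * weak_grad UNIV u x $ i) + c x * u x"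

text \<open>For real symmetric \<open>M\<close> the sum is real, so taking the real part only changes the type.\<close>

definition grad_form :: "real^'n^'n \<Rightarrow> complex^'n \<Rightarrow> real" where
  "grad_form M z = Re (\<Sum>i\<in>UNIV. \<Sum>j\<in>UNIV. z $ i * complex_of_real (M $ i $ j) * cnj (z $ j))"

section \<open>The weight function\<close>

definition sigma :: "(real^'n \<Rightarrow> real^'n^'n) \<Rightarrow> real^'n \<Rightarrow> real" where
  "sigma A x = sqrt (x \<bullet> (matrix_inv (A 0) *v x))"

definition phi :: "real \<Rightarrow> real \<Rightarrow> real" where
  "phi \<mu> r = r * exp (- integral {0..r} (\<lambda>t. (1 - exp (- \<mu> * t)) / t))"

definition weight :: "(real^'n \<Rightarrow> real^'n^'n) \<Rightarrow> real \<Rightarrow> real \<Rightarrow> real^'n \<Rightarrow> real" where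
  "weight A \<rho> \<mu> x = phi \<mu> (sigma A (x /\<^sub>R \<rho>))"

section \<open>The constants\<close>

text \<open>The argument \<open>\<kappa>\<close> stands for the product \<open>\<rho> * \<theta>2\<close>, the only way in which \<open>\<rho>\<close> and \<open>\<theta>2\<close> enter
  the constants up to and including \<open>const_C\<close>.\<close>

definition mu1 :: "real \<Rightarrow> real \<Rightarrow> real" where
  "mu1 \<theta>1 \<mu> = (if sqrt \<theta>1 * \<mu> \<le> 1 then exp (sqrt \<theta>1 * \<mu>) else exp 1 * sqrt \<theta>1 * \<mu>)"

definition CF' :: "nat \<Rightarrow> real \<Rightarrow> real \<Rightarrow> real" where
  "CF' d \<theta>1 \<kappa> = 3 * real d * \<theta>1 powr (7/2) * \<kappa>"

definition CM :: "nat \<Rightarrow> real \<Rightarrow> real \<Rightarrow> real" where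
  "CM d \<theta>1 \<kappa> = 11 * real d * \<theta>1 powr (11/2) * \<kappa>"

definition Cmu :: "nat \<Rightarrow> real \<Rightarrow> real \<Rightarrow> real \<Rightarrow> real" where
  "Cmu d \<theta>1 \<kappa> \<mu> = \<mu> - 3 * CM d \<theta>1 \<kappa>"

definition CF :: "nat \<Rightarrow> real \<Rightarrow> real \<Rightarrow> real \<Rightarrow> real" where
  "CF d \<theta>1 \<kappa> \<mu> = exp (\<mu> * sqrt \<theta>1) * (sqrt \<theta>1 * (CF' d \<theta>1 \<kappa> + \<mu>) + \<bar>real d - 2\<bar>)"

definition Cpsi :: "nat \<Rightarrow> real \<Rightarrow> real \<Rightarrow> real \<Rightarrow> real" where
  "Cpsi d \<theta>1 \<kappa> \<mu> =
     \<mu> * exp (\<mu> * sqrt \<theta>1) * \<theta>1\<^sup>2 * (sqrt \<theta>1 * (CF' d \<theta>1 \<kappa> + \<mu>) + real d - 1)"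

definition const_K :: "nat \<Rightarrow> real \<Rightarrow> real \<Rightarrow> real \<Rightarrow> real" where
  "const_K d \<theta>1 \<kappa> \<mu> =
     max (real d * Cpsi d \<theta>1 \<kappa> \<mu>) (6 * \<mu> * mu1 \<theta>1 \<mu> * exp (\<mu> * sqrt \<theta>1) * \<theta>1\<^sup>2)"

definition const_t1 :: "nat \<Rightarrow> real \<Rightarrow> real \<Rightarrow> real \<Rightarrow> real" where
  "const_t1 d \<theta>1 \<kappa> \<mu> =
     1/8 * const_K d \<theta>1 \<kappa> \<mu> * \<theta>1 powr (5/2) * (mu1 \<theta>1 \<mu>)\<^sup>2 * exp (2 * \<mu> * sqrt \<theta>1)"

definition const_p :: "nat \<Rightarrow> real \<Rightarrow> real \<Rightarrow> real \<Rightarrow> real" where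
  "const_p d \<theta>1 \<kappa> \<mu> = Cmu d \<theta>1 \<kappa> \<mu> * (exp (- 2 * \<mu> * sqrt \<theta>1) / (\<theta>1 * mu1 \<theta>1 \<mu>)\<^sup>2)"

definition const_q :: "nat \<Rightarrow> real \<Rightarrow> real \<Rightarrow> real \<Rightarrow> real" where
  "const_q d \<theta>1 \<kappa> \<mu> =
     Cmu d \<theta>1 \<kappa> \<mu> * CF d \<theta>1 \<kappa> \<mu> * (exp (- 2 * \<mu> * sqrt \<theta>1) / (\<theta>1 * mu1 \<theta>1 \<mu>)\<^sup>2)
     + const_K d \<theta>1 \<kappa> \<mu> * (const_t1 d \<theta>1 \<kappa> \<mu> + sqrt \<theta>1 / 2)"

definition const_r :: "nat \<Rightarrow> real \<Rightarrow> real \<Rightarrow> real \<Rightarrow> real" where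
  "const_r d \<theta>1 \<kappa> \<mu> = const_K d \<theta>1 \<kappa> \<mu> * (1 + (CF d \<theta>1 \<kappa> \<mu>)\<^sup>2 * \<theta>1\<^sup>2 / 2)"

definition alpha1 :: "nat \<Rightarrow> real \<Rightarrow> real \<Rightarrow> real \<Rightarrow> real" where
  "alpha1 d \<theta>1 \<kappa> \<mu> =
     const_K d \<theta>1 \<kappa> \<mu> * \<theta>1 powr (9/2) * (mu1 \<theta>1 \<mu>)\<^sup>2 * exp (2 * \<mu> * sqrt \<theta>1)"

definition alpha2 :: "nat \<Rightarrow> real \<Rightarrow> real \<Rightarrow> real \<Rightarrow> real" where
  "alpha2 d \<theta>1 \<kappa> \<mu> =
     const_q d \<theta>1 \<kappa> \<mu> / const_p d \<theta>1 \<kappa> \<mu>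
     + sqrt ((const_q d \<theta>1 \<kappa> \<mu>)\<^sup>2 / (const_p d \<theta>1 \<kappa> \<mu>)\<^sup>2
             + 2 * const_r d \<theta>1 \<kappa> \<mu> / const_p d \<theta>1 \<kappa> \<mu>)"

definition alpha0_tilde :: "nat \<Rightarrow> real \<Rightarrow> real \<Rightarrow> real \<Rightarrow> real" where
  "alpha0_tilde d \<theta>1 \<kappa> \<mu> = max (alpha1 d \<theta>1 \<kappa> \<mu>) (alpha2 d \<theta>1 \<kappa> \<mu>)"

definition const_K1 :: "nat \<Rightarrow> real \<Rightarrow> real \<Rightarrow> real \<Rightarrow> real" where
  "const_K1 d \<theta>1 \<kappa> \<mu> =
     const_K d \<theta>1 \<kappa> \<mu> / 2 + (\<theta>1 * mu1 \<theta>1 \<mu>)\<^sup>2 * exp (2 * \<mu> * sqrt \<theta>1)"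

definition const_K5 :: "nat \<Rightarrow> real \<Rightarrow> real \<Rightarrow> real \<Rightarrow> real" where
  "const_K5 d \<theta>1 \<kappa> \<mu> =
     1/2 * Cmu d \<theta>1 \<kappa> \<mu> * (exp (- 2 * \<mu> * sqrt \<theta>1) / (\<theta>1 * mu1 \<theta>1 \<mu>)\<^sup>2)"

definition C_tilde :: "nat \<Rightarrow> real \<Rightarrow> real \<Rightarrow> real \<Rightarrow> real" where
  "C_tilde d \<theta>1 \<kappa> \<mu> = const_K1 d \<theta>1 \<kappa> \<mu> / const_K5 d \<theta>1 \<kappa> \<mu>"

definition const_C :: "nat \<Rightarrow> real \<Rightarrow> real \<Rightarrow> real \<Rightarrow> real" where
  "const_C d \<theta>1 \<kappa> \<mu> = 6 * C_tilde d \<theta>1 \<kappa> \<mu>"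

text \<open>The last two arguments are the essential suprema of the first- and zeroth-order
  coefficients.\<close>

definition alpha0 :: "nat \<Rightarrow> real \<Rightarrow> real \<Rightarrow> real \<Rightarrow> real \<Rightarrow> real \<Rightarrow> real \<Rightarrow> real" where
  "alpha0 d \<rho> \<theta>1 \<theta>2 \<mu> nb nc =
     Max {alpha0_tilde d \<theta>1 (\<rho> * \<theta>2) \<mu>,
          const_C d \<theta>1 (\<rho> * \<theta>2) \<mu> * \<rho>\<^sup>2 * nb\<^sup>2 * \<theta>1 powr (3/2),
          const_C d \<theta>1 (\<rho> * \<theta>2) \<mu> powr (1/3) * \<rho> powr (4/3) * nc powr (2/3) * sqrt \<theta>1}"

end

theory Submission
  imports Defs
begin

text \<open>Carleman estimates follow from a positive commutator. For a real function \<open>u\<close> put \<open>f = w powr (- \<alpha>) * u\<close>, where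
\<open>w\<close> is the weight. With \<open>\<nu> = \<mu> / \<rho>\<close>, \<open>E = exp (\<nu> * \<sigma>)\<close> and \<open>y = (A 0)\<inverse> x\<close> the gradient of \<open>ln w\<close> is
\<open>y / (E * \<sigma>\<^sup>2)\<close>, so that \<open>P = w powr (- \<alpha>) * div (A \<nabla>u)\<close> is an explicit second order expression in \<open>f\<close>
(\<open>conjugated_operator\<close>). Up to factors this is a symmetric part, \<open>div (A \<nabla>f)\<close> plus a potential, and an antisymmetric
part, a first order operator along \<open>A y\<close>. Expanding \<open>(E * \<sigma> * P)\<^sup>2\<close> one drops the square of the symmetric part; the
cross term is a divergence, that of the vector field \<open>flux\<close>, up to a remainder (\<open>divergence_identity\<close>). The
exponential in the definition of the weight makes this remainder positive: it is at least a multiple of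
\<open>\<alpha> * |\<nabla>f|\<^sup>2 + \<alpha>\<^sup>3 * f\<^sup>2\<close>, with the factor \<open>\<nu> - 33 * L\<close>, \<open>L = d * \<theta>^(11/2) * \<theta>2\<close>; here \<open>\<nu>\<close> is the gain from the weight
and the multiple of \<open>L\<close> is the loss caused by the variation of the coefficients (\<open>coefficient_bounds\<close>). This is where
the lower bound on \<open>\<mu>\<close> enters. Integration removes the divergence, since \<open>u\<close> vanishes near the origin and near the
boundary (\<open>carleman_smooth\<close>).

The coefficients are only Lipschitz and \<open>u\<close> only has weak derivatives, so both are mollified. The Lipschitz
condition bounds the derivatives of the smoothed coefficients but does not make them converge; their limit is
found by passing to convex combinations. A bounded sequence in \<open>L\<^sup>2\<close> has convex combinations of its tails that
converge almost everywhere and have a common square integrable majorant (\<open>convex_combinations_converge\<close>); ellipticity, the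
Lipschitz condition and weak differential identities are linear conditions and survive convex combinations. Hence every
limit below is an instance of dominated convergence, and the weak divergence of \<open>A \<nabla>u\<close> is obtained on the way by the
product rule (\<open>product_weak_partial\<close>).

Complex \<open>u\<close> are treated by adding the estimates for the real and the imaginary part, the coefficients of the
principal part being real. Finally \<open>div (A \<nabla>u) = b\<^sup>T \<nabla>u + c u - L u\<close>; the square of this three-term sum costs a
factor 3, and the two last conditions in the definition of the threshold for \<open>\<alpha>\<close> allow half of the left-hand side to absorb the
lower-order terms (\<open>lower_order_absorbed\<close>), which costs a factor 2. That is the factor 6 in the final constant.\<close>

section \<open>The positivity estimate at a point, in scalar form\<close>

text \<open>All quantities are the values at one point: \<open>z\<close> is \<open>y \<bullet> A \<nabla>f\<close>, \<open>\<Gamma>\<close> is \<open>\<nabla>f \<bullet> A \<nabla>f\<close>, \<open>\<delta>\<close> is \<open>div (A \<nabla>f)\<close>, \<open>D0\<close> is the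
divergence of the flux and \<open>dd\<close> is the dimension minus 2. The square of \<open>E * \<sigma> * P\<close> is expanded and its symmetric part dropped. What remains
differs from \<open>2 * \<alpha> * D0\<close> by a term \<open>2 * \<alpha> * X * f * \<delta>\<close> with second derivatives. Expressing \<open>\<delta>\<close> through \<open>P\<close> turns it into
the positive term of order \<open>\<alpha>^3\<close> and a product of \<open>P\<close> with \<open>f\<close>, and the latter is paid for by the excess 1/8 of the
factor 9/8. The errors \<open>q\<close>, \<open>t1\<close>, \<open>g1\<close> come from the variation of the coefficients.\<close>

lemma carleman_pointwise_scalar:
  fixes \<alpha> \<nu> \<sigma> E m f z \<Gamma> \<delta> t1 q g1 L dd D0 :: real
  defines "Fh \<equiv> dd * E" and "X \<equiv> E * (t1 - m * \<nu> * \<sigma>)"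
  defines "T \<equiv> 2 * E * z + (Fh + X) * f"
  defines "P \<equiv> \<delta> + \<alpha>\<^sup>2 * m * f / (E * \<sigma>)\<^sup>2 + \<alpha> * T / (E * \<sigma>)\<^sup>2"
  assumes pos: "\<alpha> > 0" "\<nu> > 0" "\<sigma> > 0" "E > 0" "m > 0" "L \<ge> 0" "\<Gamma> \<ge> 0"
    and L: "33 * L \<le> \<nu>"
    and e: "\<nu> * \<sigma> * E \<le> \<alpha> / 60"
    and b: "\<bar>dd\<bar> * E \<le> m * \<alpha> / 2"
    and q: "\<bar>q\<bar> \<le> 7 * L * (E * m * \<sigma> * \<Gamma>)"
    and t1: "\<bar>t1\<bar> \<le> 4 * L * (m * \<sigma>)"
    and g1: "\<bar>g1\<bar> \<le> 5 * L * (m\<^sup>2 * \<sigma>)"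
    and D0: "D0 = (2 * E * z + Fh * f) * \<delta> + \<alpha>\<^sup>2 * m * f * T / (E * \<sigma>)\<^sup>2
               - (E * \<nu> * m * \<sigma> * \<Gamma> - 2 * E * \<nu> * z\<^sup>2 / \<sigma> + q) + f * dd * E * \<nu> * z / \<sigma>
               + \<alpha>\<^sup>2 * f\<^sup>2 * g1 / (E * \<sigma>\<^sup>2)"
  shows "2 * \<alpha> * D0 + 2 * \<alpha> * (\<nu> - 33 * L) * (E * m * \<sigma> * \<Gamma>)
           + 27/16 * \<alpha> ^ 3 * (\<nu> - 33 * L) * (m\<^sup>2 * f\<^sup>2 / (E * \<sigma>))
         \<le> 9/8 * (E * \<sigma> * P)\<^sup>2"
proof -
  define e' where "e' = \<nu> * \<sigma> * E"
  define \<theta> where "\<theta> = 1 - t1 / (m * \<nu> * \<sigma>)"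
  define k where "k = \<alpha> * \<nu> * m * f"
  define \<tau> where "\<tau> = T / (E * \<sigma>)"
  define p where "p = E * \<sigma> * P"
  define b' where "b' = dd * E / m"
  define J where "J = m\<^sup>2 * f\<^sup>2 / (E * \<sigma>)"
  have nz: "\<alpha> \<noteq> 0" "\<nu> \<noteq> 0" "\<sigma> \<noteq> 0" "E \<noteq> 0" "m \<noteq> 0" using pos by auto
  have J0: "J \<ge> 0" using pos by (simp add: J_def)
  have e0: "e' > 0" using pos by (simp add: e'_def)
  have e1: "e' \<le> \<alpha> / 60" using e by (simp add: e'_def)
  have b1: "\<bar>b'\<bar> \<le> \<alpha> / 2"
    using b pos by (simp add: b'_def abs_mult field_simps)
  have t2: "\<bar>t1 / (m * \<nu> * \<sigma>)\<bar> \<le> 4 / 33"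
  proof -
    have "\<bar>t1\<bar> \<le> 4/33 * (m * \<nu> * \<sigma>)"
    proof -
      have "4 * L * (m * \<sigma>) \<le> 4/33 * \<nu> * (m*\<sigma>)"
        using L pos by (intro mult_right_mono) auto
      then show ?thesis using t1 by (simp add: mult_ac)
    qed
    then show ?thesis using pos by (simp add: abs_mult field_simps)
  qed
  have \<theta>1: "29/33 \<le> \<theta>" "\<theta> \<le> 37/33" using t2 unfolding \<theta>_def abs_le_iff by linarith+
  have X: "X = - (e' * \<theta> * m)" using nz by (simp add: X_def e'_def \<theta>_def field_simps)
  have TE: "T = E * \<sigma> * \<tau>" using nz by (simp add: \<tau>_def)
  have Fh: "Fh = b' * m" using nz by (simp add: Fh_def b'_def)
  \<comment> \<open>the square is expanded, and the square of its symmetric part is dropped\<close>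
  have s1: "p\<^sup>2 \<ge> 2 * \<alpha> * \<delta> * T + 2 * \<alpha>^3 * m * f * T / (E * \<sigma>)\<^sup>2 + \<alpha>\<^sup>2 * \<tau>\<^sup>2"
  proof -
    have "p\<^sup>2 - (2 * \<alpha> * \<delta> * T + 2 * \<alpha>^3 * m * f * T / (E * \<sigma>)\<^sup>2 + \<alpha>\<^sup>2 * \<tau>\<^sup>2)
        = (E * \<sigma> * \<delta> + \<alpha>\<^sup>2 * m * f / (E * \<sigma>))\<^sup>2"
      using nz unfolding p_def P_def TE by (simp add: field_simps power2_eq_square power3_eq_cube)
    then show ?thesis by (metis diff_ge_0_iff_ge zero_le_power2)
  qed
  have s2: "2 * \<alpha> * \<delta> * T + 2 * \<alpha>^3 * m * f * T / (E * \<sigma>)\<^sup>2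
      = 2 * \<alpha> * D0 + 2 * \<alpha> * (E * \<nu> * m * \<sigma> * \<Gamma> + q)
        - 2 * \<alpha> * (2 * E * \<nu> * z\<^sup>2 / \<sigma> + f * dd * E * \<nu> * z / \<sigma>)
        - 2 * \<alpha>^3 * f\<^sup>2 * g1 / (E * \<sigma>\<^sup>2) + 2 * \<alpha> * X * f * \<delta>"
    unfolding D0 T_def by (simp add: algebra_simps add_divide_distrib diff_divide_distrib power2_eq_square power3_eq_cube)
  \<comment> \<open>the term with second derivatives, with \<open>\<delta>\<close> expressed through \<open>P\<close>\<close>
  have s3: "2 * \<alpha> * X * f * \<delta> = - 2 * \<theta> * k * p + 2 * \<alpha>^3 * \<nu> * \<theta> * J + 2 * \<alpha> * \<theta> * k * \<tau>"
  proof -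
    have d: "\<delta> = P - \<alpha>\<^sup>2 * m * f / (E * \<sigma>)\<^sup>2 - \<alpha> * \<tau> / (E * \<sigma>)"
      unfolding P_def TE using nz by (simp add: power2_eq_square)
    have P: "P = p / (E * \<sigma>)" using nz by (simp add: p_def)
    show ?thesis unfolding X d P k_def J_def e'_def using nz
      by (simp add: field_simps power2_eq_square power3_eq_cube)
  qed
  have s4: "- 2 * \<alpha> * (2 * E * \<nu> * z\<^sup>2 / \<sigma> + f * dd * E * \<nu> * z / \<sigma>)
      = - \<alpha> * e' * \<tau>\<^sup>2 + (b' - 2 * e' * \<theta>) * k * \<tau> + \<theta> * (b' - e' * \<theta>) * k\<^sup>2 / \<alpha>"
  proof -
    have z: "z = (E * \<sigma> * \<tau> - (b' * m - e' * \<theta> * m) * f) / (2 * E)"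
      using nz TE unfolding T_def X Fh by (simp add: field_simps)
    have dd: "dd = b' * m / E" using nz by (simp add: b'_def)
    have f: "f = k / (\<alpha> * \<nu> * m)" using nz by (simp add: k_def)
    show ?thesis unfolding z dd f e'_def using nz
      by (simp add: field_simps power2_eq_square)
  qed
  have s5: "- (64/5) * k\<^sup>2 \<le> p\<^sup>2/8 - 2 * \<theta> * k * p + \<alpha>\<^sup>2 * \<tau>\<^sup>2 + 2 * \<alpha> * \<theta> * k * \<tau>
        - \<alpha> * e' * \<tau>\<^sup>2 + (b' - 2 * e' * \<theta>) * k * \<tau> + \<theta> * (b' - e' * \<theta>) * k\<^sup>2 / \<alpha>"
  proof -
    \<comment> \<open>this uses the excess 1/8 of the factor 9/8\<close>
    have "0 \<le> (p - 8 * \<theta> * k)\<^sup>2 / 8" by simp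
    then have i1: "p\<^sup>2/8 - 2 * \<theta> * k * p \<ge> - 8 * \<theta>\<^sup>2 * k\<^sup>2"
      by (simp add: power2_eq_square algebra_simps)
    have \<theta>2: "\<theta>\<^sup>2 \<le> (37/33)\<^sup>2" using \<theta>1 by (intro power_mono) auto
    then have i1': "8 * \<theta>\<^sup>2 * k\<^sup>2 \<le> 8 * (37/33)\<^sup>2 * k\<^sup>2" by (intro mult_right_mono) auto
    define c where "c = 2 * \<alpha> * \<theta> + b' - 2 * e' * \<theta>"
    have c: "\<bar>c\<bar> \<le> 11/4 * \<alpha>"
    proof -
      have "e' * \<theta> \<le> \<alpha> * \<theta>" using e1 \<theta>1 pos by (intro mult_right_mono) auto
      moreover have "e' * \<theta> \<ge> 0" using e0 \<theta>1 by simp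
      moreover have "\<alpha> * \<theta> \<le> \<alpha> * (37/33)" using \<theta>1 pos by (intro mult_left_mono) auto
      ultimately show ?thesis using b1 pos unfolding c_def abs_le_iff by linarith
    qed
    have i2: "\<alpha>\<^sup>2 * \<tau>\<^sup>2 - \<alpha> * e' * \<tau>\<^sup>2 \<ge> 59/60 * (\<alpha> * \<tau>)\<^sup>2"
    proof -
      have "\<alpha> * e' \<le> \<alpha> * (\<alpha>/60)" using e1 pos by (intro mult_left_mono) auto
      then have "\<alpha> * e' * \<tau>\<^sup>2 \<le> \<alpha> * (\<alpha>/60) * \<tau>\<^sup>2" by (intro mult_right_mono) auto
      then show ?thesis by (simp add: power2_eq_square algebra_simps)
    qed
    have i3: "c * k * \<tau> \<ge> - (11/4) * \<bar>k\<bar> * \<bar>\<alpha> * \<tau>\<bar>"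
    proof -
      have "\<bar>c * k * \<tau>\<bar> \<le> 11/4 * \<alpha> * (\<bar>k\<bar> * \<bar>\<tau>\<bar>)"
        using mult_right_mono[OF c, of "\<bar>k\<bar> * \<bar>\<tau>\<bar>"] by (simp add: abs_mult mult.assoc)
      also have "\<dots> = 11/4 * \<bar>k\<bar> * \<bar>\<alpha> * \<tau>\<bar>" using pos by (simp add: abs_mult)
      finally show ?thesis unfolding abs_le_iff by linarith
    qed
    have i4: "59/60 * (\<alpha> * \<tau>)\<^sup>2 - (11/4) * \<bar>k\<bar> * \<bar>\<alpha> * \<tau>\<bar> \<ge> - 2 * k\<^sup>2"
    proof -
      have "0 \<le> 59/60 * (\<bar>\<alpha> * \<tau>\<bar> - 30/59 * 11/4 * \<bar>k\<bar>)\<^sup>2" by simp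
      also have "\<dots> = 59/60 * (\<alpha> * \<tau>)\<^sup>2 - (11/4) * \<bar>k\<bar> * \<bar>\<alpha> * \<tau>\<bar> + (30/59) * (121/32) * k\<^sup>2"
      proof -
        have *: "59/60 * (Z - 30/59 * 11/4 * K)\<^sup>2 = 59/60 * Z\<^sup>2 - (11/4) * K * Z + (30/59) * (121/32) * K\<^sup>2"
          for Z K :: real by (simp add: power2_eq_square algebra_simps)
        show ?thesis using *[of "\<bar>\<alpha> * \<tau>\<bar>" "\<bar>k\<bar>"] by simp
      qed
      finally show ?thesis using zero_le_power2[of k] by linarith
    qed
    have i5: "\<theta> * (b' - e' * \<theta>) * k\<^sup>2 / \<alpha> \<ge> - (3/5) * k\<^sup>2"
    proof -
      have "e' * \<theta> \<le> \<alpha>/60 * (37/33)" using e1 \<theta>1 e0 pos by (intro mult_mono) auto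
      moreover have "0 \<le> e' * \<theta>" using e0 \<theta>1 by simp
      ultimately have "\<bar>b' - e' * \<theta>\<bar> \<le> (1/2 + 37/1980) * \<alpha>"
        using b1 unfolding abs_le_iff by (simp add: algebra_simps)
      then have "\<theta> * \<bar>b' - e' * \<theta>\<bar> \<le> 37/33 * ((1/2 + 37/1980) * \<alpha>)"
        using \<theta>1 by (intro mult_mono) auto
      also have "\<dots> \<le> 3/5 * \<alpha>" using pos by simp
      finally have "\<bar>\<theta> * (b' - e' * \<theta>)\<bar> \<le> 3/5 * \<alpha>" using \<theta>1 by (simp add: abs_mult)
      then have "- (3/5 * \<alpha>) \<le> \<theta> * (b' - e' * \<theta>)" by linarith
      then have "- (3/5 * \<alpha>) * k\<^sup>2 \<le> \<theta> * (b' - e' * \<theta>) * k\<^sup>2" by (intro mult_right_mono) auto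
      then show ?thesis using pos by (simp add: field_simps)
    qed
    have "\<alpha>\<^sup>2 * \<tau>\<^sup>2 + 2 * \<alpha> * \<theta> * k * \<tau> - \<alpha> * e' * \<tau>\<^sup>2 + (b' - 2 * e' * \<theta>) * k * \<tau>
        = (\<alpha>\<^sup>2 * \<tau>\<^sup>2 - \<alpha> * e' * \<tau>\<^sup>2) + c * k * \<tau>" by (simp add: c_def algebra_simps)
    moreover have "8 * (37/33)\<^sup>2 * k\<^sup>2 \<le> 102/10 * k\<^sup>2" by (intro mult_right_mono) (auto simp: power2_eq_square)
    ultimately show ?thesis using i1 i1' i2 i3 i4 i5 by linarith
  qed
  have k2: "k\<^sup>2 \<le> \<alpha>^3 * \<nu> * J / 60"
  proof -
    have "k\<^sup>2 = (e' * \<alpha>\<^sup>2 * \<nu>) * J" using nz by (simp add: k_def J_def e'_def field_simps power2_eq_square)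
    also have "\<dots> \<le> (\<alpha>/60 * \<alpha>\<^sup>2 * \<nu>) * J" using e1 pos J0 by (intro mult_right_mono) auto
    finally show ?thesis by (simp add: power2_eq_square power3_eq_cube mult_ac)
  qed
  have J1: "2 * \<alpha>^3 * \<nu> * \<theta> * J \<ge> 2 * \<alpha>^3 * (\<nu> - 4 * L) * J"
  proof -
    have "\<nu> * \<theta> = \<nu> - t1 / (m * \<sigma>)" using nz by (simp add: \<theta>_def field_simps)
    moreover have "t1 / (m * \<sigma>) \<le> 4 * L" using t1 pos by (simp add: field_simps)
    ultimately have "\<nu> - 4 * L \<le> \<nu> * \<theta>" by linarith
    then have "(2 * \<alpha>^3 * J) * (\<nu> - 4 * L) \<le> (2 * \<alpha>^3 * J) * (\<nu> * \<theta>)" using pos J0 by (intro mult_left_mono) auto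
    then show ?thesis by (simp add: mult_ac)
  qed
  have J2: "2 * \<alpha>^3 * f\<^sup>2 * g1 / (E * \<sigma>\<^sup>2) \<le> 10 * \<alpha>^3 * L * J"
  proof -
    have "2 * \<alpha>^3 * f\<^sup>2 * g1 / (E * \<sigma>\<^sup>2) \<le> 2 * \<alpha>^3 * f\<^sup>2 * (5 * L * (m\<^sup>2 * \<sigma>)) / (E * \<sigma>\<^sup>2)"
      using g1 pos by (intro divide_right_mono mult_left_mono) auto
    also have "\<dots> = 10 * \<alpha>^3 * L * J" using nz by (simp add: J_def power2_eq_square)
    finally show ?thesis .
  qed
  have q1: "2 * \<alpha> * q \<ge> - 14 * \<alpha> * L * (E * m * \<sigma> * \<Gamma>)"
  proof -
    have "2 * \<alpha> * (- (7 * L * (E * m * \<sigma> * \<Gamma>))) \<le> 2 * \<alpha> * q" using q pos by (intro mult_left_mono) auto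
    then show ?thesis by (simp add: algebra_simps)
  qed
  have main: "9/8 * p\<^sup>2 \<ge> 2 * \<alpha> * D0 + 2 * \<alpha> * \<nu> * (E * m * \<sigma> * \<Gamma>) - 14 * \<alpha> * L * (E * m * \<sigma> * \<Gamma>)
      + 2 * \<alpha>^3 * (\<nu> - 4 * L) * J - 10 * \<alpha>^3 * L * J - 64/5 * (\<alpha>^3 * \<nu> * J / 60)"
    using s1 s2 s3 s4 s5 k2 J1 J2 q1 by (simp add: algebra_simps)
  have G: "2 * \<alpha> * (\<nu> - 33 * L) * (E * m * \<sigma> * \<Gamma>) \<le> 2 * \<alpha> * \<nu> * (E * m * \<sigma> * \<Gamma>) - 14 * \<alpha> * L * (E * m * \<sigma> * \<Gamma>)"
  proof -
    have "0 \<le> 52 * \<alpha> * L * (E * m * \<sigma> * \<Gamma>)" using pos by simp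
    then show ?thesis by (simp add: algebra_simps)
  qed
  have JJ: "27/16 * \<alpha>^3 * (\<nu> - 33 * L) * J \<le> 2 * \<alpha>^3 * (\<nu> - 4 * L) * J - 10 * \<alpha>^3 * L * J - 64/5 * (\<alpha>^3 * \<nu> * J / 60)"
  proof -
    have "27/16 * (\<nu> - 33 * L) \<le> 2 * (\<nu> - 4 * L) - 10 * L - 64/5 * (\<nu>/60)" using pos L by simp
    then have "(\<alpha>^3 * J) * (27/16 * (\<nu> - 33 * L)) \<le> (\<alpha>^3 * J) * (2 * (\<nu> - 4 * L) - 10 * L - 64/5 * (\<nu>/60))"
      using pos J0 by (intro mult_left_mono) auto
    then show ?thesis by (simp add: algebra_simps)
  qed
  show ?thesis using main G JJ unfolding p_def J_def by linarith
qed

section \<open>Symmetric matrices and variation of the coefficients\<close>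

abbreviation sym_mat :: "real^'n^'n \<Rightarrow> bool" where
  "sym_mat M \<equiv> \<forall>i j. M $ i $ j = M $ j $ i"

text \<open>Abbreviates that the row sum norm is at most \<open>c\<close>, in a form that is a conjunction of linear inequalities.\<close>

abbreviation rows_le :: "real \<Rightarrow> real^'n^'n \<Rightarrow> bool" where
  "rows_le c M \<equiv> \<forall>i. (\<Sum>j\<in>UNIV. \<bar>M $ i $ j\<bar>) \<le> c"

abbreviation elliptic :: "real \<Rightarrow> real^'n^'n \<Rightarrow> bool" where
  "elliptic \<theta> M \<equiv> \<forall>\<xi>. inverse \<theta> * (norm \<xi>)\<^sup>2 \<le> \<xi> \<bullet> (M *v \<xi>) \<and> \<xi> \<bullet> (M *v \<xi>) \<le> \<theta> * (norm \<xi>)\<^sup>2"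

lemma sym_inner:
  fixes M :: "real^'n^'n"
  assumes "sym_mat M"
  shows "v \<bullet> (M *v w) = w \<bullet> (M *v v)"
proof -
  have "transpose M = M" using assms by (simp add: transpose_def vec_eq_iff)
  then show ?thesis by (metis dot_lmul_matrix inner_commute transpose_matrix_vector)
qed

text \<open>Schur's test for a symmetric matrix: by symmetry the row sums also bound the column sums.\<close>

lemma rows_le_bilinear_bound:
  fixes M :: "real^'n^'n"
  assumes "sym_mat M" "rows_le c M"
  shows "\<bar>v \<bullet> (M *v w)\<bar> \<le> c * (norm v * norm w)"
proof -
  have half: "\<bar>v \<bullet> (M *v w)\<bar> \<le> c * ((norm v)\<^sup>2 + (norm w)\<^sup>2) / 2" for v w :: "real^'n"
  proof -
    have col: "(\<Sum>i\<in>UNIV. \<bar>M $ i $ j\<bar>) \<le> c" for j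
    proof -
      have "(\<Sum>i\<in>UNIV. \<bar>M $ i $ j\<bar>) = (\<Sum>i\<in>UNIV. \<bar>M $ j $ i\<bar>)"
        by (rule sum.cong) (use assms(1) in metis)+
      then show ?thesis using assms(2) by simp
    qed
    have n2: "(norm u)\<^sup>2 = (\<Sum>i\<in>UNIV. (u $ i)\<^sup>2)" for u :: "real^'n"
      by (simp only: power2_norm_eq_inner inner_vec_def) (simp add: power2_eq_square)
    have "\<bar>v \<bullet> (M *v w)\<bar> = \<bar>\<Sum>i\<in>UNIV. \<Sum>j\<in>UNIV. M $ i $ j * (v $ i * w $ j)\<bar>"
      by (simp add: inner_vec_def matrix_vector_mult_def sum_distrib_left mult_ac)
    also have "\<dots> \<le> (\<Sum>i\<in>UNIV. \<Sum>j\<in>UNIV. \<bar>M $ i $ j\<bar> * (((v $ i)\<^sup>2 + (w $ j)\<^sup>2) / 2))"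
    proof (intro order_trans[OF sum_abs] sum_mono)
      fix i j
      have "0 \<le> (\<bar>v $ i\<bar> - \<bar>w $ j\<bar>)\<^sup>2" by simp
      then have "\<bar>v $ i * w $ j\<bar> \<le> ((v $ i)\<^sup>2 + (w $ j)\<^sup>2) / 2"
        by (simp add: power2_diff abs_mult)
      then show "\<bar>M $ i $ j * (v $ i * w $ j)\<bar> \<le> \<bar>M $ i $ j\<bar> * (((v $ i)\<^sup>2 + (w $ j)\<^sup>2) / 2)"
        by (subst abs_mult) (intro mult_left_mono, auto)
    qed
    also have "\<dots> = (\<Sum>i\<in>UNIV. (\<Sum>j\<in>UNIV. \<bar>M $ i $ j\<bar>) * (v $ i)\<^sup>2) / 2
        + (\<Sum>i\<in>UNIV. \<Sum>j\<in>UNIV. \<bar>M $ i $ j\<bar> * (w $ j)\<^sup>2) / 2"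
      by (simp add: add_divide_distrib distrib_left sum.distrib sum_distrib_right sum_divide_distrib)
    also have "(\<Sum>i\<in>UNIV. \<Sum>j\<in>UNIV. \<bar>M $ i $ j\<bar> * (w $ j)\<^sup>2) = (\<Sum>j\<in>UNIV. (\<Sum>i\<in>UNIV. \<bar>M $ i $ j\<bar>) * (w $ j)\<^sup>2)"
      by (subst sum.swap) (simp add: sum_distrib_right)
    also have "(\<Sum>i\<in>UNIV. (\<Sum>j\<in>UNIV. \<bar>M $ i $ j\<bar>) * (v $ i)\<^sup>2) / 2 + \<dots> / 2
       \<le> (\<Sum>i\<in>UNIV. c * (v $ i)\<^sup>2) / 2 + (\<Sum>i\<in>UNIV. c * (w $ i)\<^sup>2) / 2"
      using assms(2) col by (intro add_mono divide_right_mono sum_mono mult_right_mono) auto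
    also have "\<dots> = c * ((norm v)\<^sup>2 + (norm w)\<^sup>2) / 2"
      by (simp add: n2 sum_distrib_left[symmetric] field_simps)
    finally show ?thesis .
  qed
  show ?thesis
  proof (cases "v = 0 \<or> w = 0")
    case True then show ?thesis by auto
  next
    case False
    have "\<bar>(v /\<^sub>R norm v) \<bullet> (M *v (w /\<^sub>R norm w))\<bar> \<le> c * (1 + 1) / 2"
      using half[of "v /\<^sub>R norm v" "w /\<^sub>R norm w"] False by simp
    then have "\<bar>v \<bullet> (M *v w)\<bar> / (norm v * norm w) \<le> c"
      using False by (simp add: matrix_vector_mult_scaleR abs_mult field_simps)
    then show ?thesis using False by (simp add: field_simps)
  qed
qed

lemma rows_le_norm_bound:
  fixes M :: "real^'n^'n"
  assumes "sym_mat M" "rows_le c M"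
  shows "norm (M *v w) \<le> c * norm w"
proof (cases "M *v w = 0")
  case True
  have "0 \<le> (\<Sum>j\<in>UNIV. \<bar>M $ i $ j\<bar>)" for i by (simp add: sum_nonneg)
  then have "0 \<le> c" using assms(2) order_trans by blast
  then show ?thesis using True by simp
next
  case False
  have "(norm (M *v w))\<^sup>2 \<le> c * (norm (M *v w) * norm w)"
    using rows_le_bilinear_bound[OF assms, of "M *v w" w] by (simp add: power2_norm_eq_inner)
  then have "norm (M *v w) * norm (M *v w) \<le> norm (M *v w) * (c * norm w)"
    by (simp add: power2_eq_square mult_ac)
  then show ?thesis using False mult_le_cancel_left_pos[of "norm (M *v w)"] by simp
qed

lemma psd_norm_bound:
  fixes M :: "real^'n^'n"
  assumes s: "sym_mat M" and \<theta>: "\<theta> > 0"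
    and p: "\<And>\<xi>. 0 \<le> \<xi> \<bullet> (M *v \<xi>)" and u: "\<And>\<xi>. \<xi> \<bullet> (M *v \<xi>) \<le> \<theta> * (norm \<xi>)\<^sup>2"
  shows "(norm (M *v w))\<^sup>2 \<le> \<theta> * (w \<bullet> (M *v w))"
proof -
  define n where "n = (norm (M *v w))\<^sup>2"
  define t where "t = inverse \<theta>"
  have "0 \<le> (w - t *\<^sub>R (M *v w)) \<bullet> (M *v (w - t *\<^sub>R (M *v w)))" by (rule p)
  also have "\<dots> = w \<bullet> (M *v w) - 2 * t * n + t\<^sup>2 * ((M *v w) \<bullet> (M *v (M *v w)))"
  proof -
    have "w \<bullet> (M *v (M *v w)) = n" using sym_inner[OF s, of w "M *v w"] by (simp add: n_def power2_norm_eq_inner)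
    moreover have "(M *v w) \<bullet> (M *v w) = n" by (simp add: n_def power2_norm_eq_inner)
    ultimately show ?thesis
      by (simp add: matrix_vector_mult_diff_distrib matrix_vector_mult_scaleR inner_diff_left inner_diff_right
        inner_commute[of "M *v w" w] power2_eq_square algebra_simps)
  qed
  also have "\<dots> \<le> w \<bullet> (M *v w) - 2 * t * n + t\<^sup>2 * (\<theta> * n)"
    using u[of "M *v w"] by (intro add_left_mono mult_left_mono) (auto simp: n_def)
  also have "\<dots> = w \<bullet> (M *v w) - n / \<theta>" using \<theta> by (simp add: t_def power2_eq_square field_simps)
  finally show ?thesis using \<theta> by (simp add: n_def field_simps)
qed

lemma matrix_vector_axis_sum:
  fixes M :: "real^'n^'n"
  shows "(\<Sum>k\<in>UNIV. v $ k * (w \<bullet> (M *v (N *v axis k 1)))) = w \<bullet> (M *v (N *v v))"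
proof -
  have "M *v (N *v v) = M *v (N *v (\<Sum>k\<in>UNIV. (v $ k) *\<^sub>R axis k 1))"
    using basis_expansion[of v] by (simp add: scalar_mult_eq_scaleR)
  also have "\<dots> = (\<Sum>k\<in>UNIV. (v $ k) *\<^sub>R (M *v (N *v axis k 1)))"
    by (simp add: linear_sum[OF matrix_vector_mul_linear] matrix_vector_mult_scaleR)
  finally show ?thesis by (simp add: inner_sum_right)
qed

lemma elliptic_bounds:
  fixes A :: "real^'n^'n"
  assumes \<theta>: "\<theta> \<ge> 1" and e: "elliptic \<theta> A" and s: "sym_mat A"
  shows "(norm v)\<^sup>2 \<le> \<theta> * (v \<bullet> (A *v v))" "(norm (A *v v))\<^sup>2 \<le> \<theta> * (v \<bullet> (A *v v))"
    "0 \<le> v \<bullet> (A *v v)"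
proof -
  have "inverse \<theta> * (norm v)\<^sup>2 \<le> v \<bullet> (A *v v)" using e by blast
  then show "(norm v)\<^sup>2 \<le> \<theta> * (v \<bullet> (A *v v))" using \<theta> by (simp add: field_simps)
  have p: "0 \<le> v \<bullet> (A *v v)" for v
  proof -
    have "0 \<le> inverse \<theta> * (norm v)\<^sup>2" using \<theta> by simp
    then show ?thesis using e order_trans by blast
  qed
  then show "0 \<le> v \<bullet> (A *v v)" by blast
  show "(norm (A *v v))\<^sup>2 \<le> \<theta> * (v \<bullet> (A *v v))"
    using psd_norm_bound[OF s _ p] \<theta> e by auto
qed

lemma inverse_norm_bound:
  fixes A0 B :: "real^'n^'n"
  assumes \<theta>: "\<theta> \<ge> 1" and e: "elliptic \<theta> A0" and i: "\<And>v. A0 *v (B *v v) = v"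
  shows "norm (B *v v) \<le> \<theta> * norm v"
proof (cases "B *v v = 0")
  case False
  have "inverse \<theta> * (norm (B *v v))\<^sup>2 \<le> (B *v v) \<bullet> (A0 *v (B *v v))" using e by blast
  also have "\<dots> \<le> norm (B *v v) * norm v" unfolding i by (rule norm_cauchy_schwarz)
  finally have "norm (B *v v) * norm (B *v v) \<le> norm (B *v v) * (\<theta> * norm v)"
    using \<theta> by (simp add: power2_eq_square field_simps)
  then show ?thesis using False mult_le_cancel_left_pos[of "norm (B *v v)"] by simp
qed (use \<theta> in auto)

lemma abs_diff_le_add: "\<bar>a\<bar> \<le> c \<Longrightarrow> \<bar>b\<bar> \<le> d \<Longrightarrow> \<bar>a - b\<bar> \<le> c + (d::real)"
  by arith

text \<open>In the last three estimates the left-hand sides vanish when the matrix is constantly \<open>A 0\<close>, because then \<open>m = 1\<close> and \<open>A B\<close> is the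
identity. In general they are controlled by \<open>A - A 0\<close> and by the derivatives of \<open>A\<close>. All powers of the ellipticity constant
that occur are rounded up to \<open>\<theta>^(11/2)\<close>, the power in \<open>L\<close>.\<close>

lemma coefficient_bounds:
  fixes A A0 B :: "real^'n^'n" and dA :: "'n \<Rightarrow> real^'n^'n" and x y f1 :: "real^'n"
    and \<theta> \<theta>2 \<sigma> :: real
  defines "D \<equiv> A - A0" and "m \<equiv> (y \<bullet> (A *v y)) / \<sigma>\<^sup>2" and "\<Gamma> \<equiv> f1 \<bullet> (A *v f1)"
    and "L \<equiv> real CARD('n) * (\<theta>^5 * sqrt \<theta>) * \<theta>2"
    and "t \<equiv> (\<Sum>k\<in>UNIV. ((A - A0) *v (B *v axis k 1)) $ k)"
    and "dv \<equiv> (\<Sum>k\<in>UNIV. (dA k *v y) $ k)"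
  assumes \<theta>: "\<theta> \<ge> 1" and \<theta>2: "\<theta>2 \<ge> 0"
    and A: "elliptic \<theta> A" "sym_mat A" and A0: "elliptic \<theta> A0" "sym_mat A0"
    and i: "\<And>v. A0 *v (B *v v) = v"  "\<And>v. B *v (A0 *v v) = v"
    and y: "y = B *v x" and \<sigma>: "\<sigma> > 0" and \<sigma>2: "\<sigma>\<^sup>2 = x \<bullet> y"
    and D: "rows_le (\<theta>2 * norm x) (A - A0)" and dA: "\<And>k. sym_mat (dA k)" "\<And>k. rows_le \<theta>2 (dA k)"
  shows "1 \<le> \<theta>\<^sup>2 * m"
    and "\<bar>t + dv - 2 * (m - 1)\<bar> \<le> 4 * L * (m * \<sigma>)"
    and "\<bar>((\<Sum>k\<in>UNIV. (A *v y) $ k * (y \<bullet> (dA k *v y))) + 2 * ((B *v (A *v y)) \<bullet> (A *v y))) / \<sigma>\<^sup>2 - 2 * m\<^sup>2\<bar>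
           \<le> 5 * L * (m\<^sup>2 * \<sigma>)"
    and "\<bar>(t + dv) * \<Gamma> + 2 * (\<Gamma> - f1 \<bullet> (A *v (B *v (A *v f1))))
            + (\<Sum>k\<in>UNIV. (A *v y) $ k * (f1 \<bullet> (dA k *v f1)))
            - 2 * (\<Sum>k\<in>UNIV. (A *v f1) $ k * (f1 \<bullet> (dA k *v y)))\<bar> \<le> 7 * L * (m * \<sigma> * \<Gamma>)"
proof -
  define h where "h = sqrt \<theta>"
  have h: "h \<ge> 1" "h * h = \<theta>" "h \<ge> 0" using \<theta> by (auto simp: h_def)
  define d where "d = real CARD('n)"
  have d: "d \<ge> 1" unfolding d_def using zero_less_card_finite[where 'a='n] by linarith
  have L: "L = d * (\<theta>^5 * h) * \<theta>2" by (simp add: L_def h_def d_def)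
  have x: "x = A0 *v y" by (simp add: y i)
  have \<sigma>y: "\<sigma>\<^sup>2 = y \<bullet> (A0 *v y)" using \<sigma>2 x by (simp add: inner_commute)
  have le_h: "norm v \<le> h * a" if "(norm v)\<^sup>2 \<le> \<theta> * a\<^sup>2" "a \<ge> 0" for v :: "real^'n" and a
  proof (rule power2_le_imp_le)
    have "(h * a)\<^sup>2 = (h * h) * a\<^sup>2" by (simp add: power2_eq_square)
    then show "(norm v)\<^sup>2 \<le> (h * a)\<^sup>2" using that(1) h by simp
  qed (use that h in auto)
  note eA = elliptic_bounds[OF \<theta> A] and eA0 = elliptic_bounds[OF \<theta> A0]
  have nx: "norm x \<le> h * \<sigma>" using eA0(2)[of y] \<sigma>y x \<sigma> by (intro le_h) auto
  have ny: "norm y \<le> h * \<sigma>" using eA0(1)[of y] \<sigma>y \<sigma> by (intro le_h) auto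
  have m\<sigma>: "m * \<sigma>\<^sup>2 = y \<bullet> (A *v y)" using \<sigma> by (simp add: m_def)
  have m0: "m \<ge> 0" unfolding m_def using eA(3) by simp
  define r where "r = sqrt m"
  have r: "r \<ge> 0" "r * r = m" using m0 by (auto simp: r_def)
  have rs: "(r * \<sigma>)\<^sup>2 = y \<bullet> (A *v y)" using m\<sigma> r by (simp add: power2_eq_square mult_ac)
  have ny': "norm y \<le> h * (r * \<sigma>)" using eA(1)[of y] rs r \<sigma> by (intro le_h) auto
  have nAy: "norm (A *v y) \<le> h * (r * \<sigma>)" using eA(2)[of y] rs r \<sigma> by (intro le_h) auto
  define g where "g = sqrt \<Gamma>"
  have \<Gamma>0: "\<Gamma> \<ge> 0" unfolding \<Gamma>_def by (rule eA(3))
  have g: "g \<ge> 0" "g * g = \<Gamma>" using \<Gamma>0 by (auto simp: g_def)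
  have nf: "norm f1 \<le> h * g" using eA(1)[of f1] g by (intro le_h) (auto simp: \<Gamma>_def[symmetric] power2_eq_square)
  have nAf: "norm (A *v f1) \<le> h * g" using eA(2)[of f1] g by (intro le_h) (auto simp: \<Gamma>_def[symmetric] power2_eq_square)
  show m1: "1 \<le> \<theta>\<^sup>2 * m"
  proof -
    have "\<sigma>\<^sup>2 \<le> \<theta> * (norm y)\<^sup>2" unfolding \<sigma>y using A0(1) by blast
    also have "\<dots> \<le> \<theta> * (\<theta> * (m * \<sigma>\<^sup>2))" using eA(1)[of y] \<theta> unfolding m\<sigma> by (intro mult_left_mono) auto
    finally have "\<sigma>\<^sup>2 * 1 \<le> \<sigma>\<^sup>2 * (\<theta>\<^sup>2 * m)" by (simp add: power2_eq_square mult_ac)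
    moreover have "\<sigma>\<^sup>2 > 0" using \<sigma> by simp
    ultimately show ?thesis by (simp only: mult_le_cancel_left_pos)
  qed
  have r1: "r \<le> \<theta> * m"
  proof -
    have "1 \<le> (\<theta> * r)\<^sup>2" using m1 r by (simp add: power2_eq_square mult_ac)
    then have "1 \<le> \<theta> * r" using power2_le_imp_le[of 1 "\<theta> * r"] r \<theta> by simp
    then have "1 * r \<le> (\<theta> * r) * r" using r by (intro mult_right_mono) auto
    then show ?thesis using r by (simp add: mult_ac)
  qed
  have symD: "sym_mat (A - A0)" using A A0 by (simp add: vector_minus_component)
  have Dbl: "\<bar>v \<bullet> (D *v w)\<bar> \<le> \<theta>2 * norm x * (norm v * norm w)" for v w
    unfolding D_def by (rule rows_le_bilinear_bound[OF symD D])
  have nB: "norm (B *v v) \<le> \<theta> * norm v" for v by (rule inverse_norm_bound[OF \<theta> A0(1) i(1)])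
  have dAbl: "\<bar>v \<bullet> (dA k *v w)\<bar> \<le> \<theta>2 * (norm v * norm w)" for v w k
    by (rule rows_le_bilinear_bound[OF dA])
  have pw: "\<theta>^a * h \<le> \<theta>^5 * h" if "a \<le> 5" for a
    using h \<theta> that by (intro mult_right_mono power_increasing) auto
  have Lmon: "c * (\<theta>^a * h) * \<theta>2 * w \<le> L * w" if "a \<le> 5" "0 \<le> w" "0 \<le> c" "c \<le> d" for a w c
    unfolding L using that pw[OF that(1)] \<theta>2 h \<theta> by (intro mult_right_mono mult_mono) auto
  have L0: "L \<ge> 0" unfolding L using d h \<theta> \<theta>2 by simp
  have tb: "\<bar>t\<bar> \<le> d * (\<theta> * h) * \<theta>2 * \<sigma>"
  proof -
    have "\<bar>t\<bar> \<le> (\<Sum>k\<in>(UNIV::'n set). \<theta>2 * (h * \<sigma>) * \<theta>)"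
      unfolding t_def
    proof (intro order_trans[OF sum_abs] sum_mono)
      fix k :: 'n
      have "\<bar>((A - A0) *v (B *v axis k 1)) $ k\<bar> = \<bar>axis k 1 \<bullet> (D *v (B *v axis k 1))\<bar>"
        by (simp add: inner_axis' D_def)
      also have "\<dots> \<le> \<theta>2 * norm x * (norm (axis k 1 :: real^'n) * norm (B *v axis k 1))" by (rule Dbl)
      also have "\<dots> \<le> \<theta>2 * (h * \<sigma>) * (1 * \<theta>)"
        using nB[of "axis k 1"] nx \<theta>2 h \<sigma> \<theta> by (intro mult_mono) (auto simp: norm_axis_1)
      finally show "\<bar>((A - A0) *v (B *v axis k 1)) $ k\<bar> \<le> \<theta>2 * (h * \<sigma>) * \<theta>" by simp
    qed
    then show ?thesis by (simp add: d_def mult_ac)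
  qed
  have dvb: "\<bar>dv\<bar> \<le> d * \<theta>2 * norm y"
  proof -
    have "\<bar>dv\<bar> \<le> (\<Sum>k\<in>(UNIV::'n set). \<theta>2 * norm y)"
      unfolding dv_def
    proof (intro order_trans[OF sum_abs] sum_mono)
      fix k :: 'n
      have "\<bar>(dA k *v y) $ k\<bar> = \<bar>axis k 1 \<bullet> (dA k *v y)\<bar>" by (simp add: inner_axis')
      also have "\<dots> \<le> \<theta>2 * (norm (axis k 1 :: real^'n) * norm y)" by (rule dAbl)
      finally show "\<bar>(dA k *v y) $ k\<bar> \<le> \<theta>2 * norm y" by (simp add: norm_axis_1)
    qed
    then show ?thesis by (simp add: d_def mult_ac)
  qed
  have dirb: "\<bar>\<Sum>k\<in>UNIV. u $ k * (v \<bullet> (dA k *v w))\<bar> \<le> d * \<theta>2 * (norm u * (norm v * norm w))" for u v w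
  proof -
    have "\<bar>\<Sum>k\<in>UNIV. u $ k * (v \<bullet> (dA k *v w))\<bar> \<le> (\<Sum>k\<in>(UNIV::'n set). norm u * (\<theta>2 * (norm v * norm w)))"
    proof (intro order_trans[OF sum_abs] sum_mono)
      fix k :: 'n
      show "\<bar>u $ k * (v \<bullet> (dA k *v w))\<bar> \<le> norm u * (\<theta>2 * (norm v * norm w))"
        unfolding abs_mult using component_le_norm_cart[of u k] dAbl[of v k w] by (intro mult_mono) auto
    qed
    then show ?thesis by (simp add: d_def mult_ac)
  qed
  have tm: "\<bar>t\<bar> \<le> L * (m * \<sigma>)"
  proof -
    have "d * (\<theta> * h) * \<theta>2 * \<sigma> * 1 \<le> d * (\<theta> * h) * \<theta>2 * \<sigma> * (\<theta>\<^sup>2 * m)"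
      using m1 d h \<theta> \<theta>2 \<sigma> by (intro mult_left_mono) auto
    also have "\<dots> = d * (\<theta>^3 * h) * \<theta>2 * (m * \<sigma>)" by (simp add: power2_eq_square power3_eq_cube mult_ac)
    also have "\<dots> \<le> L * (m * \<sigma>)" using m0 \<sigma> d by (intro Lmon) auto
    finally show ?thesis using tb by simp
  qed
  have hr: "h * (r * \<sigma>) \<le> (\<theta>^1 * h) * (m * \<sigma>)"
  proof -
    have "h * (r * \<sigma>) \<le> h * ((\<theta> * m) * \<sigma>)" using r1 h \<sigma> by (intro mult_left_mono mult_right_mono) auto
    then show ?thesis by (simp add: mult_ac)
  qed
  have dvm: "\<bar>dv\<bar> \<le> L * (m * \<sigma>)"
  proof -
    have "d * \<theta>2 * norm y \<le> d * \<theta>2 * ((\<theta>^1 * h) * (m * \<sigma>))"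
      using ny' hr d \<theta>2 by (intro mult_left_mono) auto
    also have "\<dots> = d * (\<theta>^1 * h) * \<theta>2 * (m * \<sigma>)" by (simp add: mult_ac)
    also have "\<dots> \<le> L * (m * \<sigma>)" using m0 \<sigma> d by (intro Lmon) auto
    finally show ?thesis using dvb by simp
  qed
  have m_1: "m - 1 = (y \<bullet> (D *v y)) / \<sigma>\<^sup>2"
  proof -
    have "m - 1 = (y \<bullet> (A *v y)) / \<sigma>\<^sup>2 - \<sigma>\<^sup>2 / \<sigma>\<^sup>2" using \<sigma> by (simp add: m_def)
    also have "\<dots> = (y \<bullet> (A *v y) - \<sigma>\<^sup>2) / \<sigma>\<^sup>2" by (simp only: diff_divide_distrib)
    also have "y \<bullet> (A *v y) - \<sigma>\<^sup>2 = y \<bullet> (D *v y)"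
      unfolding D_def \<sigma>y by (simp add: matrix_vector_mult_diff_rdistrib inner_diff_right)
    finally show ?thesis .
  qed
  have yDy: "\<bar>y \<bullet> (D *v y)\<bar> \<le> \<theta>2 * (h * \<sigma>) * ((h * (r * \<sigma>)) * (h * (r * \<sigma>)))"
    using Dbl[of y y] nx ny' \<theta>2 h \<sigma> r by (elim order_trans, intro mult_mono) auto
  have m1b: "\<bar>m - 1\<bar> \<le> L * (m * \<sigma>)"
  proof -
    have "\<bar>m - 1\<bar> = \<bar>y \<bullet> (D *v y)\<bar> / \<sigma>\<^sup>2" unfolding m_1 by simp
    also have "\<dots> \<le> (\<theta>2 * (h * \<sigma>) * ((h * (r * \<sigma>)) * (h * (r * \<sigma>)))) / \<sigma>\<^sup>2"
      using yDy by (intro divide_right_mono) auto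
    also have "\<dots> = (h * h) * h * \<theta>2 * ((r * r) * \<sigma>)" using \<sigma> by (simp add: field_simps power2_eq_square)
    also have "\<dots> = 1 * (\<theta>^1 * h) * \<theta>2 * (m * \<sigma>)" using h r by simp
    also have "\<dots> \<le> L * (m * \<sigma>)" using m0 \<sigma> d by (intro Lmon) auto
    finally show ?thesis .
  qed
  show "\<bar>t + dv - 2 * (m - 1)\<bar> \<le> 4 * L * (m * \<sigma>)"
  proof -
    have "\<bar>a + b - 2 * c\<bar> \<le> 4 * w" if "\<bar>a\<bar> \<le> w" "\<bar>b\<bar> \<le> w" "\<bar>c\<bar> \<le> w" for a b c w :: real
      using that by arith
    from this[OF tm dvm m1b] show ?thesis by (simp only: mult.assoc)
  qed
  have hrm: "(h * (r * \<sigma>)) * ((h * (r * \<sigma>)) * (h * (r * \<sigma>))) \<le> (\<theta>^2 * h) * (m\<^sup>2 * \<sigma>) * \<sigma>\<^sup>2"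
  proof -
    have "(h * (r * \<sigma>)) * ((h * (r * \<sigma>)) * (h * (r * \<sigma>))) \<le> ((\<theta>^1 * h) * (m * \<sigma>)) * ((h * (r * \<sigma>)) * (h * (r * \<sigma>)))"
      using hr h r \<sigma> by (intro mult_right_mono) auto
    also have "\<dots> = (\<theta> * (h * h)) * h * (m * (r * r) * \<sigma>) * \<sigma>\<^sup>2" by (simp add: power2_eq_square mult_ac)
    finally show ?thesis using h r by (simp add: power2_eq_square mult_ac)
  qed
  have ga: "\<bar>\<Sum>k\<in>UNIV. (A *v y) $ k * (y \<bullet> (dA k *v y))\<bar> / \<sigma>\<^sup>2 \<le> L * (m\<^sup>2 * \<sigma>)"
  proof -
    have "\<bar>\<Sum>k\<in>UNIV. (A *v y) $ k * (y \<bullet> (dA k *v y))\<bar> \<le> d * \<theta>2 * (norm (A *v y) * (norm y * norm y))" by (rule dirb)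
    also have "\<dots> \<le> d * \<theta>2 * ((h * (r * \<sigma>)) * ((h * (r * \<sigma>)) * (h * (r * \<sigma>))))"
      using nAy ny' d \<theta>2 h r \<sigma> by (intro mult_mono) auto
    also have "\<dots> \<le> d * \<theta>2 * ((\<theta>^2 * h) * (m\<^sup>2 * \<sigma>) * \<sigma>\<^sup>2)" using hrm d \<theta>2 by (intro mult_left_mono) auto
    finally have "\<bar>\<Sum>k\<in>UNIV. (A *v y) $ k * (y \<bullet> (dA k *v y))\<bar> / \<sigma>\<^sup>2 \<le> d * (\<theta>^2 * h) * \<theta>2 * (m\<^sup>2 * \<sigma>)"
      using \<sigma> by (simp add: field_simps)
    also have "\<dots> \<le> L * (m\<^sup>2 * \<sigma>)" using m0 \<sigma> d by (intro Lmon) auto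
    finally show ?thesis .
  qed
  have gb: "\<bar>((B *v (A *v y)) \<bullet> (A *v y)) / \<sigma>\<^sup>2 - m\<^sup>2\<bar> \<le> 2 * L * (m\<^sup>2 * \<sigma>)"
  proof -
    have AD: "A *v v = A0 *v v + D *v v" for v unfolding D_def by (simp add: matrix_vector_mult_diff_rdistrib)
    have "(B *v (A *v y)) \<bullet> (A *v y) = (B *v (A *v y)) \<bullet> (A0 *v y) + (B *v (A *v y)) \<bullet> (D *v y)"
      by (subst (2) AD) (simp add: inner_add_right)
    also have "(B *v (A *v y)) \<bullet> (A0 *v y) = y \<bullet> (A *v y)"
      using sym_inner[OF A0(2), of "B *v (A *v y)" y] i by simp
    finally have e1: "((B *v (A *v y)) \<bullet> (A *v y)) / \<sigma>\<^sup>2 = m + ((B *v (A *v y)) \<bullet> (D *v y)) / \<sigma>\<^sup>2"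
      by (simp add: m_def add_divide_distrib)
    have "m - m\<^sup>2 = - m * ((y \<bullet> (D *v y)) / \<sigma>\<^sup>2)" unfolding m_1[symmetric] by (simp add: power2_eq_square algebra_simps)
    then have e2: "((B *v (A *v y)) \<bullet> (A *v y)) / \<sigma>\<^sup>2 - m\<^sup>2
        = ((B *v (A *v y)) \<bullet> (D *v y)) / \<sigma>\<^sup>2 - m * (m - 1)"
      unfolding e1 m_1 by simp
    have p1: "\<bar>(B *v (A *v y)) \<bullet> (D *v y)\<bar> / \<sigma>\<^sup>2 \<le> L * (m\<^sup>2 * \<sigma>)"
    proof -
      have "\<bar>(B *v (A *v y)) \<bullet> (D *v y)\<bar> \<le> \<theta>2 * norm x * (norm (B *v (A *v y)) * norm y)" by (rule Dbl)
      also have "\<dots> \<le> \<theta>2 * (h * \<sigma>) * ((\<theta> * (h * (r * \<sigma>))) * (h * (r * \<sigma>)))"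
        using nx nAy ny' \<theta>2 h r \<sigma> \<theta>
        by (intro mult_mono order_trans[OF nB]) auto
      also have "\<dots> = (\<theta> * (h * h) * h) * \<theta>2 * ((r * r) * \<sigma>) * \<sigma>\<^sup>2" by (simp add: power2_eq_square mult_ac)
      also have "\<dots> = (\<theta>^2 * h) * \<theta>2 * (m * \<sigma>) * \<sigma>\<^sup>2" using h r by (simp add: power2_eq_square)
      finally have "\<bar>(B *v (A *v y)) \<bullet> (D *v y)\<bar> / \<sigma>\<^sup>2 \<le> (\<theta>^2 * h) * \<theta>2 * (m * \<sigma>) * 1"
        using \<sigma> by (simp add: field_simps)
      also have "\<dots> \<le> (\<theta>^2 * h) * \<theta>2 * (m * \<sigma>) * (\<theta>\<^sup>2 * m)" using m1 m0 h \<theta> \<theta>2 \<sigma> by (intro mult_left_mono) auto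
      also have "\<dots> = 1 * (\<theta>^4 * h) * \<theta>2 * (m\<^sup>2 * \<sigma>)" by (simp add: power2_eq_square power4_eq_xxxx mult_ac)
      also have "\<dots> \<le> L * (m\<^sup>2 * \<sigma>)" using m0 \<sigma> d by (intro Lmon) auto
      finally show ?thesis .
    qed
    have p2: "\<bar>m * (m - 1)\<bar> \<le> L * (m\<^sup>2 * \<sigma>)"
    proof -
      have "m * \<bar>m - 1\<bar> \<le> m * (L * (m * \<sigma>))" using m1b m0 by (intro mult_left_mono) auto
      then show ?thesis using m0 by (simp add: abs_mult power2_eq_square mult_ac)
    qed
    have p1': "\<bar>((B *v (A *v y)) \<bullet> (D *v y)) / \<sigma>\<^sup>2\<bar> \<le> L * (m\<^sup>2 * \<sigma>)" using p1 by simp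
    have "\<bar>((B *v (A *v y)) \<bullet> (D *v y)) / \<sigma>\<^sup>2 - m * (m - 1)\<bar> \<le> L * (m\<^sup>2 * \<sigma>) + L * (m\<^sup>2 * \<sigma>)"
      using p1' p2 by (rule abs_diff_le_add)
    then show ?thesis unfolding e2 by (simp only: mult.assoc)
  qed
  have ga': "\<bar>(\<Sum>k\<in>UNIV. (A *v y) $ k * (y \<bullet> (dA k *v y))) / \<sigma>\<^sup>2\<bar> \<le> L * (m\<^sup>2 * \<sigma>)" using ga by simp
  show "\<bar>((\<Sum>k\<in>UNIV. (A *v y) $ k * (y \<bullet> (dA k *v y))) + 2 * ((B *v (A *v y)) \<bullet> (A *v y))) / \<sigma>\<^sup>2 - 2 * m\<^sup>2\<bar>
           \<le> 5 * L * (m\<^sup>2 * \<sigma>)"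
  proof -
    have "((\<Sum>k\<in>UNIV. (A *v y) $ k * (y \<bullet> (dA k *v y))) + 2 * ((B *v (A *v y)) \<bullet> (A *v y))) / \<sigma>\<^sup>2 - 2 * m\<^sup>2
       = (\<Sum>k\<in>UNIV. (A *v y) $ k * (y \<bullet> (dA k *v y))) / \<sigma>\<^sup>2 + 2 * (((B *v (A *v y)) \<bullet> (A *v y)) / \<sigma>\<^sup>2 - m\<^sup>2)"
      by (simp add: add_divide_distrib)
    moreover have "\<bar>a + 2 * b\<bar> \<le> 5 * c" if "\<bar>a\<bar> \<le> c" "\<bar>b\<bar> \<le> 2 * c" for a b c :: real
      using that by arith
    ultimately show ?thesis using ga' gb by (simp only: mult.assoc)
  qed
  have qa: "\<bar>(t + dv) * \<Gamma>\<bar> \<le> 2 * L * (m * \<sigma> * \<Gamma>)"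
  proof -
    have "\<bar>t + dv\<bar> * \<Gamma> \<le> (2 * L * (m * \<sigma>)) * \<Gamma>" using tm dvm \<Gamma>0 by (intro mult_right_mono) auto
    then show ?thesis using \<Gamma>0 by (simp add: abs_mult mult_ac)
  qed
  have qb: "\<bar>\<Gamma> - f1 \<bullet> (A *v (B *v (A *v f1)))\<bar> \<le> L * (m * \<sigma> * \<Gamma>)"
  proof -
    have AD: "A *v v = A0 *v v + D *v v" for v unfolding D_def by (simp add: matrix_vector_mult_diff_rdistrib)
    have "f1 \<bullet> (A *v (B *v (A *v f1))) = (B *v (A *v f1)) \<bullet> (A *v f1)"
      by (rule sym_inner[OF A(2)])
    also have "\<dots> = (B *v (A *v f1)) \<bullet> (A0 *v f1) + (B *v (A *v f1)) \<bullet> (D *v f1)"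
      by (subst (2) AD) (simp add: inner_add_right)
    also have "(B *v (A *v f1)) \<bullet> (A0 *v f1) = \<Gamma>"
      using sym_inner[OF A0(2), of "B *v (A *v f1)" f1] i by (simp add: \<Gamma>_def)
    finally have "\<bar>\<Gamma> - f1 \<bullet> (A *v (B *v (A *v f1)))\<bar> = \<bar>(B *v (A *v f1)) \<bullet> (D *v f1)\<bar>" by simp
    also have "\<dots> \<le> \<theta>2 * norm x * (norm (B *v (A *v f1)) * norm f1)" by (rule Dbl)
    also have "\<dots> \<le> \<theta>2 * (h * \<sigma>) * ((\<theta> * (h * g)) * (h * g))"
      using nx nf nAf \<theta>2 h g \<sigma> \<theta> by (intro mult_mono order_trans[OF nB]) auto
    also have "\<dots> = (\<theta> * (h * h) * h) * \<theta>2 * (\<sigma> * (g * g))" by (simp add: mult_ac)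
    also have "\<dots> = (\<theta>^2 * h) * \<theta>2 * (\<sigma> * \<Gamma>) * 1" using h g by (simp add: power2_eq_square)
    also have "\<dots> \<le> (\<theta>^2 * h) * \<theta>2 * (\<sigma> * \<Gamma>) * (\<theta>\<^sup>2 * m)" using m1 \<Gamma>0 h \<theta> \<theta>2 \<sigma> by (intro mult_left_mono) auto
    also have "\<dots> = 1 * (\<theta>^4 * h) * \<theta>2 * (m * \<sigma> * \<Gamma>)" by (simp add: power2_eq_square power4_eq_xxxx mult_ac)
    also have "\<dots> \<le> L * (m * \<sigma> * \<Gamma>)" using m0 \<sigma> d \<Gamma>0 by (intro Lmon) auto
    finally show ?thesis .
  qed
  have qcd: "norm u * (norm v * norm w) \<le> (\<theta>^2 * h) * (m * \<sigma> * \<Gamma>)"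
    if "norm u \<le> h * g" "norm v \<le> h * g" "norm w \<le> h * (r * \<sigma>)" for u v w :: "real^'n"
  proof -
    have "norm u * (norm v * norm w) \<le> (h * g) * ((h * g) * ((\<theta>^1 * h) * (m * \<sigma>)))"
      using that h g hr r \<sigma> by (intro mult_mono order_trans[OF that(3) hr]) auto
    also have "\<dots> = (\<theta> * (h * h) * h) * (m * \<sigma> * (g * g))" by (simp add: mult_ac)
    finally show ?thesis using h g by (simp add: power2_eq_square)
  qed
  have dq: "d * \<theta>2 * ((\<theta>^2 * h) * (m * \<sigma> * \<Gamma>)) \<le> L * (m * \<sigma> * \<Gamma>)"
    using Lmon[of 2 "m * \<sigma> * \<Gamma>" d] m0 \<sigma> d \<Gamma>0 by (simp add: mult_ac)
  have qc: "\<bar>\<Sum>k\<in>UNIV. (A *v y) $ k * (f1 \<bullet> (dA k *v f1))\<bar> \<le> L * (m * \<sigma> * \<Gamma>)"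
  proof -
    have "\<bar>\<Sum>k\<in>UNIV. (A *v y) $ k * (f1 \<bullet> (dA k *v f1))\<bar> \<le> d * \<theta>2 * (norm (A *v y) * (norm f1 * norm f1))" by (rule dirb)
    also have "\<dots> \<le> d * \<theta>2 * ((\<theta>^2 * h) * (m * \<sigma> * \<Gamma>))"
      using qcd[OF nf nf nAy] d \<theta>2 by (intro mult_left_mono) (auto simp: mult_ac)
    finally show ?thesis using dq by simp
  qed
  have qd: "\<bar>\<Sum>k\<in>UNIV. (A *v f1) $ k * (f1 \<bullet> (dA k *v y))\<bar> \<le> L * (m * \<sigma> * \<Gamma>)"
  proof -
    have "\<bar>\<Sum>k\<in>UNIV. (A *v f1) $ k * (f1 \<bullet> (dA k *v y))\<bar> \<le> d * \<theta>2 * (norm (A *v f1) * (norm f1 * norm y))" by (rule dirb)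
    also have "\<dots> \<le> d * \<theta>2 * ((\<theta>^2 * h) * (m * \<sigma> * \<Gamma>))"
      using qcd[OF nAf nf ny'] d \<theta>2 by (intro mult_left_mono) auto
    finally show ?thesis using dq by simp
  qed
  show "\<bar>(t + dv) * \<Gamma> + 2 * (\<Gamma> - f1 \<bullet> (A *v (B *v (A *v f1))))
            + (\<Sum>k\<in>UNIV. (A *v y) $ k * (f1 \<bullet> (dA k *v f1)))
            - 2 * (\<Sum>k\<in>UNIV. (A *v f1) $ k * (f1 \<bullet> (dA k *v y)))\<bar> \<le> 7 * L * (m * \<sigma> * \<Gamma>)"
  proof -
    have "\<bar>a + 2 * b + c - 2 * e\<bar> \<le> 7 * w" if "\<bar>a\<bar> \<le> 2 * w" "\<bar>b\<bar> \<le> w" "\<bar>c\<bar> \<le> w" "\<bar>e\<bar> \<le> w" for a b c e w :: real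
      using that by arith
    from this[OF _ qb qc qd, of "(t + dv) * \<Gamma>"] show ?thesis using qa by (simp only: mult.assoc)
  qed
qed

section \<open>The flux and its divergence\<close>

text \<open>The vector field whose divergence is the cross term of the expanded square: the Rellich field
\<open>2 (\<gamma> \<bullet> \<nabla>f) A \<nabla>f - (\<nabla>f \<bullet> A \<nabla>f) \<gamma>\<close> for the multiplier \<open>\<gamma> = E A y\<close>, with one correction for the divergence of the multiplier and one for
the potential \<open>\<alpha>\<^sup>2 m / (E \<sigma>)\<^sup>2\<close>. As an algebraic expression it depends only on the values of the functions at the point.\<close>

definition flux ::
  "real \<Rightarrow> real \<Rightarrow> real \<Rightarrow> real^'n^'n \<Rightarrow> real^'n \<Rightarrow> real \<Rightarrow> real^'n \<Rightarrow> real^'n" where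
  "flux \<nu> \<alpha> \<sigma> A y f f1 = (let E = exp (\<nu> * \<sigma>); \<gamma> = E *\<^sub>R (A *v y) in
     (2 * (\<gamma> \<bullet> f1)) *\<^sub>R (A *v f1) - (f1 \<bullet> (A *v f1)) *\<^sub>R \<gamma>
     + ((real CARD('n) - 2) * E * f) *\<^sub>R (A *v f1)
     + (\<alpha>\<^sup>2 * (((y \<bullet> (A *v y)) / \<sigma>\<^sup>2) * f\<^sup>2 / (E * \<sigma>)\<^sup>2)) *\<^sub>R \<gamma>)"

text \<open>The derivative of the flux in one direction, primed letters denoting the derivatives of the arguments. Having it as an
algebraic expression separates the computation of the divergence from all questions of differentiability.\<close>

definition flux_partial ::
  "real \<Rightarrow> real \<Rightarrow> real \<Rightarrow> real^'n^'n \<Rightarrow> real^'n \<Rightarrow> real \<Rightarrow> real^'n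
     \<Rightarrow> real \<Rightarrow> real^'n^'n \<Rightarrow> real^'n \<Rightarrow> real \<Rightarrow> real^'n \<Rightarrow> real^'n" where
  "flux_partial \<nu> \<alpha> \<sigma> A y f f1 \<sigma>' A' y' f' f1' =
    (let E = exp (\<nu> * \<sigma>); \<gamma> = E *\<^sub>R (A *v y); \<Gamma> = f1 \<bullet> (A *v f1); dd = real CARD('n) - 2;
         m = (y \<bullet> (A *v y)) / \<sigma>\<^sup>2;
         \<gamma>' = (\<nu> * E * \<sigma>') *\<^sub>R (A *v y) + E *\<^sub>R (A' *v y + A *v y');
         m' = (2 * (y' \<bullet> (A *v y)) + y \<bullet> (A' *v y)) / \<sigma>\<^sup>2 - 2 * m * \<sigma>' / \<sigma>;
         N' = (m' * f\<^sup>2 + 2 * m * f * f') / (E * \<sigma>)\<^sup>2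
              - 2 * (m * f\<^sup>2) * (\<sigma>' * (\<nu> + 1 / \<sigma>)) / (E * \<sigma>)\<^sup>2
     in (2 * (\<gamma>' \<bullet> f1 + \<gamma> \<bullet> f1')) *\<^sub>R (A *v f1)
            + (2 * (\<gamma> \<bullet> f1)) *\<^sub>R (A' *v f1 + A *v f1')
            - (f1' \<bullet> (A *v f1) + f1 \<bullet> (A' *v f1 + A *v f1')) *\<^sub>R \<gamma> - \<Gamma> *\<^sub>R \<gamma>'
            + (dd * (\<nu> * E * \<sigma>') * f + dd * E * f') *\<^sub>R (A *v f1)
            + (dd * E * f) *\<^sub>R (A' *v f1 + A *v f1')
            + (\<alpha>\<^sup>2 * N') *\<^sub>R \<gamma> + (\<alpha>\<^sup>2 * (m * f\<^sup>2 / (E * \<sigma>)\<^sup>2)) *\<^sub>R \<gamma>')"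

text \<open>A matrix calculation. For \<open>A = A 0\<close> constant the remainders \<open>t1\<close>, \<open>q\<close>, \<open>g1\<close> vanish; the derivative of \<open>E\<close> produces the terms with \<open>\<nu>\<close>,
from which positivity will come. Symmetry of the Hessian cancels the second derivatives that are not collected in \<open>\<delta>\<close>.\<close>

lemma divergence_identity:
  fixes A A0 B :: "real^'n^'n" and dA :: "'n \<Rightarrow> real^'n^'n" and y f1 :: "real^'n" and f2 :: "'n \<Rightarrow> real^'n"
    and E \<sigma> \<nu> \<alpha> f :: real
  defines "m \<equiv> (y \<bullet> (A *v y)) / \<sigma>\<^sup>2" and "\<Gamma> \<equiv> f1 \<bullet> (A *v f1)"
    and "t \<equiv> (\<Sum>k\<in>UNIV. ((A - A0) *v (B *v axis k 1)) $ k)"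
    and "dv \<equiv> (\<Sum>k\<in>UNIV. (dA k *v y) $ k)"
    and "z \<equiv> y \<bullet> (A *v f1)" and "dd \<equiv> real CARD('n) - 2"
    and "\<delta> \<equiv> \<Sum>k\<in>UNIV. (dA k *v f1 + A *v f2 k) $ k"
    and "\<gamma> \<equiv> E *\<^sub>R (A *v y)"
    and "\<gamma>' \<equiv> \<lambda>k. (\<nu> * E * (y $ k / \<sigma>)) *\<^sub>R (A *v y) + E *\<^sub>R (dA k *v y + A *v (B *v axis k 1))"
  defines "t1 \<equiv> t + dv - 2 * (m - 1)"
    and "g1 \<equiv> ((\<Sum>k\<in>UNIV. (A *v y) $ k * (y \<bullet> (dA k *v y))) + 2 * ((B *v (A *v y)) \<bullet> (A *v y))) / \<sigma>\<^sup>2 - 2 * m\<^sup>2"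
    and "q \<equiv> (t + dv) * \<Gamma> + 2 * (\<Gamma> - f1 \<bullet> (A *v (B *v (A *v f1))))
            + (\<Sum>k\<in>UNIV. (A *v y) $ k * (f1 \<bullet> (dA k *v f1)))
            - 2 * (\<Sum>k\<in>UNIV. (A *v f1) $ k * (f1 \<bullet> (dA k *v y)))"
    and "m' \<equiv> \<lambda>k. (2 * ((B *v axis k 1) \<bullet> (A *v y)) + y \<bullet> (dA k *v y)) / \<sigma>\<^sup>2 - 2 * m * y $ k / \<sigma>\<^sup>2"
  defines "N' \<equiv> \<lambda>k. (m' k * f\<^sup>2 + 2 * m * f * f1 $ k) / (E * \<sigma>)\<^sup>2
              - 2 * (m * f\<^sup>2) * (y $ k / \<sigma> * (\<nu> + 1 / \<sigma>)) / (E * \<sigma>)\<^sup>2"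
  assumes A: "sym_mat A" and i: "\<And>v. A0 *v (B *v v) = v"
    and dA: "\<And>k. sym_mat (dA k)" and f2: "\<And>k l. f2 k $ l = f2 l $ k"
    and E: "E = exp (\<nu> * \<sigma>)" and \<sigma>: "\<sigma> > 0"
  shows "(\<Sum>k\<in>UNIV. flux_partial \<nu> \<alpha> \<sigma> A y f f1 (y $ k / \<sigma>) (dA k) (B *v axis k 1) (f1 $ k) (f2 k) $ k)
    = (2 * E * z + dd * E * f) * \<delta>
      + \<alpha>\<^sup>2 * m * f * (2 * E * z + (dd * E + E * (t1 - m * \<nu> * \<sigma>)) * f) / (E * \<sigma>)\<^sup>2
      - (E * \<nu> * m * \<sigma> * \<Gamma> - 2 * E * \<nu> * z\<^sup>2 / \<sigma> + E * q)
      + f * dd * E * \<nu> * z / \<sigma> + \<alpha>\<^sup>2 * f\<^sup>2 * g1 / (E * \<sigma>\<^sup>2)"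
proof -
  have nz: "E \<noteq> 0" "\<sigma> \<noteq> 0" using \<sigma> E by auto
  define DV where "DV = (\<lambda>k. (2 * (\<gamma>' k \<bullet> f1 + \<gamma> \<bullet> f2 k)) *\<^sub>R (A *v f1)
            + (2 * (\<gamma> \<bullet> f1)) *\<^sub>R (dA k *v f1 + A *v f2 k)
            - (f2 k \<bullet> (A *v f1) + f1 \<bullet> (dA k *v f1 + A *v f2 k)) *\<^sub>R \<gamma> - \<Gamma> *\<^sub>R \<gamma>' k
            + (dd * (\<nu> * E * (y $ k / \<sigma>)) * f + dd * E * f1 $ k) *\<^sub>R (A *v f1)
            + (dd * E * f) *\<^sub>R (dA k *v f1 + A *v f2 k)
            + (\<alpha>\<^sup>2 * N' k) *\<^sub>R \<gamma> + (\<alpha>\<^sup>2 * (m * f\<^sup>2 / (E * \<sigma>)\<^sup>2)) *\<^sub>R \<gamma>' k)"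
  have DV: "flux_partial \<nu> \<alpha> \<sigma> A y f f1 (y $ k / \<sigma>) (dA k) (B *v axis k 1) (f1 $ k) (f2 k) = DV k" for k
  proof -
    have "2 * m * (y $ k / \<sigma>) / \<sigma> = 2 * m * y $ k / \<sigma>\<^sup>2" by (simp add: power2_eq_square)
    then show ?thesis
      by (simp only: DV_def flux_partial_def Let_def N'_def m'_def \<gamma>'_def \<gamma>_def \<Gamma>_def m_def dd_def E[symmetric])
  qed
  have m\<sigma>: "y \<bullet> (A *v y) = m * \<sigma>\<^sup>2" using nz by (simp add: m_def)
  have z': "f1 \<bullet> (A *v y) = z" unfolding z_def by (rule sym_inner[OF A])
  define tr where "tr = (\<Sum>k\<in>UNIV. (A *v (B *v axis k 1)) $ k)"
  have tr: "tr = t + real CARD('n)"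
  proof -
    have "((A - A0) *v (B *v axis k 1)) $ k = (A *v (B *v axis k 1)) $ k - 1" for k
      by (simp add: matrix_vector_mult_diff_rdistrib i axis_def)
    then show ?thesis by (simp add: t_def tr_def sum_subtractf)
  qed
  define c3 where "c3 = (\<Sum>k\<in>UNIV. (A *v y) $ k * (f1 \<bullet> (dA k *v f1)))"
  define c4 where "c4 = (\<Sum>k\<in>UNIV. (A *v f1) $ k * (f1 \<bullet> (dA k *v y)))"
  define c5 where "c5 = (\<Sum>k\<in>UNIV. (A *v y) $ k * (y \<bullet> (dA k *v y)))"
  define F2 where "F2 = (\<Sum>k\<in>UNIV. (A *v y) $ k * (f2 k \<bullet> (A *v f1)))"
  have inn: "(\<Sum>k\<in>UNIV. u $ k * v $ k) = u \<bullet> v" for u v :: "real^'n" by (simp add: inner_vec_def)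
  have inn': "(\<Sum>k\<in>UNIV. u $ k * (v $ k * c)) = (u \<bullet> v) * c" for u v :: "real^'n" and c :: real
    by (simp add: inner_vec_def sum_distrib_right mult.assoc)
  have F2': "(\<Sum>k\<in>UNIV. (A *v f1) $ k * ((A *v y) \<bullet> f2 k)) = F2"
  proof -
    have "(\<Sum>k\<in>UNIV. (A *v f1) $ k * ((A *v y) \<bullet> f2 k)) = (\<Sum>k\<in>UNIV. \<Sum>l\<in>UNIV. (A *v f1) $ k * ((A *v y) $ l * f2 k $ l))"
      by (simp add: inner_vec_def sum_distrib_left)
    also have "\<dots> = (\<Sum>l\<in>UNIV. \<Sum>k\<in>UNIV. (A *v f1) $ k * ((A *v y) $ l * f2 k $ l))" by (rule sum.swap)
    also have "\<dots> = F2" unfolding F2_def inner_vec_def sum_distrib_left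
      by (intro sum.cong refl) (simp add: f2 mult_ac)
    finally show ?thesis .
  qed
  have s\<gamma>: "(\<Sum>k\<in>UNIV. \<gamma>' k $ k) = E * (\<nu> * m * \<sigma> + dv + tr)"
  proof -
    have "(\<Sum>k\<in>UNIV. \<gamma>' k $ k) = (\<Sum>k\<in>UNIV. y $ k * ((A *v y) $ k * (\<nu> * E / \<sigma>)))
       + E * (\<Sum>k\<in>UNIV. (dA k *v y) $ k) + E * (\<Sum>k\<in>UNIV. (A *v (B *v axis k 1)) $ k)"
      by (simp add: \<gamma>'_def sum.distrib sum_distrib_left algebra_simps)
    then show ?thesis unfolding inn' m\<sigma> dv_def[symmetric] tr_def[symmetric]
      using nz by (simp add: field_simps power2_eq_square)
  qed
  have s1: "(\<Sum>k\<in>UNIV. (\<gamma>' k \<bullet> f1) * (A *v f1) $ k)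
     = \<nu> * E / \<sigma> * z\<^sup>2 + E * (c4 + f1 \<bullet> (A *v (B *v (A *v f1))))"
  proof -
    have "(\<gamma>' k \<bullet> f1) * (A *v f1) $ k = y $ k * ((A *v f1) $ k * (\<nu> * E / \<sigma> * z))
        + E * ((A *v f1) $ k * (f1 \<bullet> (dA k *v y))) + E * ((A *v f1) $ k * (f1 \<bullet> (A *v (B *v axis k 1))))" for k
      unfolding \<gamma>'_def z'[symmetric] by (simp add: inner_add_left inner_commute algebra_simps)
    then have "(\<Sum>k\<in>UNIV. (\<gamma>' k \<bullet> f1) * (A *v f1) $ k) = (\<Sum>k\<in>UNIV. y $ k * ((A *v f1) $ k * (\<nu> * E / \<sigma> * z)))
        + E * (\<Sum>k\<in>UNIV. (A *v f1) $ k * (f1 \<bullet> (dA k *v y))) + E * (\<Sum>k\<in>UNIV. (A *v f1) $ k * (f1 \<bullet> (A *v (B *v axis k 1))))"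
      by (simp add: sum.distrib sum_distrib_left)
    then show ?thesis unfolding inn' matrix_vector_axis_sum c4_def[symmetric] z_def[symmetric]
      by (simp add: power2_eq_square algebra_simps)
  qed
  have s2: "(\<Sum>k\<in>UNIV. (\<gamma> \<bullet> f2 k) * (A *v f1) $ k) = E * F2"
    unfolding F2'[symmetric] sum_distrib_left by (intro sum.cong refl) (simp add: \<gamma>_def mult_ac)
  have s3: "(\<Sum>k\<in>UNIV. (f2 k \<bullet> (A *v f1) + f1 \<bullet> (dA k *v f1 + A *v f2 k)) * \<gamma> $ k) = 2 * E * F2 + E * c3"
  proof -
    have "f1 \<bullet> (A *v f2 k) = f2 k \<bullet> (A *v f1)" for k by (rule sym_inner[OF A])
    then have "(f2 k \<bullet> (A *v f1) + f1 \<bullet> (dA k *v f1 + A *v f2 k)) * \<gamma> $ k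
       = 2 * E * ((A *v y) $ k * (f2 k \<bullet> (A *v f1))) + E * ((A *v y) $ k * (f1 \<bullet> (dA k *v f1)))" for k
      by (simp add: \<gamma>_def inner_add_right algebra_simps)
    then show ?thesis by (simp add: sum.distrib F2_def c3_def sum_distrib_left)
  qed
  have s4: "(\<Sum>k\<in>UNIV. (dd * (\<nu> * E * (y $ k / \<sigma>)) * f + dd * E * f1 $ k) * (A *v f1) $ k)
     = dd * \<nu> * E * f / \<sigma> * z + dd * E * \<Gamma>"
  proof -
    have "(\<Sum>k\<in>UNIV. (dd * (\<nu> * E * (y $ k / \<sigma>)) * f + dd * E * f1 $ k) * (A *v f1) $ k)
       = (\<Sum>k\<in>UNIV. y $ k * ((A *v f1) $ k * (dd * \<nu> * E * f / \<sigma>))) + (\<Sum>k\<in>UNIV. f1 $ k * ((A *v f1) $ k * (dd * E)))"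
      by (simp add: sum.distrib[symmetric] algebra_simps)
    then show ?thesis unfolding inn' by (simp add: z_def \<Gamma>_def mult_ac)
  qed
  have s5: "(\<Sum>k\<in>UNIV. m' k * (A *v y) $ k) = g1"
  proof -
    have 1: "(B *v axis k 1) \<bullet> (A *v y) = y \<bullet> (A *v (B *v axis k 1))" for k by (rule sym_inner[OF A])
    have "(\<Sum>k\<in>UNIV. m' k * (A *v y) $ k) = (2 * (\<Sum>k\<in>UNIV. (A *v y) $ k * (y \<bullet> (A *v (B *v axis k 1)))) + c5) / \<sigma>\<^sup>2
         - (\<Sum>k\<in>UNIV. y $ k * ((A *v y) $ k * (2 * m / \<sigma>\<^sup>2)))"
      by (simp add: m'_def 1 c5_def sum_subtractf sum_distrib_left sum.distrib sum_divide_distrib algebra_simps add_divide_distrib)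
    also have "\<dots> = (2 * (y \<bullet> (A *v (B *v (A *v y)))) + c5) / \<sigma>\<^sup>2 - 2 * m\<^sup>2"
      unfolding matrix_vector_axis_sum inn' m\<sigma> using nz by (simp add: power2_eq_square)
    also have "y \<bullet> (A *v (B *v (A *v y))) = (B *v (A *v y)) \<bullet> (A *v y)" by (rule sym_inner[OF A])
    finally show ?thesis by (simp add: g1_def c5_def add.commute)
  qed
  have s6: "(\<Sum>k\<in>UNIV. N' k * \<gamma> $ k) = f\<^sup>2 * g1 / (E * \<sigma>\<^sup>2) + m * f * (2 * E * z - 2 * f * E * m * (\<nu> * \<sigma> + 1)) / (E * \<sigma>)\<^sup>2"
  proof -
    have "(\<Sum>k\<in>UNIV. N' k * \<gamma> $ k) = (f\<^sup>2 * E / (E * \<sigma>)\<^sup>2) * (\<Sum>k\<in>UNIV. m' k * (A *v y) $ k)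
        + (\<Sum>k\<in>UNIV. f1 $ k * ((A *v y) $ k * (2 * m * f * E / (E * \<sigma>)\<^sup>2)))
        - (\<Sum>k\<in>UNIV. y $ k * ((A *v y) $ k * (2 * (m * f\<^sup>2) * E * (\<nu> + 1 / \<sigma>) / \<sigma> / (E * \<sigma>)\<^sup>2)))"
      unfolding sum_distrib_left sum.distrib[symmetric] sum_subtractf[symmetric] N'_def \<gamma>_def
      by (intro sum.cong refl) (use nz in \<open>simp add: field_simps\<close>)
    also have "\<dots> = (f\<^sup>2 * E / (E * \<sigma>)\<^sup>2) * g1 + z * (2 * m * f * E / (E * \<sigma>)\<^sup>2)
        - (m * \<sigma>\<^sup>2) * (2 * (m * f\<^sup>2) * E * (\<nu> + 1 / \<sigma>) / \<sigma> / (E * \<sigma>)\<^sup>2)"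
      unfolding s5 inn' m\<sigma> z' ..
    also have "\<dots> = f\<^sup>2 * g1 / (E * \<sigma>\<^sup>2) + m * f * (2 * E * z - 2 * f * E * m * (\<nu> * \<sigma> + 1)) / (E * \<sigma>)\<^sup>2"
      using nz by (simp add: field_simps power2_eq_square)
    finally show ?thesis .
  qed
  have s7: "(\<Sum>k\<in>UNIV. c * (dA k *v f1 + A *v f2 k) $ k) = c * \<delta>" for c
    by (simp add: \<delta>_def sum_distrib_left)
  have \<gamma>f: "\<gamma> \<bullet> f1 = E * z" using z' by (simp add: \<gamma>_def inner_commute)
  have "(\<Sum>k\<in>UNIV. DV k $ k) =
      2 * (\<Sum>k\<in>UNIV. (\<gamma>' k \<bullet> f1) * (A *v f1) $ k) + 2 * (\<Sum>k\<in>UNIV. (\<gamma> \<bullet> f2 k) * (A *v f1) $ k)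
      + (\<Sum>k\<in>UNIV. (2 * (\<gamma> \<bullet> f1)) * (dA k *v f1 + A *v f2 k) $ k)
      - (\<Sum>k\<in>UNIV. (f2 k \<bullet> (A *v f1) + f1 \<bullet> (dA k *v f1 + A *v f2 k)) * \<gamma> $ k)
      - \<Gamma> * (\<Sum>k\<in>UNIV. \<gamma>' k $ k)
      + (\<Sum>k\<in>UNIV. (dd * (\<nu> * E * (y $ k / \<sigma>)) * f + dd * E * f1 $ k) * (A *v f1) $ k)
      + (\<Sum>k\<in>UNIV. (dd * E * f) * (dA k *v f1 + A *v f2 k) $ k)
      + \<alpha>\<^sup>2 * (\<Sum>k\<in>UNIV. N' k * \<gamma> $ k) + \<alpha>\<^sup>2 * (m * f\<^sup>2 / (E * \<sigma>)\<^sup>2) * (\<Sum>k\<in>UNIV. \<gamma>' k $ k)"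
    unfolding DV_def sum_distrib_left sum.distrib[symmetric] sum_subtractf[symmetric]
    by (intro sum.cong refl) (simp add: algebra_simps)
  also have "\<dots> = 2 * (\<nu> * E / \<sigma> * z\<^sup>2 + E * (c4 + f1 \<bullet> (A *v (B *v (A *v f1))))) + 2 * (E * F2)
      + 2 * (E * z) * \<delta> - (2 * E * F2 + E * c3) - \<Gamma> * (E * (\<nu> * m * \<sigma> + dv + tr))
      + (dd * \<nu> * E * f / \<sigma> * z + dd * E * \<Gamma>) + (dd * E * f) * \<delta>
      + \<alpha>\<^sup>2 * (f\<^sup>2 * g1 / (E * \<sigma>\<^sup>2) + m * f * (2 * E * z - 2 * f * E * m * (\<nu> * \<sigma> + 1)) / (E * \<sigma>)\<^sup>2)
      + \<alpha>\<^sup>2 * (m * f\<^sup>2 / (E * \<sigma>)\<^sup>2) * (E * (\<nu> * m * \<sigma> + dv + tr))"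
    unfolding s1 s2 s3 s4 s6 s7 s\<gamma> \<gamma>f by simp
  also have "\<dots> = (2 * E * z + dd * E * f) * \<delta>
      + \<alpha>\<^sup>2 * m * f * (2 * E * z + (dd * E + E * (t1 - m * \<nu> * \<sigma>)) * f) / (E * \<sigma>)\<^sup>2
      - (E * \<nu> * m * \<sigma> * \<Gamma> - 2 * E * \<nu> * z\<^sup>2 / \<sigma> + E * q)
      + f * dd * E * \<nu> * z / \<sigma> + \<alpha>\<^sup>2 * f\<^sup>2 * g1 / (E * \<sigma>\<^sup>2)"
  proof -
    have t1: "t1 = tr - real CARD('n) + dv - 2 * m + 2" by (simp add: t1_def tr)
    have q: "q = (tr - real CARD('n) + dv) * \<Gamma> + 2 * (\<Gamma> - f1 \<bullet> (A *v (B *v (A *v f1)))) + c3 - 2 * c4"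
      by (simp add: q_def tr c3_def c4_def)
    define w where "w = f1 \<bullet> (A *v (B *v (A *v f1)))"
    show ?thesis unfolding t1 q dd_def w_def[symmetric] using nz
      by (simp add: field_simps power2_eq_square)
  qed
  finally show ?thesis unfolding DV .
qed

section \<open>Derivatives along coordinate lines\<close>

text \<open>Only derivatives along coordinate lines are needed, and these pass directly
to parameter integrals.\<close>

definition has_partial :: "'n \<Rightarrow> (real^'n \<Rightarrow> 'b::real_normed_vector) \<Rightarrow> 'b \<Rightarrow> real^'n \<Rightarrow> bool" where
  "has_partial k F D x \<longleftrightarrow> ((\<lambda>s. F (x + s *\<^sub>R axis k 1)) has_vector_derivative D) (at 0)"

lemma has_partial_const: "has_partial k (\<lambda>x. c) 0 x"
  by (simp add: has_partial_def)

lemma has_partial_add: "has_partial k F D x \<Longrightarrow> has_partial k G D' x \<Longrightarrow> has_partial k (\<lambda>x. F x + G x) (D + D') x"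
  unfolding has_partial_def by (rule has_vector_derivative_add)

lemma has_partial_diff: "has_partial k F D x \<Longrightarrow> has_partial k G D' x \<Longrightarrow> has_partial k (\<lambda>x. F x - G x) (D - D') x"
  unfolding has_partial_def by (rule has_vector_derivative_diff)

text \<open>One product rule for scalars, scalar multiples, inner products and matrix-vector products.\<close>

lemma has_partial_bilinear:
  assumes "bounded_bilinear P" "has_partial k F D x" "has_partial k G D' x"
  shows "has_partial k (\<lambda>x. P (F x) (G x)) (P (F x) D' + P D (G x)) x"
  using bounded_bilinear.has_vector_derivative[OF assms(1) assms(2,3)[unfolded has_partial_def]]
  unfolding has_partial_def by simp

lemma bounded_bilinear_matrix_vector: "bounded_bilinear (\<lambda>(M::real^'n^'m) v. M *v v)"
proof (rule bounded_bilinear.intro)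
  show "\<exists>K. \<forall>(M::real^'n^'m) v. norm (M *v v) \<le> norm M * norm v * K"
  proof (intro exI allI)
    fix M :: "real^'n^'m" and v
    have "norm (M *v v) \<le> (\<Sum>i\<in>UNIV. \<bar>(M *v v) $ i\<bar>)" by (rule norm_le_l1_cart)
    also have "\<dots> \<le> (\<Sum>i\<in>(UNIV::'m set). norm M * norm v)"
    proof (rule sum_mono)
      fix i
      have "\<bar>(M *v v) $ i\<bar> = \<bar>M $ i \<bullet> v\<bar>" by (simp add: matrix_vector_mult_def inner_vec_def)
      also have "\<dots> \<le> norm (M $ i) * norm v" by (rule Cauchy_Schwarz_ineq2)
      also have "\<dots> \<le> norm M * norm v" by (intro mult_right_mono Finite_Cartesian_Product.norm_nth_le) auto
      finally show "\<bar>(M *v v) $ i\<bar> \<le> norm M * norm v" .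
    qed
    finally show "norm (M *v v) \<le> norm M * norm v * real CARD('m)" by (simp add: mult_ac)
  qed
qed (auto simp: matrix_vector_mult_add_rdistrib matrix_vector_right_distrib scaleR_matrix_vector_assoc
   matrix_vector_mult_scaleR vec_eq_iff matrix_vector_mult_def sum_distrib_left algebra_simps sum.distrib)

lemmas has_partial_mult = has_partial_bilinear[OF bounded_bilinear_mult]
  and has_partial_scaleR = has_partial_bilinear[OF bounded_bilinear_scaleR]
  and has_partial_inner = has_partial_bilinear[OF bounded_bilinear_inner]
  and has_partial_matvec = has_partial_bilinear[OF bounded_bilinear_matrix_vector]

lemma has_partial_chain:
  fixes F :: "real^'n \<Rightarrow> real"
  assumes "has_partial k F D x" "(h has_vector_derivative h') (at (F x))"
  shows "has_partial k (\<lambda>x. h (F x)) (D *\<^sub>R h') x"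
  using vector_diff_chain_at[OF assms(1)[unfolded has_partial_def], of h h'] assms(2)
  by (simp add: has_partial_def o_def)

lemma has_partial_linear:
  assumes "bounded_linear P" "has_partial k F D x"
  shows "has_partial k (\<lambda>x. P (F x)) (P D) x"
  using bounded_linear.has_vector_derivative[OF assms(1) assms(2)[unfolded has_partial_def]] by (simp add: has_partial_def)

lemma has_partial_cong:
  assumes "open S" "x \<in> S" "\<And>y. y \<in> S \<Longrightarrow> F y = G y" "has_partial k G D x"
  shows "has_partial k F D x"
proof -
  have "((\<lambda>s. x + s *\<^sub>R axis k (1::real)) \<longlongrightarrow> x) (nhds 0)"
  proof -
    have "((\<lambda>s. x + s *\<^sub>R axis k (1::real)) \<longlongrightarrow> x + 0 *\<^sub>R axis k 1) (nhds 0)"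
      by (intro tendsto_add tendsto_const tendsto_scaleR filterlim_ident)
    then show ?thesis by simp
  qed
  then have "\<forall>\<^sub>F s in nhds 0. x + s *\<^sub>R axis k 1 \<in> S"
    using assms(1,2) topological_tendstoD by fastforce
  then have "\<forall>\<^sub>F s in nhds 0. F (x + s *\<^sub>R axis k 1) = G (x + s *\<^sub>R axis k 1)"
    by (rule eventually_mono) (use assms(3) in auto)
  then show ?thesis using assms(2,3,4) unfolding has_partial_def
    by (subst has_vector_derivative_cong_ev[OF _]) (auto elim!: eventually_mono)
qed

lemma has_partial_vec:
  fixes F :: "real^'n \<Rightarrow> 'c::real_normed_vector^'m"
  assumes "\<And>i. has_partial k (\<lambda>x. F x $ i) (D $ i) x"
  shows "has_partial k F D x"
proof -
  have 1: "has_partial k (\<lambda>x. axis i (F x $ i)) (axis i (D $ i)) x" for i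
  proof (rule has_partial_linear[OF _ assms])
    show "bounded_linear (\<lambda>c. axis i c :: 'c^'m)"
    proof (rule bounded_linear_intro[where K = 1])
      fix c :: 'c
      have "norm (axis i c :: 'c^'m) \<le> (\<Sum>j\<in>UNIV. norm ((axis i c :: 'c^'m) $ j))"
        unfolding norm_vec_def by (rule L2_set_le_sum) simp
      also have "\<dots> = (\<Sum>j\<in>UNIV. if j = i then norm c else 0)" by (intro sum.cong) (auto simp: axis_def)
      finally show "norm (axis i c :: 'c^'m) \<le> norm c * 1" by simp
    qed (auto simp: vec_eq_iff axis_def)
  qed
  have 2: "v = (\<Sum>i\<in>UNIV. axis i (v $ i))" for v :: "'c^'m"
    by (simp add: vec_eq_iff axis_def)
  have "has_partial k (\<lambda>y. \<Sum>i\<in>UNIV. axis i (F y $ i)) (\<Sum>i\<in>UNIV. axis i (D $ i)) x"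
    unfolding has_partial_def
    by (rule has_vector_derivative_sum) (rule 1[unfolded has_partial_def])
  then show ?thesis unfolding 2[symmetric] .
qed

lemma has_partial_nth: "has_partial k F D x \<Longrightarrow> has_partial k (\<lambda>x. F x $ i) (D $ i) x"
  by (rule has_partial_linear[OF bounded_linear_vec_nth])

lemma has_partial_line:
  assumes "\<And>x. has_partial k F (D x) x"
  shows "((\<lambda>s. F (x + s *\<^sub>R axis k 1)) has_vector_derivative D (x + s *\<^sub>R axis k 1)) (at s)"
proof -
  have "((\<lambda>h. F ((x + s *\<^sub>R axis k 1) + h *\<^sub>R axis k 1)) has_vector_derivative D (x + s *\<^sub>R axis k 1)) (at (s - s))"
    using assms[of "x + s *\<^sub>R axis k 1"] unfolding has_partial_def by simp
  moreover have "((\<lambda>h. h - s) has_vector_derivative 1) (at s)"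
    by (auto intro!: derivative_eq_intros simp: has_vector_derivative_def)
  ultimately show ?thesis
    using vector_diff_chain_at[of "\<lambda>h. h - s" 1 s "\<lambda>h. F ((x + s *\<^sub>R axis k 1) + h *\<^sub>R axis k 1)"]
    by (simp add: o_def algebra_simps)
qed

text \<open>A function of compact support with bounded partial derivative is Lipschitz along the coordinate lines, so its
difference quotients converge boundedly to the derivative; each difference quotient has integral 0 by translation invariance.\<close>

lemma integral_partial_eq_0:
  fixes F :: "real^'n \<Rightarrow> real"
  assumes K: "compact K" and D: "\<And>x. has_partial k F (W x) x"
    and F0: "\<And>x. x \<notin> K \<Longrightarrow> F x = 0" and W0: "\<And>x. x \<notin> K \<Longrightarrow> W x = 0"
    and Wc: "continuous_on K W" and Fm: "F \<in> borel_measurable borel"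
  shows "integrable lborel W" "integral\<^sup>L lborel W = 0"
proof -
  have Kb: "K \<in> sets borel" using K by (simp add: borel_compact)
  have Weq: "W = (\<lambda>x. if x \<in> K then W x else 0)" using W0 by (auto simp: fun_eq_iff)
  show Wi: "integrable lborel W"
    using borel_integrable_compact[OF K Wc] unfolding indicator_scaleR_eq_if by (subst Weq)
  obtain M where M: "\<And>x. \<bar>W x\<bar> \<le> M" "M \<ge> 0"
  proof -
    obtain B where B: "\<And>x. x \<in> K \<Longrightarrow> norm (W x) \<le> B"
      using compact_imp_bounded[OF compact_continuous_image[OF Wc K]] unfolding bounded_iff by auto
    have "\<bar>W x\<bar> \<le> \<bar>B\<bar>" for x using B[of x] W0[of x] by (cases "x \<in> K") auto
    then show ?thesis by (rule that) auto
  qed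
  define e where "e = (axis k 1 :: real^'n)"
  have lip: "\<bar>F (x + s *\<^sub>R e) - F x\<bar> \<le> M * \<bar>s\<bar>" for x s
  proof -
    have "norm (F (x + s *\<^sub>R e) - F (x + 0 *\<^sub>R e)) \<le> M * norm (s - 0)"
    proof (rule differentiable_bound[of UNIV "\<lambda>s. F (x + s *\<^sub>R e)" "\<lambda>s h. h * W (x + s *\<^sub>R e)"])
      show "((\<lambda>s. F (x + s *\<^sub>R e)) has_derivative (\<lambda>h. h * W (x + t *\<^sub>R e))) (at t within UNIV)" for t
        using has_partial_line[OF D, of x t] by (simp add: e_def has_vector_derivative_def)
      show "onorm (\<lambda>h. h * W (x + t *\<^sub>R e)) \<le> M" for t
        by (rule onorm_bound) (auto simp: abs_mult mult.commute[of M] intro!: mult_left_mono M)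
    qed auto
    then show ?thesis by simp
  qed
  have Kint: "F \<in> borel_measurable lborel" using Fm by simp
  have Fi: "integrable lborel F"
  proof -
    have cont: "\<bar>F x\<bar> \<le> M * (2 * diameter K + 1)" for x
    proof (cases "x \<in> K")
      case True
      let ?y = "x + (diameter K + 1) *\<^sub>R e"
      have "?y \<notin> K"
      proof
        assume "?y \<in> K"
        then have "dist x ?y \<le> diameter K" using True diameter_bounded_bound compact_imp_bounded[OF K] by blast
        then show False using diameter_ge_0[OF compact_imp_bounded[OF K]] by (simp add: dist_norm e_def)
      qed
      then have "\<bar>F x\<bar> \<le> M * \<bar>diameter K + 1\<bar>" using lip[of x "diameter K + 1"] F0 by simp
      also have "\<dots> \<le> M * (2 * diameter K + 1)"
        using M diameter_ge_0[OF compact_imp_bounded[OF K]] by (intro mult_left_mono) auto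
      finally show ?thesis .
    qed (use F0 M diameter_ge_0[OF compact_imp_bounded[OF K]] in auto)
    have "integrable lborel (\<lambda>x. (M * (2 * diameter K + 1)) * indicator K x)"
      using emeasure_compact_finite[OF K] Kb by (intro integrable_mult_right integrable_real_indicator) auto
    then show ?thesis
      by (rule Bochner_Integration.integrable_bound[OF _ Kint]) (use F0 in \<open>auto intro!: AE_I2 order_trans[OF cont abs_ge_self] simp: indicator_def\<close>)
  qed
  define h where "h n = inverse (real (Suc n))" for n
  have h: "h n > 0" "h n \<le> 1" for n by (auto simp: h_def inverse_le_1_iff)
  have h_lim: "h \<longlonglongrightarrow> 0" unfolding h_def by (rule LIMSEQ_inverse_real_of_nat)
  define q where "q n x = (F (x + h n *\<^sub>R e) - F x) / h n" for n x
  have shift: "integrable lborel (\<lambda>x. F (x + v))" "(\<integral>x. F (x + v) \<partial>lborel) = (\<integral>x. F x \<partial>lborel)" for v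
  proof -
    have d: "distr lborel borel (\<lambda>x. v + x) = (lborel :: (real^'n) measure)" by (rule lborel_distr_plus)
    have "integrable (distr lborel borel (\<lambda>x. v + x)) F" unfolding d by (rule Fi)
    then show "integrable lborel (\<lambda>x. F (x + v))" using Fm by (subst (asm) integrable_distr_eq) (auto simp: add.commute)
    have "(\<integral>x. F x \<partial>distr lborel borel (\<lambda>x. v + x)) = (\<integral>x. F (v + x) \<partial>lborel)" using Fm by (intro integral_distr) auto
    then show "(\<integral>x. F (x + v) \<partial>lborel) = (\<integral>x. F x \<partial>lborel)" unfolding d by (simp add: add.commute)
  qed
  have q0: "(\<integral>x. q n x \<partial>lborel) = 0" for n
    unfolding q_def using Fi shift by (simp add: Bochner_Integration.integral_diff)
  have qlim: "(\<lambda>n. q n x) \<longlonglongrightarrow> W x" for x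
  proof -
    have "((\<lambda>s. (F (x + s *\<^sub>R e) - F x) / s) \<longlongrightarrow> W x) (at 0)"
      using D[of x] unfolding has_partial_def e_def
      by (simp add: has_real_derivative_iff_has_vector_derivative[symmetric] DERIV_def)
    moreover have "filterlim h (at 0) sequentially"
      using h(1) h_lim by (intro filterlim_atI) (auto simp: less_imp_neq[symmetric])
    ultimately show ?thesis unfolding q_def by (rule filterlim_compose)
  qed
  obtain R where R: "\<And>x. x \<in> K \<Longrightarrow> norm x \<le> R" using compact_imp_bounded[OF K] unfolding bounded_iff by auto
  have "(\<lambda>n. \<integral>x. q n x \<partial>lborel) \<longlonglongrightarrow> (\<integral>x. W x \<partial>lborel)"
  proof (rule integral_dominated_convergence)
    show "integrable lborel (\<lambda>x. M * indicator (cball (0::real^'n) (R + 1)) x)"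
      by (intro integrable_mult_right integrable_real_indicator) (use emeasure_compact_finite[of "cball (0::real^'n) (R + 1)"] in auto)
    show "AE x in lborel. norm (q n x) \<le> M * indicator (cball 0 (R + 1)) x" for n
    proof (intro AE_I2)
      fix x
      have 1: "norm (q n x) \<le> M"
      proof -
        have "\<bar>F (x + h n *\<^sub>R e) - F x\<bar> \<le> M * h n" using lip[of x "h n"] h(1)[of n] by simp
        then show ?thesis using h(1)[of n] by (simp add: q_def field_simps)
      qed
      moreover have "q n x = 0" if "norm x > R + 1"
      proof -
        have "norm x \<le> norm (x + h n *\<^sub>R e) + norm (h n *\<^sub>R e)"
          using norm_triangle_ineq4[of "x + h n *\<^sub>R e" "h n *\<^sub>R e"] by simp
        moreover have "norm (h n *\<^sub>R e) \<le> 1" using h[of n] by (simp add: e_def)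
        ultimately have "norm (x + h n *\<^sub>R e) > R" "norm x > R" using that by linarith+
        then have "x + h n *\<^sub>R e \<notin> K" "x \<notin> K" using R not_le by blast+
        then show ?thesis using F0 by (simp add: q_def)
      qed
      ultimately show "norm (q n x) \<le> M * indicator (cball 0 (R + 1)) x" by (cases "norm x > R + 1") auto
    qed
    show "W \<in> borel_measurable lborel" using Wi by simp
    show "q n \<in> borel_measurable lborel" for n
      using shift(1)[of "h n *\<^sub>R e"] Fi unfolding q_def by (intro borel_measurable_divide borel_measurable_diff) auto
  qed (use qlim in auto)
  then show "integral\<^sup>L lborel W = 0" by (simp add: q0 LIMSEQ_const_iff)
qed

section \<open>The weight function\<close>

text \<open>The integrand in the definition of \<^const>\<open>phi\<close>, extended continuously to 0.\<close>

definition phi_rate :: "real \<Rightarrow> real \<Rightarrow> real" where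
  "phi_rate \<mu> t = (if t = 0 then \<mu> else (1 - exp (- \<mu> * t)) / t)"

lemma phi_rate_bounds:
  assumes "\<mu> > 0" "t \<ge> 0"
  shows "0 \<le> phi_rate \<mu> t" "phi_rate \<mu> t \<le> \<mu>" "t > 0 \<Longrightarrow> phi_rate \<mu> t \<le> 1 / t"
proof -
  have "1 - \<mu> * t \<le> exp (- \<mu> * t)" using exp_ge_add_one_self[of "- \<mu> * t"] by simp
  moreover have "exp (- \<mu> * t) \<le> 1" using assms by simp
  ultimately show "0 \<le> phi_rate \<mu> t" "phi_rate \<mu> t \<le> \<mu>" "t > 0 \<Longrightarrow> phi_rate \<mu> t \<le> 1 / t"
    using assms by (auto simp: phi_rate_def field_simps)
qed

lemma continuous_on_phi_rate: "continuous_on S (phi_rate \<mu>)"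
proof -
  have "isCont (phi_rate \<mu>) t" for t
  proof (cases "t = 0")
    case True
    have "((\<lambda>t. 1 - exp (- \<mu> * t)) has_real_derivative \<mu>) (at 0)"
      by (auto intro!: derivative_eq_intros)
    then have "((\<lambda>t. (1 - exp (- \<mu> * t)) / t) \<longlongrightarrow> \<mu>) (at 0)" by (simp add: DERIV_def)
    then have "(phi_rate \<mu> \<longlongrightarrow> \<mu>) (at 0)"
      by (rule Lim_transform_eventually) (auto simp: phi_rate_def eventually_at_filter)
    then show ?thesis using True by (simp add: isCont_def phi_rate_def)
  next
    case False
    have "isCont (\<lambda>t. (1 - exp (- \<mu> * t)) / t) t" using False by (intro continuous_intros) auto
    moreover have "\<forall>\<^sub>F s in nhds t. phi_rate \<mu> s = (1 - exp (- \<mu> * s)) / s"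
      using t1_space_nhds[OF False] by (rule eventually_mono) (simp add: phi_rate_def)
    ultimately show ?thesis by (subst isCont_cong)
  qed
  then show ?thesis by (simp add: continuous_at_imp_continuous_on)
qed

lemma phi_eq: "phi \<mu> r = r * exp (- integral {0..r} (phi_rate \<mu>))"
proof -
  have "integral {0..r} (\<lambda>t. (1 - exp (- \<mu> * t)) / t) = integral {0..r} (phi_rate \<mu>)"
    by (rule integral_spike[of "{0}"]) (auto simp: phi_rate_def)
  then show ?thesis by (simp add: phi_def)
qed

lemma phi_pos: "r > 0 \<Longrightarrow> phi \<mu> r > 0"
  by (simp add: phi_eq)

lemma integral_phi_rate_nonneg:
  assumes "\<mu> > 0" "0 \<le> a"
  shows "0 \<le> integral {a..b} (phi_rate \<mu>)"
  using phi_rate_bounds(1)[OF assms(1)] assms(2)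
  by (intro integral_nonneg integrable_continuous_interval continuous_on_phi_rate) auto

lemma phi_le: "\<mu> > 0 \<Longrightarrow> r \<ge> 0 \<Longrightarrow> phi \<mu> r \<le> r"
  using integral_phi_rate_nonneg[of \<mu> 0 r] by (simp add: phi_eq mult_left_le)

lemma ln_phi_derivative:
  assumes "r > 0"
  shows "((\<lambda>r. ln (phi \<mu> r)) has_real_derivative exp (- \<mu> * r) / r) (at r)"
proof -
  have "((\<lambda>x. integral {0..x} (phi_rate \<mu>)) has_real_derivative phi_rate \<mu> r) (at r within {0..r+1})"
    using assms by (intro integral_has_real_derivative continuous_on_phi_rate) auto
  then have "((\<lambda>x. integral {0..x} (phi_rate \<mu>)) has_real_derivative phi_rate \<mu> r) (at r)"
    using assms by (subst (asm) at_within_interior) auto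
  then have "((\<lambda>r. ln r - integral {0..r} (phi_rate \<mu>)) has_real_derivative 1 / r - phi_rate \<mu> r) (at r)"
    using assms by (auto intro!: derivative_eq_intros)
  moreover have "1 / r - phi_rate \<mu> r = exp (- \<mu> * r) / r"
    using assms by (simp add: phi_rate_def field_simps)
  moreover have "\<forall>\<^sub>F s in nhds r. ln (phi \<mu> s) = ln s - integral {0..s} (phi_rate \<mu>)"
  proof (rule eventually_mono)
    show "\<forall>\<^sub>F s in nhds r. s \<in> {0<..}" using assms by (intro eventually_nhds_in_open) auto
  qed (auto simp: phi_eq ln_mult)
  ultimately show ?thesis by (subst DERIV_cong_ev[OF refl _ refl]) auto
qed

lemma mu1_ge:
  assumes "\<theta>1 \<ge> 1" "\<mu> > 0"
  shows "mu1 \<theta>1 \<mu> \<ge> 1 + sqrt \<theta>1 * \<mu>"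
proof (cases "sqrt \<theta>1 * \<mu> \<le> 1")
  case False
  have "2 * (sqrt \<theta>1 * \<mu>) \<le> exp 1 * (sqrt \<theta>1 * \<mu>)"
    using False exp_ge_add_one_self[of 1] by (intro mult_right_mono) auto
  then show ?thesis using False by (simp add: mu1_def)
qed (simp add: mu1_def)

text \<open>The integral in the exponent is at most \<open>\<mu> * r\<close>, and beyond \<open>1 / \<mu>\<close> it grows at most logarithmically; the two cases in the
definition of \<^const>\<open>mu1\<close> correspond to these two regimes.\<close>

lemma phi_ge:
  assumes \<theta>: "\<theta>1 \<ge> 1" and \<mu>: "\<mu> > 0" and r: "0 \<le> r" "r \<le> sqrt \<theta>1"
  shows "r \<le> mu1 \<theta>1 \<mu> * phi \<mu> r"
proof -
  define s where "s = sqrt \<theta>1 * \<mu>"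
  let ?I = "\<lambda>a b. integral {a..b} (phi_rate \<mu>)"
  have int: "phi_rate \<mu> integrable_on {a..b}" for a b
    by (intro integrable_continuous_interval continuous_on_phi_rate)
  have I1: "?I 0 b \<le> \<mu> * b" if "b \<ge> 0" for b
  proof -
    have "?I 0 b \<le> integral {0..b} (\<lambda>_. \<mu>)"
      using phi_rate_bounds(2)[OF \<mu>] by (intro integral_le int) auto
    then show ?thesis using that by (simp add: mult.commute)
  qed
  have "?I 0 (sqrt \<theta>1) \<le> ln (mu1 \<theta>1 \<mu>)"
  proof (cases "s \<le> 1")
    case True
    then show ?thesis using I1[of "sqrt \<theta>1"] \<theta> by (simp add: mu1_def s_def mult.commute)
  next
    case False
    have c: "1 / \<mu> \<le> sqrt \<theta>1" using False \<mu> by (simp add: s_def field_simps)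
    have "?I 0 (sqrt \<theta>1) = ?I 0 (1/\<mu>) + ?I (1/\<mu>) (sqrt \<theta>1)"
      using Henstock_Kurzweil_Integration.integral_combine[OF _ c int, of 0] \<mu> by simp
    moreover have "?I 0 (1/\<mu>) \<le> 1" using I1[of "1/\<mu>"] \<mu> by simp
    moreover have "?I (1/\<mu>) (sqrt \<theta>1) \<le> ln (sqrt \<theta>1) - ln (1/\<mu>)"
    proof -
      have hi: "((\<lambda>t. 1/t) has_integral ln (sqrt \<theta>1) - ln (1/\<mu>)) {1/\<mu>..sqrt \<theta>1}"
        using c \<mu> by (intro fundamental_theorem_of_calculus)
          (auto intro!: derivative_eq_intros simp: has_real_derivative_iff_has_vector_derivative[symmetric] has_field_derivative_at_within
            less_le_trans[of 0 "1/\<mu>"])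
      show ?thesis
      proof (rule has_integral_le[OF integrable_integral[OF int] hi])
        fix t assume "t \<in> {1/\<mu>..sqrt \<theta>1}"
        then have "t > 0" using \<mu> by (auto intro: less_le_trans[of 0 "1/\<mu>"])
        then show "phi_rate \<mu> t \<le> 1 / t" using phi_rate_bounds(3)[OF \<mu>, of t] by simp
      qed
    qed
    moreover have "ln (mu1 \<theta>1 \<mu>) = 1 + (ln (sqrt \<theta>1) - ln (1/\<mu>))"
      using False \<mu> \<theta> by (simp add: mu1_def s_def ln_mult ln_div)
    ultimately show ?thesis by linarith
  qed
  moreover have "?I 0 r \<le> ?I 0 (sqrt \<theta>1)"
    using Henstock_Kurzweil_Integration.integral_combine[OF r int] integral_phi_rate_nonneg[OF \<mu> r(1), of "sqrt \<theta>1"] by linarith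
  ultimately have "exp (?I 0 r) \<le> exp (ln (mu1 \<theta>1 \<mu>))" by simp
  moreover have "mu1 \<theta>1 \<mu> > 0" using mu1_ge[OF \<theta> \<mu>] \<mu> \<theta> by (smt (verit) mult_pos_pos real_sqrt_gt_zero)
  ultimately have "exp (?I 0 r) \<le> mu1 \<theta>1 \<mu>" by simp
  then have "1 \<le> mu1 \<theta>1 \<mu> * exp (- ?I 0 r)" by (simp add: exp_minus field_simps)
  then have "r * 1 \<le> r * (mu1 \<theta>1 \<mu> * exp (- ?I 0 r))" using r by (intro mult_left_mono) auto
  then show ?thesis by (simp add: phi_eq mult_ac)
qed

lemma elliptic_inverse:
  fixes A0 :: "real^'n^'n"
  assumes \<theta>: "\<theta> \<ge> 1" and e: "elliptic \<theta> A0" and s: "sym_mat A0"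
  shows "A0 *v (matrix_inv A0 *v v) = v" "matrix_inv A0 *v (A0 *v v) = v"
    "v \<bullet> (matrix_inv A0 *v w) = w \<bullet> (matrix_inv A0 *v v)"
    "v \<noteq> 0 \<Longrightarrow> 0 < v \<bullet> (matrix_inv A0 *v v)"
proof -
  have "inj ((*v) A0)"
  proof (rule injI)
    fix v w assume "A0 *v v = A0 *v w"
    then have "A0 *v (v - w) = 0" by (simp add: matrix_vector_mult_diff_distrib)
    then have "(norm (v - w))\<^sup>2 \<le> 0" using elliptic_bounds(1)[OF \<theta> e s, of "v - w"] by simp
    then show "v = w" by simp
  qed
  then have "invertible A0" by (simp add: invertible_left_inverse matrix_left_invertible_injective)
  then have "A0 ** matrix_inv A0 = mat 1 \<and> matrix_inv A0 ** A0 = mat 1"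
    unfolding matrix_inv_def invertible_def by (rule someI_ex)
  then show 1: "A0 *v (matrix_inv A0 *v v) = v" and 2: "matrix_inv A0 *v (A0 *v v) = v" for v
    by (simp_all add: matrix_vector_mul_assoc)
  show "v \<bullet> (matrix_inv A0 *v w) = w \<bullet> (matrix_inv A0 *v v)"
    using sym_inner[OF s, of "matrix_inv A0 *v w" "matrix_inv A0 *v v"] 1 by (simp add: inner_commute)
  assume "v \<noteq> 0"
  then have "matrix_inv A0 *v v \<noteq> 0" using 1[of v] by auto
  then have "0 < (norm (matrix_inv A0 *v v))\<^sup>2" by simp
  also have "\<dots> \<le> \<theta> * ((matrix_inv A0 *v v) \<bullet> (A0 *v (matrix_inv A0 *v v)))"
    by (rule elliptic_bounds(1)[OF \<theta> e s])
  finally show "0 < v \<bullet> (matrix_inv A0 *v v)" using 1 \<theta> by (simp add: inner_commute zero_less_mult_iff)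
qed

lemma sigma_scale: "\<rho> > 0 \<Longrightarrow> sigma A (x /\<^sub>R \<rho>) = sigma A x / \<rho>"
proof -
  assume \<rho>: "\<rho> > 0"
  have "(x /\<^sub>R \<rho>) \<bullet> (M *v (x /\<^sub>R \<rho>)) = (x \<bullet> (M *v x)) / \<rho>\<^sup>2" for M
    by (simp add: matrix_vector_mult_scaleR divide_inverse power2_eq_square mult_ac)
  then show ?thesis using \<rho> by (simp add: sigma_def real_sqrt_divide)
qed

lemma has_partial_matvec_linear: "has_partial k (\<lambda>x. (M::real^'n^'n) *v x) (M *v axis k 1) x"
proof -
  have "has_partial k (\<lambda>x::real^'n. x) (axis k 1) x"
    unfolding has_partial_def by (auto intro!: derivative_eq_intros simp: has_vector_derivative_def)
  then show ?thesis
    by (rule has_partial_linear[OF matrix_vector_mul_bounded_linear])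
qed

lemma has_partial_sigma:
  fixes A :: "real^'n \<Rightarrow> real^'n^'n"
  defines "B \<equiv> matrix_inv (A 0)"
  assumes \<theta>: "\<theta> \<ge> 1" and e: "elliptic \<theta> (A 0)" and s: "sym_mat (A 0)" and x: "x \<noteq> 0"
  shows "has_partial k (sigma A) ((B *v x) $ k / sigma A x) x"
proof -
  note inv = elliptic_inverse[OF \<theta> e s, folded B_def]
  have id: "has_partial k (\<lambda>x::real^'n. x) (axis k 1) x"
    unfolding has_partial_def by (auto intro!: derivative_eq_intros simp: has_vector_derivative_def)
  have "has_partial k (\<lambda>x. x \<bullet> (B *v x)) (x \<bullet> (B *v axis k 1) + axis k 1 \<bullet> (B *v x)) x"
    by (rule has_partial_inner[OF id has_partial_matvec_linear])
  then have 1: "has_partial k (\<lambda>x. x \<bullet> (B *v x)) (2 * (B *v x) $ k) x"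
    using inv(3)[of x "axis k 1"] by (simp add: inner_axis')
  have pos: "x \<bullet> (B *v x) > 0" using inv(4) x by blast
  have "has_partial k (\<lambda>x. sqrt (x \<bullet> (B *v x))) ((2 * (B *v x) $ k) *\<^sub>R (inverse (sqrt (x \<bullet> (B *v x))) / 2)) x"
    by (rule has_partial_chain[OF 1]) (use DERIV_real_sqrt[OF pos] in \<open>simp add: has_real_derivative_iff_has_vector_derivative\<close>)
  moreover have "sigma A = (\<lambda>x. sqrt (x \<bullet> (B *v x)))" unfolding sigma_def B_def ..
  moreover have "(2 * b) *\<^sub>R (inverse s / 2) = b / s" for b s :: real by (simp add: field_simps)
  ultimately show ?thesis by simp
qed

text \<open>The exponent in \<^const>\<open>phi\<close> is made for this formula: it turns the logarithmic derivative \<open>1 / r\<close> into \<open>exp (- \<mu> r) / r\<close>.\<close>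

lemma has_partial_ln_weight:
  fixes A :: "real^'n \<Rightarrow> real^'n^'n"
  defines "B \<equiv> matrix_inv (A 0)"
  assumes \<theta>: "\<theta> \<ge> 1" and e: "elliptic \<theta> (A 0)" and s: "sym_mat (A 0)" and x: "x \<noteq> 0" and \<rho>: "\<rho> > 0"
  shows "has_partial k (\<lambda>x. ln (weight A \<rho> \<mu> x)) ((B *v x) $ k / (exp (\<mu> / \<rho> * sigma A x) * (sigma A x)\<^sup>2)) x"
proof -
  have sp: "sigma A x > 0" using elliptic_inverse(4)[OF \<theta> e s x] by (simp add: sigma_def)
  have 1: "has_partial k (\<lambda>x. sigma A x * (1/\<rho>)) (sigma A x * 0 + ((B *v x) $ k / sigma A x) * (1/\<rho>)) x"
    unfolding B_def by (rule has_partial_mult[OF has_partial_sigma[where \<theta>=\<theta>] has_partial_const]) (use assms in auto)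
  have "has_partial k (\<lambda>x. ln (phi \<mu> (sigma A x * (1/\<rho>))))
     ((sigma A x * 0 + ((B *v x) $ k / sigma A x) * (1/\<rho>)) *\<^sub>R (exp (- \<mu> * (sigma A x * (1/\<rho>))) / (sigma A x * (1/\<rho>)))) x"
    by (rule has_partial_chain[OF 1]) (use ln_phi_derivative[of "sigma A x * (1/\<rho>)" \<mu>] sp \<rho> in \<open>simp add: has_real_derivative_iff_has_vector_derivative\<close>)
  moreover have "(\<lambda>x. ln (phi \<mu> (sigma A x * (1/\<rho>)))) = (\<lambda>x. ln (weight A \<rho> \<mu> x))"
    unfolding weight_def sigma_scale[OF \<rho>] by simp
  ultimately show ?thesis
    using \<rho> sp by (simp add: exp_minus field_simps power2_eq_square)
qed

section \<open>The conjugated operator and the pointwise estimate\<close>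

lemma sigma_bounds:
  fixes A :: "real^'n \<Rightarrow> real^'n^'n"
  assumes \<theta>: "\<theta> \<ge> 1" and e: "elliptic \<theta> (A 0)" and s: "sym_mat (A 0)" and x: "x \<noteq> 0"
  shows "0 < sigma A x" "(sigma A x)\<^sup>2 = x \<bullet> (matrix_inv (A 0) *v x)" "sigma A x \<le> sqrt \<theta> * norm x"
proof -
  have p: "0 < x \<bullet> (matrix_inv (A 0) *v x)" by (rule elliptic_inverse(4)[of \<theta> "A 0", OF \<theta> e s x])
  then show "0 < sigma A x" "(sigma A x)\<^sup>2 = x \<bullet> (matrix_inv (A 0) *v x)" by (auto simp: sigma_def)
  have "x \<bullet> (matrix_inv (A 0) *v x) \<le> norm x * norm (matrix_inv (A 0) *v x)" by (rule norm_cauchy_schwarz)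
  also have "\<dots> \<le> norm x * (\<theta> * norm x)"
    by (intro mult_left_mono inverse_norm_bound[OF \<theta> e] elliptic_inverse(1)[OF \<theta> e s]) auto
  finally have "sigma A x \<le> sqrt (\<theta> * (norm x)\<^sup>2)" unfolding sigma_def
    by (intro real_sqrt_le_mono) (simp add: power2_eq_square mult_ac)
  then show "sigma A x \<le> sqrt \<theta> * norm x" by (simp add: real_sqrt_mult)
qed

text \<open>The weight is comparable to \<open>\<sigma> / \<rho>\<close> in the ball.\<close>

lemma weight_bounds:
  fixes A :: "real^'n \<Rightarrow> real^'n^'n"
  assumes \<theta>: "\<theta> \<ge> 1" and e: "elliptic \<theta> (A 0)" and s: "sym_mat (A 0)"
    and x: "x \<noteq> 0" "norm x \<le> \<rho>" and \<rho>: "\<rho> > 0" and \<mu>: "\<mu> > 0"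
  shows "0 < weight A \<rho> \<mu> x" "weight A \<rho> \<mu> x \<le> sigma A x / \<rho>"
    "sigma A x / \<rho> \<le> mu1 \<theta> \<mu> * weight A \<rho> \<mu> x" "sigma A x / \<rho> \<le> sqrt \<theta>"
proof -
  note sb = sigma_bounds[of \<theta> A x, OF \<theta> e s x(1)]
  have "sigma A x \<le> sqrt \<theta> * \<rho>" using sb(3) x(2) \<theta> by (meson mult_left_mono order_trans real_sqrt_ge_0_iff zero_le_one)
  then show r: "sigma A x / \<rho> \<le> sqrt \<theta>" using \<rho> by (simp add: field_simps)
  have w: "weight A \<rho> \<mu> x = phi \<mu> (sigma A x / \<rho>)" by (simp only: weight_def sigma_scale[OF \<rho>])
  have p: "0 < sigma A x / \<rho>" using sb(1) \<rho> by simp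
  show "0 < weight A \<rho> \<mu> x" unfolding w by (rule phi_pos[OF p])
  show "weight A \<rho> \<mu> x \<le> sigma A x / \<rho>" unfolding w by (rule phi_le[OF \<mu>]) (use p in auto)
  show "sigma A x / \<rho> \<le> mu1 \<theta> \<mu> * weight A \<rho> \<mu> x" unfolding w by (rule phi_ge[OF \<theta> \<mu> _ r]) (use p in auto)
qed

lemma quadratic_form_add_le:
  fixes M :: "real^'n^'n"
  assumes s: "sym_mat M" and p: "\<And>v. 0 \<le> v \<bullet> (M *v v)"
  shows "(v + w) \<bullet> (M *v (v + w)) \<le> 2 * (v \<bullet> (M *v v)) + 2 * (w \<bullet> (M *v w))"
proof -
  have "0 \<le> (v - w) \<bullet> (M *v (v - w))" by (rule p)
  then show ?thesis using sym_inner[OF s, of v w]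
    by (simp add: matrix_vector_mult_diff_distrib matrix_vector_right_distrib inner_diff_left inner_diff_right
      inner_add_left inner_add_right)
qed

text \<open>Conjugation with \<open>W = w powr (- \<alpha>)\<close> written out: \<open>g\<close> and \<open>g2\<close> are the first and second derivatives of \<open>ln w\<close>. The right-hand side
contains \<open>div (A \<nabla>u)\<close>, the left-hand side is the expression \<open>P\<close> of the scalar estimate.\<close>

lemma conjugated_operator:
  fixes a A0 B :: "real^'n^'n" and da :: "'n \<Rightarrow> real^'n^'n" and y u1 f1 :: "real^'n" and u2 f2 :: "'n \<Rightarrow> real^'n"
    and E \<sigma> \<nu> \<alpha> u f W :: real
  defines "g \<equiv> (1 / (E * \<sigma>\<^sup>2)) *\<^sub>R y"
    and "g2 \<equiv> \<lambda>k. (1 / (E * \<sigma>\<^sup>2)) *\<^sub>R (B *v axis k 1) - ((2 + \<nu> * \<sigma>) * y $ k / (E * \<sigma>^4)) *\<^sub>R y"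
    and "m \<equiv> (y \<bullet> (a *v y)) / \<sigma>\<^sup>2"
    and "t1 \<equiv> (\<Sum>k\<in>UNIV. ((a - A0) *v (B *v axis k 1)) $ k) + (\<Sum>k\<in>UNIV. (da k *v y) $ k) - 2 * ((y \<bullet> (a *v y)) / \<sigma>\<^sup>2 - 1)"
    and "\<delta> \<equiv> (\<Sum>k\<in>UNIV. (da k *v f1 + a *v f2 k) $ k)"
  assumes a: "sym_mat a" and i: "\<And>v. A0 *v (B *v v) = v" and E: "E > 0" and \<sigma>: "\<sigma> > 0"
    and f: "f = W * u" and f1: "f1 = W *\<^sub>R (u1 - (\<alpha> * u) *\<^sub>R g)"
    and f2: "\<And>k. f2 k = W *\<^sub>R (u2 k - (\<alpha> * u1 $ k) *\<^sub>R g - (\<alpha> * u) *\<^sub>R g2 k - (\<alpha> * g $ k) *\<^sub>R (u1 - (\<alpha> * u) *\<^sub>R g))"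
  shows "\<delta> + \<alpha>\<^sup>2 * m * f / (E * \<sigma>)\<^sup>2
      + \<alpha> * (2 * E * (y \<bullet> (a *v f1)) + ((real CARD('n) - 2) * E + E * (t1 - m * \<nu> * \<sigma>)) * f) / (E * \<sigma>)\<^sup>2
    = W * (\<Sum>k\<in>UNIV. (da k *v u1 + a *v u2 k) $ k)"
proof -
  define Lu where "Lu = (\<Sum>k\<in>UNIV. (da k *v u1 + a *v u2 k) $ k)"
  define dg where "dg = (\<Sum>k\<in>UNIV. (da k *v g + a *v g2 k) $ k)"
  define v where "v = u1 - (\<alpha> * u) *\<^sub>R g"
  have nz: "E \<noteq> 0" "\<sigma> \<noteq> 0" using E \<sigma> by auto
  have inn: "(\<Sum>k\<in>UNIV. c * (p $ k * q $ k)) = c * (p \<bullet> q)" for p q :: "real^'n" and c :: real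
    by (simp add: inner_vec_def sum_distrib_left)
  have term1: "(da k *v f1 + a *v f2 k) $ k = W * (da k *v u1 + a *v u2 k) $ k - (W * \<alpha> * u) * (da k *v g + a *v g2 k) $ k
      - (W * \<alpha>) * (u1 $ k * (a *v g) $ k) - (W * \<alpha>) * (g $ k * (a *v v) $ k)" for k
    unfolding f1 f2 v_def
    by (simp add: matrix_vector_mult_scaleR matrix_vector_mult_diff_distrib algebra_simps)
  have \<delta>: "\<delta> = W * Lu - (W * \<alpha> * u) * dg - (W * \<alpha>) * (u1 \<bullet> (a *v g)) - (W * \<alpha>) * (g \<bullet> (a *v v))"
    unfolding \<delta>_def term1 sum_subtractf inn by (simp add: Lu_def dg_def sum_distrib_left)
  have ym: "y \<bullet> (a *v y) = m * \<sigma>\<^sup>2" using nz by (simp add: m_def)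
  have dg: "dg = ((real CARD('n) - 2) * E + E * (t1 - m * \<nu> * \<sigma>)) / (E * \<sigma>)\<^sup>2"
  proof -
    have "((a - A0) *v (B *v axis k 1)) $ k = (a *v (B *v axis k 1)) $ k - 1" for k
      by (simp add: matrix_vector_mult_diff_rdistrib i axis_def)
    then have t1: "t1 = (\<Sum>k\<in>UNIV. (a *v (B *v axis k 1)) $ k) - real CARD('n) + (\<Sum>k\<in>UNIV. (da k *v y) $ k) - 2 * (m - 1)"
      by (simp add: t1_def m_def sum_subtractf)
    have "(da k *v g + a *v g2 k) $ k = (1 / (E * \<sigma>\<^sup>2)) * (da k *v y) $ k + (1 / (E * \<sigma>\<^sup>2)) * (a *v (B *v axis k 1)) $ k
        - ((2 + \<nu> * \<sigma>) / (E * \<sigma>^4)) * (y $ k * (a *v y) $ k)" for k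
      unfolding g_def g2_def by (simp add: matrix_vector_mult_scaleR matrix_vector_mult_diff_distrib)
    then have "dg = (1 / (E * \<sigma>\<^sup>2)) * (\<Sum>k\<in>UNIV. (da k *v y) $ k) + (1 / (E * \<sigma>\<^sup>2)) * (\<Sum>k\<in>UNIV. (a *v (B *v axis k 1)) $ k)
        - ((2 + \<nu> * \<sigma>) / (E * \<sigma>^4)) * (m * \<sigma>\<^sup>2)"
      by (simp only: dg_def sum_subtractf sum.distrib inn ym) (simp only: sum_distrib_left)
    also have "\<dots> = ((real CARD('n) - 2) * E + E * (t1 - m * \<nu> * \<sigma>)) / (E * \<sigma>)\<^sup>2"
      unfolding t1 using nz by (simp add: field_simps power2_eq_square power4_eq_xxxx)
    finally show ?thesis .
  qed
  have gg: "g \<bullet> (a *v g) = m / (E * \<sigma>)\<^sup>2"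
    unfolding g_def using nz ym by (simp add: matrix_vector_mult_scaleR field_simps power2_eq_square)
  have gv: "W * (g \<bullet> (a *v v)) = (y \<bullet> (a *v f1)) / (E * \<sigma>\<^sup>2)"
  proof -
    have "f1 = W *\<^sub>R v" unfolding f1 v_def ..
    then show ?thesis unfolding g_def by (simp add: matrix_vector_mult_scaleR)
  qed
  have gu: "W * (u1 \<bullet> (a *v g)) = (y \<bullet> (a *v f1)) / (E * \<sigma>\<^sup>2) + \<alpha> * f * (m / (E * \<sigma>)\<^sup>2)"
  proof -
    have u1v: "u1 = v + (\<alpha> * u) *\<^sub>R g" by (simp add: v_def)
    have "g \<bullet> (a *v (v + (\<alpha> * u) *\<^sub>R g)) = g \<bullet> (a *v v) + (\<alpha> * u) * (g \<bullet> (a *v g))"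
      by (simp add: matrix_vector_right_distrib matrix_vector_mult_scaleR inner_add_right)
    then have "u1 \<bullet> (a *v g) = g \<bullet> (a *v v) + (\<alpha> * u) * (g \<bullet> (a *v g))"
      unfolding u1v[symmetric] using sym_inner[OF a, of u1 g] by simp
    then have "W * (u1 \<bullet> (a *v g)) = W * (g \<bullet> (a *v v)) + \<alpha> * f * (g \<bullet> (a *v g))"
      by (simp add: f algebra_simps)
    then show ?thesis unfolding gv gg .
  qed
  define Z where "Z = (y \<bullet> (a *v f1))"
  have \<delta>': "\<delta> = W * Lu - \<alpha> * f * dg - \<alpha> * (Z / (E * \<sigma>\<^sup>2) + \<alpha> * f * (m / (E * \<sigma>)\<^sup>2)) - \<alpha> * (Z / (E * \<sigma>\<^sup>2))"
  proof -
    have "\<delta> = W * Lu - \<alpha> * (W * u) * dg - \<alpha> * (W * (u1 \<bullet> (a *v g))) - \<alpha> * (W * (g \<bullet> (a *v v)))"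
      unfolding \<delta> by (simp add: mult_ac)
    then show ?thesis unfolding gu gv f[symmetric] Z_def .
  qed
  show ?thesis unfolding Z_def[symmetric] Lu_def[symmetric] \<delta>' dg using nz
    by (simp add: field_simps power2_eq_square)
qed

lemma has_partial_flux:
  fixes A :: "real^'n \<Rightarrow> real^'n^'n"
  assumes a: "sym_mat (A x)" and \<sigma>: "\<sigma> x > 0"
    and d: "has_partial k \<sigma> \<sigma>' x" "has_partial k A A' x" "has_partial k y y' x"
      "has_partial k f f' x" "has_partial k f1 f1' x"
  shows "has_partial k (\<lambda>x. flux \<nu> \<alpha> (\<sigma> x) (A x) (y x) (f x) (f1 x))
     (flux_partial \<nu> \<alpha> (\<sigma> x) (A x) (y x) (f x) (f1 x) \<sigma>' A' y' f' f1') x"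
proof -
  define E where "E = (\<lambda>x. exp (\<nu> * \<sigma> x))"
  define \<gamma> where "\<gamma> = (\<lambda>x. E x *\<^sub>R (A x *v y x))"
  define m where "m = (\<lambda>x. (y x \<bullet> (A x *v y x)) / (\<sigma> x)\<^sup>2)"
  define \<gamma>' where "\<gamma>' = (\<nu> * E x * \<sigma>') *\<^sub>R (A x *v y x) + E x *\<^sub>R (A' *v y x + A x *v y')"
  define m' where "m' = (2 * (y' \<bullet> (A x *v y x)) + y x \<bullet> (A' *v y x)) / (\<sigma> x)\<^sup>2 - 2 * m x * \<sigma>' / \<sigma> x"
  define N where "N = (\<lambda>x. m x * (f x)\<^sup>2 / (E x * \<sigma> x)\<^sup>2)"
  define N' where "N' = (m' * (f x)\<^sup>2 + 2 * m x * f x * f') / (E x * \<sigma> x)\<^sup>2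
              - 2 * (m x * (f x)\<^sup>2) * (\<sigma>' * (\<nu> + 1 / \<sigma> x)) / (E x * \<sigma> x)\<^sup>2"
  define dd where "dd = real CARD('n) - 2"
  have E0: "E x > 0" by (simp add: E_def)
  have hE: "has_partial k E (\<nu> * E x * \<sigma>') x"
  proof -
    have "has_partial k E (\<sigma>' *\<^sub>R (\<nu> * exp (\<nu> * \<sigma> x))) x" unfolding E_def
      by (rule has_partial_chain[OF d(1)])
        (auto intro!: derivative_eq_intros simp: has_real_derivative_iff_has_vector_derivative[symmetric])
    then show ?thesis by (simp add: E_def mult_ac)
  qed
  have hAy: "has_partial k (\<lambda>x. A x *v y x) (A' *v y x + A x *v y') x"
    using has_partial_matvec[OF d(2,3)] by (simp add: add.commute)
  have hAf: "has_partial k (\<lambda>x. A x *v f1 x) (A' *v f1 x + A x *v f1') x"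
    using has_partial_matvec[OF d(2,5)] by (simp add: add.commute)
  have h\<gamma>: "has_partial k \<gamma> \<gamma>' x"
    unfolding \<gamma>_def \<gamma>'_def using has_partial_scaleR[OF hE hAy] by (simp add: add.commute)
  have hm: "has_partial k m m' x"
  proof -
    have 1: "has_partial k (\<lambda>x. y x \<bullet> (A x *v y x)) (2 * (y' \<bullet> (A x *v y x)) + y x \<bullet> (A' *v y x)) x"
      using has_partial_inner[OF d(3) hAy] sym_inner[OF a, of "y x" y'] by (simp add: inner_add_right algebra_simps)
    have 2: "has_partial k (\<lambda>x. 1 / (\<sigma> x)\<^sup>2) (\<sigma>' *\<^sub>R (- 2 / (\<sigma> x)^3)) x"
      by (rule has_partial_chain[OF d(1)])
        (use \<sigma> in \<open>auto intro!: derivative_eq_intros simp: has_real_derivative_iff_has_vector_derivative[symmetric]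
           field_simps power2_eq_square power3_eq_cube\<close>)
    show ?thesis using has_partial_mult[OF 1 2] \<sigma>
      unfolding m_def m'_def by (simp add: field_simps power2_eq_square power3_eq_cube)
  qed
  have hN: "has_partial k N N' x"
  proof -
    have 1: "has_partial k (\<lambda>x. m x * (f x * f x)) (m x * (f x * f' + f' * f x) + m' * (f x * f x)) x"
      by (rule has_partial_mult[OF hm has_partial_mult[OF d(4) d(4)]])
    have 2: "has_partial k (\<lambda>x. 1 / (exp (\<nu> * \<sigma> x) * \<sigma> x)\<^sup>2) (\<sigma>' *\<^sub>R (- 2 * (\<nu> + 1 / \<sigma> x) / (exp (\<nu> * \<sigma> x) * \<sigma> x)\<^sup>2)) x"
      by (rule has_partial_chain[OF d(1)])
        (use \<sigma> in \<open>auto intro!: derivative_eq_intros simp: has_real_derivative_iff_has_vector_derivative[symmetric]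
           field_simps power2_eq_square power3_eq_cube\<close>)
    show ?thesis using has_partial_mult[OF 1 2] \<sigma>
      unfolding N_def N'_def E_def[abs_def] by (simp add: field_simps power2_eq_square)
  qed
  have h\<Gamma>: "has_partial k (\<lambda>x. f1 x \<bullet> (A x *v f1 x)) (f1' \<bullet> (A x *v f1 x) + f1 x \<bullet> (A' *v f1 x + A x *v f1')) x"
    using has_partial_inner[OF d(5) hAf] by (simp add: add.commute)
  have hgf: "has_partial k (\<lambda>x. 2 * (\<gamma> x \<bullet> f1 x)) (2 * (\<gamma>' \<bullet> f1 x + \<gamma> x \<bullet> f1')) x"
    using has_partial_mult[OF has_partial_const has_partial_inner[OF h\<gamma> d(5)], of 2] by (simp add: add.commute)
  have hF: "has_partial k (\<lambda>x. dd * E x * f x) (dd * (\<nu> * E x * \<sigma>') * f x + dd * E x * f') x"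
    using has_partial_mult[OF has_partial_mult[OF has_partial_const hE] d(4), of dd] by (simp add: add.commute)
  have hN2: "has_partial k (\<lambda>x. \<alpha>\<^sup>2 * N x) (\<alpha>\<^sup>2 * N') x"
    using has_partial_mult[OF has_partial_const hN, of "\<alpha>\<^sup>2"] by simp
  have fl: "flux \<nu> \<alpha> (\<sigma> x) (A x) (y x) (f x) (f1 x) =
     (2 * (\<gamma> x \<bullet> f1 x)) *\<^sub>R (A x *v f1 x) - (f1 x \<bullet> (A x *v f1 x)) *\<^sub>R \<gamma> x + (dd * E x * f x) *\<^sub>R (A x *v f1 x) + (\<alpha>\<^sup>2 * N x) *\<^sub>R \<gamma> x" for x
    by (simp only: flux_def Let_def \<gamma>_def E_def N_def m_def dd_def)
  have fp: "flux_partial \<nu> \<alpha> (\<sigma> x) (A x) (y x) (f x) (f1 x) \<sigma>' A' y' f' f1' =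
     (2 * (\<gamma>' \<bullet> f1 x + \<gamma> x \<bullet> f1')) *\<^sub>R (A x *v f1 x)
            + (2 * (\<gamma> x \<bullet> f1 x)) *\<^sub>R (A' *v f1 x + A x *v f1')
            - (f1' \<bullet> (A x *v f1 x) + f1 x \<bullet> (A' *v f1 x + A x *v f1')) *\<^sub>R \<gamma> x - (f1 x \<bullet> (A x *v f1 x)) *\<^sub>R \<gamma>'
            + (dd * (\<nu> * E x * \<sigma>') * f x + dd * E x * f') *\<^sub>R (A x *v f1 x)
            + (dd * E x * f x) *\<^sub>R (A' *v f1 x + A x *v f1')
            + (\<alpha>\<^sup>2 * N') *\<^sub>R \<gamma> x + (\<alpha>\<^sup>2 * N x) *\<^sub>R \<gamma>'"
    by (simp only: flux_partial_def Let_def \<gamma>_def E_def N_def m_def dd_def \<gamma>'_def N'_def m'_def)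
  show ?thesis unfolding fl fp
    using has_partial_add[OF has_partial_add[OF has_partial_diff[OF has_partial_scaleR[OF hgf hAf] has_partial_scaleR[OF h\<Gamma> h\<gamma>]]
        has_partial_scaleR[OF hF hAf]] has_partial_scaleR[OF hN2 h\<gamma>]]
    by (simp add: algebra_simps)
qed

text \<open>The scalar estimate with \<open>E\<close> bounded above and below, with \<open>\<sigma>\<close> replaced by the weight, and with \<open>\<nabla>f\<close> translated back into
\<open>\<nabla>u\<close>. Translation mixes \<open>\<nabla>u\<close> and \<open>u\<close>, which is why both positive terms of the scalar estimate are needed. The two
conditions on \<open>\<alpha>\<close> are those of the scalar estimate.\<close>

lemma carleman_pointwise:
  fixes A :: "real^'n \<Rightarrow> real^'n^'n" and a :: "real^'n^'n" and da :: "'n \<Rightarrow> real^'n^'n"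
    and x u1 :: "real^'n" and u2 :: "'n \<Rightarrow> real^'n"
    and \<rho> \<theta> \<theta>2 \<mu> \<alpha> u :: real
  defines "B \<equiv> matrix_inv (A 0)" and "\<nu> \<equiv> \<mu> / \<rho>" and "\<sigma> \<equiv> sigma A x" and "w \<equiv> weight A \<rho> \<mu> x"
  defines "y \<equiv> B *v x" and "E \<equiv> exp (\<nu> * \<sigma>)" and "s \<equiv> sqrt \<theta> * \<mu>"
  defines "W \<equiv> w powr (- \<alpha>)" and "g \<equiv> (1 / (E * \<sigma>\<^sup>2)) *\<^sub>R y"
    and "g2 \<equiv> \<lambda>k. (1 / (E * \<sigma>\<^sup>2)) *\<^sub>R (B *v axis k 1) - ((2 + \<nu> * \<sigma>) * y $ k / (E * \<sigma>^4)) *\<^sub>R y"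
  defines "f \<equiv> W * u" and "f1 \<equiv> W *\<^sub>R (u1 - (\<alpha> * u) *\<^sub>R g)"
    and "f2 \<equiv> \<lambda>k. W *\<^sub>R (u2 k - (\<alpha> * u1 $ k) *\<^sub>R g - (\<alpha> * u) *\<^sub>R g2 k - (\<alpha> * g $ k) *\<^sub>R (u1 - (\<alpha> * u) *\<^sub>R g))"
  defines "c \<equiv> \<nu> - 33 * (real CARD('n) * (\<theta>^5 * sqrt \<theta>) * \<theta>2)"
    and "H \<equiv> (\<theta> * mu1 \<theta> \<mu>)\<^sup>2 * exp (2 * \<mu> * sqrt \<theta>)"
  assumes \<rho>: "\<rho> > 0" and \<theta>: "\<theta> \<ge> 1" and \<theta>2: "\<theta>2 \<ge> 0" and c: "c > 0" and \<alpha>: "\<alpha> > 0"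
    and A0: "elliptic \<theta> (A 0)" "sym_mat (A 0)" and x: "x \<noteq> 0" "norm x \<le> \<rho>"
    and a: "elliptic \<theta> a" "sym_mat a" and D: "rows_le (\<theta>2 * norm x) (a - A 0)"
    and da: "\<And>k. sym_mat (da k)" "\<And>k. rows_le \<theta>2 (da k)"
    and u2: "\<And>k l. u2 k $ l = u2 l $ k"
    and e: "s * exp s \<le> \<alpha> / 60" and b: "\<theta>\<^sup>2 * \<bar>real CARD('n) - 2\<bar> * exp s \<le> \<alpha> / 2"
  shows "\<alpha> * \<rho>\<^sup>2 * w powr (1 - 2 * \<alpha>) * (u1 \<bullet> (a *v u1)) + \<alpha>^3 * w powr (- 1 - 2 * \<alpha>) * u\<^sup>2
      + (32/9 * H * \<rho> * \<theta>\<^sup>2 * \<alpha> / c) * (\<Sum>k\<in>UNIV. flux_partial \<nu> \<alpha> \<sigma> a y f f1 (y $ k / \<sigma>) (da k) (B *v axis k 1) (f1 $ k) (f2 k) $ k)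
      \<le> (2 * H\<^sup>2 * \<rho>^3 / c) * (w powr (2 - 2 * \<alpha>) * (\<Sum>k\<in>UNIV. (da k *v u1 + a *v u2 k) $ k)\<^sup>2)"
proof -
  define L where "L = real CARD('n) * (\<theta>^5 * sqrt \<theta>) * \<theta>2"
  have L0: "L \<ge> 0" using \<theta> \<theta>2 by (simp add: L_def)
  have cL: "c = \<nu> - 33 * L" by (simp add: c_def L_def)
  have \<nu>: "\<nu> > 0" using c cL L0 by linarith
  have \<mu>: "\<mu> > 0" using \<nu> \<rho> by (simp add: \<nu>_def zero_less_divide_iff)
  note sb = sigma_bounds[of \<theta> A x, OF \<theta> A0 x(1), folded \<sigma>_def B_def y_def]
  note wb = weight_bounds[of \<theta> A x \<rho> \<mu>, OF \<theta> A0 x \<rho> \<mu>, folded w_def \<sigma>_def]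
  note inv = elliptic_inverse[OF \<theta> A0, folded B_def]
  have E1: "E \<ge> 1" using \<nu> sb(1) by (simp add: E_def)
  have \<nu>s: "\<nu> * \<sigma> \<le> s"
  proof -
    have "\<nu> * \<sigma> = \<mu> * (\<sigma> / \<rho>)" by (simp add: \<nu>_def)
    also have "\<dots> \<le> \<mu> * sqrt \<theta>" using wb(4) \<mu> by (intro mult_left_mono) auto
    finally show ?thesis by (simp add: s_def mult.commute)
  qed
  then have Es: "E \<le> exp s" by (simp add: E_def)
  define m where "m = (y \<bullet> (a *v y)) / \<sigma>\<^sup>2"
  define \<Gamma> where "\<Gamma> = f1 \<bullet> (a *v f1)"
  define t1 where "t1 = (\<Sum>k\<in>UNIV. ((a - A 0) *v (B *v axis k 1)) $ k) + (\<Sum>k\<in>UNIV. (da k *v y) $ k) - 2 * (m - 1)"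
  define g1 where "g1 = ((\<Sum>k\<in>UNIV. (a *v y) $ k * (y \<bullet> (da k *v y))) + 2 * ((B *v (a *v y)) \<bullet> (a *v y))) / \<sigma>\<^sup>2 - 2 * m\<^sup>2"
  define q where "q = ((\<Sum>k\<in>UNIV. ((a - A 0) *v (B *v axis k 1)) $ k) + (\<Sum>k\<in>UNIV. (da k *v y) $ k)) * \<Gamma> + 2 * (\<Gamma> - f1 \<bullet> (a *v (B *v (a *v f1))))
            + (\<Sum>k\<in>UNIV. (a *v y) $ k * (f1 \<bullet> (da k *v f1)))
            - 2 * (\<Sum>k\<in>UNIV. (a *v f1) $ k * (f1 \<bullet> (da k *v y)))"
  define \<delta> where "\<delta> = (\<Sum>k\<in>UNIV. (da k *v f1 + a *v f2 k) $ k)"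
  define z where "z = y \<bullet> (a *v f1)"
  define dd where "dd = real CARD('n) - 2"
  define D0 where "D0 = (\<Sum>k\<in>UNIV. flux_partial \<nu> \<alpha> \<sigma> a y f f1 (y $ k / \<sigma>) (da k) (B *v axis k 1) (f1 $ k) (f2 k) $ k)"
  define Lu where "Lu = (\<Sum>k\<in>UNIV. (da k *v u1 + a *v u2 k) $ k)"
  note cb = coefficient_bounds(1-3)[where dA = da, OF \<theta> \<theta>2 a A0 inv(1,2) meta_eq_to_obj_eq[OF y_def] sb(1,2) D da,
      folded m_def L_def, folded t1_def g1_def]
    coefficient_bounds(4)[where dA = da and ?f1.0 = f1, OF \<theta> \<theta>2 a A0 inv(1,2) meta_eq_to_obj_eq[OF y_def] sb(1,2) D da,
      folded m_def L_def \<Gamma>_def, folded q_def]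
  have m0: "m > 0"
  proof -
    have "0 < \<theta>\<^sup>2 * m" using cb(1) by linarith
    then show ?thesis using \<theta> by (simp add: zero_less_mult_iff)
  qed
  have \<Gamma>0: "\<Gamma> \<ge> 0" unfolding \<Gamma>_def by (rule elliptic_bounds(3)[OF \<theta> a])
  have W0: "W > 0" using wb(1) by (simp add: W_def)
  have f2s: "f2 k $ l = f2 l $ k" for k l
  proof -
    have "(B *v axis k 1) $ l = (B *v axis l 1) $ k" for k l
      using inv(3)[of "axis l 1" "axis k 1"] by (simp add: inner_axis')
    then show ?thesis using u2[of k l] by (simp add: f2_def g2_def g_def algebra_simps)
  qed
  have D0: "D0 = (2 * E * z + dd * E * f) * \<delta>
      + \<alpha>\<^sup>2 * m * f * (2 * E * z + (dd * E + E * (t1 - m * \<nu> * \<sigma>)) * f) / (E * \<sigma>)\<^sup>2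
      - (E * \<nu> * m * \<sigma> * \<Gamma> - 2 * E * \<nu> * z\<^sup>2 / \<sigma> + E * q)
      + f * dd * E * \<nu> * z / \<sigma> + \<alpha>\<^sup>2 * f\<^sup>2 * g1 / (E * \<sigma>\<^sup>2)"
    unfolding D0_def
    using divergence_identity[OF a(2) inv(1) da(1) f2s meta_eq_to_obj_eq[OF E_def] sb(1), of \<alpha> y f f1]
    unfolding m_def t1_def g1_def q_def \<delta>_def z_def dd_def \<Gamma>_def .
  have nE: "\<nu> * \<sigma> * E \<le> \<alpha> / 60"
  proof -
    have "\<nu> * \<sigma> * E \<le> s * exp s" using \<nu>s Es \<nu> sb(1) E1 by (intro mult_mono) (auto intro: order_trans[OF _ \<nu>s])
    then show ?thesis using e by linarith
  qed
  have bb: "\<bar>dd\<bar> * E \<le> m * \<alpha> / 2"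
  proof -
    have "1 * (\<bar>dd\<bar> * E) \<le> (\<theta>\<^sup>2 * m) * (\<bar>dd\<bar> * exp s)" using cb(1) Es E1 by (intro mult_mono) auto
    also have "\<dots> = m * (\<theta>\<^sup>2 * \<bar>dd\<bar> * exp s)" by simp
    also have "\<dots> \<le> m * (\<alpha> / 2)" using b m0 by (intro mult_left_mono) (auto simp: dd_def)
    finally show ?thesis by simp
  qed
  have qb: "\<bar>E * q\<bar> \<le> 7 * L * (E * m * \<sigma> * \<Gamma>)"
  proof -
    have "E * \<bar>q\<bar> \<le> E * (7 * L * (m * \<sigma> * \<Gamma>))" using cb(4) E1 by (intro mult_left_mono) auto
    then show ?thesis using E1 by (simp add: abs_mult mult_ac)
  qed
  have P: "\<delta> + \<alpha>\<^sup>2 * m * f / (E * \<sigma>)\<^sup>2 + \<alpha> * (2 * E * z + (dd * E + E * (t1 - m * \<nu> * \<sigma>)) * f) / (E * \<sigma>)\<^sup>2 = W * Lu"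
    unfolding \<delta>_def m_def z_def dd_def t1_def Lu_def
    by (rule conjugated_operator[OF a(2) inv(1) _ sb(1)]) (use E1 in \<open>auto simp: f_def f1_def f2_def g_def g2_def\<close>)
  have main: "2 * \<alpha> * D0 + 2 * \<alpha> * c * (E * m * \<sigma> * \<Gamma>) + 27/16 * \<alpha>^3 * c * (m\<^sup>2 * f\<^sup>2 / (E * \<sigma>)) \<le> 9/8 * (E * \<sigma> * (W * Lu))\<^sup>2"
    unfolding P[symmetric] cL
    by (rule carleman_pointwise_scalar[OF \<alpha> \<nu> sb(1) _ m0 L0 \<Gamma>0 _ nE bb qb cb(2) cb(3) D0]) (use E1 c cL in auto)
  define M where "M = mu1 \<theta> \<mu>"
  have s0: "s \<ge> 0" using \<theta> \<mu> by (simp add: s_def)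
  have M1: "M \<ge> 1" using mu1_ge[OF \<theta> \<mu>] s0 unfolding M_def s_def by linarith
  have H: "H = \<theta>\<^sup>2 * M\<^sup>2 * (exp s)\<^sup>2"
    by (simp add: H_def M_def s_def power_mult_distrib exp_double[symmetric] mult_ac)
  define \<kappa> where "\<kappa> = 16/9 * H * \<rho> * \<theta>\<^sup>2 / c"
  have es1: "exp s \<ge> 1" using s0 by simp
  have H1: "H \<ge> 1"
  proof -
    have "1 * 1 * 1 \<le> \<theta>\<^sup>2 * M\<^sup>2 * (exp s)\<^sup>2" using \<theta> M1 es1 by (intro mult_mono one_le_power) auto
    then show ?thesis by (simp add: H)
  qed
  have \<kappa>0: "\<kappa> \<ge> 0" using H1 \<rho> c by (simp add: \<kappa>_def)
  have \<theta>p: "\<theta>\<^sup>2 * m \<ge> 1" by (rule cb(1))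
  have R: "\<kappa> * (9/8 * (E * \<sigma> * (W * Lu))\<^sup>2) \<le> (2 * H\<^sup>2 * \<rho>^3 / c) * (w powr (2 - 2 * \<alpha>) * Lu\<^sup>2)"
  proof -
    have ww: "w powr (2 - 2 * \<alpha>) = w\<^sup>2 * W\<^sup>2"
    proof -
      have "w powr (2 - 2 * \<alpha>) = w powr (2 + (-\<alpha>) + (-\<alpha>))" by simp
      also have "\<dots> = w\<^sup>2 * W * W" unfolding powr_add W_def using wb(1) by simp
      finally show ?thesis by (simp add: power2_eq_square)
    qed
    have "\<sigma> \<le> \<rho> * (M * w)" using wb(3) \<rho> by (simp add: M_def field_simps)
    then have "E * \<sigma> \<le> exp s * (\<rho> * (M * w))" using Es E1 sb(1) by (intro mult_mono) auto
    then have "(E * \<sigma>)\<^sup>2 \<le> (exp s * (\<rho> * (M * w)))\<^sup>2" using E1 sb(1) by (intro power_mono) auto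
    then have "(E * \<sigma>)\<^sup>2 * (W * Lu)\<^sup>2 \<le> (exp s * (\<rho> * (M * w)))\<^sup>2 * (W * Lu)\<^sup>2" by (intro mult_right_mono) auto
    then have "\<kappa> * (9/8 * (E * \<sigma> * (W * Lu))\<^sup>2) \<le> \<kappa> * (9/8 * ((exp s * (\<rho> * (M * w)))\<^sup>2 * (W * Lu)\<^sup>2))"
      using \<kappa>0 by (intro mult_left_mono) (auto simp: power_mult_distrib)
    also have "\<dots> = (2 * H\<^sup>2 * \<rho>^3 / c) * (w powr (2 - 2 * \<alpha>) * Lu\<^sup>2)"
      unfolding ww \<kappa>_def H by (simp add: power_mult_distrib power2_eq_square power3_eq_cube field_simps)
    finally show ?thesis .
  qed
  have Wu1: "u1 = (1/W) *\<^sub>R (f1 + (\<alpha> * f) *\<^sub>R g)"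
    using W0 by (simp add: f1_def f_def algebra_simps)
  have gg: "g \<bullet> (a *v g) = m / (E * \<sigma>)\<^sup>2"
    unfolding g_def m_def using sb(1) by (simp add: matrix_vector_mult_scaleR field_simps power2_eq_square)
  have au: "u1 \<bullet> (a *v u1) \<le> (1/W)\<^sup>2 * (2 * \<Gamma> + 2 * (\<alpha>\<^sup>2 * f\<^sup>2 * (m / (E * \<sigma>)\<^sup>2)))"
  proof -
    have "(f1 + (\<alpha> * f) *\<^sub>R g) \<bullet> (a *v (f1 + (\<alpha> * f) *\<^sub>R g)) \<le> 2 * \<Gamma> + 2 * (((\<alpha> * f) *\<^sub>R g) \<bullet> (a *v ((\<alpha> * f) *\<^sub>R g)))"
      unfolding \<Gamma>_def by (rule quadratic_form_add_le[OF a(2) elliptic_bounds(3)[OF \<theta> a]])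
    also have "((\<alpha> * f) *\<^sub>R g) \<bullet> (a *v ((\<alpha> * f) *\<^sub>R g)) = \<alpha>\<^sup>2 * f\<^sup>2 * (m / (E * \<sigma>)\<^sup>2)"
      unfolding gg[symmetric] by (simp add: matrix_vector_mult_scaleR power2_eq_square)
    finally have 1: "(f1 + (\<alpha> * f) *\<^sub>R g) \<bullet> (a *v (f1 + (\<alpha> * f) *\<^sub>R g)) \<le> 2 * \<Gamma> + 2 * (\<alpha>\<^sup>2 * f\<^sup>2 * (m / (E * \<sigma>)\<^sup>2))" .
    have "u1 \<bullet> (a *v u1) = (1/W)\<^sup>2 * ((f1 + (\<alpha> * f) *\<^sub>R g) \<bullet> (a *v (f1 + (\<alpha> * f) *\<^sub>R g)))"
      by (subst (1 2) Wu1) (simp only: matrix_vector_mult_scaleR inner_scaleR_left inner_scaleR_right power2_eq_square mult.assoc)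
    then show ?thesis using 1 by (simp only: mult_left_mono zero_le_power2)
  qed
  have w1: "w powr (1 - 2 * \<alpha>) * (1/W)\<^sup>2 = w"
  proof -
    have "w powr (1 - 2 * \<alpha>) = w powr (1 + (-\<alpha>) + (-\<alpha>))" by simp
    also have "\<dots> = w * W * W" unfolding powr_add W_def using wb(1) by simp
    finally show ?thesis using W0 by (simp add: power2_eq_square)
  qed
  have w2: "w powr (- 1 - 2 * \<alpha>) * u\<^sup>2 = f\<^sup>2 / w"
  proof -
    have "- 1 - 2 * \<alpha> = -1 + (-\<alpha>) + (-\<alpha>)" by simp
    then have "w powr (- 1 - 2 * \<alpha>) = w powr (-1 + (-\<alpha>) + (-\<alpha>))" by (simp only:)
    also have "\<dots> = (1/w) * W * W" unfolding powr_add W_def using wb(1) by (simp add: powr_minus divide_inverse)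
    finally show ?thesis by (simp add: f_def power2_eq_square)
  qed
  have dens: "\<alpha> * \<rho>\<^sup>2 * w powr (1 - 2 * \<alpha>) * (u1 \<bullet> (a *v u1)) + \<alpha>^3 * w powr (- 1 - 2 * \<alpha>) * u\<^sup>2
     \<le> \<kappa> * (2 * \<alpha> * c * (E * m * \<sigma> * \<Gamma>) + 27/16 * \<alpha>^3 * c * (m\<^sup>2 * f\<^sup>2 / (E * \<sigma>)))"
  proof -
    define G where "G = \<Gamma> + \<alpha>\<^sup>2 * f\<^sup>2 * (m / (E * \<sigma>)\<^sup>2)"
    have G0: "G \<ge> 0" using \<Gamma>0 m0 by (simp add: G_def)
    have "\<alpha> * \<rho>\<^sup>2 * w powr (1 - 2 * \<alpha>) * (u1 \<bullet> (a *v u1)) \<le> \<alpha> * \<rho>\<^sup>2 * w powr (1 - 2 * \<alpha>) * ((1/W)\<^sup>2 * (2 * G))"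
      using au \<alpha> by (intro mult_left_mono) (auto simp: G_def)
    also have "\<dots> = \<alpha> * \<rho>\<^sup>2 * (w powr (1 - 2 * \<alpha>) * (1/W)\<^sup>2) * (2 * G)" by (simp only: mult.assoc)
    also have "\<dots> = \<alpha> * \<rho>\<^sup>2 * w * (2 * G)" by (simp only: w1)
    also have "\<dots> \<le> \<alpha> * \<rho>\<^sup>2 * (\<sigma> / \<rho>) * (2 * G)" using wb(2) \<alpha> G0 by (intro mult_right_mono mult_left_mono) auto
    also have "\<dots> = 2 * \<alpha> * \<rho> * \<sigma> * G" using \<rho> by (simp add: power2_eq_square)
    finally have d1: "\<alpha> * \<rho>\<^sup>2 * w powr (1 - 2 * \<alpha>) * (u1 \<bullet> (a *v u1)) \<le> 2 * \<alpha> * \<rho> * \<sigma> * G" .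
    have "\<alpha>^3 * w powr (- 1 - 2 * \<alpha>) * u\<^sup>2 = \<alpha>^3 * f\<^sup>2 * (1 / w)" using w2 by (simp add: mult.assoc)
    also have "1 / w \<le> \<rho> * M / \<sigma>" using wb(1,3) \<rho> sb(1) by (simp add: M_def field_simps)
    then have "\<alpha>^3 * f\<^sup>2 * (1 / w) \<le> \<alpha>^3 * f\<^sup>2 * (\<rho> * M / \<sigma>)" using \<alpha> by (intro mult_left_mono) auto
    finally have d2: "\<alpha>^3 * w powr (- 1 - 2 * \<alpha>) * u\<^sup>2 \<le> \<alpha>^3 * f\<^sup>2 * (\<rho> * M / \<sigma>)" .
    have d3: "2 * \<alpha> * \<rho> * \<sigma> * \<Gamma> \<le> \<kappa> * (2 * \<alpha> * c * (E * m * \<sigma> * \<Gamma>))"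
    proof -
      have "1 \<le> (32/9 * H) * ((\<theta>\<^sup>2 * m) * E) / 2"
      proof -
        have "1 * (1 * 1) \<le> H * ((\<theta>\<^sup>2 * m) * E)" using H1 \<theta>p E1 by (intro mult_mono) auto
        then show ?thesis by (simp add: mult_ac)
      qed
      then have "(2 * \<alpha> * \<rho> * \<sigma> * \<Gamma>) * 1 \<le> (2 * \<alpha> * \<rho> * \<sigma> * \<Gamma>) * ((32/9 * H) * ((\<theta>\<^sup>2 * m) * E) / 2)"
        using \<alpha> \<rho> sb(1) \<Gamma>0 by (intro mult_left_mono) auto
      also have "\<dots> = \<kappa> * (2 * \<alpha> * c * (E * m * \<sigma> * \<Gamma>))" using c by (simp add: \<kappa>_def field_simps)
      finally show ?thesis by simp
    qed
    have d4: "2 * m / E + M * E \<le> 3 * H * \<theta>\<^sup>2 * m\<^sup>2"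
    proof -
      have "2 * m / E \<le> 2 * m / 1" using E1 m0 by (intro divide_left_mono) auto
      also have "2 * m / 1 \<le> 2 * (m * (\<theta>\<^sup>2 * m)) * H"
      proof -
        have "m * (1 * 1) \<le> m * ((\<theta>\<^sup>2 * m) * H)" using \<theta>p H1 m0 by (intro mult_left_mono mult_mono) auto
        then show ?thesis by (simp add: mult_ac)
      qed
      finally have 1: "2 * m / E \<le> 2 * H * \<theta>\<^sup>2 * m\<^sup>2" by (simp add: power2_eq_square mult_ac)
      have "M * E \<le> (M * exp s) * 1" using Es M1 by (simp add: mult_left_mono)
      also have "\<dots> \<le> (M * exp s) * (M * exp s)" using M1 es1 mult_mono[of 1 M 1 "exp s"] by (intro mult_left_mono) auto
      also have "\<dots> \<le> (M * exp s) * (M * exp s) * ((\<theta>\<^sup>2 * m) * (\<theta>\<^sup>2 * m))"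
        using \<theta>p M1 mult_mono[of 1 "\<theta>\<^sup>2 * m" 1 "\<theta>\<^sup>2 * m"] by (simp add: mult_le_cancel_left1)
      also have "\<dots> = H * \<theta>\<^sup>2 * m\<^sup>2" by (simp add: H power2_eq_square)
      finally show ?thesis using 1 by simp
    qed
    have d5: "2 * \<alpha> * \<rho> * \<sigma> * (\<alpha>\<^sup>2 * f\<^sup>2 * (m / (E * \<sigma>)\<^sup>2)) + \<alpha>^3 * f\<^sup>2 * (\<rho> * M / \<sigma>)
        \<le> \<kappa> * (27/16 * \<alpha>^3 * c * (m\<^sup>2 * f\<^sup>2 / (E * \<sigma>)))"
    proof -
      have "2 * \<alpha> * \<rho> * \<sigma> * (\<alpha>\<^sup>2 * f\<^sup>2 * (m / (E * \<sigma>)\<^sup>2)) + \<alpha>^3 * f\<^sup>2 * (\<rho> * M / \<sigma>)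
          = (\<alpha>^3 * f\<^sup>2 * \<rho> / (E * \<sigma>)) * (2 * m / E + M * E)"
        using sb(1) E1 by (simp add: field_simps power2_eq_square power3_eq_cube)
      also have "\<dots> \<le> (\<alpha>^3 * f\<^sup>2 * \<rho> / (E * \<sigma>)) * (3 * H * \<theta>\<^sup>2 * m\<^sup>2)"
        using d4 \<alpha> \<rho> sb(1) E1 by (intro mult_left_mono) auto
      also have "\<dots> = \<kappa> * (27/16 * \<alpha>^3 * c * (m\<^sup>2 * f\<^sup>2 / (E * \<sigma>)))"
        using c by (simp add: \<kappa>_def)
      finally show ?thesis .
    qed
    show ?thesis using d1 d2 d3 d5 by (simp add: G_def distrib_left)
  qed
  have "\<kappa> * (2 * \<alpha> * D0 + 2 * \<alpha> * c * (E * m * \<sigma> * \<Gamma>) + 27/16 * \<alpha>^3 * c * (m\<^sup>2 * f\<^sup>2 / (E * \<sigma>))) \<le> \<kappa> * (9/8 * (E * \<sigma> * (W * Lu))\<^sup>2)"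
    using main \<kappa>0 by (intro mult_left_mono)
  then have "\<kappa> * (2 * \<alpha> * D0) + \<kappa> * (2 * \<alpha> * c * (E * m * \<sigma> * \<Gamma>) + 27/16 * \<alpha>^3 * c * (m\<^sup>2 * f\<^sup>2 / (E * \<sigma>))) \<le> \<kappa> * (9/8 * (E * \<sigma> * (W * Lu))\<^sup>2)"
    by (simp add: distrib_left)
  moreover have "\<kappa> * (2 * \<alpha> * D0) = (32/9 * H * \<rho> * \<theta>\<^sup>2 * \<alpha> / c) * D0" by (simp add: \<kappa>_def)
  ultimately show ?thesis using dens R unfolding D0_def Lu_def by linarith
qed

section \<open>The estimate for smooth data\<close>

lemma weight_pos:
  fixes A :: "real^'n \<Rightarrow> real^'n^'n"
  assumes \<theta>: "\<theta> \<ge> 1" and e: "elliptic \<theta> (A 0)" and s: "sym_mat (A 0)" and x: "x \<noteq> 0" and \<rho>: "\<rho> > 0"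
  shows "0 < weight A \<rho> \<mu> x"
  using sigma_bounds(1)[of \<theta> A x, OF \<theta> e s x] \<rho> unfolding weight_def sigma_scale[OF \<rho>]
  by (intro phi_pos) simp

lemma continuous_on_sigma: "continuous_on S (sigma A)"
  unfolding sigma_def by (intro continuous_intros continuous_on_inner linear_continuous_on matrix_vector_mul_bounded_linear)

lemma continuous_on_weight:
  fixes A :: "real^'n \<Rightarrow> real^'n^'n"
  assumes \<theta>: "\<theta> \<ge> 1" and e: "elliptic \<theta> (A 0)" and s: "sym_mat (A 0)" and \<rho>: "\<rho> > 0" and S: "0 \<notin> S"
  shows "continuous_on S (weight A \<rho> \<mu>)"
proof -
  have "continuous_on {0<..} (phi \<mu>)"
  proof -
    have "continuous_on {0<..} (\<lambda>r. exp (ln (phi \<mu> r)))"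
      by (intro continuous_on_exp continuous_at_imp_continuous_on ballI DERIV_isCont[OF ln_phi_derivative]) auto
    then show ?thesis by (rule continuous_on_eq) (auto simp: phi_pos)
  qed
  moreover have "0 < sigma A x / \<rho>" if "x \<in> S" for x
    using sigma_bounds(1)[of \<theta> A x, OF \<theta> e s] that S \<rho> by (cases "x = 0") auto
  ultimately have "continuous_on S (\<lambda>x. phi \<mu> (sigma A x / \<rho>))"
    by (elim continuous_on_compose2) (use \<rho> in \<open>auto intro!: continuous_intros continuous_on_sigma\<close>)
  then show ?thesis unfolding weight_def[abs_def] sigma_scale[OF \<rho>] .
qed

lemma integrable_compact_support:
  fixes F :: "real^'n \<Rightarrow> 'b::{banach, second_countable_topology}"
  assumes "compact K" "continuous_on K F" "\<And>x. x \<notin> K \<Longrightarrow> F x = 0"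
  shows "integrable lborel F"
proof -
  have "F = (\<lambda>x. if x \<in> K then F x else 0)" using assms(3) by (auto simp: fun_eq_iff)
  then show ?thesis using borel_integrable_compact[OF assms(1,2)] unfolding indicator_scaleR_eq_if by simp
qed

lemmas continuous_on_matvec = bounded_bilinear.continuous_on[OF bounded_bilinear_matrix_vector]

lemma continuous_on_flux:
  fixes A :: "real^'n \<Rightarrow> real^'n^'n"
  assumes "continuous_on K \<sigma>" "continuous_on K A" "continuous_on K y" "continuous_on K f" "continuous_on K f1"
    "\<And>x. x \<in> K \<Longrightarrow> \<sigma> x > 0"
  shows "continuous_on K (\<lambda>x. flux \<nu> \<alpha> (\<sigma> x) (A x) (y x) (f x) (f1 x))"
  unfolding flux_def Let_def using assms
  by (intro continuous_intros continuous_on_matvec) (auto simp: less_imp_neq[symmetric])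

lemma continuous_on_flux_partial:
  fixes A :: "real^'n \<Rightarrow> real^'n^'n"
  assumes "continuous_on K \<sigma>" "continuous_on K A" "continuous_on K y" "continuous_on K f" "continuous_on K f1"
    "continuous_on K \<sigma>'" "continuous_on K A'" "continuous_on K y'" "continuous_on K f'" "continuous_on K f1'"
    "\<And>x. x \<in> K \<Longrightarrow> \<sigma> x > 0"
  shows "continuous_on K (\<lambda>x. flux_partial \<nu> \<alpha> (\<sigma> x) (A x) (y x) (f x) (f1 x) (\<sigma>' x) (A' x) (y' x) (f' x) (f1' x))"
  unfolding flux_partial_def Let_def using assms
  by (intro continuous_intros continuous_on_matvec) (auto simp: less_imp_neq[symmetric])

text \<open>The pointwise inequality is integrated; the flux has compact support away from the origin, so its divergence
integrates to 0.\<close>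

lemma carleman_smooth:
  fixes A a :: "real^'n \<Rightarrow> real^'n^'n" and da :: "'n \<Rightarrow> real^'n \<Rightarrow> real^'n^'n"
    and u :: "real^'n \<Rightarrow> real" and u1 :: "real^'n \<Rightarrow> real^'n" and u2 :: "'n \<Rightarrow> real^'n \<Rightarrow> real^'n"
    and \<rho> \<theta> \<theta>2 \<mu> \<alpha> :: real
  defines "w \<equiv> weight A \<rho> \<mu>" and "s \<equiv> sqrt \<theta> * \<mu>"
    and "c \<equiv> \<mu> / \<rho> - 33 * (real CARD('n) * (\<theta>^5 * sqrt \<theta>) * \<theta>2)"
    and "H \<equiv> (\<theta> * mu1 \<theta> \<mu>)\<^sup>2 * exp (2 * \<mu> * sqrt \<theta>)"
  assumes \<rho>: "\<rho> > 0" and \<theta>: "\<theta> \<ge> 1" and \<theta>2: "\<theta>2 \<ge> 0" and c: "c > 0" and \<alpha>: "\<alpha> > 0"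
    and A0: "elliptic \<theta> (A 0)" "sym_mat (A 0)" and K: "compact K" "K \<subseteq> ball 0 \<rho> - {0}"
    and a: "\<And>x. x \<in> K \<Longrightarrow> elliptic \<theta> (a x)" "\<And>x. x \<in> K \<Longrightarrow> sym_mat (a x)"
    and D: "\<And>x. x \<in> K \<Longrightarrow> rows_le (\<theta>2 * norm x) (a x - A 0)"
    and da: "\<And>x k. x \<in> K \<Longrightarrow> sym_mat (da k x)" "\<And>x k. x \<in> K \<Longrightarrow> rows_le \<theta>2 (da k x)"
    and a1: "\<And>x k. x \<in> K \<Longrightarrow> has_partial k a (da k x) x" "continuous_on K a" "\<And>k. continuous_on K (da k)"
    and u1: "\<And>x k. has_partial k u (u1 x $ k) x" "continuous_on K u" "continuous_on K u1"
    and u2: "\<And>x k. has_partial k u1 (u2 k x) x" "\<And>k. continuous_on K (u2 k)" "\<And>x k l. u2 k x $ l = u2 l x $ k"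
    and u0: "\<And>x. x \<notin> K \<Longrightarrow> u x = 0" "\<And>x. x \<notin> K \<Longrightarrow> u1 x = 0" "\<And>x k. x \<notin> K \<Longrightarrow> u2 k x = 0"
    and e: "s * exp s \<le> \<alpha> / 60" and b: "\<theta>\<^sup>2 * \<bar>real CARD('n) - 2\<bar> * exp s \<le> \<alpha> / 2"
  shows "(\<integral>x. \<alpha> * \<rho>\<^sup>2 * w x powr (1 - 2 * \<alpha>) * (u1 x \<bullet> (a x *v u1 x)) + \<alpha>^3 * w x powr (- 1 - 2 * \<alpha>) * (u x)\<^sup>2 \<partial>lborel)
      \<le> (2 * H\<^sup>2 * \<rho>^3 / c) * (\<integral>x. w x powr (2 - 2 * \<alpha>) * (\<Sum>k\<in>UNIV. (da k x *v u1 x + a x *v u2 k x) $ k)\<^sup>2 \<partial>lborel)"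
proof -
  define \<nu> where "\<nu> = \<mu> / \<rho>"
  define \<sigma> where "\<sigma> = sigma A"
  define B where "B = matrix_inv (A 0)"
  define y where "y = (\<lambda>x. B *v x)"
  define E where "E = (\<lambda>x. exp (\<nu> * \<sigma> x))"
  define W where "W = (\<lambda>x. w x powr (- \<alpha>))"
  define g where "g = (\<lambda>x. (1 / (E x * (\<sigma> x)\<^sup>2)) *\<^sub>R y x)"
  define g2 where "g2 = (\<lambda>k x. (1 / (E x * (\<sigma> x)\<^sup>2)) *\<^sub>R (B *v axis k 1) - ((2 + \<nu> * \<sigma> x) * y x $ k / (E x * (\<sigma> x)^4)) *\<^sub>R y x)"
  define f where "f = (\<lambda>x. W x * u x)"
  define f1 where "f1 = (\<lambda>x. W x *\<^sub>R (u1 x - (\<alpha> * u x) *\<^sub>R g x))"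
  define f2 where "f2 = (\<lambda>k x. W x *\<^sub>R (u2 k x - (\<alpha> * u1 x $ k) *\<^sub>R g x - (\<alpha> * u x) *\<^sub>R g2 k x - (\<alpha> * g x $ k) *\<^sub>R (u1 x - (\<alpha> * u x) *\<^sub>R g x)))"
  define V where "V = (\<lambda>x. flux \<nu> \<alpha> (\<sigma> x) (a x) (y x) (f x) (f1 x))"
  define DV where "DV = (\<lambda>k x. flux_partial \<nu> \<alpha> (\<sigma> x) (a x) (y x) (f x) (f1 x) (y x $ k / \<sigma> x) (da k x) (B *v axis k 1) (f1 x $ k) (f2 k x))"
  have x0: "x \<noteq> 0" if "x \<in> K" for x using K that by auto
  have xr: "norm x \<le> \<rho>" if "x \<in> K" for x using K that by auto
  have \<sigma>p: "\<sigma> x > 0" if "x \<noteq> 0" for x using sigma_bounds(1)[of \<theta> A x, OF \<theta> A0 that] by (simp add: \<sigma>_def)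
  have wp: "w x > 0" if "x \<noteq> 0" for x using weight_pos[of \<theta> A x, OF \<theta> A0 that \<rho>] by (simp add: w_def)
  have h\<sigma>: "has_partial k \<sigma> (y x $ k / \<sigma> x) x" if "x \<noteq> 0" for k x
    unfolding \<sigma>_def y_def B_def by (rule has_partial_sigma[where A = A and x = x, OF \<theta> A0 that])
  have hy: "has_partial k y (B *v axis k 1) x" for k x unfolding y_def by (rule has_partial_matvec_linear)
  have hW: "has_partial k W (- \<alpha> * W x * g x $ k) x" if x: "x \<noteq> 0" for k x
  proof -
    have "has_partial k (\<lambda>x. exp (- \<alpha> * ln (w x))) (((B *v x) $ k / (exp (\<mu> / \<rho> * sigma A x) * (sigma A x)\<^sup>2)) *\<^sub>R (- \<alpha> * exp (- \<alpha> * ln (w x)))) x"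
      unfolding w_def B_def
      by (rule has_partial_chain[OF has_partial_ln_weight[where A = A and x = x, OF \<theta> A0 x \<rho>]])
        (auto intro!: derivative_eq_intros simp: has_real_derivative_iff_has_vector_derivative[symmetric])
    then have "has_partial k (\<lambda>x. exp (- \<alpha> * ln (w x))) (- \<alpha> * W x * g x $ k) x"
      using wp[OF x] by (simp add: g_def y_def E_def \<nu>_def \<sigma>_def W_def powr_def mult_ac)
    then show ?thesis
      by (rule has_partial_cong[of "- {0}" x W "\<lambda>x. exp (- \<alpha> * ln (w x))", rotated 3])
        (use x wp in \<open>auto simp: W_def powr_def\<close>, metis less_irrefl)
  qed
  have hg: "has_partial k g (g2 k x) x" if x: "x \<noteq> 0" for k x
  proof -
    have "has_partial k (\<lambda>x. 1 / (exp (\<nu> * \<sigma> x) * (\<sigma> x)\<^sup>2)) ((y x $ k / \<sigma> x) *\<^sub>R (- (2 + \<nu> * \<sigma> x) / (exp (\<nu> * \<sigma> x) * (\<sigma> x)^3))) x"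
      by (rule has_partial_chain[OF h\<sigma>[OF x]])
        (use \<sigma>p[OF x] in \<open>auto intro!: derivative_eq_intros simp: has_real_derivative_iff_has_vector_derivative[symmetric]
           field_simps power2_eq_square power3_eq_cube\<close>)
    moreover have "(y x $ k / \<sigma> x) *\<^sub>R (- (2 + \<nu> * \<sigma> x) / (exp (\<nu> * \<sigma> x) * (\<sigma> x)^3)) = - ((2 + \<nu> * \<sigma> x) * y x $ k / (exp (\<nu> * \<sigma> x) * (\<sigma> x)^4))"
      using \<sigma>p[OF x] by (simp add: field_simps power4_eq_xxxx power3_eq_cube)
    ultimately have "has_partial k (\<lambda>x. 1 / (exp (\<nu> * \<sigma> x) * (\<sigma> x)\<^sup>2)) (- ((2 + \<nu> * \<sigma> x) * y x $ k / (exp (\<nu> * \<sigma> x) * (\<sigma> x)^4))) x"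
      by (simp only:)
    from has_partial_scaleR[OF this hy] show ?thesis
      unfolding g_def g2_def E_def by simp
  qed
  have hf: "has_partial k f (f1 x $ k) x" if x: "x \<noteq> 0" for k x
    using has_partial_mult[OF hW[OF x] u1(1)] unfolding f_def f1_def by (simp add: algebra_simps)
  have hf1: "has_partial k f1 (f2 k x) x" if x: "x \<noteq> 0" for k x
  proof -
    have "has_partial k (\<lambda>x. u1 x - (\<alpha> * u x) *\<^sub>R g x) (u2 k x - ((\<alpha> * u x) *\<^sub>R g2 k x + (\<alpha> * u1 x $ k) *\<^sub>R g x)) x"
      using has_partial_diff[OF u2(1) has_partial_scaleR[OF has_partial_mult[OF has_partial_const u1(1)] hg[OF x]]] by simp
    from has_partial_scaleR[OF hW[OF x] this] show ?thesis unfolding f1_def f2_def by (simp add: algebra_simps)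
  qed
  have f0: "f x = 0" "f1 x = 0" "f2 k x = 0" if "x \<notin> K" for x k
    using u0[OF that] by (auto simp: f_def f1_def f2_def)
  have V0: "V x = 0" if "x \<notin> K" for x using f0[OF that] by (simp add: V_def flux_def Let_def)
  have DV0: "DV k x = 0" if "x \<notin> K" for x k using f0[OF that] by (simp add: DV_def flux_partial_def Let_def)
  have hV: "has_partial k V (DV k x) x" for k x
  proof (cases "x \<in> K")
    case True
    then show ?thesis unfolding V_def DV_def
      by (intro has_partial_flux a \<sigma>p x0 h\<sigma> a1 hy hf hf1)
  next
    case False
    have "has_partial k V 0 x"
      by (rule has_partial_cong[of "- K" x V "\<lambda>_. 0", OF _ _ _ has_partial_const])
        (use False V0 K compact_imp_closed in auto)
    then show ?thesis using DV0[OF False] by simp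
  qed
  have K0: "0 \<notin> K" using x0 by blast
  have cs: "continuous_on K \<sigma>" unfolding \<sigma>_def by (rule continuous_on_sigma)
  have cw: "continuous_on K w" unfolding w_def by (rule continuous_on_weight[where A = A, OF \<theta> A0 \<rho> K0])
  have cpw: "continuous_on K (\<lambda>x. w x powr t)" for t
    by (intro continuous_on_powr cw continuous_on_const) (use wp x0 in force)
  have cy: "continuous_on K y" unfolding y_def by (intro linear_continuous_on matrix_vector_mul_bounded_linear)
  have sn: "\<sigma> x \<noteq> 0" if "x \<in> K" for x using \<sigma>p[OF x0[OF that]] by simp
  have cg: "continuous_on K g" unfolding g_def E_def by (intro continuous_intros cs cy) (use sn in auto)
  have cg2: "continuous_on K (g2 k)" for k unfolding g2_def E_def by (intro continuous_intros cs cy) (use sn in auto)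
  have cW: "continuous_on K W" unfolding W_def by (rule cpw)
  have cf: "continuous_on K f" unfolding f_def by (intro continuous_intros cW u1)
  have cf1: "continuous_on K f1" unfolding f1_def by (intro continuous_intros cW u1 cg)
  have cf2: "continuous_on K (f2 k)" for k unfolding f2_def by (intro continuous_intros cW u1 cg u2 cg2)
  have cV: "continuous_on K V" unfolding V_def
    by (intro continuous_on_flux cs a1 cy cf cf1 \<sigma>p x0)
  have cDV: "continuous_on K (DV k)" for k unfolding DV_def
    by (intro continuous_on_flux_partial cs a1 cy cf cf1 cf2 \<sigma>p x0 continuous_intros) (use sn in auto)
  have iDV: "integrable lborel (\<lambda>x. DV k x $ k)" "(\<integral>x. DV k x $ k \<partial>lborel) = 0" for k
  proof -
    have m: "(\<lambda>x. V x $ k) \<in> borel_measurable borel"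
      using borel_measurable_integrable[OF integrable_compact_support[OF K(1) continuous_on_component[OF cV]]] V0 by auto
    show "integrable lborel (\<lambda>x. DV k x $ k)" "(\<integral>x. DV k x $ k \<partial>lborel) = 0"
      by (rule integral_partial_eq_0[OF K(1) has_partial_nth[OF hV, of k k] _ _ _ m];
          use V0 DV0 cDV in \<open>auto intro!: continuous_on_component\<close>)+
  qed
  define dens where "dens = (\<lambda>x. \<alpha> * \<rho>\<^sup>2 * w x powr (1 - 2 * \<alpha>) * (u1 x \<bullet> (a x *v u1 x)) + \<alpha>^3 * w x powr (- 1 - 2 * \<alpha>) * (u x)\<^sup>2)"
  define rhs where "rhs = (\<lambda>x. w x powr (2 - 2 * \<alpha>) * (\<Sum>k\<in>UNIV. (da k x *v u1 x + a x *v u2 k x) $ k)\<^sup>2)"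
  have id: "integrable lborel dens"
    unfolding dens_def
    by (rule integrable_compact_support[OF K(1)])
      (use u0 in \<open>auto intro!: continuous_intros cpw u1 a1 continuous_on_matvec\<close>)
  have ir: "integrable lborel rhs"
    unfolding rhs_def
    by (rule integrable_compact_support[OF K(1)])
      (use u0 in \<open>auto intro!: continuous_intros cpw u1 u2 a1 continuous_on_matvec\<close>)
  define \<kappa> where "\<kappa> = 32/9 * H * \<rho> * \<theta>\<^sup>2 * \<alpha> / c"
  have pw: "dens x + \<kappa> * (\<Sum>k\<in>UNIV. DV k x $ k) \<le> (2 * H\<^sup>2 * \<rho>^3 / c) * rhs x" for x
  proof (cases "x \<in> K")
    case True
    show ?thesis
      unfolding dens_def rhs_def \<kappa>_def DV_def H_def c_def w_def f_def f1_def f2_def W_def g_def g2_def y_def E_def B_def \<sigma>_def \<nu>_def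
      by (rule carleman_pointwise[where ?\<theta>2.0 = \<theta>2])
        (use \<rho> \<theta> \<theta>2 c \<alpha> A0 x0[OF True] xr[OF True] a[OF True] D[OF True] da[OF True] u2(3) e b in \<open>simp_all add: c_def s_def\<close>)
  next
    case False
    then show ?thesis using u0[OF False] DV0[OF False] by (simp add: dens_def rhs_def)
  qed
  have "(\<integral>x. dens x + \<kappa> * (\<Sum>k\<in>UNIV. DV k x $ k) \<partial>lborel) \<le> (\<integral>x. (2 * H\<^sup>2 * \<rho>^3 / c) * rhs x \<partial>lborel)"
    by (intro integral_mono pw Bochner_Integration.integrable_add integrable_mult_right id ir Bochner_Integration.integrable_sum iDV)
  also have "(\<integral>x. dens x + \<kappa> * (\<Sum>k\<in>UNIV. DV k x $ k) \<partial>lborel) = (\<integral>x. dens x \<partial>lborel) + \<kappa> * (\<Sum>k\<in>UNIV. \<integral>x. DV k x $ k \<partial>lborel)"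
    by (simp add: id iDV Bochner_Integration.integral_add Bochner_Integration.integral_sum)
  finally have "(\<integral>x. dens x \<partial>lborel) \<le> (2 * H\<^sup>2 * \<rho>^3 / c) * (\<integral>x. rhs x \<partial>lborel)" by (simp add: iDV)
  then show ?thesis by (simp only: dens_def rhs_def)
qed

section \<open>Test functions\<close>

text \<open>A one-dimensional counterpart of \<^const>\<open>Ck\<close> that is convenient for recursion.\<close>

primrec diff_times :: "nat \<Rightarrow> (real \<Rightarrow> real) \<Rightarrow> bool" where
  "diff_times 0 h \<longleftrightarrow> continuous_on UNIV h"
| "diff_times (Suc k) h \<longleftrightarrow> (\<exists>h'. (\<forall>t. (h has_real_derivative h' t) (at t)) \<and> diff_times k h')"

lemma diff_times_mono: "diff_times (Suc k) h \<Longrightarrow> diff_times k h"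
proof (induction k arbitrary: h)
  case 0
  then show ?case by simp (meson DERIV_isCont continuous_at_imp_continuous_on)
next
  case (Suc k)
  then show ?case by (metis diff_times.simps(2))
qed

lemma diff_times_const: "diff_times k (\<lambda>t. c)"
  by (induction k arbitrary: c) (auto intro!: exI[of _ "\<lambda>t. 0"])

lemma diff_times_add: "diff_times k f \<Longrightarrow> diff_times k g \<Longrightarrow> diff_times k (\<lambda>t. f t + g t)"
proof (induction k arbitrary: f g)
  case (Suc k)
  from Suc.prems obtain f' g' where "\<And>t. (f has_real_derivative f' t) (at t)" "diff_times k f'"
     "\<And>t. (g has_real_derivative g' t) (at t)" "diff_times k g'" by auto
  then show ?case using Suc.IH by (auto intro!: exI[of _ "\<lambda>t. f' t + g' t"] derivative_intros)
qed (auto intro!: continuous_intros)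

lemma diff_times_mult: "diff_times k f \<Longrightarrow> diff_times k g \<Longrightarrow> diff_times k (\<lambda>t. f t * g t)"
proof (induction k arbitrary: f g)
  case (Suc k)
  from Suc.prems obtain f' g' where d: "\<And>t. (f has_real_derivative f' t) (at t)" "diff_times k f'"
     "\<And>t. (g has_real_derivative g' t) (at t)" "diff_times k g'" by auto
  have "((\<lambda>t. f t * g t) has_real_derivative f t * g' t + f' t * g t) (at t)" for t
    using DERIV_mult[OF d(1,3), of t] by (simp add: algebra_simps)
  moreover have "diff_times k (\<lambda>t. f t * g' t + f' t * g t)"
    by (intro diff_times_add Suc.IH d diff_times_mono[OF Suc.prems(1)] diff_times_mono[OF Suc.prems(2)])
  ultimately show ?case unfolding diff_times.simps by (intro exI[of _ "\<lambda>t. f t * g' t + f' t * g t"]) auto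
qed (auto intro!: continuous_intros)

lemma diff_times_affine: "diff_times k h \<Longrightarrow> diff_times k (\<lambda>t. h (a + b * t))"
proof (induction k arbitrary: h)
  case 0
  then show ?case by (auto intro!: continuous_intros continuous_on_compose2[of UNIV h])
next
  case (Suc k)
  then obtain h' where h': "\<And>t. (h has_real_derivative h' t) (at t)" "diff_times k h'" by auto
  have "((\<lambda>t. h (a + b * t)) has_real_derivative b * h' (a + b * t)) (at t)" for t
  proof -
    have "((\<lambda>t. a + b * t) has_real_derivative b) (at t)" by (auto intro!: derivative_eq_intros)
    from DERIV_chain2[OF h'(1) this] show ?thesis by (simp add: mult.commute)
  qed
  moreover have "diff_times k (\<lambda>t. b * h' (a + b * t))"
    by (intro diff_times_mult diff_times_const Suc.IH h')
  ultimately show ?case unfolding diff_times.simps by (intro exI[of _ "\<lambda>t. b * h' (a + b * t)"]) auto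
qed

text \<open>Derivatives of \<open>exp (- c / t)\<close> are of the form \<open>p (1 / t) * exp (- c / t)\<close>, so this family is closed under differentiation,
also at 0, where all its members vanish to infinite order.\<close>

definition flat :: "real poly \<Rightarrow> real \<Rightarrow> real \<Rightarrow> real" where
  "flat p c t = (if t > 0 then poly p (1 / t) * exp (- c / t) else 0)"

lemma poly_exp_tendsto_0:
  assumes "c > 0"
  shows "((\<lambda>x. poly p x * exp (- c * x)) \<longlongrightarrow> (0::real)) at_top"
proof -
  have "((\<lambda>x. x ^ k * exp (- c * x)) \<longlongrightarrow> 0) at_top" for k
  proof -
    have "((\<lambda>x. (1/c)^k * ((c * x) ^ k / exp (c * x))) \<longlongrightarrow> (1/c)^k * 0) at_top"
      by (intro tendsto_intros filterlim_compose[OF tendsto_power_div_exp_0]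
         filterlim_tendsto_pos_mult_at_top[OF tendsto_const assms filterlim_ident])
    then show ?thesis using assms by (simp add: exp_minus power_mult_distrib field_simps)
  qed
  then have "((\<lambda>x. \<Sum>i\<le>degree p. coeff p i * (x ^ i * exp (- c * x))) \<longlongrightarrow> (\<Sum>i\<le>degree p. coeff p i * 0)) at_top"
    by (intro tendsto_intros)
  then show ?thesis by (simp add: poly_altdef sum_distrib_right mult.assoc)
qed

lemma flat_derivative:
  assumes c: "c > 0"
  shows "(flat p c has_real_derivative flat (monom 1 2 * (smult c p - pderiv p)) c t) (at t)"
proof (cases "t = 0")
  case False
  show ?thesis
  proof (cases "t > 0")
    case True
    have 1: "((\<lambda>t. 1 / t) has_real_derivative - (1 / t\<^sup>2)) (at t)"
      using True by (auto intro!: derivative_eq_intros simp: power2_eq_square)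
    have 2: "((\<lambda>t. exp (- c / t)) has_real_derivative exp (- c / t) * (c / t\<^sup>2)) (at t)"
      using True by (auto intro!: derivative_eq_intros simp: power2_eq_square)
    have "((\<lambda>t. poly p (1 / t) * exp (- c / t)) has_real_derivative
        poly (monom 1 2 * (smult c p - pderiv p)) (1 / t) * exp (- c / t)) (at t)"
      by (rule DERIV_cong[OF DERIV_mult[OF DERIV_chain2[OF poly_DERIV 1] 2]])
        (simp add: poly_monom power_divide algebra_simps)
    then show ?thesis
      by (rule has_field_derivative_transform_within_open[of _ _ _ "{0<..}", THEN DERIV_cong])
        (use True in \<open>auto simp: flat_def\<close>)
  next
    case neg: False
    have "((\<lambda>t. 0::real) has_real_derivative 0) (at t)" by simp
    then show ?thesis
      by (rule has_field_derivative_transform_within_open[of _ _ _ "{..<0}", THEN DERIV_cong])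
        (use False neg in \<open>auto simp: flat_def\<close>)
  qed
next
  case True
  have "((\<lambda>s. flat p c s / s) \<longlongrightarrow> 0) (at 0)"
  proof (rule filterlim_split_at)
    show "((\<lambda>s. flat p c s / s) \<longlongrightarrow> 0) (at_left 0)"
      by (rule Lim_transform_eventually[OF tendsto_const]) (auto simp: flat_def eventually_at_filter)
    have "((\<lambda>s. poly (pCons 0 p) (inverse s) * exp (- c * inverse s)) \<longlongrightarrow> 0) (at_right 0)"
      by (rule filterlim_compose[OF poly_exp_tendsto_0[OF c] filterlim_inverse_at_top_right])
    then show "((\<lambda>s. flat p c s / s) \<longlongrightarrow> 0) (at_right 0)"
      by (rule Lim_transform_eventually) (auto simp: flat_def eventually_at_filter divide_inverse)
  qed
  then show ?thesis using True by (simp add: DERIV_def flat_def)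
qed

lemma diff_times_flat: "c > 0 \<Longrightarrow> diff_times k (flat p c)"
proof (induction k arbitrary: p)
  case 0
  then show ?case using flat_derivative[OF 0] by simp (meson DERIV_isCont continuous_at_imp_continuous_on)
next
  case (Suc k)
  then show ?case using flat_derivative[OF Suc.prems] by auto
qed

definition bump1 :: "real \<Rightarrow> real \<Rightarrow> real \<Rightarrow> real \<Rightarrow> real" where
  "bump1 c a b t = flat 1 c (t - a) * flat 1 c (b - t)"

lemma bump1_eq: "bump1 c a b t = (if a < t \<and> t < b then exp (- c / (t - a)) * exp (- c / (b - t)) else 0)"
  by (auto simp: bump1_def flat_def)

lemma bump1_bounds: "c > 0 \<Longrightarrow> 0 \<le> bump1 c a b t \<and> bump1 c a b t \<le> 1"
  by (auto simp: bump1_eq intro!: mult_le_one)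

lemma diff_times_bump1: "c > 0 \<Longrightarrow> diff_times k (bump1 c a b)"
  unfolding bump1_def[abs_def]
  using diff_times_affine[OF diff_times_flat[of c k 1], of "-a" 1] diff_times_affine[OF diff_times_flat[of c k 1], of b "-1"]
  by (intro diff_times_mult) auto

lemma prod_has_derivative:
  fixes h :: "'n::finite \<Rightarrow> real \<Rightarrow> real"
  assumes "\<And>i t. (h i has_real_derivative h' i t) (at t)"
  shows "((\<lambda>x::real^'n. \<Prod>i\<in>UNIV. h i (x $ i)) has_derivative
     (\<lambda>v. \<Sum>i\<in>UNIV. (h' i (x $ i) * v $ i) * (\<Prod>j\<in>UNIV - {i}. h j (x $ j)))) (at x)"
proof (rule has_derivative_prod)
  fix i
  have "((\<lambda>x::real^'n. x $ i) has_derivative (\<lambda>v. v $ i)) (at x)"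
    by (rule bounded_linear_imp_has_derivative[OF bounded_linear_vec_nth])
  from has_derivative_compose[OF this, of "h i" "\<lambda>v. h' i (x $ i) * v"] assms[of i "x $ i"]
  show "((\<lambda>x::real^'n. h i (x $ i)) has_derivative (\<lambda>v. h' i (x $ i) * v $ i)) (at x)"
    by (simp add: has_field_derivative_def)
qed

lemma partial_deriv_prod:
  fixes h :: "'n::finite \<Rightarrow> real \<Rightarrow> real"
  assumes "\<And>i t. (h i has_real_derivative h' i t) (at t)"
  shows "partial_deriv k (\<lambda>x::real^'n. \<Prod>i\<in>UNIV. h i (x $ i)) = (\<lambda>x. \<Prod>i\<in>UNIV. (h(k := h' k)) i (x $ i))"
proof
  fix x :: "real^'n"
  have "partial_deriv k (\<lambda>x::real^'n. \<Prod>i\<in>UNIV. h i (x $ i)) x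
     = (\<Sum>i\<in>UNIV. (h' i (x $ i) * (axis k 1 :: real^'n) $ i) * (\<Prod>j\<in>UNIV - {i}. h j (x $ j)))"
    unfolding partial_deriv_def by (subst frechet_derivative_at[OF prod_has_derivative[OF assms], symmetric]) (rule refl)
  also have "\<dots> = (\<Sum>i\<in>UNIV. if i = k then h' i (x $ i) * (\<Prod>j\<in>UNIV - {i}. h j (x $ j)) else 0)"
    by (intro sum.cong) (auto simp: axis_def)
  also have "\<dots> = h' k (x $ k) * (\<Prod>j\<in>UNIV - {k}. h j (x $ j))" by simp
  also have "(\<Prod>j\<in>UNIV - {k}. h j (x $ j)) = (\<Prod>j\<in>UNIV - {k}. (h(k := h' k)) j (x $ j))"
    by (intro prod.cong) auto
  also have "h' k (x $ k) * \<dots> = (\<Prod>i\<in>UNIV. (h(k := h' k)) i (x $ i))"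
    by (subst (2) prod.remove[of _ k]) auto
  finally show "partial_deriv k (\<lambda>x::real^'n. \<Prod>i\<in>UNIV. h i (x $ i)) x = (\<Prod>i\<in>UNIV. (h(k := h' k)) i (x $ i))" .
qed

text \<open>Each partial derivative of a product of functions of the single coordinates is again such a product.\<close>

lemma Ck_prod:
  fixes h :: "'n::finite \<Rightarrow> real \<Rightarrow> real"
  assumes "\<And>i. diff_times k (h i)"
  shows "Ck k (\<lambda>x::real^'n. \<Prod>i\<in>UNIV. h i (x $ i))"
  using assms
proof (induction k arbitrary: h)
  case 0
  have "continuous_on UNIV (\<lambda>x::real^'n. h i (x $ i))" for i
    using 0[of i] by (auto intro!: continuous_on_compose2[of UNIV "h i"] continuous_intros)
  then show ?case by (auto intro!: continuous_on_prod)
next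
  case (Suc k)
  then obtain h' where h': "\<And>i t. (h i has_real_derivative h' i t) (at t)" "\<And>i. diff_times k (h' i)"
    by (simp add: all_conj_distrib choice_iff) metis
  have "Ck k (partial_deriv j (\<lambda>x::real^'n. \<Prod>i\<in>UNIV. h i (x $ i)))" for j
    unfolding partial_deriv_prod[OF h'(1)]
    by (rule Suc.IH) (simp add: h'(2) diff_times_mono[OF Suc.prems])
  moreover have "(\<lambda>x::real^'n. \<Prod>i\<in>UNIV. h i (x $ i)) differentiable (at x)" for x
    by (rule differentiableI[OF prod_has_derivative[OF h'(1)]])
  ultimately show ?case by simp
qed

text \<open>A product of one-dimensional bumps. As \<open>c\<close> tends to 0 these functions tend to the indicator of the box, so test functions
detect integrals over boxes, without convolution.\<close>

definition box_bump :: "real \<Rightarrow> real^'n \<Rightarrow> real^'n \<Rightarrow> real^'n \<Rightarrow> real" where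
  "box_bump c a b x = (\<Prod>i\<in>UNIV. bump1 c (a $ i) (b $ i) (x $ i))"

lemma box_bump_bounds: "c > 0 \<Longrightarrow> 0 \<le> box_bump c a b x \<and> box_bump c a b x \<le> 1"
  unfolding box_bump_def using bump1_bounds[of c] by (auto intro!: prod_nonneg prod_le_1)

lemma box_bump_eq_0: "x \<notin> box a b \<Longrightarrow> box_bump c a b x = 0"
  by (auto simp: box_bump_def mem_box_cart bump1_eq)

lemma box_bump_pos: "x \<in> box a b \<Longrightarrow> box_bump c a b x > 0"
  by (auto simp: box_bump_def mem_box_cart bump1_eq intro!: prod_pos)

lemma box_bump_tendsto:
  "(\<lambda>n. box_bump (inverse (real (Suc n))) a b x) \<longlonglongrightarrow> indicator (box a b) x"
proof (cases "x \<in> box a b")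
  case True
  have "(\<lambda>n. exp (- inverse (real (Suc n)) / r) * exp (- inverse (real (Suc n)) / r')) \<longlonglongrightarrow> exp (- 0 / r) * exp (- 0 / r')" if "r > 0" "r' > 0" for r r' :: real
    using that by (intro tendsto_intros LIMSEQ_inverse_real_of_nat) auto
  then have "(\<lambda>n. bump1 (inverse (real (Suc n))) (a $ i) (b $ i) (x $ i)) \<longlonglongrightarrow> 1" for i
    using True by (simp add: bump1_eq mem_box_cart)
  then have "(\<lambda>n. box_bump (inverse (real (Suc n))) a b x) \<longlonglongrightarrow> (\<Prod>i\<in>(UNIV::'a set). 1)"
    unfolding box_bump_def by (intro tendsto_prod)
  then show ?thesis using True by simp
qed (simp add: box_bump_eq_0)

lemma test_fun_box_bump:
  assumes "c > 0" "cbox a b \<subseteq> \<Omega>"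
  shows "test_fun \<Omega> (box_bump c a b)"
  unfolding test_fun_def
proof (intro conjI allI)
  have sub: "closure {x. box_bump c a b x \<noteq> 0} \<subseteq> cbox a b"
  proof (rule closure_minimal)
    show "{x. box_bump c a b x \<noteq> 0} \<subseteq> cbox a b"
      using box_bump_eq_0[of _ a b c] box_subset_cbox[of a b] by blast
  qed (rule closed_cbox)
  then show "closure {x. box_bump c a b x \<noteq> 0} \<subseteq> \<Omega>" using assms by blast
  show "compact (closure {x. box_bump c a b x \<noteq> 0})"
    using sub by (meson bounded_cbox bounded_subset closed_closure compact_eq_bounded_closed)
  show "Ck k (box_bump c a b)" for k
    unfolding box_bump_def[abs_def] by (intro Ck_prod diff_times_bump1 assms)
qed

lemma test_fun_has_partial:
  assumes "test_fun \<Omega> \<phi>"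
  shows "has_partial k \<phi> (partial_deriv k \<phi> x) x" "continuous_on UNIV \<phi>" "continuous_on UNIV (partial_deriv k \<phi>)"
    "Ck m (partial_deriv k \<phi>)"
proof -
  have C: "Ck (Suc m) \<phi>" for m using assms by (simp add: test_fun_def)
  then show "Ck m (partial_deriv k \<phi>)" for m by (metis Ck.simps(2))
  then show "continuous_on UNIV (partial_deriv k \<phi>)" by (metis Ck.simps(1))
  have d: "\<phi> differentiable (at x)" for x using C[of 0] by simp
  then show "continuous_on UNIV \<phi>" by (simp add: continuous_at_imp_continuous_on differentiable_imp_continuous_within)
  have "(\<phi> has_derivative frechet_derivative \<phi> (at x)) (at (x + 0 *\<^sub>R axis k 1))"
    using d[of x] by (simp add: frechet_derivative_works)
  moreover have "((\<lambda>s. x + s *\<^sub>R axis k 1) has_derivative (\<lambda>s. s *\<^sub>R axis k (1::real))) (at 0)"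
    by (auto intro!: derivative_eq_intros)
  ultimately have "((\<lambda>s. \<phi> (x + s *\<^sub>R axis k 1)) has_derivative (\<lambda>s. frechet_derivative \<phi> (at x) (s *\<^sub>R axis k 1))) (at 0)"
    by (rule has_derivative_compose[rotated])
  moreover have "frechet_derivative \<phi> (at x) (s *\<^sub>R axis k 1) = s *\<^sub>R partial_deriv k \<phi> x" for s
    unfolding partial_deriv_def using linear_frechet_derivative[OF d[of x]] linear_scale by blast
  ultimately show "has_partial k \<phi> (partial_deriv k \<phi> x) x"
    by (simp add: has_partial_def has_vector_derivative_def)
qed

lemma test_fun_partial_deriv:
  assumes "test_fun \<Omega> \<phi>"
  shows "test_fun \<Omega> (partial_deriv k \<phi>)"
proof -
  let ?S = "closure {x. \<phi> x \<noteq> 0}"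
  have "partial_deriv k \<phi> x = 0" if "x \<notin> ?S" for x
  proof -
    have "has_partial k \<phi> 0 x"
      by (rule has_partial_cong[of "- ?S" x \<phi> "\<lambda>_. 0", OF _ _ _ has_partial_const])
        (use that closure_subset[of "{x. \<phi> x \<noteq> 0}"] in auto)
    with test_fun_has_partial(1)[OF assms, of k x] show ?thesis
      unfolding has_partial_def by (rule vector_derivative_unique_at)
  qed
  then have "{x. partial_deriv k \<phi> x \<noteq> 0} \<subseteq> ?S" by blast
  then have "closure {x. partial_deriv k \<phi> x \<noteq> 0} \<subseteq> ?S" by (rule closure_minimal) simp
  then show ?thesis using assms test_fun_has_partial(4)[OF assms]
    unfolding test_fun_def by (meson bounded_subset closed_closure compact_eq_bounded_closed order_trans)
qed

section \<open>The fundamental lemma and uniqueness of weak derivatives\<close>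

text \<open>Boxes generate the Borel sets and are closed under intersection, so the integrals over all Borel sets vanish.\<close>

lemma AE_eq_0_if_box_integrals_eq_0:
  fixes h :: "real^'n \<Rightarrow> real"
  assumes h: "integrable lborel h" and z: "\<And>p q. (\<integral>x. indicator (box p q) x * h x \<partial>lborel) = 0"
  shows "AE x in lborel. h x = 0"
proof (rule sigma_finite_measure.density_zero[OF lborel.sigma_finite_measure_axioms h])
  have univ: "(\<integral>x. h x \<partial>lborel) = 0"
  proof -
    define B where "B n = box (\<chi> i. - real n) ((\<chi> i. real n) :: real^'n)" for n
    have "(\<lambda>n. \<integral>x. indicator (B n :: (real^'n) set) x * h x \<partial>lborel) \<longlonglongrightarrow> (\<integral>x. h x \<partial>lborel)"
    proof (rule integral_dominated_convergence[where w = "\<lambda>x. norm (h x)"])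
      show "AE x in lborel. (\<lambda>n. indicator (B n) x * h x) \<longlonglongrightarrow> h x"
      proof (rule AE_I2)
        fix x :: "real^'n"
        obtain N where N: "norm x < real N" using reals_Archimedean2 by blast
        have "x \<in> B n" if "n \<ge> N" for n
          using N that component_le_norm_cart[of x] unfolding B_def mem_box_cart
          by (auto simp: abs_le_iff) (smt (verit) of_nat_mono)+
        then have "\<forall>\<^sub>F n in sequentially. indicator (B n) x * h x = h x"
          by (auto simp: eventually_sequentially intro!: exI[of _ N])
        then show "(\<lambda>n. indicator (B n) x * h x) \<longlonglongrightarrow> h x" by (rule tendsto_eventually)
      qed
    qed (use h in \<open>auto simp: B_def indicator_def\<close>)
    then show ?thesis using z by (simp add: B_def LIMSEQ_const_iff)
  qed
  fix A :: "(real^'n) set" assume "A \<in> sets lborel"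
  then have A: "A \<in> sigma_sets UNIV (range (\<lambda>(a, b). box a b))" by (simp add: borel_eq_box)
  have I: "Int_stable (range (\<lambda>(a, b). box a b :: (real^'n) set))" by (auto simp: Int_stable_def box_Int_box)
  have P: "range (\<lambda>(a, b). box a b :: (real^'n) set) \<subseteq> Pow UNIV" by simp
  from I P A show "set_lebesgue_integral lborel A h = 0"
  proof (induction A rule: sigma_sets_induct_disjoint)
    case (basic A) then show ?case using z by (auto simp: set_lebesgue_integral_def)
  next
    case empty show ?case by (simp add: set_lebesgue_integral_def)
  next
    case (compl A)
    then have A: "A \<in> sets lborel" by (simp add: borel_eq_box)
    have "(LINT x:UNIV - A|lborel. h x) = (\<integral>x. h x - indicator A x * h x \<partial>lborel)"
      unfolding set_lebesgue_integral_def by (intro Bochner_Integration.integral_cong) (auto simp: indicator_def)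
    also have "\<dots> = (\<integral>x. h x \<partial>lborel) - (LINT x:A|lborel. h x)"
      unfolding set_lebesgue_integral_def using h integrable_real_mult_indicator[OF A h]
      by (subst Bochner_Integration.integral_diff) (auto simp: mult.commute)
    finally show ?case using compl univ by simp
  next
    case (union A)
    have A: "A i \<in> sets lborel" for i using union(2) by (auto simp: borel_eq_box)
    have "set_integrable lborel (\<Union>i. A i) h"
      unfolding set_integrable_def using integrable_real_mult_indicator[of "\<Union>i. A i", OF _ h] A by (auto simp: mult.commute)
    then have "(LINT x:(\<Union>i. A i)|lborel. h x) = (\<Sum>i. (LINT x:(A i)|lborel. h x))"
      using A union(1) by (intro lebesgue_integral_countable_add) (auto simp: disjoint_family_on_def)
    then show ?case using union by simp
  qed
qed

lemma AE_eq_0_on_box: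
  fixes h :: "real^'n \<Rightarrow> real"
  assumes h: "integrable lborel h" and \<Omega>: "cbox a b \<subseteq> \<Omega>"
    and z: "\<And>\<phi>. test_fun \<Omega> \<phi> \<Longrightarrow> (\<integral>x. \<phi> x * h x \<partial>lborel) = 0"
  shows "AE x in lborel. x \<in> box a b \<longrightarrow> h x = 0"
proof -
  have box: "(\<integral>x. indicator (box p q) x * h x \<partial>lborel) = 0" if "cbox p q \<subseteq> \<Omega>" for p q
  proof -
    have "(\<lambda>n. \<integral>x. box_bump (inverse (real (Suc n))) p q x * h x \<partial>lborel) \<longlonglongrightarrow> (\<integral>x. indicator (box p q) x * h x \<partial>lborel)"
    proof (rule integral_dominated_convergence[where w = "\<lambda>x. norm (h x)"])
      have c: "inverse (real (Suc n)) > 0" for n by simp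
      have m: "box_bump (inverse (real (Suc n))) p q \<in> borel_measurable borel" for n
        using test_fun_has_partial(2)[OF test_fun_box_bump[OF c that]] by (rule borel_measurable_continuous_onI)
      show "(\<lambda>x. box_bump (inverse (real (Suc n))) p q x * h x) \<in> borel_measurable lborel" for n
        using m[of n] h by (intro borel_measurable_times) auto
      show "AE x in lborel. norm (box_bump (inverse (real (Suc n))) p q x * h x) \<le> norm (h x)" for n
        using box_bump_bounds[OF c, of n p q] by (intro AE_I2) (auto simp: abs_mult intro!: mult_left_le_one_le)
      show "AE x in lborel. (\<lambda>n. box_bump (inverse (real (Suc n))) p q x * h x) \<longlonglongrightarrow> indicator (box p q) x * h x"
        by (intro AE_I2 tendsto_intros box_bump_tendsto)
    qed (use h in auto)
    moreover have "(\<integral>x. box_bump (inverse (real (Suc n))) p q x * h x \<partial>lborel) = 0" for n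
      by (intro z test_fun_box_bump that) simp
    ultimately show ?thesis by (simp add: LIMSEQ_const_iff)
  qed
  have "AE x in lborel. indicator (box a b) x * h x = 0"
  proof (rule AE_eq_0_if_box_integrals_eq_0)
    show "integrable lborel (\<lambda>x. indicator (box a b) x * h x)"
      using integrable_real_mult_indicator[OF _ h, of "box a b"] by (simp add: mult.commute)
    fix p q
    obtain p' q' where pq: "box p q \<inter> box a b = box p' q'" by (meson box_Int_box)
    have "(\<integral>x. indicator (box p q) x * (indicator (box a b) x * h x) \<partial>lborel) = (\<integral>x. indicator (box p' q') x * h x \<partial>lborel)"
      unfolding pq[symmetric] by (intro Bochner_Integration.integral_cong) (auto simp: indicator_def)
    also have "\<dots> = 0"
    proof (cases "box p' q' = {}")
      case False
      then have "box p' q' \<subseteq> box a b" "box a b \<noteq> {}" using pq by auto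
      then have "cbox p' q' \<subseteq> cbox a b"
        using closure_mono[of "box p' q'" "box a b"] False by (simp only: closure_box not_False_eq_True)
      then show ?thesis using box \<Omega> by blast
    qed simp
    finally show "(\<integral>x. indicator (box p q) x * (indicator (box a b) x * h x) \<partial>lborel) = 0" .
  qed
  then show ?thesis by eventually_elim (auto simp: indicator_def split: if_splits)
qed

lemma AE_on_open_if_AE_on_boxes:
  fixes \<Omega> :: "(real^'n) set"
  assumes "open \<Omega>" "\<And>a b. cbox a b \<subseteq> \<Omega> \<Longrightarrow> AE x in lborel. x \<in> box a b \<longrightarrow> P x"
  shows "AE x in lborel. x \<in> \<Omega> \<longrightarrow> P x"
proof -
  obtain \<D> where D: "countable \<D>" "\<D> \<subseteq> Pow \<Omega>" "\<And>X. X \<in> \<D> \<Longrightarrow> \<exists>a b. X = cbox a b" "\<Union>\<D> = \<Omega>"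
    using open_countable_Union_open_cbox[OF assms(1)] by blast
  have "AE x in lborel. x \<in> X \<longrightarrow> P x" if X: "X \<in> \<D>" for X
  proof -
    obtain a b where ab: "X = cbox a b" using D(3) X by blast
    have "cbox a b \<subseteq> \<Omega>" using D(2) X ab by blast
    from assms(2)[OF this] have 1: "AE x in lborel. x \<in> box a b \<longrightarrow> P x" .
    have "cbox a b - box a b \<in> null_sets lborel"
      using negligible_frontier_interval[of a b] by (simp add: negligible_iff_null_sets null_sets_completion_iff)
    then have "AE x in lborel. x \<notin> cbox a b - box a b" by (rule AE_not_in)
    with 1 show ?thesis unfolding ab by eventually_elim auto
  qed
  then have "AE x in lborel. \<forall>X\<in>\<D>. x \<in> X \<longrightarrow> P x" by (subst AE_ball_countable[OF D(1)]) blast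
  then show ?thesis by eventually_elim (use D(4) in blast)
qed

lemma fundamental_lemma:
  fixes h :: "real^'n \<Rightarrow> real"
  assumes "open \<Omega>" "integrable lborel h"
    and "\<And>\<phi>. test_fun \<Omega> \<phi> \<Longrightarrow> (\<integral>x. \<phi> x * h x \<partial>lborel) = 0"
  shows "AE x in lborel. x \<in> \<Omega> \<longrightarrow> h x = 0"
  by (rule AE_on_open_if_AE_on_boxes[OF assms(1)]) (rule AE_eq_0_on_box[OF assms(2) _ assms(3)])

lemma lebesgue_integrable_borel_rep:
  fixes h :: "real^'n \<Rightarrow> real"
  assumes "h \<in> borel_measurable lebesgue"
  obtains g where "g \<in> borel_measurable borel" "AE x in lborel. h x = g x"
  using completion_ex_borel_measurable_real[OF assms] by auto

lemma integral_lebesgue_cong_lborel: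
  fixes h g :: "real^'n \<Rightarrow> real"
  assumes "h \<in> borel_measurable lebesgue" "g \<in> borel_measurable borel" "AE x in lborel. h x = g x"
  shows "integrable lebesgue h \<longleftrightarrow> integrable lborel g" "integral\<^sup>L lebesgue h = integral\<^sup>L lborel g"
proof -
  have ae: "AE x in lebesgue. h x = g x" using assms(3) by (rule AE_completion)
  have g: "g \<in> borel_measurable lebesgue" using assms(2) by (intro measurable_completion) simp
  show "integrable lebesgue h \<longleftrightarrow> integrable lborel g"
    using integrable_cong_AE[OF assms(1) g ae] integrable_completion[of g lborel] assms(2) by simp
  show "integral\<^sup>L lebesgue h = integral\<^sup>L lborel g"
    using integral_cong_AE[OF assms(1) g ae] integral_completion[of g lborel] assms(2) by simp
qed

text \<open>Reduction to real integrable Borel functions: real and imaginary parts are taken, and on each box the function is integrable and has a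
Borel representative.\<close>

lemma fundamental_lemma_lebesgue:
  fixes h :: "real^'n \<Rightarrow> complex"
  assumes \<Omega>: "open \<Omega>" and h: "locally_integrable \<Omega> h"
    and z: "\<And>\<phi>. test_fun \<Omega> \<phi> \<Longrightarrow> (LINT x:\<Omega>|lebesgue. \<phi> x *\<^sub>R h x) = 0"
  shows "AE x in lebesgue. x \<in> \<Omega> \<longrightarrow> h x = 0"
proof -
  have "AE x in lborel. x \<in> \<Omega> \<longrightarrow> h x = 0"
  proof (rule AE_on_open_if_AE_on_boxes[OF \<Omega>])
    fix a b :: "real^'n" assume ab: "cbox a b \<subseteq> \<Omega>"
    define k where "k = (\<lambda>x. indicator (cbox a b) x *\<^sub>R h x)"
    have ki: "integrable lebesgue k" using h ab unfolding locally_integrable_def k_def set_integrable_def by auto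
    have part: "AE x in lborel. x \<in> box a b \<longrightarrow> F (h x) = 0" if F: "bounded_linear F" for F :: "complex \<Rightarrow> real"
    proof -
      have Fi: "integrable lebesgue (\<lambda>x. F (k x))" by (rule integrable_bounded_linear[OF F ki])
      obtain g where g: "g \<in> borel_measurable borel" "AE x in lborel. F (k x) = g x"
        using lebesgue_integrable_borel_rep[OF borel_measurable_integrable[OF Fi]] by blast
      have gi: "integrable lborel g" using integral_lebesgue_cong_lborel(1)[OF _ g] Fi by auto
      have "AE x in lborel. x \<in> box a b \<longrightarrow> g x = 0"
      proof (rule fundamental_lemma[OF open_box gi])
        fix \<phi> assume t: "test_fun (box a b) \<phi>"
        have t': "test_fun \<Omega> \<phi>" using t ab box_subset_cbox[of a b] unfolding test_fun_def by blast
        have c: "continuous_on UNIV \<phi>" by (rule test_fun_has_partial(2)[OF t])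
        have m: "\<phi> \<in> borel_measurable borel" using c by (rule borel_measurable_continuous_onI)
        have m': "\<phi> \<in> borel_measurable lebesgue" using m by (intro measurable_completion) simp
        have sub: "closure {x. \<phi> x \<noteq> 0} \<subseteq> box a b" using t by (simp add: test_fun_def)
        then have s: "\<phi> x = 0" if "x \<notin> box a b" for x using that closure_subset[of "{x. \<phi> x \<noteq> 0}"] by blast
        have kb: "\<phi> x *\<^sub>R k x = indicator \<Omega> x *\<^sub>R (\<phi> x *\<^sub>R h x)" for x
          using s[of x] ab box_subset_cbox[of a b] by (auto simp: k_def indicator_def)
        have bd: "\<exists>M. \<forall>x. norm (\<phi> x) \<le> M"
        proof -
          have "compact (closure {x. \<phi> x \<noteq> 0})" using t by (simp add: test_fun_def)
          from compact_imp_bounded[OF compact_continuous_image[OF continuous_on_subset[OF c] this]]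
          obtain M where M: "\<And>x. x \<in> closure {x. \<phi> x \<noteq> 0} \<Longrightarrow> norm (\<phi> x) \<le> M" unfolding bounded_iff by auto
          have "norm (\<phi> x) \<le> \<bar>M\<bar>" for x
            using M[of x] closure_subset[of "{x. \<phi> x \<noteq> 0}"] by (cases "\<phi> x = 0") auto
          then show ?thesis by blast
        qed
        then obtain M where M: "\<And>x. norm (\<phi> x) \<le> M" by blast
        have \<phi>k: "integrable lebesgue (\<lambda>x. \<phi> x *\<^sub>R k x)"
        proof (rule Bochner_Integration.integrable_bound[where f = "\<lambda>x. M *\<^sub>R k x"])
          show "integrable lebesgue (\<lambda>x. M *\<^sub>R k x)" using ki by simp
          show "AE x in lebesgue. norm (\<phi> x *\<^sub>R k x) \<le> norm (M *\<^sub>R k x)"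
            using order_trans[OF M abs_ge_self] by (intro AE_I2) (simp add: mult_right_mono)
        qed (use m' ki in auto)
        have "(\<integral>x. \<phi> x * g x \<partial>lborel) = (\<integral>x. F (\<phi> x *\<^sub>R k x) \<partial>lebesgue)"
        proof (rule integral_lebesgue_cong_lborel(2)[symmetric])
          show "(\<lambda>x. F (\<phi> x *\<^sub>R k x)) \<in> borel_measurable lebesgue"
            using integrable_bounded_linear[OF F \<phi>k] by auto
          show "AE x in lborel. F (\<phi> x *\<^sub>R k x) = \<phi> x * g x"
            using g(2) by eventually_elim (simp add: linear_scale[OF bounded_linear.linear[OF F]])
        qed (use m g in auto)
        also have "\<dots> = F (\<integral>x. \<phi> x *\<^sub>R k x \<partial>lebesgue)" by (rule integral_bounded_linear[OF F \<phi>k])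
        also have "(\<integral>x. \<phi> x *\<^sub>R k x \<partial>lebesgue) = 0"
          using z[OF t'] unfolding kb set_lebesgue_integral_def .
        finally show "(\<integral>x. \<phi> x * g x \<partial>lborel) = 0" using F by (simp add: linear_0 bounded_linear.linear)
      qed
      with g(2) show ?thesis
        by eventually_elim (use box_subset_cbox[of a b] in \<open>auto simp: k_def\<close>)
    qed
    from part[OF bounded_linear_Re] part[OF bounded_linear_Im]
    show "AE x in lborel. x \<in> box a b \<longrightarrow> h x = 0" by eventually_elim (auto simp: complex_eq_iff)
  qed
  then show ?thesis by (rule AE_completion)
qed

lemma test_fun_set_integrable:
  fixes h :: "real^'n \<Rightarrow> complex"
  assumes t: "test_fun \<Omega> \<phi>" and h: "locally_integrable \<Omega> h"
  shows "set_integrable lebesgue \<Omega> (\<lambda>x. \<phi> x *\<^sub>R h x)"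
proof -
  define K where "K = closure {x. \<phi> x \<noteq> 0}"
  have K: "compact K" "K \<subseteq> \<Omega>" using t by (auto simp: test_fun_def K_def)
  have z: "\<phi> x = 0" if "x \<notin> K" for x using that closure_subset[of "{x. \<phi> x \<noteq> 0}"] by (auto simp: K_def)
  have c: "continuous_on UNIV \<phi>" by (rule test_fun_has_partial(2)[OF t])
  have m': "\<phi> \<in> borel_measurable lebesgue"
    using borel_measurable_continuous_onI[OF c] by (intro measurable_completion) simp
  have ki: "integrable lebesgue (\<lambda>x. indicator K x *\<^sub>R h x)" using h K unfolding locally_integrable_def set_integrable_def by auto
  from compact_imp_bounded[OF compact_continuous_image[OF continuous_on_subset[OF c] K(1)]]
  obtain M where M: "\<And>x. x \<in> K \<Longrightarrow> norm (\<phi> x) \<le> M" unfolding bounded_iff by auto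
  have eq: "indicator \<Omega> x *\<^sub>R (\<phi> x *\<^sub>R h x) = \<phi> x *\<^sub>R (indicator K x *\<^sub>R h x)" for x
    using z[of x] K by (auto simp: indicator_def)
  show ?thesis unfolding set_integrable_def eq
  proof (rule Bochner_Integration.integrable_bound[where f = "\<lambda>x. M *\<^sub>R (indicator K x *\<^sub>R h x)"])
    show "integrable lebesgue (\<lambda>x. M *\<^sub>R (indicator K x *\<^sub>R h x))" by (rule integrable_scaleR_right) (rule ki)
    show "AE x in lebesgue. norm (\<phi> x *\<^sub>R (indicator K x *\<^sub>R h x)) \<le> norm (M *\<^sub>R (indicator K x *\<^sub>R h x))"
      using order_trans[OF M abs_ge_self] by (intro AE_I2) (auto simp: indicator_def mult_right_mono)
    show "(\<lambda>x. \<phi> x *\<^sub>R (indicator K x *\<^sub>R h x)) \<in> borel_measurable lebesgue"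
      by (rule borel_measurable_scaleR[OF m' borel_measurable_integrable[OF ki]])
  qed
qed

lemma weak_partial_unique:
  assumes \<Omega>: "open \<Omega>" and g: "has_weak_partial \<Omega> i f g" and g': "has_weak_partial \<Omega> i f g'"
  shows "AE x in lebesgue. x \<in> \<Omega> \<longrightarrow> g x = g' x"
proof -
  have l: "locally_integrable \<Omega> (\<lambda>x. g x - g' x)"
    using g g' unfolding has_weak_partial_def locally_integrable_def by auto
  have "AE x in lebesgue. x \<in> \<Omega> \<longrightarrow> g x - g' x = 0"
  proof (rule fundamental_lemma_lebesgue[OF \<Omega> l])
    fix \<phi> assume t: "test_fun \<Omega> \<phi>"
    have "(LINT x:\<Omega>|lebesgue. \<phi> x *\<^sub>R (g x - g' x)) = (LINT x:\<Omega>|lebesgue. \<phi> x *\<^sub>R g x) - (LINT x:\<Omega>|lebesgue. \<phi> x *\<^sub>R g' x)"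
      unfolding scaleR_diff_right using t g g' by (intro set_integral_diff test_fun_set_integrable) (auto simp: has_weak_partial_def)
    moreover have "- (LINT x:\<Omega>|lebesgue. \<phi> x *\<^sub>R g x) = - (LINT x:\<Omega>|lebesgue. \<phi> x *\<^sub>R g' x)"
      using g g' t unfolding has_weak_partial_def by metis
    ultimately show "(LINT x:\<Omega>|lebesgue. \<phi> x *\<^sub>R (g x - g' x)) = 0" by simp
  qed
  then show ?thesis by eventually_elim auto
qed

lemma weak_partial_eq:
  assumes "open \<Omega>" "has_weak_partial \<Omega> i f g"
  shows "AE x in lebesgue. x \<in> \<Omega> \<longrightarrow> weak_partial \<Omega> i f x = g x"
proof (rule weak_partial_unique[OF assms(1) _ assms(2)])
  show "has_weak_partial \<Omega> i f (weak_partial \<Omega> i f)" unfolding weak_partial_def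
    by (rule someI[where P = "has_weak_partial \<Omega> i f", OF assms(2)])
qed

section \<open>Convex combinations converging almost everywhere\<close>

text \<open>Coefficients of a convex combination of the terms with indices from \<open>n\<close> to \<open>N\<close>.\<close>

definition tail_weights :: "nat \<Rightarrow> nat \<Rightarrow> (nat \<Rightarrow> real) \<Rightarrow> bool" where
  "tail_weights n N c \<longleftrightarrow> (\<forall>m. c m \<ge> 0) \<and> (\<forall>m. m < n \<or> N < m \<longrightarrow> c m = 0) \<and> (\<Sum>m\<le>N. c m) = 1"

lemma tail_weights_extend:
  assumes "tail_weights n N c" "N \<le> N'"
  shows "(\<Sum>m\<le>N'. c m * a m) = (\<Sum>m\<le>N. c m * a m)"
  using assms by (intro sum.mono_neutral_right) (auto simp: tail_weights_def not_le)

lemma tail_weights_mid: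
  assumes "tail_weights n N c" "tail_weights n N' c'"
  shows "tail_weights n (max N N') (\<lambda>m. (c m + c' m) / 2)"
  using tail_weights_extend[OF assms(1), of "max N N'" "\<lambda>_. 1"] tail_weights_extend[OF assms(2), of "max N N'" "\<lambda>_. 1"] assms
  by (auto simp: tail_weights_def sum_divide_distrib[symmetric] sum.distrib)

lemma tail_weights_mono: "tail_weights n N c \<Longrightarrow> k \<le> n \<Longrightarrow> tail_weights k N c"
  by (auto simp: tail_weights_def)

text \<open>Let \<open>D n\<close> be the infimum of the squared norms of convex combinations of the terms from \<open>n\<close> on. This sequence
is increasing and bounded. Nearly minimal combinations are close to each other by the parallelogram law, since
their midpoint is again a convex combination. Choosing them with geometrically decreasing error makes the sum of the
consecutive distances finite, which gives convergence almost everywhere and the majorant.\<close>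

lemma convex_combinations_converge:
  fixes z :: "nat \<Rightarrow> 'i::finite \<Rightarrow> 'a \<Rightarrow> real" and M :: "'a measure"
  assumes zm: "\<And>n i. z n i \<in> borel_measurable M" and zi: "\<And>n i. integrable M (\<lambda>x. (z n i x)\<^sup>2)"
    and zb: "\<And>n. (\<Sum>i\<in>UNIV. \<integral>x. (z n i x)\<^sup>2 \<partial>M) \<le> C"
  obtains c N Hh where "\<And>n. tail_weights n (N n) (c n)" "integrable M Hh"
    "AE x in M. \<forall>i. (\<forall>n. (\<Sum>m\<le>N n. c n m * z m i x)\<^sup>2 \<le> Hh x) \<and> convergent (\<lambda>n. \<Sum>m\<le>N n. c n m * z m i x)"
proof -
  define Q where "Q v = (\<Sum>i\<in>UNIV. \<integral>x. (v i x)\<^sup>2 \<partial>M)" for v :: "'i \<Rightarrow> 'a \<Rightarrow> real"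
  define cb where "cb N c i x = (\<Sum>m\<le>N. c m * z m i x)" for N :: nat and c i x
  define L2 where "L2 f \<longleftrightarrow> f \<in> borel_measurable M \<and> integrable M (\<lambda>x. (f x)\<^sup>2)" for f :: "'a \<Rightarrow> real"
  have L2_add: "L2 (\<lambda>x. f x + g x)" if "L2 f" "L2 g" for f g
    unfolding L2_def
  proof
    show m: "(\<lambda>x. f x + g x) \<in> borel_measurable M" using that by (auto simp: L2_def)
    show "integrable M (\<lambda>x. (f x + g x)\<^sup>2)"
    proof (rule Bochner_Integration.integrable_bound[where f = "\<lambda>x. 2 * (f x)\<^sup>2 + 2 * (g x)\<^sup>2"])
      show "integrable M (\<lambda>x. 2 * (f x)\<^sup>2 + 2 * (g x)\<^sup>2)" using that by (auto simp: L2_def)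
      have "(a + b)\<^sup>2 \<le> 2 * a\<^sup>2 + 2 * b\<^sup>2" for a b :: real
        using zero_le_power2[of "a - b"] by (simp add: power2_eq_square algebra_simps)
      then show "AE x in M. norm ((f x + g x)\<^sup>2) \<le> norm (2 * (f x)\<^sup>2 + 2 * (g x)\<^sup>2)" by simp
    qed (use m in auto)
  qed
  have L2_scale: "L2 (\<lambda>x. a * f x)" if "L2 f" for a f using that by (auto simp: L2_def power_mult_distrib)
  have L2_diff: "L2 (\<lambda>x. f x - g x)" if "L2 f" "L2 g" for f g
    using L2_add[OF that(1) L2_scale[OF that(2), of "-1"]] by simp
  have L2_z: "L2 (z n i)" for n i using zm zi by (auto simp: L2_def)
  have L2_0: "L2 (\<lambda>x. 0)" by (auto simp: L2_def)
  have L2_cb: "L2 (cb N c i)" for N c i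
  proof -
    have "L2 (\<lambda>x. \<Sum>m\<in>S. c m * z m i x)" if "finite S" for S
      using that
    proof (induction S)
      case (insert m S)
      then show ?case using L2_add[OF L2_scale[OF L2_z[of m i], of "c m"] insert.IH] by simp
    qed (simp add: L2_0)
    then show ?thesis unfolding cb_def[abs_def] by simp
  qed
  define D where "D n = Inf {Q (cb N c) |N c. tail_weights n N c}" for n
  have Q0: "Q v \<ge> 0" for v unfolding Q_def by (intro sum_nonneg integral_nonneg_AE) auto
  have bdd: "bdd_below {Q (cb N c) |N c. tail_weights n N c}" for n using Q0 by (intro bdd_belowI[of _ 0]) auto
  have unit: "tail_weights n n (\<lambda>m. if m = n then 1 else 0)" for n by (auto simp: tail_weights_def)
  have D_le: "D n \<le> Q (cb N c)" if "tail_weights n N c" for n N c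
    unfolding D_def using that by (intro cInf_lower bdd) auto
  have DC: "D n \<le> C" for n
  proof -
    have "cb n (\<lambda>m. if m = n then 1 else 0) = z n"
      by (auto simp: cb_def fun_eq_iff if_distrib[of "\<lambda>c. c * _"] cong: if_cong)
    then have "D n \<le> Q (z n)" using D_le[OF unit[of n]] by simp
    then show ?thesis using zb[of n] by (simp add: Q_def)
  qed
  have bddD: "bdd_above (range D)" using DC by (intro bdd_aboveI[of _ C]) auto
  define DD where "DD = (SUP n. D n)"
  have D_mono: "D n \<le> D m" if "n \<le> m" for n m
    unfolding D_def using unit[of m] tail_weights_mono that by (intro cInf_superset_mono bdd) blast+
  define e where "e k = (1/16::real)^k" for k :: nat
  have e0: "e k > 0" for k by (simp add: e_def)
  have ex: "\<exists>n N c. k \<le> n \<and> D n \<ge> DD - e k \<and> tail_weights n N c \<and> Q (cb N c) \<le> DD + e k" for k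
  proof -
    have "\<exists>n. D n > DD - e k"
      using less_cSUP_iff[OF _ bddD, of "DD - e k"] e0[of k] by (auto simp: DD_def)
    then obtain n where n: "D n > DD - e k" by blast
    let ?n = "max n k"
    have 1: "D ?n \<ge> DD - e k" using n D_mono[of n ?n] by simp
    have "D ?n < DD + e k" using cSUP_upper[OF _ bddD, of ?n] e0[of k] by (simp add: DD_def)
    then obtain N c where "tail_weights ?n N c" "Q (cb N c) < DD + e k"
      using cInf_lessD[of "{Q (cb N c) |N c. tail_weights ?n N c}" "DD + e k"] unit[of ?n] unfolding D_def by auto
    then show ?thesis using 1 by (intro exI[of _ ?n] exI[of _ N] exI[of _ c]) auto
  qed
  then obtain nn N c where nn: "\<And>k. k \<le> nn k" "\<And>k. D (nn k) \<ge> DD - e k" "\<And>k. tail_weights (nn k) (N k) (c k)"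
    "\<And>k. Q (cb (N k) (c k)) \<le> DD + e k" by metis
  define v where "v k = cb (N k) (c k)" for k
  have L2_v: "L2 (v k i)" for k i unfolding v_def by (rule L2_cb)
  have Qd: "Q (\<lambda>i x. v (Suc k) i x - v k i x) \<le> 8 * e k" for k
  proof -
    define n where "n = min (nn k) (nn (Suc k))"
    have w: "tail_weights n (N k) (c k)" "tail_weights n (N (Suc k)) (c (Suc k))"
      using tail_weights_mono[OF nn(3)] by (auto simp: n_def)
    have ee: "e (Suc k) \<le> e k" by (simp add: e_def)
    have Dn: "D n \<ge> DD - e k" using nn(2)[of k] nn(2)[of "Suc k"] ee by (auto simp: n_def min_def)
    have mid: "cb (max (N k) (N (Suc k))) (\<lambda>m. (c k m + c (Suc k) m) / 2) = (\<lambda>i x. (v k i x + v (Suc k) i x) / 2)"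
    proof (intro ext)
      fix i x
      have "cb (max (N k) (N (Suc k))) (\<lambda>m. (c k m + c (Suc k) m) / 2) i x
        = ((\<Sum>m\<le>max (N k) (N (Suc k)). c k m * z m i x) + (\<Sum>m\<le>max (N k) (N (Suc k)). c (Suc k) m * z m i x)) / 2"
        by (simp add: cb_def sum.distrib[symmetric] sum_divide_distrib algebra_simps add_divide_distrib)
      also have "\<dots> = (v k i x + v (Suc k) i x) / 2"
        using tail_weights_extend[OF w(1), of "max (N k) (N (Suc k))"] tail_weights_extend[OF w(2), of "max (N k) (N (Suc k))"]
        by (simp add: v_def cb_def)
      finally show "cb (max (N k) (N (Suc k))) (\<lambda>m. (c k m + c (Suc k) m) / 2) i x = (v k i x + v (Suc k) i x) / 2" .
    qed
    have Qm: "Q (\<lambda>i x. (v k i x + v (Suc k) i x) / 2) \<ge> DD - e k"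
      using D_le[OF tail_weights_mid[OF w]] Dn unfolding mid by simp
    have par: "(\<integral>x. (v (Suc k) i x - v k i x)\<^sup>2 \<partial>M) = 2 * (\<integral>x. (v k i x)\<^sup>2 \<partial>M) + 2 * (\<integral>x. (v (Suc k) i x)\<^sup>2 \<partial>M)
        - 4 * (\<integral>x. ((v k i x + v (Suc k) i x) / 2)\<^sup>2 \<partial>M)" for i
    proof -
      have i1: "integrable M (\<lambda>x. (v k i x)\<^sup>2)" "integrable M (\<lambda>x. (v (Suc k) i x)\<^sup>2)" using L2_v by (auto simp: L2_def)
      have i2: "integrable M (\<lambda>x. ((v k i x + v (Suc k) i x) / 2)\<^sup>2)"
        using L2_scale[OF L2_add[OF L2_v[of k i] L2_v[of "Suc k" i]], of "1/2"] by (simp add: L2_def)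
      have "(\<integral>x. (v (Suc k) i x - v k i x)\<^sup>2 \<partial>M) = (\<integral>x. 2 * (v k i x)\<^sup>2 + 2 * (v (Suc k) i x)\<^sup>2 - 4 * ((v k i x + v (Suc k) i x) / 2)\<^sup>2 \<partial>M)"
        by (intro Bochner_Integration.integral_cong) (auto simp: power2_eq_square algebra_simps)
      then show ?thesis using i1 i2 by simp
    qed
    have "Q (\<lambda>i x. v (Suc k) i x - v k i x) = 2 * Q (v k) + 2 * Q (v (Suc k)) - 4 * Q (\<lambda>i x. (v k i x + v (Suc k) i x) / 2)"
      unfolding Q_def par by (simp add: sum.distrib sum_subtractf sum_distrib_left)
    also have "\<dots> \<le> 2 * (DD + e k) + 2 * (DD + e (Suc k)) - 4 * (DD - e k)"
      using nn(4)[of k] nn(4)[of "Suc k"] Qm by (simp add: v_def)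
    finally show ?thesis using ee by simp
  qed
  define d where "d k i x = v (Suc k) i x - v k i x" for k i x
  have L2_d: "L2 (d k i)" for k i unfolding d_def[abs_def] by (intro L2_diff L2_v)
  have dint: "(\<integral>x. (d k i x)\<^sup>2 \<partial>M) \<le> 8 * e k" for k i
  proof -
    have "(\<integral>x. (d k i x)\<^sup>2 \<partial>M) \<le> Q (d k)" unfolding Q_def
      by (rule member_le_sum[of i UNIV "\<lambda>i. \<integral>x. (d k i x)\<^sup>2 \<partial>M"]) (auto intro: integral_nonneg_AE)
    then show ?thesis using Qd[of k] by (simp add: d_def[abs_def])
  qed
  define g where "g i k x = 4 ^ k * (d k i x)\<^sup>2" for i k x
  have gi: "integrable M (g i k)" for i k using L2_d[of k i] by (simp add: g_def[abs_def] L2_def)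
  have gint: "(\<integral>x. norm (g i k x) \<partial>M) \<le> 8 * (1/4)^k" for i k
  proof -
    have "(\<integral>x. norm (g i k x) \<partial>M) = 4^k * (\<integral>x. (d k i x)\<^sup>2 \<partial>M)" by (simp add: g_def abs_mult)
    also have "\<dots> \<le> 4^k * (8 * e k)" using dint[of k i] by (intro mult_left_mono) auto
    also have "\<dots> = 8 * (1/4)^k" by (simp add: e_def power_divide power_mult_distrib[symmetric] field_simps flip: power_mult_distrib)
    finally show ?thesis .
  qed
  have gsum: "summable (\<lambda>k. \<integral>x. norm (g i k x) \<partial>M)" for i
    by (rule summable_comparison_test'[where g = "\<lambda>k. 8 * (1/4::real)^k" and N = 0])
      (use gint in \<open>auto intro!: summable_mult summable_geometric\<close>)
  have gAE: "AE x in M. summable (\<lambda>k. norm (g i k x))" for i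
  proof -
    have "(\<integral>\<^sup>+x. (\<Sum>k. ennreal (norm (g i k x))) \<partial>M) = (\<Sum>k. \<integral>\<^sup>+x. ennreal (norm (g i k x)) \<partial>M)"
      using gi by (intro nn_integral_suminf) auto
    also have "\<dots> = (\<Sum>k. ennreal (\<integral>x. norm (g i k x) \<partial>M))"
      using gi by (intro suminf_cong nn_integral_eq_integral) auto
    also have "\<dots> \<noteq> \<infinity>" using gsum by (subst suminf_ennreal2) (auto intro: integral_nonneg_AE)
    finally have "AE x in M. (\<Sum>k. ennreal (norm (g i k x))) \<noteq> \<infinity>"
      using gi by (intro nn_integral_noteq_infinite) auto
    then show ?thesis
      by eventually_elim (rule summable_suminf_not_top, auto)
  qed
  define S where "S i x = (\<Sum>k. g i k x)" for i x
  have Si: "integrable M (S i)" for i unfolding S_def[abs_def] by (rule integrable_suminf[OF gi gAE gsum])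
  define Hh where "Hh x = (\<Sum>i\<in>UNIV. 2 * (v 0 i x)\<^sup>2 + 8 * S i x)" for x
  have HhI: "integrable M Hh" unfolding Hh_def[abs_def]
    using L2_v Si by (auto simp: L2_def)
  have "AE x in M. \<forall>i\<in>UNIV. summable (\<lambda>k. norm (g i k x))"
    by (subst AE_ball_countable) (use gAE in \<open>auto simp: countable_finite\<close>)
  then have AE: "AE x in M. \<forall>i. (\<forall>n. (v n i x)\<^sup>2 \<le> Hh x) \<and> convergent (\<lambda>n. v n i x)"
  proof eventually_elim
    fix x assume sm: "\<forall>i\<in>UNIV. summable (\<lambda>k. norm (g i k x))"
    have g0: "g i k x \<ge> 0" for i k by (simp add: g_def)
    have sg: "summable (\<lambda>k. g i k x)" for i using sm by (auto intro: summable_norm_cancel)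
    have S0: "S i x \<ge> 0" for i unfolding S_def by (rule suminf_nonneg[OF sg g0])
    have dk: "\<bar>d k i x\<bar> \<le> sqrt (S i x) * (1/2)^k" for k i
    proof (rule power2_le_imp_le)
      have "g i k x \<le> S i x" unfolding S_def using sum_le_suminf[OF sg, of "{k}" i] g0 by simp
      then have "(d k i x)\<^sup>2 \<le> S i x / 4^k" by (simp add: g_def field_simps)
      also have "\<dots> = (sqrt (S i x) * (1/2)^k)\<^sup>2"
      proof -
        have "(4::real)^k = (2^k)\<^sup>2" by (simp add: power2_eq_square flip: power_mult_distrib)
        then show ?thesis using S0[of i] by (simp add: power_mult_distrib power_divide)
      qed
      finally show "\<bar>d k i x\<bar>\<^sup>2 \<le> (sqrt (S i x) * (1/2)^k)\<^sup>2" by simp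
    qed (use S0 in auto)
    have sd: "summable (\<lambda>k. d k i x)" for i
      by (rule summable_comparison_test'[where g = "\<lambda>k. sqrt (S i x) * (1/2::real)^k" and N = 0])
        (use dk in \<open>auto intro!: summable_mult summable_geometric\<close>)
    have tel: "(\<Sum>k<n. d k i x) = v n i x - v 0 i x" for n i
      unfolding d_def by (rule sum_lessThan_telescope)
    have bd: "\<bar>v n i x - v 0 i x\<bar> \<le> 2 * sqrt (S i x)" for n i
    proof -
      have "\<bar>v n i x - v 0 i x\<bar> \<le> (\<Sum>k<n. sqrt (S i x) * (1/2)^k)"
        unfolding tel[symmetric] by (intro order_trans[OF sum_abs] sum_mono dk)
      also have "\<dots> = sqrt (S i x) * (\<Sum>k<n. (1/2)^k)" by (simp add: sum_distrib_left)
      also have "\<dots> \<le> sqrt (S i x) * 2"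
      proof (intro mult_left_mono)
        have "(\<Sum>k<n. (1/2::real)^k) = 2 - 2 * (1/2)^n" by (induction n) auto
        then show "(\<Sum>k<n. (1/2::real)^k) \<le> 2" by simp
      qed (use S0 in auto)
      finally show ?thesis by simp
    qed
    have "(v n i x)\<^sup>2 \<le> 2 * (v 0 i x)\<^sup>2 + 8 * S i x" for n i
    proof -
      have "(v n i x - v 0 i x)\<^sup>2 \<le> (2 * sqrt (S i x))\<^sup>2" using bd[of n i] abs_le_square_iff[of "v n i x - v 0 i x" "2 * sqrt (S i x)"] S0 by simp
      then have 1: "(v n i x - v 0 i x)\<^sup>2 \<le> 4 * S i x" using S0 by (simp add: power_mult_distrib)
      have "(a + b)\<^sup>2 \<le> 2 * a\<^sup>2 + 2 * b\<^sup>2" for a b :: real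
        using zero_le_power2[of "a - b"] by (simp add: power2_eq_square algebra_simps)
      from this[of "v 0 i x" "v n i x - v 0 i x"] 1 show ?thesis by simp
    qed
    moreover have "2 * (v 0 i x)\<^sup>2 + 8 * S i x \<le> Hh x" for i unfolding Hh_def
      by (rule member_le_sum[of i UNIV "\<lambda>i. 2 * (v 0 i x)\<^sup>2 + 8 * S i x"]) (use S0 in auto)
    ultimately have b: "(v n i x)\<^sup>2 \<le> Hh x" for n i using order_trans by blast
    have "convergent (\<lambda>n. v n i x)" for i
    proof -
      have "(\<lambda>n. (\<Sum>k<n. d k i x) + v 0 i x) \<longlonglongrightarrow> (\<Sum>k. d k i x) + v 0 i x"
        by (intro tendsto_intros summable_LIMSEQ sd)
      then show ?thesis unfolding tel convergent_def by auto
    qed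
    with b show "\<forall>i. (\<forall>n. (v n i x)\<^sup>2 \<le> Hh x) \<and> convergent (\<lambda>n. v n i x)" by blast
  qed
  show thesis
    by (rule that[of N c Hh]) (use tail_weights_mono[OF nn(3) nn(1)] HhI AE in \<open>auto simp: v_def cb_def\<close>)
qed

section \<open>Mollifiers\<close>

lemma has_partial_lipschitz:
  fixes F :: "real^'n \<Rightarrow> real"
  assumes D: "\<And>x. has_partial k F (W x) x" and M: "\<And>x. \<bar>W x\<bar> \<le> M"
  shows "\<bar>F (x + s *\<^sub>R axis k 1) - F x\<bar> \<le> M * \<bar>s\<bar>"
proof -
  have "norm (F (x + s *\<^sub>R axis k 1) - F (x + 0 *\<^sub>R axis k 1)) \<le> M * norm (s - 0)"
  proof (rule differentiable_bound[of UNIV "\<lambda>s. F (x + s *\<^sub>R axis k 1)" "\<lambda>s h. h * W (x + s *\<^sub>R axis k 1)"])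
    show "((\<lambda>s. F (x + s *\<^sub>R axis k 1)) has_derivative (\<lambda>h. h * W (x + t *\<^sub>R axis k 1))) (at t within UNIV)" for t
      using has_partial_line[OF D, of x t] by (simp add: has_vector_derivative_def)
    show "onorm (\<lambda>h. h * W (x + t *\<^sub>R axis k 1)) \<le> M" for t
      by (rule onorm_bound) (auto simp: abs_mult mult.commute[of M] intro!: mult_left_mono M order_trans[OF abs_ge_zero M])
  qed auto
  then show ?thesis by simp
qed

lemma Ck_affine:
  fixes x0 :: "real^'n"
  assumes "Ck k \<phi>"
  shows "Ck k (\<lambda>y. s * \<phi> (x0 + t *\<^sub>R y))"
    and "(\<And>x. \<phi> differentiable (at x)) \<Longrightarrow> partial_deriv i (\<lambda>y. s * \<phi> (x0 + t *\<^sub>R y)) = (\<lambda>y. (s * t) * partial_deriv i \<phi> (x0 + t *\<^sub>R y))"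
proof -
  have D: "((\<lambda>y. s * \<phi> (x0 + t *\<^sub>R y)) has_derivative (\<lambda>v. s * frechet_derivative \<phi> (at (x0 + t *\<^sub>R y)) (t *\<^sub>R v))) (at y)"
    if d: "\<And>x. \<phi> differentiable (at x)" for \<phi> :: "real^'n \<Rightarrow> real" and s y
  proof -
    have 1: "((\<lambda>y. x0 + t *\<^sub>R y) has_derivative (\<lambda>v. t *\<^sub>R v)) (at y)" by (auto intro!: derivative_eq_intros)
    have 2: "(\<phi> has_derivative frechet_derivative \<phi> (at (x0 + t *\<^sub>R y))) (at (x0 + t *\<^sub>R y))"
      using d frechet_derivative_works by blast
    show ?thesis using has_derivative_mult_right[OF has_derivative_compose[OF 1 2], of s] by simp
  qed
  have pd: "partial_deriv i (\<lambda>y. s * \<phi> (x0 + t *\<^sub>R y)) = (\<lambda>y. (s * t) * partial_deriv i \<phi> (x0 + t *\<^sub>R y))"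
    if d: "\<And>x. \<phi> differentiable (at x)" for \<phi> :: "real^'n \<Rightarrow> real" and s i
  proof
    fix y
    have "partial_deriv i (\<lambda>y. s * \<phi> (x0 + t *\<^sub>R y)) y = s * frechet_derivative \<phi> (at (x0 + t *\<^sub>R y)) (t *\<^sub>R axis i 1)"
      unfolding partial_deriv_def by (subst frechet_derivative_at[OF D[OF d], symmetric]) (rule refl)
    also have "frechet_derivative \<phi> (at (x0 + t *\<^sub>R y)) (t *\<^sub>R axis i 1) = t *\<^sub>R frechet_derivative \<phi> (at (x0 + t *\<^sub>R y)) (axis i 1)"
      by (rule linear_scale[OF linear_frechet_derivative[OF d]])
    finally show "partial_deriv i (\<lambda>y. s * \<phi> (x0 + t *\<^sub>R y)) y = (s * t) * partial_deriv i \<phi> (x0 + t *\<^sub>R y)"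
      by (simp add: partial_deriv_def)
  qed
  then show "(\<And>x. \<phi> differentiable (at x)) \<Longrightarrow> partial_deriv i (\<lambda>y. s * \<phi> (x0 + t *\<^sub>R y)) = (\<lambda>y. (s * t) * partial_deriv i \<phi> (x0 + t *\<^sub>R y))"
    by blast
  show "Ck k (\<lambda>y. s * \<phi> (x0 + t *\<^sub>R y))" using assms
  proof (induction k arbitrary: \<phi> s)
    case 0
    then show ?case by (auto intro!: continuous_intros continuous_on_compose2[of UNIV \<phi>])
  next
    case (Suc k)
    then have d: "\<And>x. \<phi> differentiable (at x)" by simp
    have "(\<lambda>y. s * \<phi> (x0 + t *\<^sub>R y)) differentiable (at y)" for y by (rule differentiableI[OF D[OF d]])
    moreover have "Ck k (partial_deriv i (\<lambda>y. s * \<phi> (x0 + t *\<^sub>R y)))" for i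
      unfolding pd[OF d] by (rule Suc.IH) (use Suc.prems in simp)
    ultimately show ?case by simp
  qed
qed

lemma test_fun_differentiable: "test_fun \<Omega> \<phi> \<Longrightarrow> \<phi> differentiable (at x)"
proof -
  assume "test_fun \<Omega> \<phi>"
  then have "Ck (Suc 0) \<phi>" unfolding test_fun_def by blast
  then show ?thesis by simp
qed

lemma test_fun_bounded:
  assumes "test_fun \<Omega> \<phi>"
  obtains M where "M \<ge> 0" "\<And>x. \<bar>\<phi> x\<bar> \<le> M"
proof -
  have "compact (closure {x. \<phi> x \<noteq> 0})" using assms by (simp add: test_fun_def)
  from compact_imp_bounded[OF compact_continuous_image[OF continuous_on_subset[OF test_fun_has_partial(2)[OF assms]] this]]
  obtain M where M: "\<And>x. x \<in> closure {x. \<phi> x \<noteq> 0} \<Longrightarrow> norm (\<phi> x) \<le> M" unfolding bounded_iff by auto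
  have "\<bar>\<phi> x\<bar> \<le> \<bar>M\<bar>" for x
    using M[of x] closure_subset[of "{x. \<phi> x \<noteq> 0}"] by (cases "\<phi> x = 0") auto
  then show ?thesis using that[of "\<bar>M\<bar>"] by simp
qed

lemma test_fun_vanishes: "test_fun \<Omega> \<phi> \<Longrightarrow> x \<notin> closure {x. \<phi> x \<noteq> 0} \<Longrightarrow> \<phi> x = 0"
  using closure_subset[of "{x. \<phi> x \<noteq> 0}"] by blast

lemma test_fun_integrable:
  assumes t: "test_fun \<Omega> \<phi>"
  shows "integrable lborel \<phi>"
proof (rule integrable_compact_support)
  show "compact (closure {x. \<phi> x \<noteq> 0})" using t by (simp add: test_fun_def)
  show "continuous_on (closure {x. \<phi> x \<noteq> 0}) \<phi>"
    by (rule continuous_on_subset[OF test_fun_has_partial(2)[OF t]]) simp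
  show "\<phi> x = 0" if "x \<notin> closure {x. \<phi> x \<noteq> 0}" for x by (rule test_fun_vanishes[OF t that])
qed

lemma test_fun_borel: "test_fun \<Omega> \<phi> \<Longrightarrow> \<phi> \<in> borel_measurable borel"
  by (rule borel_measurable_continuous_onI[OF test_fun_has_partial(2)])

lemma test_fun_reflect:
  assumes "test_fun UNIV \<phi>"
  shows "test_fun UNIV (\<lambda>y. s * \<phi> (x - y))" "partial_deriv k (\<lambda>y. \<phi> (x - y)) y = - partial_deriv k \<phi> (x - y)"
proof -
  let ?K = "closure {x. \<phi> x \<noteq> 0}"
  have "compact ((\<lambda>z. x - z) ` ?K)" using assms unfolding test_fun_def
    by (intro compact_continuous_image continuous_intros) auto
  moreover have "{y. s * \<phi> (x - y) \<noteq> 0} \<subseteq> (\<lambda>z. x - z) ` ?K"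
  proof
    fix y assume "y \<in> {y. s * \<phi> (x - y) \<noteq> 0}"
    then have "x - y \<in> ?K" using closure_subset[of "{x. \<phi> x \<noteq> 0}"] by auto
    then show "y \<in> (\<lambda>z. x - z) ` ?K" by (intro image_eqI[of _ _ "x - y"]) auto
  qed
  ultimately have "compact (closure {y. s * \<phi> (x - y) \<noteq> 0})"
    by (simp only: compact_closure) (rule bounded_subset[OF compact_imp_bounded])
  moreover have "Ck k (\<lambda>y. s * \<phi> (x - y))" for k
    using Ck_affine(1)[of k \<phi> s x "-1"] assms by (simp add: test_fun_def)
  ultimately show "test_fun UNIV (\<lambda>y. s * \<phi> (x - y))" by (simp add: test_fun_def)
  show "partial_deriv k (\<lambda>y. \<phi> (x - y)) y = - partial_deriv k \<phi> (x - y)"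
    using Ck_affine(2)[of 0 \<phi> k 1 x "-1"] test_fun_differentiable[OF assms] test_fun_has_partial(2)[OF assms] by simp
qed

text \<open>Commuting second derivatives are part of the definition: they make the Hessians of mollified functions symmetric, and
for a product of functions of the single coordinates they are evident.\<close>

definition mollifier :: "real \<Rightarrow> (real^'n \<Rightarrow> real) \<Rightarrow> bool" where
  "mollifier r \<kappa> \<longleftrightarrow> (\<forall>x. 0 \<le> \<kappa> x) \<and> (\<forall>x. r \<le> norm x \<longrightarrow> \<kappa> x = 0) \<and> integral\<^sup>L lborel \<kappa> = 1 \<and> test_fun UNIV \<kappa>
     \<and> (\<forall>k l x. partial_deriv k (partial_deriv l \<kappa>) x = partial_deriv l (partial_deriv k \<kappa>) x)"

lemma mollifier_exists:
  assumes r: "r > 0"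
  shows "\<exists>\<kappa>::real^'n \<Rightarrow> real. mollifier r \<kappa>"
proof -
  define \<delta> where "\<delta> = r / real CARD('n)"
  have \<delta>: "\<delta> > 0" using r by (simp add: \<delta>_def)
  define a where "a = ((\<chi> i. - \<delta>) :: real^'n)"
  define b where "b = ((\<chi> i. \<delta>) :: real^'n)"
  have a: "a $ i = - \<delta>" and b: "b $ i = \<delta>" for i :: 'n unfolding b_def by (simp_all add: a_def)
  define \<beta> where "\<beta> = box_bump 1 a b"
  have t: "test_fun UNIV \<beta>" unfolding \<beta>_def by (rule test_fun_box_bump) auto
  define Z where "Z = integral\<^sup>L lborel \<beta>"
  have \<beta>0: "\<beta> x \<ge> 0" for x using box_bump_bounds[of 1 a b x] by (simp add: \<beta>_def)
  have Z: "Z > 0"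
  proof (rule ccontr)
    assume "\<not> Z > 0"
    moreover have "Z \<ge> 0" unfolding Z_def by (intro integral_nonneg_AE AE_I2 \<beta>0)
    ultimately have "integral\<^sup>L lborel \<beta> = 0" unfolding Z_def by linarith
    then have "AE x in lborel. \<beta> x = 0"
      using integral_nonneg_eq_0_iff_AE[OF test_fun_integrable[OF t]] \<beta>0 by simp
    then have "AE x in lborel. x \<notin> box a b"
      by eventually_elim (use box_bump_pos[of _ a b 1] in \<open>force simp: \<beta>_def\<close>)
    then have "emeasure lborel (box a b) = 0"
      by (subst (asm) AE_iff_measurable[of "box a b"]) auto
    then have "negligible (box a b)"
      by (simp add: negligible_iff_null_sets null_sets_completionI null_sets_def)
    moreover have "0 \<in> box a b" using \<delta> a b by (simp add: mem_box_cart)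
    ultimately show False by (simp only: negligible_interval(2)) auto
  qed
  define \<kappa> where "\<kappa> = (\<lambda>x. (1/Z) * \<beta> (0 + 1 *\<^sub>R x))"
  have \<kappa>: "\<kappa> x = \<beta> x / Z" for x by (simp add: \<kappa>_def)
  have d: "\<phi> differentiable (at x)" if "test_fun UNIV \<phi>" for \<phi> :: "real^'n \<Rightarrow> real" and x by (rule test_fun_differentiable[OF that])
  have C0: "Ck 0 \<phi>" if "test_fun UNIV \<phi>" for \<phi> :: "real^'n \<Rightarrow> real" using that by (simp add: test_fun_def)
  have pd: "partial_deriv l (\<lambda>x. (1/Z) * \<phi> (0 + 1 *\<^sub>R x)) = (\<lambda>x. (1/Z) * partial_deriv l \<phi> (0 + 1 *\<^sub>R x))" if "test_fun UNIV \<phi>" for l and \<phi> :: "real^'n \<Rightarrow> real"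
    using Ck_affine(2)[OF C0[OF that], of l "1/Z" 0 1] d[OF that] by simp
  have sym\<beta>: "partial_deriv k (partial_deriv l \<beta>) = partial_deriv l (partial_deriv k \<beta>)" for k l
  proof (cases "k = l")
    case False
    define h where "h = (\<lambda>i::'n. bump1 1 (a $ i) (b $ i))"
    have "diff_times 2 (h i)" for i unfolding h_def by (rule diff_times_bump1) simp
    then have "\<exists>h' h''. (\<forall>t. (h i has_real_derivative h' t) (at t)) \<and> (\<forall>t. (h' has_real_derivative h'' t) (at t))" for i
      by (simp add: numeral_2_eq_2) blast
    then obtain h' h'' where h: "\<And>i t. (h i has_real_derivative h' i t) (at t)" "\<And>i t. (h' i has_real_derivative h'' i t) (at t)" by metis
    have "partial_deriv k (partial_deriv l \<beta>) = (\<lambda>x. \<Prod>i\<in>UNIV. (h(l := h' l, k := h' k)) i (x $ i))" if "k \<noteq> l" for k l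
    proof -
      have "partial_deriv l \<beta> = (\<lambda>x. \<Prod>i\<in>UNIV. (h(l := h' l)) i (x $ i))"
        unfolding \<beta>_def box_bump_def[abs_def] using partial_deriv_prod[OF h(1), of l] by (simp add: h_def)
      then have "partial_deriv k (partial_deriv l \<beta>) = partial_deriv k (\<lambda>x. \<Prod>i\<in>UNIV. (h(l := h' l)) i (x $ i))" by (rule arg_cong)
      also have "\<dots> = (\<lambda>x. \<Prod>i\<in>UNIV. ((h(l := h' l))(k := (h'(l := h'' l)) k)) i (x $ i))"
        by (rule partial_deriv_prod) (use h in auto)
      finally show ?thesis using that by simp
    qed
    from this[OF False] this[OF False[symmetric]] show ?thesis using fun_upd_twist[OF False, of h] by simp
  qed simp
  have "mollifier r \<kappa>" unfolding mollifier_def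
  proof (intro conjI allI impI)
    fix x
    show "0 \<le> \<kappa> x" using \<beta>0[of x] Z by (simp add: \<kappa>)
    show "partial_deriv k (partial_deriv l \<kappa>) x = partial_deriv l (partial_deriv k \<kappa>) x" for k l
      unfolding \<kappa>_def pd[OF t] pd[OF test_fun_partial_deriv[OF t]] sym\<beta>[of k l] ..
    assume x: "r \<le> norm x"
    have "x \<notin> box a b"
    proof
      assume "x \<in> box a b"
      then have "\<bar>x $ i\<bar> < \<delta>" for i using a b by (auto simp: mem_box_cart abs_less_iff) (metis minus_less_iff)
      then have "(\<Sum>i\<in>UNIV. \<bar>x $ i\<bar>) < (\<Sum>i\<in>(UNIV::'n set). \<delta>)" by (intro sum_strict_mono) auto
      then show False using norm_le_l1_cart[of x] x by (simp add: \<delta>_def)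
    qed
    then show "\<kappa> x = 0" by (simp add: \<kappa> \<beta>_def box_bump_eq_0)
  next
    show "integral\<^sup>L lborel \<kappa> = 1" using Z unfolding \<kappa>[abs_def] by (simp add: Z_def)
    have "{x. \<kappa> x \<noteq> 0} = {x. \<beta> x \<noteq> 0}" using Z by (auto simp: \<kappa>)
    moreover have "Ck k \<kappa>" for k
      unfolding \<kappa>_def by (rule Ck_affine(1)) (use t in \<open>simp add: test_fun_def\<close>)
    ultimately show "test_fun UNIV \<kappa>" using t by (simp only: test_fun_def) blast
  qed
  then show ?thesis by (intro exI[of _ \<kappa>])
qed

section \<open>Convolution\<close>

definition conv :: "(real^'n \<Rightarrow> real) \<Rightarrow> (real^'n \<Rightarrow> real) \<Rightarrow> real^'n \<Rightarrow> real" where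
  "conv \<kappa> f x = (\<integral>y. \<kappa> (x - y) * f y \<partial>lborel)"

lemma conv_integrable:
  assumes t: "test_fun UNIV \<psi>" and f: "integrable lborel f"
  shows "integrable lborel (\<lambda>y. \<psi> (x - y) * f y)"
proof -
  obtain M where M: "M \<ge> 0" "\<And>x. \<bar>\<psi> x\<bar> \<le> M" using test_fun_bounded[OF t] by blast
  show ?thesis
  proof (rule Bochner_Integration.integrable_bound[where f = "\<lambda>y. M * f y"])
    show "(\<lambda>y. \<psi> (x - y) * f y) \<in> borel_measurable lborel"
      using test_fun_borel[OF test_fun_reflect(1)[OF t, of 1 x]] f by (intro borel_measurable_times) auto
    show "AE y in lborel. norm (\<psi> (x - y) * f y) \<le> norm (M * f y)"
      using M by (intro AE_I2) (auto simp: abs_mult intro!: mult_right_mono order_trans[OF M(2)])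
  qed (use f in simp)
qed

text \<open>Differentiation under the integral; the difference quotients of the kernel are bounded.\<close>

lemma conv_has_partial:
  assumes t: "test_fun UNIV \<psi>" and f: "integrable lborel f"
  shows "has_partial k (conv \<psi> f) (conv (partial_deriv k \<psi>) f x) x"
proof -
  have t': "test_fun UNIV (partial_deriv k \<psi>)" by (rule test_fun_partial_deriv[OF t])
  obtain M where M: "M \<ge> 0" "\<And>x. \<bar>partial_deriv k \<psi> x\<bar> \<le> M" using test_fun_bounded[OF t'] by blast
  have "((\<lambda>s. (conv \<psi> f (x + s *\<^sub>R axis k 1) - conv \<psi> f x) / s) \<longlongrightarrow> conv (partial_deriv k \<psi>) f x) (at 0)"
    unfolding tendsto_at_iff_sequentially
  proof (intro allI impI, unfold o_def)
    fix X :: "nat \<Rightarrow> real" assume X: "\<forall>i. X i \<in> UNIV - {0}" "X \<longlonglongrightarrow> 0"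
    then have X0: "X i \<noteq> 0" for i by auto
    define q where "q i y = (\<psi> (x + X i *\<^sub>R axis k 1 - y) - \<psi> (x - y)) / X i * f y" for i y
    have e: "(conv \<psi> f (x + X i *\<^sub>R axis k 1) - conv \<psi> f x) / X i = (\<integral>y. q i y \<partial>lborel)" for i
      unfolding conv_def q_def using conv_integrable[OF t f] by (simp add: Bochner_Integration.integral_diff[symmetric] left_diff_distrib[symmetric])
    have "(\<lambda>i. \<integral>y. q i y \<partial>lborel) \<longlonglongrightarrow> (\<integral>y. partial_deriv k \<psi> (x - y) * f y \<partial>lborel)"
    proof (rule integral_dominated_convergence[where w = "\<lambda>y. M * norm (f y)"])
      show "integrable lborel (\<lambda>y. M * norm (f y))" using f by simp
      show "(\<lambda>y. partial_deriv k \<psi> (x - y) * f y) \<in> borel_measurable lborel" using conv_integrable[OF t' f] by auto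
      show "q i \<in> borel_measurable lborel" for i
        unfolding q_def[abs_def] using test_fun_borel[OF test_fun_reflect(1)[OF t, of 1]] f
        by (intro borel_measurable_times borel_measurable_divide borel_measurable_diff) auto
      show "AE y in lborel. (\<lambda>i. q i y) \<longlonglongrightarrow> partial_deriv k \<psi> (x - y) * f y"
      proof (rule AE_I2)
        fix y
        have "((\<lambda>s. (\<psi> (x - y + s *\<^sub>R axis k 1) - \<psi> (x - y)) / s) \<longlongrightarrow> partial_deriv k \<psi> (x - y)) (at 0)"
          using test_fun_has_partial(1)[OF t, of k "x - y"] unfolding has_partial_def
          by (simp add: has_real_derivative_iff_has_vector_derivative[symmetric] DERIV_def)
        then have "(\<lambda>i. (\<psi> (x - y + X i *\<^sub>R axis k 1) - \<psi> (x - y)) / X i) \<longlonglongrightarrow> partial_deriv k \<psi> (x - y)"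
          using X unfolding tendsto_at_iff_sequentially o_def by blast
        then show "(\<lambda>i. q i y) \<longlonglongrightarrow> partial_deriv k \<psi> (x - y) * f y"
          unfolding q_def by (intro tendsto_mult tendsto_const) (simp add: algebra_simps)
      qed
      show "AE y in lborel. norm (q i y) \<le> M * norm (f y)" for i
      proof (rule AE_I2)
        fix y
        have "\<bar>\<psi> (x - y + X i *\<^sub>R axis k 1) - \<psi> (x - y)\<bar> \<le> M * \<bar>X i\<bar>"
          by (rule has_partial_lipschitz[OF test_fun_has_partial(1)[OF t] M(2)])
        then have b: "\<bar>(\<psi> (x + X i *\<^sub>R axis k 1 - y) - \<psi> (x - y)) / X i\<bar> \<le> M"
          using X0[of i] by (simp add: field_simps)
        have "norm (q i y) = \<bar>(\<psi> (x + X i *\<^sub>R axis k 1 - y) - \<psi> (x - y)) / X i\<bar> * \<bar>f y\<bar>"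
          unfolding q_def by (simp only: abs_mult real_norm_def)
        also have "\<dots> \<le> M * \<bar>f y\<bar>" by (intro mult_right_mono b) simp
        finally show "norm (q i y) \<le> M * norm (f y)" by simp
      qed
    qed
    then show "(\<lambda>i. (conv \<psi> f (x + X i *\<^sub>R axis k 1) - conv \<psi> f x) / X i) \<longlonglongrightarrow> conv (partial_deriv k \<psi>) f x"
      unfolding e by (simp add: conv_def)
  qed
  then show ?thesis
    unfolding has_partial_def by (simp add: has_real_derivative_iff_has_vector_derivative[symmetric] DERIV_def)
qed

lemma conv_continuous:
  assumes t: "test_fun UNIV \<psi>" and f: "integrable lborel f"
  shows "continuous_on UNIV (conv \<psi> f)"
proof -
  obtain M where M: "M \<ge> 0" "\<And>x. \<bar>\<psi> x\<bar> \<le> M" using test_fun_bounded[OF t] by blast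
  have "(\<lambda>n. conv \<psi> f (X n)) \<longlonglongrightarrow> conv \<psi> f x" if X: "X \<longlonglongrightarrow> x" for X x
    unfolding conv_def
  proof (rule integral_dominated_convergence[where w = "\<lambda>y. M * norm (f y)"])
    show "AE y in lborel. (\<lambda>n. \<psi> (X n - y) * f y) \<longlonglongrightarrow> \<psi> (x - y) * f y"
    proof (rule AE_I2)
      fix y
      have "isCont \<psi> (x - y)" using test_fun_has_partial(2)[OF t] by (simp add: continuous_on_eq_continuous_at)
      then have "(\<lambda>n. \<psi> (X n - y)) \<longlonglongrightarrow> \<psi> (x - y)"
        by (rule isCont_tendsto_compose) (intro tendsto_intros X)
      then show "(\<lambda>n. \<psi> (X n - y) * f y) \<longlonglongrightarrow> \<psi> (x - y) * f y" by (intro tendsto_intros)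
    qed
    show "AE y in lborel. norm (\<psi> (X n - y) * f y) \<le> M * norm (f y)" for n
      using M by (intro AE_I2) (auto simp: abs_mult intro!: mult_right_mono)
  qed (use f conv_integrable[OF t f] in auto)
  then show ?thesis by (simp add: continuous_on_sequentially o_def)
qed

text \<open>The definition of the weak derivative, tested with the reflected and translated kernel.\<close>

lemma conv_weak_partial:
  assumes t: "test_fun UNIV \<psi>"
    and w: "\<And>\<phi>. test_fun UNIV \<phi> \<Longrightarrow> (\<integral>y. partial_deriv k \<phi> y * f y \<partial>lborel) = - (\<integral>y. \<phi> y * g y \<partial>lborel)"
  shows "conv (partial_deriv k \<psi>) f x = conv \<psi> g x"
proof -
  have t1: "test_fun UNIV (\<lambda>y. \<psi> (x - y))" using test_fun_reflect(1)[OF t, of 1 x] by simp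
  show ?thesis using w[OF t1] unfolding test_fun_reflect(2)[OF t] by (simp add: conv_def)
qed

lemma integral_reflect:
  fixes F :: "real^'n \<Rightarrow> real"
  assumes "F \<in> borel_measurable borel"
  shows "(\<integral>y. F (x - y) \<partial>lborel) = (\<integral>y. F y \<partial>lborel)"
proof -
  have "lborel = density (distr lborel borel (\<lambda>y. x + (-1) *\<^sub>R y)) (\<lambda>_. ennreal (\<bar>-1::real\<bar> ^ DIM(real^'n)))"
    by (rule lborel_affine) simp
  then have "(lborel :: (real^'n) measure) = distr lborel borel (\<lambda>y. x - y)" by (simp add: density_1)
  then have "(\<integral>y. F y \<partial>lborel) = (\<integral>y. F y \<partial>distr lborel borel (\<lambda>y. x - y))" by simp
  also have "\<dots> = (\<integral>y. F (x - y) \<partial>lborel)" using assms by (intro integral_distr) auto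
  finally show ?thesis by simp
qed

lemma integrable_reflect:
  fixes F :: "real^'n \<Rightarrow> real"
  assumes "integrable lborel F"
  shows "integrable lborel (\<lambda>y. F (x - y))"
proof -
  have "lborel = density (distr lborel borel (\<lambda>y. x + (-1) *\<^sub>R y)) (\<lambda>_. ennreal (\<bar>-1::real\<bar> ^ DIM(real^'n)))"
    by (rule lborel_affine) simp
  then have "(lborel :: (real^'n) measure) = distr lborel borel (\<lambda>y. x - y)" by (simp add: density_1)
  then have "integrable (distr lborel borel (\<lambda>y. x - y)) F" using assms by simp
  then show ?thesis using assms by (subst (asm) integrable_distr_eq) auto
qed

lemma integral_translate:
  fixes F :: "real^'n \<Rightarrow> real"
  assumes "F \<in> borel_measurable borel"
  shows "(\<integral>y. F (y - x) \<partial>lborel) = (\<integral>y. F y \<partial>lborel)"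
proof -
  have "(\<integral>y. F y \<partial>distr lborel borel (\<lambda>y. - x + y)) = (\<integral>y. F (- x + y) \<partial>lborel)" using assms by (intro integral_distr) auto
  then show ?thesis unfolding lborel_distr_plus by (simp add: add.commute)
qed

lemma fubini_conv:
  fixes F :: "real^'n \<Rightarrow> real" and G :: "real^'n \<Rightarrow> real^'n \<Rightarrow> real"
  assumes F: "integrable lborel F" and G: "case_prod G \<in> borel_measurable (borel \<Otimes>\<^sub>M borel)"
    and C: "\<And>y. integrable lborel (\<lambda>x. G x y)" "\<And>y. (\<integral>x. \<bar>G x y\<bar> \<partial>lborel) \<le> C"
  shows "(\<integral>x. (\<integral>y. G x y * F y \<partial>lborel) \<partial>lborel) = (\<integral>y. (\<integral>x. G x y \<partial>lborel) * F y \<partial>lborel)"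
    and "integrable lborel (\<lambda>x. \<integral>y. G x y * F y \<partial>lborel)"
proof -
  interpret pair_sigma_finite "lborel :: (real^'n) measure" "lborel :: (real^'n) measure" ..
  have Gm: "case_prod G \<in> borel_measurable (lborel \<Otimes>\<^sub>M lborel)" using G by simp
  have Fm: "F \<in> borel_measurable lborel" using F by simp
  have m: "(\<lambda>(x, y). G x y * F y) \<in> borel_measurable (lborel \<Otimes>\<^sub>M lborel)"
    using Gm Fm unfolding case_prod_beta' by measurable
  then have m': "(\<lambda>(y, x). G x y * F y) \<in> borel_measurable (lborel \<Otimes>\<^sub>M lborel)"
    by (subst measurable_pair_swap_iff) (simp add: case_prod_beta')
  have "integrable (lborel \<Otimes>\<^sub>M lborel) (\<lambda>(y, x). G x y * F y)"
  proof (rule lborel_pair.Fubini_integrable)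
    show "integrable lborel (\<lambda>y. \<integral>x. norm (case (y, x) of (y, x) \<Rightarrow> G x y * F y) \<partial>lborel)"
    proof (rule Bochner_Integration.integrable_bound[where f = "\<lambda>y. C * F y"])
      show "(\<lambda>y. \<integral>x. norm (case (y, x) of (y, x) \<Rightarrow> G x y * F y) \<partial>lborel) \<in> borel_measurable lborel"
        using m' by (intro lborel.borel_measurable_lebesgue_integral) (simp add: case_prod_beta')
      show "AE y in lborel. norm (\<integral>x. norm (case (y, x) of (y, x) \<Rightarrow> G x y * F y) \<partial>lborel) \<le> norm (C * F y)"
      proof (rule AE_I2)
        fix y
        have "(\<integral>x. norm (case (y, x) of (y, x) \<Rightarrow> G x y * F y) \<partial>lborel) = (\<integral>x. \<bar>G x y\<bar> \<partial>lborel) * \<bar>F y\<bar>" by (simp add: abs_mult)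
        moreover have "0 \<le> (\<integral>x. \<bar>G x y\<bar> \<partial>lborel)" by (intro integral_nonneg_AE) auto
        ultimately show "norm (\<integral>x. norm (case (y, x) of (y, x) \<Rightarrow> G x y * F y) \<partial>lborel) \<le> norm (C * F y)"
          using C(2)[of y] by (simp add: abs_mult mult_right_mono)
      qed
    qed (use F in simp)
    show "AE y in lborel. integrable lborel (\<lambda>x. case (y, x) of (y, x) \<Rightarrow> G x y * F y)" using C(1) by simp
  qed (use m' in simp)
  then have i: "integrable (lborel \<Otimes>\<^sub>M lborel) (\<lambda>(x, y). G x y * F y)"
    by (subst (asm) lborel_pair.integrable_product_swap_iff[symmetric]) simp
  show "(\<integral>x. (\<integral>y. G x y * F y \<partial>lborel) \<partial>lborel) = (\<integral>y. (\<integral>x. G x y \<partial>lborel) * F y \<partial>lborel)"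
    using lborel_pair.Fubini_integral[OF i] by simp
  show "integrable lborel (\<lambda>x. \<integral>y. G x y * F y \<partial>lborel)"
    using lborel_pair.integrable_fst[OF i] by simp
qed

lemma kernel_measurable:
  assumes "\<kappa> \<in> borel_measurable borel"
  shows "(\<lambda>(x, y). \<kappa> (x - y :: real^'n) :: real) \<in> borel_measurable (borel \<Otimes>\<^sub>M borel)"
proof -
  have "(\<lambda>p. fst p - snd p :: real^'n) \<in> borel_measurable (borel \<Otimes>\<^sub>M borel)" by measurable
  from measurable_compose[OF this assms] show ?thesis by (simp add: case_prod_beta')
qed

text \<open>Jensen's inequality: a mollification is an average with respect to a probability density.\<close>

lemma conv_L2:
  assumes \<kappa>: "mollifier r \<kappa>" and f: "integrable lborel f" "integrable lborel (\<lambda>x. (f x)\<^sup>2)"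
  shows "integrable lborel (\<lambda>x. (conv \<kappa> f x)\<^sup>2)" "(\<integral>x. (conv \<kappa> f x)\<^sup>2 \<partial>lborel) \<le> (\<integral>x. (f x)\<^sup>2 \<partial>lborel)"
proof -
  have t: "test_fun UNIV \<kappa>" and \<kappa>0: "\<And>x. \<kappa> x \<ge> 0" and k1: "integral\<^sup>L lborel \<kappa> = 1" using \<kappa> by (auto simp: mollifier_def)
  note km = test_fun_borel[OF t]
  have tr: "test_fun UNIV (\<lambda>y. \<kappa> (x - y))" for x using test_fun_reflect(1)[OF t, of 1 x] by simp
  have jensen: "(conv \<kappa> f x)\<^sup>2 \<le> conv \<kappa> (\<lambda>y. (f y)\<^sup>2) x" for x
  proof -
    define c where "c = conv \<kappa> f x"
    have i: "integrable lborel (\<lambda>y. \<kappa> (x - y))" "integrable lborel (\<lambda>y. \<kappa> (x - y) * f y)" "integrable lborel (\<lambda>y. \<kappa> (x - y) * (f y)\<^sup>2)"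
      using test_fun_integrable[OF tr] conv_integrable[OF t] f by auto
    have "0 \<le> (\<integral>y. \<kappa> (x - y) * (f y - c)\<^sup>2 \<partial>lborel)" by (intro integral_nonneg_AE AE_I2) (simp add: \<kappa>0)
    also have "\<dots> = (\<integral>y. \<kappa> (x - y) * (f y)\<^sup>2 - (2 * c) * (\<kappa> (x - y) * f y) + c\<^sup>2 * \<kappa> (x - y) \<partial>lborel)"
      by (intro Bochner_Integration.integral_cong) (auto simp: power2_eq_square algebra_simps)
    also have "\<dots> = conv \<kappa> (\<lambda>y. (f y)\<^sup>2) x - (2 * c) * c + c\<^sup>2 * (\<integral>y. \<kappa> (x - y) \<partial>lborel)"
      using i by (simp add: conv_def c_def)
    also have "(\<integral>y. \<kappa> (x - y) \<partial>lborel) = 1" using integral_reflect[OF km] k1 by simp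
    finally show ?thesis by (simp add: c_def power2_eq_square)
  qed
  have C: "integrable lborel (\<lambda>x. \<kappa> (x - y))" "(\<integral>x. \<bar>\<kappa> (x - y)\<bar> \<partial>lborel) \<le> 1" for y
  proof -
    have 1: "(\<integral>x. \<kappa> (x - y) \<partial>lborel) = 1" using integral_translate[OF km] k1 by simp
    then show "integrable lborel (\<lambda>x. \<kappa> (x - y))" using not_integrable_integral_eq by fastforce
    show "(\<integral>x. \<bar>\<kappa> (x - y)\<bar> \<partial>lborel) \<le> 1" using 1 \<kappa>0 by simp
  qed
  note fub = fubini_conv[OF f(2) kernel_measurable[OF km] C]
  have i: "integrable lborel (conv \<kappa> (\<lambda>y. (f y)\<^sup>2))" using fub(2) by (simp add: conv_def[abs_def])
  have m: "conv \<kappa> f \<in> borel_measurable borel" by (rule borel_measurable_continuous_onI[OF conv_continuous[OF t f(1)]])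
  show i2: "integrable lborel (\<lambda>x. (conv \<kappa> f x)\<^sup>2)"
    by (rule Bochner_Integration.integrable_bound[OF i])
      (use m jensen in \<open>auto intro!: AE_I2 order_trans[OF jensen]\<close>)
  have "(\<integral>x. (conv \<kappa> f x)\<^sup>2 \<partial>lborel) \<le> (\<integral>x. conv \<kappa> (\<lambda>y. (f y)\<^sup>2) x \<partial>lborel)" by (intro integral_mono i i2 jensen)
  also have "\<dots> = (\<integral>y. (\<integral>x. \<kappa> (x - y) \<partial>lborel) * (f y)\<^sup>2 \<partial>lborel)" using fub(1) by (simp add: conv_def)
  also have "\<dots> = (\<integral>y. (f y)\<^sup>2 \<partial>lborel)" using integral_translate[OF km] k1 by simp
  finally show "(\<integral>x. (conv \<kappa> f x)\<^sup>2 \<partial>lborel) \<le> (\<integral>x. (f x)\<^sup>2 \<partial>lborel)" .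
qed

lemma conv_support:
  assumes "mollifier r \<kappa>" "\<And>y. f y \<noteq> 0 \<Longrightarrow> r \<le> norm (x - y)"
  shows "conv \<kappa> f x = 0"
proof -
  have "(\<lambda>y. \<kappa> (x - y) * f y) = (\<lambda>y. 0)" using assms unfolding mollifier_def by (auto simp: fun_eq_iff)
  then show ?thesis by (simp add: conv_def)
qed

lemma abs_integral_le:
  fixes F G :: "'a \<Rightarrow> real"
  assumes F: "integrable M F" and G: "integrable M G" and le: "\<And>x. \<bar>F x\<bar> \<le> G x"
  shows "\<bar>integral\<^sup>L M F\<bar> \<le> integral\<^sup>L M G"
proof -
  have "\<bar>integral\<^sup>L M F\<bar> \<le> (\<integral>x. \<bar>F x\<bar> \<partial>M)" by (rule integral_abs_bound)
  also have "\<dots> \<le> integral\<^sup>L M G" by (intro integral_mono integrable_abs F G le)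
  finally show ?thesis .
qed

text \<open>By Fubini the kernel can be moved to the test function, which is Lipschitz, so that averaging changes it little. Weak convergence is all
that is needed here, because the limit of the convex combinations exists independently.\<close>

lemma conv_weak_approx:
  fixes f \<phi> :: "real^'n \<Rightarrow> real"
  assumes \<phi>: "test_fun UNIV \<phi>" and f: "integrable lborel f" and e: "e > 0"
  obtains r0 where "r0 > 0" "\<And>r \<kappa>. r \<le> r0 \<Longrightarrow> mollifier r \<kappa> \<Longrightarrow>
     integrable lborel (\<lambda>x. \<phi> x * conv \<kappa> f x) \<and> \<bar>(\<integral>x. \<phi> x * conv \<kappa> f x \<partial>lborel) - (\<integral>x. \<phi> x * f x \<partial>lborel)\<bar> \<le> e"
proof -
  define n1 where "n1 = (\<integral>x. \<bar>f x\<bar> \<partial>lborel)"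
  have n1: "n1 \<ge> 0" unfolding n1_def by (intro integral_nonneg_AE) auto
  define e' where "e' = e / (n1 + 1)"
  have e': "e' > 0" using e n1 by (simp add: e'_def)
  define K where "K = closure {x. \<phi> x \<noteq> 0}"
  have K: "compact K" using \<phi> by (simp add: K_def test_fun_def)
  obtain R where R: "\<And>x. x \<in> K \<Longrightarrow> norm x \<le> R" using compact_imp_bounded[OF K] unfolding bounded_iff by auto
  have "uniformly_continuous_on (cball 0 (R + 2)) \<phi>"
    by (rule compact_uniformly_continuous[OF continuous_on_subset[OF test_fun_has_partial(2)[OF \<phi>]]]) auto
  then obtain d where d: "d > 0" "\<And>x y. x \<in> cball 0 (R+2) \<Longrightarrow> y \<in> cball 0 (R+2) \<Longrightarrow> dist x y < d \<Longrightarrow> dist (\<phi> x) (\<phi> y) < e'"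
    unfolding uniformly_continuous_on_def using e' by metis
  have uc: "\<bar>\<phi> x - \<phi> y\<bar> \<le> e'" if "norm (x - y) < min d 1" for x y
  proof (cases "x \<in> cball 0 (R+2) \<and> y \<in> cball 0 (R+2)")
    case True
    then show ?thesis using d(2)[of x y] that by (auto simp: dist_norm)
  next
    case False
    have "norm x \<le> norm y + norm (x - y)" "norm y \<le> norm x + norm (x - y)"
      using norm_triangle_ineq[of y "x - y"] norm_triangle_ineq[of x "y - x"] by (simp_all add: norm_minus_commute)
    then have "norm x > R" "norm y > R" using False that by auto
    then have "x \<notin> K" "y \<notin> K" using R not_le by blast+
    then have "\<phi> x = 0" "\<phi> y = 0" using test_fun_vanishes[OF \<phi>, folded K_def] by blast+
    then show ?thesis using e' by simp
  qed
  obtain M where M: "M \<ge> 0" "\<And>x. \<bar>\<phi> x\<bar> \<le> M" using test_fun_bounded[OF \<phi>] by blast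
  show ?thesis
  proof (rule that[of "min d 1"])
    show "min d 1 > 0" using d by simp
    fix r :: real and \<kappa> :: "real^'n \<Rightarrow> real" assume r: "r \<le> min d 1" and \<kappa>: "mollifier r \<kappa>"
    have t: "test_fun UNIV \<kappa>" and \<kappa>0: "\<And>x. \<kappa> x \<ge> 0" and k1: "integral\<^sup>L lborel \<kappa> = 1" and ks: "\<And>x. r \<le> norm x \<Longrightarrow> \<kappa> x = 0"
      using \<kappa> by (auto simp: mollifier_def)
    note km = test_fun_borel[OF t] and \<phi>m = test_fun_borel[OF \<phi>]
    have 1: "(\<integral>x. \<kappa> (x - y) \<partial>lborel) = 1" for y using integral_translate[OF km] k1 by simp
    then have ki: "integrable lborel (\<lambda>x. \<kappa> (x - y))" for y using not_integrable_integral_eq by fastforce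
    have Gi: "integrable lborel (\<lambda>x. \<phi> x * \<kappa> (x - y))" for y
    proof (rule Bochner_Integration.integrable_bound[where f = "\<lambda>x. M * \<kappa> (x - y)"])
      show "(\<lambda>x. \<phi> x * \<kappa> (x - y)) \<in> borel_measurable lborel" using \<phi>m ki by (intro borel_measurable_times) auto
      show "AE x in lborel. norm (\<phi> x * \<kappa> (x - y)) \<le> norm (M * \<kappa> (x - y))"
        using M by (intro AE_I2) (auto simp: abs_mult intro!: mult_right_mono)
    qed (use ki in simp)
    have C: "(\<integral>x. \<bar>\<phi> x * \<kappa> (x - y)\<bar> \<partial>lborel) \<le> M" for y
    proof -
      have "(\<integral>x. \<bar>\<phi> x * \<kappa> (x - y)\<bar> \<partial>lborel) \<le> (\<integral>x. M * \<kappa> (x - y) \<partial>lborel)"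
      proof (rule integral_mono)
        show "integrable lborel (\<lambda>x. \<bar>\<phi> x * \<kappa> (x - y)\<bar>)" by (rule integrable_abs[OF Gi])
        show "integrable lborel (\<lambda>x. M * \<kappa> (x - y))" using ki by simp
        show "\<bar>\<phi> x * \<kappa> (x - y)\<bar> \<le> M * \<kappa> (x - y)" for x
          using M \<kappa>0 by (simp add: abs_mult mult_right_mono)
      qed
      then show ?thesis using 1[of y] by simp
    qed
    have "(\<lambda>(x, y). \<phi> x * \<kappa> (x - y)) \<in> borel_measurable (borel \<Otimes>\<^sub>M borel)"
      using kernel_measurable[OF km] \<phi>m unfolding case_prod_beta' by measurable
    note fub = fubini_conv[OF f this Gi C]
    have eq: "(\<integral>y. \<phi> x * \<kappa> (x - y) * f y \<partial>lborel) = \<phi> x * conv \<kappa> f x" for x by (simp add: conv_def mult.assoc)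
    have i1: "integrable lborel (\<lambda>x. \<phi> x * conv \<kappa> f x)" using fub(2) unfolding eq .
    define \<Phi> where "\<Phi> y = (\<integral>x. \<phi> x * \<kappa> (x - y) \<partial>lborel)" for y
    have close: "\<bar>\<Phi> y - \<phi> y\<bar> \<le> e'" for y
    proof -
      have "\<Phi> y - \<phi> y = (\<integral>x. \<phi> x * \<kappa> (x - y) - \<phi> y * \<kappa> (x - y) \<partial>lborel)"
        using Gi ki 1[of y] by (simp add: \<Phi>_def)
      also have "\<bar>\<dots>\<bar> \<le> (\<integral>x. e' * \<kappa> (x - y) \<partial>lborel)"
      proof (rule abs_integral_le)
        fix x
        show "abs (\<phi> x * \<kappa> (x - y) - \<phi> y * \<kappa> (x - y)) \<le> e' * \<kappa> (x - y)"
        proof (cases "r \<le> norm (x - y)")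
          case False
          then have "\<bar>\<phi> x - \<phi> y\<bar> \<le> e'" using uc r by simp
          then show ?thesis using \<kappa>0[of "x - y"] by (simp add: left_diff_distrib[symmetric] abs_mult mult_right_mono)
        qed (simp add: ks)
      qed (use Gi ki in auto)
      finally show ?thesis using 1[of y] by simp
    qed
    have \<phi>fi: "integrable lborel (\<lambda>y. \<phi> y * f y)"
    proof (rule Bochner_Integration.integrable_bound[where f = "\<lambda>y. M * f y"])
      show "AE y in lborel. norm (\<phi> y * f y) \<le> norm (M * f y)"
        using M by (intro AE_I2) (auto simp: abs_mult intro!: mult_right_mono order_trans[OF M(2)])
    qed (use f \<phi>m in auto)
    have \<Phi>i: "integrable lborel (\<lambda>y. \<Phi> y * f y)"
    proof (rule Bochner_Integration.integrable_bound[where f = "\<lambda>y. (M + e') * f y"])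
      have "(\<lambda>(y, x). \<phi> x * \<kappa> (x - y)) \<in> borel_measurable (lborel \<Otimes>\<^sub>M lborel)"
      proof -
        have "(\<lambda>p. \<kappa> (snd p - fst p)) \<in> borel_measurable (borel \<Otimes>\<^sub>M borel)"
          by (rule measurable_compose[OF _ km]) measurable
        then show ?thesis using \<phi>m unfolding case_prod_beta' by measurable
      qed
      then have "\<Phi> \<in> borel_measurable lborel" unfolding \<Phi>_def[abs_def] by (rule lborel.borel_measurable_lebesgue_integral)
      then show "(\<lambda>y. \<Phi> y * f y) \<in> borel_measurable lborel" using f by (intro borel_measurable_times) auto
      have "\<bar>\<Phi> y\<bar> \<le> M + e'" for y using close[of y] M(2)[of y] by linarith
      then show "AE y in lborel. norm (\<Phi> y * f y) \<le> norm ((M + e') * f y)"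
        using M e' by (intro AE_I2) (auto simp: abs_mult intro!: mult_right_mono)
    qed (use f in simp)
    have "(\<integral>x. \<phi> x * conv \<kappa> f x \<partial>lborel) - (\<integral>x. \<phi> x * f x \<partial>lborel) = (\<integral>y. \<Phi> y * f y - \<phi> y * f y \<partial>lborel)"
      using fub(1) \<phi>fi \<Phi>i unfolding eq \<Phi>_def by simp
    also have "\<bar>\<dots>\<bar> \<le> (\<integral>y. e' * \<bar>f y\<bar> \<partial>lborel)"
    proof (rule abs_integral_le)
      show "integrable lborel (\<lambda>y. \<Phi> y * f y - \<phi> y * f y)" by (intro Bochner_Integration.integrable_diff \<Phi>i \<phi>fi)
      show "integrable lborel (\<lambda>y. e' * \<bar>f y\<bar>)" using f by simp
      show "\<bar>\<Phi> y * f y - \<phi> y * f y\<bar> \<le> e' * \<bar>f y\<bar>" for y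
        unfolding left_diff_distrib[symmetric] abs_mult by (intro mult_right_mono close) simp
    qed
    also have "\<dots> = e' * n1" by (simp add: n1_def)
    also have "\<dots> \<le> e" using n1 e by (simp add: e'_def field_simps)
    finally show "integrable lborel (\<lambda>x. \<phi> x * conv \<kappa> f x) \<and> \<bar>(\<integral>x. \<phi> x * conv \<kappa> f x \<partial>lborel) - (\<integral>x. \<phi> x * f x \<partial>lborel)\<bar> \<le> e"
      using i1 by blast
  qed
qed

section \<open>Simultaneous mollification\<close>

lemma integrable_if_square_bounded_support:
  fixes f :: "real^'n \<Rightarrow> real"
  assumes f: "f \<in> borel_measurable borel" and H: "integrable lborel H" "AE x in lborel. (f x)\<^sup>2 \<le> H x"
    and K: "compact K" "AE x in lborel. x \<notin> K \<longrightarrow> f x = 0"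
  shows "integrable lborel f"
proof (rule Bochner_Integration.integrable_bound[where f = "\<lambda>x. indicator K x + H x"])
  have "integrable lborel (indicator K :: real^'n \<Rightarrow> real)"
    using emeasure_compact_finite[OF K(1)] K(1) by (intro integrable_real_indicator) (auto simp: borel_compact)
  then show "integrable lborel (\<lambda>x. indicator K x + H x)" using H by simp
  show "AE x in lborel. norm (f x) \<le> norm (indicator K x + H x)"
    using H(2) K(2)
  proof eventually_elim
    case (elim x)
    have "\<bar>f x\<bar> \<le> 1 + (f x)\<^sup>2" using zero_le_power2[of "\<bar>f x\<bar> - 1/2"] by (simp add: power2_eq_square algebra_simps)
    moreover have "0 \<le> H x" using elim(1) zero_le_power2 order_trans by blast
    ultimately show ?case using elim by (cases "x \<in> K") auto
  qed
qed (use f in simp)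

lemma tail_weights_sum_le:
  assumes "tail_weights n N c" "\<And>m. n \<le> m \<Longrightarrow> a m \<le> b"
  shows "(\<Sum>m\<le>N. c m * a m) \<le> b"
proof -
  have "(\<Sum>m\<le>N. c m * a m) \<le> (\<Sum>m\<le>N. c m * b)"
  proof (rule sum_mono)
    fix m show "c m * a m \<le> c m * b"
      using assms by (cases "m < n") (auto simp: tail_weights_def intro!: mult_left_mono)
  qed
  also have "\<dots> = b" using assms(1) by (simp add: sum_distrib_right[symmetric] tail_weights_def)
  finally show ?thesis .
qed

lemma tail_weights_sum_close:
  assumes "tail_weights n N c" "\<And>m. n \<le> m \<Longrightarrow> \<bar>a m - L\<bar> \<le> e"
  shows "\<bar>(\<Sum>m\<le>N. c m * a m) - L\<bar> \<le> e"
proof -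
  have "(\<Sum>m\<le>N. c m * (a m - L)) \<le> e" "(\<Sum>m\<le>N. c m * (L - a m)) \<le> e"
    using assms(2) by (auto intro!: tail_weights_sum_le[OF assms(1)] simp: abs_le_iff)
  moreover have "(\<Sum>m\<le>N. c m * L) = L" using assms(1) by (simp add: sum_distrib_right[symmetric] tail_weights_def)
  ultimately show ?thesis by (simp add: right_diff_distrib sum_subtractf abs_le_iff)
qed

lemma tail_weights_tendsto:
  assumes c: "\<And>n. tail_weights n (N n) (c n)" and a: "a \<longlonglongrightarrow> (L::real)"
  shows "(\<lambda>n. \<Sum>m\<le>N n. c n m * a m) \<longlonglongrightarrow> L"
proof (rule LIMSEQ_I)
  fix e :: real assume e: "e > 0"
  then obtain n0 where n0: "\<And>m. m \<ge> n0 \<Longrightarrow> norm (a m - L) < e / 2" using LIMSEQ_D[OF a, of "e/2"] by auto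
  have "norm ((\<Sum>m\<le>N n. c n m * a m) - L) < e" if "n \<ge> n0" for n
  proof -
    have "\<bar>(\<Sum>m\<le>N n. c n m * a m) - L\<bar> \<le> e / 2"
      by (rule tail_weights_sum_close[OF c]) (use n0 that in \<open>force intro: less_imp_le\<close>)
    then show ?thesis using e by simp
  qed
  then show "\<exists>n0. \<forall>n\<ge>n0. norm ((\<Sum>m\<le>N n. c n m * a m) - L) < e" by blast
qed

lemma has_partial_weighted_sum:
  fixes F :: "nat \<Rightarrow> real^'n \<Rightarrow> real"
  assumes "\<And>m. has_partial k (F m) (D m) x"
  shows "has_partial k (\<lambda>x. \<Sum>m\<le>N. c m * F m x) (\<Sum>m\<le>N. c m * D m) x"
  unfolding has_partial_def
  by (rule has_vector_derivative_sum) (use assms in \<open>auto simp: has_partial_def intro!: derivative_eq_intros has_vector_derivative_mult_right\<close>)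

lemma abs_mult_le_squares: "\<bar>p * q\<bar> \<le> p\<^sup>2 + (q::real)\<^sup>2"
proof -
  have "0 \<le> (\<bar>p\<bar> - \<bar>q\<bar>)\<^sup>2" by simp
  then have "2 * \<bar>p * q\<bar> \<le> p\<^sup>2 + q\<^sup>2" by (simp add: power2_diff abs_mult)
  then show ?thesis using abs_ge_zero[of "p * q"] by linarith
qed

text \<open>Mollifications are bounded in \<open>L\<^sup>2\<close>, so convex combinations converge almost everywhere with a majorant. The limit
coincides with the function itself because mollifications converge weakly to it and tail averages do not change weak
limits. One choice of weights serves all members of the family, so that derivatives of the smoothed
function are the smoothed derivatives.\<close>

lemma mollify_family:
  fixes F :: "'i::finite \<Rightarrow> real^'n \<Rightarrow> real"
  assumes K: "compact K" and \<delta>: "\<delta> > 0"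
    and Fm: "\<And>i. F i \<in> borel_measurable borel" and F2: "\<And>i. integrable lborel (\<lambda>x. (F i x)\<^sup>2)"
    and F0: "\<And>i x. x \<notin> K \<Longrightarrow> F i x = 0"
  obtains \<kappa> c N Hh where "\<And>m. mollifier \<delta> (\<kappa> m)" "\<And>n. tail_weights n (N n) (c n)" "integrable lborel Hh"
    "AE x in lborel. \<forall>i. (\<forall>n. (\<Sum>m\<le>N n. c n m * conv (\<kappa> m) (F i) x)\<^sup>2 \<le> Hh x) \<and> (\<lambda>n. \<Sum>m\<le>N n. c n m * conv (\<kappa> m) (F i) x) \<longlonglongrightarrow> F i x"
proof -
  define r where "r m = \<delta> * inverse (real (Suc m))" for m
  have rp: "r m > 0" for m using \<delta> by (simp add: r_def)
  have r0: "r \<longlonglongrightarrow> 0" unfolding r_def using tendsto_mult[OF tendsto_const LIMSEQ_inverse_real_of_nat, of \<delta>] by simp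
  have r\<delta>: "r m \<le> \<delta>" for m using \<delta> by (simp add: r_def mult_left_le inverse_le_1_iff)
  have "\<exists>\<kappa> :: nat \<Rightarrow> real^'n \<Rightarrow> real. \<forall>m. mollifier (r m) (\<kappa> m)"
    by (rule choice) (rule allI, rule mollifier_exists, rule rp)
  then obtain \<kappa> :: "nat \<Rightarrow> real^'n \<Rightarrow> real" where \<kappa>: "\<And>m. mollifier (r m) (\<kappa> m)" by (elim exE) (rule that, blast)
  have \<kappa>\<delta>: "mollifier \<delta> (\<kappa> m)" for m
    using \<kappa>[of m] r\<delta>[of m] unfolding mollifier_def by (meson order_trans)
  have t: "test_fun UNIV (\<kappa> m)" for m using \<kappa> by (simp add: mollifier_def)
  have Fi: "integrable lborel (F i)" for i
    by (rule integrable_if_square_bounded_support[OF Fm F2 _ K]) (use F0 in auto)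
  have cm: "conv (\<kappa> m) (F i) \<in> borel_measurable borel" for m i
    by (rule borel_measurable_continuous_onI[OF conv_continuous[OF t Fi]])
  obtain c N Hh where w: "\<And>n. tail_weights n (N n) (c n)" and Hh: "integrable lborel Hh"
    and ae: "AE x in lborel. \<forall>i. (\<forall>n. (\<Sum>m\<le>N n. c n m * conv (\<kappa> m) (F i) x)\<^sup>2 \<le> Hh x) \<and> convergent (\<lambda>n. \<Sum>m\<le>N n. c n m * conv (\<kappa> m) (F i) x)"
  proof (rule convex_combinations_converge[of "\<lambda>m i. conv (\<kappa> m) (F i)" lborel "\<Sum>i\<in>UNIV. \<integral>x. (F i x)\<^sup>2 \<partial>lborel"])
    show "(\<Sum>i\<in>UNIV. \<integral>x. (conv (\<kappa> n) (F i) x)\<^sup>2 \<partial>lborel) \<le> (\<Sum>i\<in>UNIV. \<integral>x. (F i x)\<^sup>2 \<partial>lborel)" for n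
      by (intro sum_mono conv_L2(2)[OF \<kappa>] Fi F2)
  qed (use cm conv_L2(1)[OF \<kappa> Fi F2] in auto)
  define v where "v n i x = (\<Sum>m\<le>N n. c n m * conv (\<kappa> m) (F i) x)" for n i x
  have vm: "v n i \<in> borel_measurable borel" for n i unfolding v_def[abs_def] using cm by measurable
  define L where "L i x = lim (\<lambda>n. v n i x)" for i x
  have Lm: "L i \<in> borel_measurable borel" for i
    unfolding L_def[abs_def] using vm by (rule borel_measurable_lim_metric)
  have ae': "AE x in lborel. \<forall>i. (\<forall>n. (v n i x)\<^sup>2 \<le> Hh x) \<and> (\<lambda>n. v n i x) \<longlonglongrightarrow> L i x"
    using ae by eventually_elim (simp add: v_def L_def convergent_LIMSEQ_iff)
  have aeL: "AE x in lborel. (L i x)\<^sup>2 \<le> Hh x" for i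
    using ae'
  proof eventually_elim
    case (elim x)
    then have "(\<lambda>n. (v n i x)\<^sup>2) \<longlonglongrightarrow> (L i x)\<^sup>2" by (intro tendsto_power) blast
    then show ?case by (rule LIMSEQ_le_const2) (use elim in blast)
  qed
  have eq: "AE x in lborel. L i x = F i x" for i
  proof -
    have "AE x in lborel. x \<in> UNIV \<longrightarrow> L i x - F i x = 0"
    proof (rule AE_on_open_if_AE_on_boxes[OF open_UNIV])
      fix a b :: "real^'n"
      define S where "S = cbox a b"
      define D where "D = (\<lambda>x. indicator (cbox a b) x * (L i x - F i x))"
      have Li: "integrable lborel (\<lambda>x. indicator (cbox a b) x * L i x)"
        by (rule integrable_if_square_bounded_support[OF _ Hh _ compact_cbox[of a b]])
          (use Lm aeL[of i] in \<open>auto elim!: eventually_mono simp: indicator_def order_trans[OF zero_le_power2]\<close>)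
      have Di: "integrable lborel D" unfolding D_def right_diff_distrib
        using integrable_real_mult_indicator[OF _ Fi[of i], of "cbox a b"] by (intro Bochner_Integration.integrable_diff Li) (auto simp: mult.commute)
      have "AE x in lborel. x \<in> box a b \<longrightarrow> D x = 0"
      proof (rule fundamental_lemma[OF open_box Di])
        fix \<phi> assume tb: "test_fun (box a b) \<phi>"
        then have t\<phi>: "test_fun UNIV \<phi>" by (simp add: test_fun_def)
        have sub: "closure {x. \<phi> x \<noteq> 0} \<subseteq> box a b" using tb by (simp add: test_fun_def)
        have \<phi>0: "\<phi> x = 0" if "x \<notin> cbox a b" for x
          using test_fun_vanishes[OF tb, of x] sub box_subset_cbox[of a b] that by blast
        note \<phi>m = test_fun_borel[OF t\<phi>]
        obtain M where M: "M \<ge> 0" "\<And>x. \<bar>\<phi> x\<bar> \<le> M" using test_fun_bounded[OF t\<phi>] by blast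
        have \<phi>2: "integrable lborel (\<lambda>x. (\<phi> x)\<^sup>2)"
        proof (rule Bochner_Integration.integrable_bound[where f = "\<lambda>x. M * \<phi> x"])
          show "AE x in lborel. norm ((\<phi> x)\<^sup>2) \<le> norm (M * \<phi> x)"
          proof (rule AE_I2)
            fix x
            have "\<bar>\<phi> x\<bar> * \<bar>\<phi> x\<bar> \<le> M * \<bar>\<phi> x\<bar>" by (intro mult_right_mono M) simp
            then show "norm ((\<phi> x)\<^sup>2) \<le> norm (M * \<phi> x)" using M(1) by (simp add: power2_eq_square abs_mult)
          qed
        qed (use test_fun_integrable[OF t\<phi>] \<phi>m in auto)
        have lim1: "(\<lambda>n. \<integral>x. \<phi> x * v n i x \<partial>lborel) \<longlonglongrightarrow> (\<integral>x. \<phi> x * L i x \<partial>lborel)"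
        proof (rule integral_dominated_convergence[where w = "\<lambda>x. (\<phi> x)\<^sup>2 + Hh x"])
          show "AE x in lborel. norm (\<phi> x * v n i x) \<le> (\<phi> x)\<^sup>2 + Hh x" for n
            using ae'
          proof eventually_elim
            case (elim x)
            then have "(v n i x)\<^sup>2 \<le> Hh x" by blast
            then show ?case using abs_mult_le_squares[of "\<phi> x" "v n i x"] unfolding real_norm_def by linarith
          qed
          show "AE x in lborel. (\<lambda>n. \<phi> x * v n i x) \<longlonglongrightarrow> \<phi> x * L i x"
            using ae' by eventually_elim (auto intro!: tendsto_intros)
        qed (use \<phi>2 Hh \<phi>m vm Lm in auto)
        have lim2: "(\<lambda>n. \<integral>x. \<phi> x * v n i x \<partial>lborel) \<longlonglongrightarrow> (\<integral>x. \<phi> x * F i x \<partial>lborel)"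
        proof (rule LIMSEQ_I)
          fix e :: real assume e: "e > 0"
          obtain r0 where r0': "r0 > 0" "\<And>r \<kappa>. r \<le> r0 \<Longrightarrow> mollifier r \<kappa> \<Longrightarrow> integrable lborel (\<lambda>x. \<phi> x * conv \<kappa> (F i) x) \<and>
             \<bar>(\<integral>x. \<phi> x * conv \<kappa> (F i) x \<partial>lborel) - (\<integral>x. \<phi> x * F i x \<partial>lborel)\<bar> \<le> e / 2"
            using conv_weak_approx[OF t\<phi> Fi[of i], of "e/2"] e by auto
          obtain n0 where n0: "\<And>m. m \<ge> n0 \<Longrightarrow> r m \<le> r0"
            using order_tendstoD(2)[OF r0 r0'(1)] unfolding eventually_sequentially by (meson less_imp_le)
          have ci: "integrable lborel (\<lambda>x. \<phi> x * conv (\<kappa> m) (F i) x)" for m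
          proof (rule Bochner_Integration.integrable_bound[where f = "\<lambda>x. (\<phi> x)\<^sup>2 + (conv (\<kappa> m) (F i) x)\<^sup>2"])
            show "integrable lborel (\<lambda>x. (\<phi> x)\<^sup>2 + (conv (\<kappa> m) (F i) x)\<^sup>2)"
              using \<phi>2 conv_L2(1)[OF \<kappa> Fi F2] by simp
            have "\<bar>p * q\<bar> \<le> \<bar>p\<^sup>2 + q\<^sup>2\<bar>" for p q :: real
              by (rule order_trans[OF abs_mult_le_squares abs_ge_self])
            then show "AE x in lborel. norm (\<phi> x * conv (\<kappa> m) (F i) x) \<le> norm ((\<phi> x)\<^sup>2 + (conv (\<kappa> m) (F i) x)\<^sup>2)" by simp
          qed (use \<phi>m cm in auto)
          have "norm ((\<integral>x. \<phi> x * v n i x \<partial>lborel) - (\<integral>x. \<phi> x * F i x \<partial>lborel)) < e" if n: "n \<ge> n0" for n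
          proof -
            have "(\<integral>x. \<phi> x * v n i x \<partial>lborel) = (\<integral>x. (\<Sum>m\<le>N n. c n m * (\<phi> x * conv (\<kappa> m) (F i) x)) \<partial>lborel)"
              by (simp add: v_def sum_distrib_left mult_ac)
            also have "\<dots> = (\<Sum>m\<le>N n. c n m * (\<integral>x. \<phi> x * conv (\<kappa> m) (F i) x \<partial>lborel))"
              using ci by (simp add: Bochner_Integration.integral_sum)
            finally have e1: "(\<integral>x. \<phi> x * v n i x \<partial>lborel) = (\<Sum>m\<le>N n. c n m * (\<integral>x. \<phi> x * conv (\<kappa> m) (F i) x \<partial>lborel))" .
            have "\<bar>(\<Sum>m\<le>N n. c n m * (\<integral>x. \<phi> x * conv (\<kappa> m) (F i) x \<partial>lborel)) - (\<integral>x. \<phi> x * F i x \<partial>lborel)\<bar> \<le> e / 2"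
              by (rule tail_weights_sum_close[OF w]) (use r0'(2)[OF n0 \<kappa>] n in auto)
            then show ?thesis unfolding e1 using e by simp
          qed
          then show "\<exists>n0. \<forall>n\<ge>n0. norm ((\<integral>x. \<phi> x * v n i x \<partial>lborel) - (\<integral>x. \<phi> x * F i x \<partial>lborel)) < e" by blast
        qed
        have LF: "(\<integral>x. \<phi> x * L i x \<partial>lborel) = (\<integral>x. \<phi> x * F i x \<partial>lborel)" by (rule LIMSEQ_unique[OF lim1 lim2])
        have i\<phi>: "integrable lborel (\<lambda>x. \<phi> x * h x)" if "integrable lborel h" for h :: "real^'n \<Rightarrow> real"
        proof (rule Bochner_Integration.integrable_bound[where f = "\<lambda>x. M * h x"])
          show "AE x in lborel. norm (\<phi> x * h x) \<le> norm (M * h x)"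
            using M by (intro AE_I2) (auto simp: abs_mult intro!: mult_right_mono order_trans[OF M(2)])
        qed (use that \<phi>m in auto)
        have "(\<integral>x. \<phi> x * D x \<partial>lborel) = (\<integral>x. \<phi> x * (indicator (cbox a b) x * L i x) - \<phi> x * F i x \<partial>lborel)"
          by (intro Bochner_Integration.integral_cong) (auto simp: D_def \<phi>0 indicator_def algebra_simps)
        also have "\<dots> = (\<integral>x. \<phi> x * (indicator (cbox a b) x * L i x) \<partial>lborel) - (\<integral>x. \<phi> x * F i x \<partial>lborel)"
          by (intro Bochner_Integration.integral_diff i\<phi> Li Fi)
        also have "(\<integral>x. \<phi> x * (indicator (cbox a b) x * L i x) \<partial>lborel) = (\<integral>x. \<phi> x * L i x \<partial>lborel)"
          by (intro Bochner_Integration.integral_cong) (auto simp: \<phi>0 indicator_def)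
        finally show "(\<integral>x. \<phi> x * D x \<partial>lborel) = 0" using LF by simp
      qed
      then show "AE x in lborel. x \<in> box a b \<longrightarrow> L i x - F i x = 0"
        by eventually_elim (use box_subset_cbox[of a b] in \<open>auto simp: D_def\<close>)
    qed
    then show ?thesis by eventually_elim simp
  qed
  have "AE x in lborel. \<forall>i\<in>UNIV. L i x = F i x" by (subst AE_ball_countable) (use eq in \<open>auto simp: countable_finite\<close>)
  with ae' have "AE x in lborel. \<forall>i. (\<forall>n. (v n i x)\<^sup>2 \<le> Hh x) \<and> (\<lambda>n. v n i x) \<longlonglongrightarrow> F i x" by eventually_elim auto
  then show ?thesis by (intro that[of \<kappa> N c Hh]) (use \<kappa>\<delta> w Hh in \<open>auto simp: v_def\<close>)
qed

section \<open>Approximation of the coefficients\<close>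

text \<open>Ellipticity and row sum bounds say that certain linear functionals of the matrix are at most some constant; in this form they
pass to averages.\<close>

definition matrix_functional :: "('n \<Rightarrow> 'n \<Rightarrow> real) \<Rightarrow> real^'n^'n \<Rightarrow> real" where
  "matrix_functional e M = (\<Sum>i\<in>UNIV. \<Sum>j\<in>UNIV. e i j * M $ i $ j)"

lemma quadratic_form_functional: "\<xi> \<bullet> (M *v \<xi>) = matrix_functional (\<lambda>i j. \<xi> $ i * \<xi> $ j) M"
  by (simp add: matrix_functional_def inner_vec_def matrix_vector_mult_def sum_distrib_left mult_ac)

lemma matrix_functional_minus: "matrix_functional (\<lambda>i j. - e i j) M = - matrix_functional e M"
  by (simp add: matrix_functional_def sum_negf)

lemma row_functional: "matrix_functional (\<lambda>i j. if i = i0 then e j else 0) M = (\<Sum>j\<in>UNIV. e j * M $ i0 $ j)"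
proof -
  have "(\<Sum>j\<in>UNIV. (if i = i0 then e j else 0) * M $ i $ j) = (if i = i0 then (\<Sum>j\<in>UNIV. e j * M $ i0 $ j) else 0)" for i by auto
  then show ?thesis by (simp add: matrix_functional_def)
qed

text \<open>A sum of absolute values is the maximum over all signed sums.\<close>

lemma rows_le_iff_functional:
  "rows_le c M \<longleftrightarrow> (\<forall>i0 e. (\<forall>j. \<bar>e j\<bar> \<le> 1) \<longrightarrow> matrix_functional (\<lambda>i j. if i = i0 then e j else 0) M \<le> c)"
proof
  assume r: "rows_le c M"
  show "\<forall>i0 e. (\<forall>j. \<bar>e j\<bar> \<le> 1) \<longrightarrow> matrix_functional (\<lambda>i j. if i = i0 then e j else 0) M \<le> c"
  proof (intro allI impI)
    fix i0 and e :: "'a \<Rightarrow> real" assume e: "\<forall>j. \<bar>e j\<bar> \<le> 1"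
    have "(\<Sum>j\<in>UNIV. e j * M $ i0 $ j) \<le> (\<Sum>j\<in>UNIV. \<bar>M $ i0 $ j\<bar>)"
    proof (rule sum_mono)
      fix j
      have "e j * M $ i0 $ j \<le> \<bar>e j\<bar> * \<bar>M $ i0 $ j\<bar>" by (simp add: abs_mult[symmetric])
      also have "\<dots> \<le> 1 * \<bar>M $ i0 $ j\<bar>" using e by (intro mult_right_mono) auto
      finally show "e j * M $ i0 $ j \<le> \<bar>M $ i0 $ j\<bar>" by simp
    qed
    then show "matrix_functional (\<lambda>i j. if i = i0 then e j else 0) M \<le> c"
      unfolding row_functional using r order_trans by blast
  qed
next
  assume f: "\<forall>i0 e. (\<forall>j. \<bar>e j\<bar> \<le> 1) \<longrightarrow> matrix_functional (\<lambda>i j. if i = i0 then e j else 0) M \<le> c"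
  show "rows_le c M"
  proof
    fix i
    have "matrix_functional (\<lambda>i' j. if i' = i then sgn (M $ i $ j) else 0) M \<le> c"
      using f by (auto simp: abs_sgn_eq)
    then show "(\<Sum>j\<in>UNIV. \<bar>M $ i $ j\<bar>) \<le> c" unfolding row_functional by (simp add: abs_sgn mult.commute)
  qed
qed

lemma conv_linear:
  fixes F :: "'i \<Rightarrow> real^'n \<Rightarrow> real"
  assumes t: "test_fun UNIV \<kappa>" and F: "\<And>i. integrable lborel (F i)"
  shows "conv \<kappa> (\<lambda>y. \<Sum>i\<in>I. e i * F i y) x = (\<Sum>i\<in>I. e i * conv \<kappa> (F i) x)"
proof -
  have "conv \<kappa> (\<lambda>y. \<Sum>i\<in>I. e i * F i y) x = (\<integral>y. (\<Sum>i\<in>I. e i * (\<kappa> (x - y) * F i y)) \<partial>lborel)"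
    unfolding conv_def by (simp add: sum_distrib_left mult_ac)
  also have "\<dots> = (\<Sum>i\<in>I. e i * conv \<kappa> (F i) x)"
    unfolding conv_def using conv_integrable[OF t F] by (subst Bochner_Integration.integral_sum) auto
  finally show ?thesis .
qed

lemma conv_le:
  assumes \<kappa>: "mollifier r \<kappa>" and F: "integrable lborel F" and le: "\<And>y. norm (x - y) < r \<Longrightarrow> F y \<le> b"
  shows "conv \<kappa> F x \<le> b"
proof -
  have t: "test_fun UNIV \<kappa>" and \<kappa>0: "\<And>x. \<kappa> x \<ge> 0" and k1: "integral\<^sup>L lborel \<kappa> = 1" and ks: "\<And>x. r \<le> norm x \<Longrightarrow> \<kappa> x = 0"
    using \<kappa> by (auto simp: mollifier_def)
  have i: "integrable lborel (\<lambda>y. \<kappa> (x - y))" by (rule integrable_reflect[OF test_fun_integrable[OF t]])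
  have "conv \<kappa> F x \<le> (\<integral>y. \<kappa> (x - y) * b \<partial>lborel)" unfolding conv_def
  proof (rule integral_mono)
    show "integrable lborel (\<lambda>y. \<kappa> (x - y) * F y)" by (rule conv_integrable[OF t F])
    show "integrable lborel (\<lambda>y. \<kappa> (x - y) * b)" using i by simp
    fix y
    show "\<kappa> (x - y) * F y \<le> \<kappa> (x - y) * b"
      using ks[of "x - y"] le[of y] \<kappa>0[of "x - y"] by (cases "norm (x - y) < r") (auto intro: mult_left_mono)
  qed
  also have "\<dots> = b" using integral_reflect[OF test_fun_borel[OF t], of x] k1 by simp
  finally show ?thesis .
qed

lemma conv_diff_le:
  assumes \<kappa>: "mollifier r \<kappa>" and F: "integrable lborel F"
    and le: "\<And>z. norm z < r \<Longrightarrow> F (x - z) - F (x' - z) \<le> b"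
  shows "conv \<kappa> F x - conv \<kappa> F x' \<le> b"
proof -
  have t: "test_fun UNIV \<kappa>" and \<kappa>0: "\<And>x. \<kappa> x \<ge> 0" and k1: "integral\<^sup>L lborel \<kappa> = 1" and ks: "\<And>x. r \<le> norm x \<Longrightarrow> \<kappa> x = 0"
    using \<kappa> by (auto simp: mollifier_def)
  have c: "conv \<kappa> F x = (\<integral>z. \<kappa> z * F (x - z) \<partial>lborel)" "integrable lborel (\<lambda>z. \<kappa> z * F (x - z))" for x
  proof -
    have i: "integrable lborel (\<lambda>y. \<kappa> (x - y) * F y)" by (rule conv_integrable[OF t F])
    show "integrable lborel (\<lambda>z. \<kappa> z * F (x - z))" using integrable_reflect[OF i, of x] by simp
    show "conv \<kappa> F x = (\<integral>z. \<kappa> z * F (x - z) \<partial>lborel)"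
      unfolding conv_def using integral_reflect[of "\<lambda>y. \<kappa> (x - y) * F y" x] i by simp
  qed
  have "conv \<kappa> F x - conv \<kappa> F x' = (\<integral>z. \<kappa> z * F (x - z) - \<kappa> z * F (x' - z) \<partial>lborel)" using c by simp
  also have "\<dots> \<le> (\<integral>z. \<kappa> z * b \<partial>lborel)"
  proof (rule integral_mono)
    show "integrable lborel (\<lambda>z. \<kappa> z * F (x - z) - \<kappa> z * F (x' - z))" using c by simp
    show "integrable lborel (\<lambda>z. \<kappa> z * b)" using test_fun_integrable[OF t] by simp
    fix z
    show "\<kappa> z * F (x - z) - \<kappa> z * F (x' - z) \<le> \<kappa> z * b"
      using ks[of z] mult_left_mono[OF le[of z] \<kappa>0[of z]] by (cases "norm z < r") (auto simp: right_diff_distrib)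
  qed
  also have "\<dots> = b" using k1 by simp
  finally show ?thesis .
qed

lemma has_partial_dilate:
  assumes "has_partial k F D (t *\<^sub>R x)"
  shows "has_partial k (\<lambda>x. F (t *\<^sub>R x)) (t *\<^sub>R D) x"
proof -
  have "((\<lambda>s. t * s) has_vector_derivative t) (at 0)"
    by (auto intro!: derivative_eq_intros simp: has_vector_derivative_def)
  moreover have "((\<lambda>s. F (t *\<^sub>R x + s *\<^sub>R axis k 1)) has_vector_derivative D) (at (t * 0))"
    using assms by (simp add: has_partial_def)
  ultimately show ?thesis
    using vector_diff_chain_at[of "\<lambda>s. t * s" t 0 "\<lambda>s. F (t *\<^sub>R x + s *\<^sub>R axis k 1)" D]
    by (simp add: has_partial_def o_def algebra_simps)
qed

lemma has_partial_le:
  fixes F :: "real^'n \<Rightarrow> real"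
  assumes D: "has_partial k F D x" and S: "open S" "x \<in> S"
    and le: "\<And>y. y \<in> S \<Longrightarrow> F y - F x \<le> b * norm (y - x)"
  shows "D \<le> b"
proof -
  have "((\<lambda>s. (F (x + s *\<^sub>R axis k 1) - F x) / s) \<longlongrightarrow> D) (at_right 0)"
    using D unfolding has_partial_def
    by (simp add: has_real_derivative_iff_has_vector_derivative[symmetric] DERIV_def filterlim_at_split)
  moreover have "\<forall>\<^sub>F s in at_right 0. (F (x + s *\<^sub>R axis k 1) - F x) / s \<le> b"
  proof -
    have "((\<lambda>s. x + s *\<^sub>R axis k (1::real)) \<longlongrightarrow> x + 0 *\<^sub>R axis k 1) (at_right 0)"
      by (intro tendsto_add tendsto_const tendsto_scaleR tendsto_ident_at)
    then have "\<forall>\<^sub>F s in at_right 0. x + s *\<^sub>R axis k 1 \<in> S" using S topological_tendstoD by fastforce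
    moreover have "\<forall>\<^sub>F s in at_right (0::real). s > 0" by (rule eventually_at_right_less)
    ultimately show ?thesis
    proof eventually_elim
      case (elim s)
      then show ?case using le[of "x + s *\<^sub>R axis k 1"] by (simp add: field_simps)
    qed
  qed
  ultimately show ?thesis by (rule tendsto_upperbound) simp
qed

text \<open>The matrix is averaged over a ball of radius \<open>s * \<delta>\<close> around \<open>(1 - s) * x\<close>. Contracting the argument by \<open>1 - s\<close> keeps the average inside the ball
where the assumptions hold; moreover for \<open>norm x \<ge> \<delta>\<close> all points used have norm at most \<open>norm x\<close>, so the distance to \<open>A 0\<close> is bounded by
\<open>\<theta>2 * norm x\<close> without loss. The derivatives are bounded by \<open>\<theta>2\<close>, and convex combinations of them converge.\<close>

lemma coefficient_approximation:
  fixes A :: "real^'n \<Rightarrow> real^'n^'n"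
  assumes \<theta>2: "\<theta>2 \<ge> 0" and \<delta>: "0 < \<delta>" "\<delta> \<le> \<rho>"
    and sA: "\<And>x. sym_mat (A x)" and eA: "\<And>x. x \<in> ball 0 \<rho> \<Longrightarrow> elliptic \<theta> (A x)"
    and lA: "\<And>x y. x \<in> ball 0 \<rho> \<Longrightarrow> y \<in> ball 0 \<rho> \<Longrightarrow> rows_le (\<theta>2 * norm (x - y)) (A x - A y)"
  obtains a da DA where
    "\<And>n k x. has_partial k (a n) (da n k x) x" "\<And>n. continuous_on UNIV (a n)" "\<And>n k. continuous_on UNIV (da n k)"
    "\<And>n x. x \<in> ball 0 \<rho> \<Longrightarrow> elliptic \<theta> (a n x)" "\<And>n x. sym_mat (a n x)"
    "\<And>n x. x \<in> ball 0 \<rho> \<Longrightarrow> \<delta> \<le> norm x \<Longrightarrow> rows_le (\<theta>2 * norm x) (a n x - A 0)"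
    "\<And>n k x. sym_mat (da n k x)" "\<And>n k x. x \<in> ball 0 \<rho> \<Longrightarrow> rows_le \<theta>2 (da n k x)"
    "\<And>x. x \<in> ball 0 \<rho> \<Longrightarrow> (\<lambda>n. a n x) \<longlonglongrightarrow> A x"
    "\<And>k i j. (\<lambda>x. DA k x $ i $ j :: real) \<in> borel_measurable borel"
    "AE x in lborel. x \<in> ball 0 \<rho> \<longrightarrow> (\<forall>k. (\<lambda>n. da n k x) \<longlonglongrightarrow> DA k x)"
proof -
  let ?B = "ball (0::real^'n) \<rho>"
  have \<rho>: "\<rho> > 0" using \<delta> by simp
  define Ab where "Ab i j x = (if x \<in> ?B then A x $ i $ j else 0)" for i j x
  have entry: "\<bar>A x $ i $ j - A y $ i $ j\<bar> \<le> \<theta>2 * norm (x - y)" if "x \<in> ?B" "y \<in> ?B" for x y i j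
  proof -
    have "\<bar>(A x - A y) $ i $ j\<bar> \<le> (\<Sum>j\<in>UNIV. \<bar>(A x - A y) $ i $ j\<bar>)"
      by (rule member_le_sum[of j UNIV "\<lambda>j. \<bar>(A x - A y) $ i $ j\<bar>"]) auto
    then show ?thesis using lA[OF that] order_trans by fastforce
  qed
  have cA: "continuous_on ?B (\<lambda>x. A x $ i $ j)" for i j
  proof (rule continuous_onI)
    fix x e assume x: "x \<in> ?B" and e: "(e::real) > 0"
    show "\<exists>d>0. \<forall>x'\<in>?B. dist x' x < d \<longrightarrow> dist (A x' $ i $ j) (A x $ i $ j) \<le> e"
    proof (intro exI[of _ "e / (\<theta>2 + 1)"] conjI ballI impI)
      show "e / (\<theta>2 + 1) > 0" using e \<theta>2 by simp
      fix x' assume x': "x' \<in> ?B" and d: "dist x' x < e / (\<theta>2 + 1)"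
      have "dist (A x' $ i $ j) (A x $ i $ j) \<le> \<theta>2 * dist x' x" using entry[OF x' x] by (simp add: dist_norm)
      also have "\<dots> \<le> (\<theta>2 + 1) * (e / (\<theta>2 + 1))" using d \<theta>2 by (intro mult_mono) auto
      finally show "dist (A x' $ i $ j) (A x $ i $ j) \<le> e" using \<theta>2 by simp
    qed
  qed
  have iB: "integrable lborel (indicator ?B :: real^'n \<Rightarrow> real)"
    by (intro integrable_real_indicator) (use emeasure_bounded_finite[OF bounded_ball, of "0::real^'n" \<rho>] in auto)
  have Ai: "integrable lborel (Ab i j)" for i j
  proof (rule Bochner_Integration.integrable_bound[where f = "\<lambda>x. (\<bar>A 0 $ i $ j\<bar> + \<theta>2 * \<rho>) * indicator ?B x"])
    show "integrable lborel (\<lambda>x. (\<bar>A 0 $ i $ j\<bar> + \<theta>2 * \<rho>) * indicator ?B x)" using iB by simp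
    have "(\<lambda>x. indicator ?B x *\<^sub>R (A x $ i $ j)) \<in> borel_measurable borel"
      by (rule borel_measurable_continuous_on_indicator[OF _ cA]) simp
    moreover have "Ab i j = (\<lambda>x. indicator ?B x *\<^sub>R (A x $ i $ j))" by (auto simp: Ab_def fun_eq_iff)
    ultimately show "Ab i j \<in> borel_measurable lborel" by simp
    show "AE x in lborel. norm (Ab i j x) \<le> norm ((\<bar>A 0 $ i $ j\<bar> + \<theta>2 * \<rho>) * indicator ?B x)"
    proof (rule AE_I2)
      fix x show "norm (Ab i j x) \<le> norm ((\<bar>A 0 $ i $ j\<bar> + \<theta>2 * \<rho>) * indicator ?B x)"
      proof (cases "x \<in> ?B")
        case True
        have "\<bar>A x $ i $ j - A 0 $ i $ j\<bar> \<le> \<theta>2 * norm x" using entry[OF True, of 0] \<rho> by simp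
        also have "\<dots> \<le> \<theta>2 * \<rho>" using True \<theta>2 by (intro mult_left_mono) auto
        finally show ?thesis using True \<theta>2 \<rho> by (simp add: Ab_def)
      qed (simp add: Ab_def)
    qed
  qed
  \<comment> \<open>two successors keep the contraction factor \<open>1 - s m\<close> positive\<close>
  define s where "s m = inverse (real (Suc (Suc m)))" for m
  have s: "0 < s m" "s m < 1" for m by (auto simp: s_def inverse_less_1_iff)
  have s0: "s \<longlonglongrightarrow> 0" unfolding s_def by (rule LIMSEQ_Suc[OF LIMSEQ_inverse_real_of_nat])
  have rp: "s m * \<delta> > 0" for m using s \<delta> by simp
  have "\<exists>\<kappa> :: nat \<Rightarrow> real^'n \<Rightarrow> real. \<forall>m. mollifier (s m * \<delta>) (\<kappa> m)"
    by (rule choice) (rule allI, rule mollifier_exists, rule rp)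
  then obtain \<kappa> :: "nat \<Rightarrow> real^'n \<Rightarrow> real" where \<kappa>: "\<And>m. mollifier (s m * \<delta>) (\<kappa> m)" by (elim exE) (rule that, blast)
  have t: "test_fun UNIV (\<kappa> m)" for m using \<kappa> by (simp add: mollifier_def)
  have t': "test_fun UNIV (partial_deriv k (\<kappa> m))" for m k by (rule test_fun_partial_deriv[OF t])
  define am :: "nat \<Rightarrow> real^'n \<Rightarrow> real^'n^'n" where "am m x = (\<chi> i j. conv (\<kappa> m) (Ab i j) ((1 - s m) *\<^sub>R x))" for m x
  define dam :: "nat \<Rightarrow> 'n \<Rightarrow> real^'n \<Rightarrow> real^'n^'n" where
    "dam m k x = (\<chi> i j. (1 - s m) * conv (partial_deriv k (\<kappa> m)) (Ab i j) ((1 - s m) *\<^sub>R x))" for m k x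
  have hp: "has_partial k (\<lambda>x. am m x $ i $ j) (dam m k x $ i $ j) x" for m k x i j
    using has_partial_dilate[OF conv_has_partial[OF t[of m] Ai[of i j]], of k "1 - s m" x] by (simp add: am_def dam_def)
  have ca: "continuous_on UNIV (\<lambda>x. am m x $ i $ j)" for m i j
    unfolding am_def by (simp, intro continuous_on_compose2[OF conv_continuous[OF t Ai]] continuous_intros) auto
  have cda: "continuous_on UNIV (\<lambda>x. dam m k x $ i $ j)" for m k i j
    unfolding dam_def by (simp, intro continuous_intros continuous_on_compose2[OF conv_continuous[OF t' Ai]]) auto
  have near: "y \<in> ?B" "norm y \<le> (1 - s m) * norm x + s m * \<delta>" "norm (y - x) \<le> 2 * \<rho> * s m"
    if x: "x \<in> ?B" and y: "norm ((1 - s m) *\<^sub>R x - y) < s m * \<delta>" for x y m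
  proof -
    have ns: "norm ((1 - s m) *\<^sub>R x) = (1 - s m) * norm x" "norm (s m *\<^sub>R x) = s m * norm x" using s[of m] by simp_all
    have n: "norm y \<le> norm ((1 - s m) *\<^sub>R x) + norm ((1 - s m) *\<^sub>R x - y)"
      using norm_triangle_ineq4[of "(1 - s m) *\<^sub>R x" "(1 - s m) *\<^sub>R x - y"] by simp
    then show n1: "norm y \<le> (1 - s m) * norm x + s m * \<delta>" using y unfolding ns by linarith
    have "norm y < (1 - s m) * norm x + s m * \<delta>" using n y unfolding ns by linarith
    also have "\<dots> \<le> (1 - s m) * \<rho> + s m * \<rho>" using x \<delta> s[of m] by (intro add_mono mult_left_mono) auto
    finally show "y \<in> ?B" by (simp add: algebra_simps)
    have "norm (y - x) \<le> norm (y - (1 - s m) *\<^sub>R x) + norm (s m *\<^sub>R x)"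
      using norm_triangle_ineq4[of "y - (1 - s m) *\<^sub>R x" "s m *\<^sub>R x"] by (simp add: algebra_simps)
    also have "\<dots> \<le> s m * \<delta> + s m * norm x" using y unfolding ns norm_minus_commute[of y] by linarith
    also have "\<dots> \<le> s m * \<rho> + s m * \<rho>" using x \<delta> s[of m] by (intro add_mono mult_left_mono) auto
    finally show "norm (y - x) \<le> 2 * \<rho> * s m" by simp
  qed
  \<comment> \<open>a linear inequality for the matrices near a point passes to their averages\<close>
  have fi: "integrable lborel (\<lambda>y. matrix_functional e (\<chi> i j. Ab i j y))" for e
    unfolding matrix_functional_def using Ai by (auto intro!: Bochner_Integration.integrable_sum)
  have fl: "matrix_functional e (am m x) = conv (\<kappa> m) (\<lambda>y. matrix_functional e (\<chi> i j. Ab i j y)) ((1 - s m) *\<^sub>R x)" for e m x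
  proof -
    define p where "p = (1 - s m) *\<^sub>R x"
    have "conv (\<kappa> m) (\<lambda>y. matrix_functional e (\<chi> i j. Ab i j y)) p = conv (\<kappa> m) (\<lambda>y. \<Sum>i\<in>UNIV. 1 * (\<Sum>j\<in>UNIV. e i j * Ab i j y)) p"
      by (simp add: matrix_functional_def)
    also have "\<dots> = (\<Sum>i\<in>UNIV. 1 * conv (\<kappa> m) (\<lambda>y. \<Sum>j\<in>UNIV. e i j * Ab i j y) p)"
      by (rule conv_linear[OF t]) (intro Bochner_Integration.integrable_sum integrable_mult_right Ai)
    also have "\<dots> = (\<Sum>i\<in>UNIV. 1 * (\<Sum>j\<in>UNIV. e i j * conv (\<kappa> m) (Ab i j) p))"
      by (simp only: conv_linear[OF t Ai])
    finally show ?thesis by (simp add: p_def matrix_functional_def am_def)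
  qed
  have fAb: "matrix_functional e (\<chi> i j. Ab i j y) = matrix_functional e (A y)" if "y \<in> ?B" for e y
    using that by (simp add: matrix_functional_def Ab_def)
  have av: "matrix_functional e (am m x) \<le> b"
    if x: "x \<in> ?B" and le: "\<And>y. y \<in> ?B \<Longrightarrow> norm y \<le> (1 - s m) * norm x + s m * \<delta> \<Longrightarrow> norm (y - x) \<le> 2 * \<rho> * s m \<Longrightarrow> matrix_functional e (A y) \<le> b" for e m x b
    unfolding fl
  proof (rule conv_le[OF \<kappa> fi])
    fix y assume "norm ((1 - s m) *\<^sub>R x - y) < s m * \<delta>"
    note n = near[OF x this]
    show "matrix_functional e (\<chi> i j. Ab i j y) \<le> b" unfolding fAb[OF n(1)] by (rule le[OF n])
  qed
  have dav: "matrix_functional (\<lambda>i j. if i = i0 then e j else 0) (dam m k x) \<le> \<theta>2"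
    if x: "x \<in> ?B" and e: "\<forall>j. \<bar>e j\<bar> \<le> 1" for e i0 m k x
  proof (rule has_partial_le)
    let ?e = "\<lambda>i j. if i = i0 then e j else 0"
    have "has_partial k (\<lambda>x. \<Sum>j\<in>UNIV. e j * am m x $ i0 $ j) (\<Sum>j\<in>UNIV. e j * dam m k x $ i0 $ j) x"
      unfolding has_partial_def
      by (rule has_vector_derivative_sum) (use hp in \<open>auto simp: has_partial_def intro!: has_vector_derivative_mult_right\<close>)
    then show "has_partial k (\<lambda>x. matrix_functional ?e (am m x)) (matrix_functional ?e (dam m k x)) x"
      unfolding row_functional .
    show "open ?B" by simp
    show "x \<in> ?B" by (rule x)
    fix y assume y: "y \<in> ?B"
    show "matrix_functional ?e (am m y) - matrix_functional ?e (am m x) \<le> \<theta>2 * norm (y - x)"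
      unfolding fl
    proof (rule conv_diff_le[OF \<kappa> fi])
      fix z :: "real^'n" assume z: "norm z < s m * \<delta>"
      have B: "(1 - s m) *\<^sub>R y - z \<in> ?B" "(1 - s m) *\<^sub>R x - z \<in> ?B"
        using near(1)[OF y, of m "(1 - s m) *\<^sub>R y - z"] near(1)[OF x, of m "(1 - s m) *\<^sub>R x - z"] z by simp_all
      have "matrix_functional ?e (A ((1 - s m) *\<^sub>R y - z)) - matrix_functional ?e (A ((1 - s m) *\<^sub>R x - z))
          = matrix_functional ?e (A ((1 - s m) *\<^sub>R y - z) - A ((1 - s m) *\<^sub>R x - z))"
        unfolding row_functional by (simp add: sum_subtractf right_diff_distrib)
      also have "\<dots> \<le> \<theta>2 * norm (((1 - s m) *\<^sub>R y - z) - ((1 - s m) *\<^sub>R x - z))"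
        using lA[OF B] e unfolding rows_le_iff_functional by blast
      also have "((1 - s m) *\<^sub>R y - z) - ((1 - s m) *\<^sub>R x - z) = (1 - s m) *\<^sub>R (y - x)" by (simp add: scaleR_diff_right)
      also have "\<theta>2 * norm ((1 - s m) *\<^sub>R (y - x)) \<le> \<theta>2 * norm (y - x)"
        using s[of m] \<theta>2 by (intro mult_left_mono) (auto intro!: mult_left_le_one_le)
      finally show "matrix_functional ?e (\<chi> i j. Ab i j ((1 - s m) *\<^sub>R y - z)) - matrix_functional ?e (\<chi> i j. Ab i j ((1 - s m) *\<^sub>R x - z)) \<le> \<theta>2 * norm (y - x)"
        by (simp only: fAb[OF B(1)] fAb[OF B(2)])
    qed
  qed
  have dentry: "\<bar>dam m k x $ i $ j\<bar> \<le> \<theta>2" if "x \<in> ?B" for m k x i j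
  proof -
    have "rows_le \<theta>2 (dam m k x)" unfolding rows_le_iff_functional using dav[OF that] by blast
    moreover have "\<bar>dam m k x $ i $ j\<bar> \<le> (\<Sum>j\<in>UNIV. \<bar>dam m k x $ i $ j\<bar>)"
      by (rule member_le_sum[of j UNIV "\<lambda>j. \<bar>dam m k x $ i $ j\<bar>"]) auto
    ultimately show ?thesis using order_trans by blast
  qed
  define z where "z m p x = indicator ?B x * dam m (fst p) x $ fst (snd p) $ snd (snd p)" for m and p :: "'n \<times> 'n \<times> 'n" and x
  have zm: "z m p \<in> borel_measurable borel" for m p
    unfolding z_def using borel_measurable_continuous_onI[OF cda] by (intro borel_measurable_times borel_measurable_indicator) auto
  have zb: "(z m p x)\<^sup>2 \<le> \<theta>2\<^sup>2 * indicator ?B x" for m p x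
    using dentry[of x m "fst p" "fst (snd p)" "snd (snd p)"] abs_le_square_iff[of "dam m (fst p) x $ fst (snd p) $ snd (snd p)" \<theta>2] \<theta>2
    by (cases "x \<in> ?B") (auto simp: z_def)
  have z2: "integrable lborel (\<lambda>x. (z m p x)\<^sup>2)" for m p
    by (rule Bochner_Integration.integrable_bound[where f = "\<lambda>x. \<theta>2\<^sup>2 * indicator ?B x"])
      (use iB zm zb in \<open>auto intro!: AE_I2\<close>)
  obtain c N Hh where w: "\<And>n. tail_weights n (N n) (c n)"
    and ae: "AE x in lborel. \<forall>p. (\<forall>n. (\<Sum>m\<le>N n. c n m * z m p x)\<^sup>2 \<le> Hh x) \<and> convergent (\<lambda>n. \<Sum>m\<le>N n. c n m * z m p x)"
  proof (rule convex_combinations_converge[of z lborel "\<Sum>p\<in>(UNIV::('n \<times> 'n \<times> 'n) set). \<integral>x. \<theta>2\<^sup>2 * indicator ?B x \<partial>lborel"])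
    show "(\<Sum>p\<in>UNIV. \<integral>x. (z n p x)\<^sup>2 \<partial>lborel) \<le> (\<Sum>p\<in>(UNIV::('n \<times> 'n \<times> 'n) set). \<integral>x. \<theta>2\<^sup>2 * indicator ?B x \<partial>lborel)" for n
      by (intro sum_mono integral_mono z2 zb) (use iB in simp)
  qed (use zm z2 in auto)
  define a :: "nat \<Rightarrow> real^'n \<Rightarrow> real^'n^'n" where "a n x = (\<chi> i j. \<Sum>m\<le>N n. c n m * am m x $ i $ j)" for n x
  define da :: "nat \<Rightarrow> 'n \<Rightarrow> real^'n \<Rightarrow> real^'n^'n" where "da n k x = (\<chi> i j. \<Sum>m\<le>N n. c n m * dam m k x $ i $ j)" for n k x
  define DA :: "'n \<Rightarrow> real^'n \<Rightarrow> real^'n^'n" where "DA k x = (\<chi> i j. lim (\<lambda>n. \<Sum>m\<le>N n. c n m * z m (k, i, j) x))" for k x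
  have mf_a: "matrix_functional e (\<chi> i j. \<Sum>m\<le>N n. c n m * M m $ i $ j) = (\<Sum>m\<le>N n. c n m * matrix_functional e (M m))" for e n and M :: "nat \<Rightarrow> real^'n^'n"
  proof -
    have "matrix_functional e (\<chi> i j. \<Sum>m\<le>N n. c n m * M m $ i $ j) = (\<Sum>i\<in>UNIV. \<Sum>j\<in>UNIV. \<Sum>m\<le>N n. c n m * (e i j * M m $ i $ j))"
      by (simp add: matrix_functional_def sum_distrib_left mult_ac)
    also have "\<dots> = (\<Sum>m\<le>N n. \<Sum>i\<in>UNIV. \<Sum>j\<in>UNIV. c n m * (e i j * M m $ i $ j))"
    proof -
      have "(\<Sum>i\<in>UNIV. \<Sum>j\<in>UNIV. \<Sum>m\<le>N n. c n m * (e i j * M m $ i $ j)) = (\<Sum>i\<in>UNIV. \<Sum>m\<le>N n. \<Sum>j\<in>UNIV. c n m * (e i j * M m $ i $ j))"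
        by (intro sum.cong refl) (rule sum.swap)
      also have "\<dots> = (\<Sum>m\<le>N n. \<Sum>i\<in>UNIV. \<Sum>j\<in>UNIV. c n m * (e i j * M m $ i $ j))" by (rule sum.swap)
      finally show ?thesis .
    qed
    finally show ?thesis by (simp add: matrix_functional_def sum_distrib_left)
  qed
  have a_le: "matrix_functional e (a n x) \<le> b"
    if x: "x \<in> ?B" and le: "\<And>m y. y \<in> ?B \<Longrightarrow> norm y \<le> (1 - s m) * norm x + s m * \<delta> \<Longrightarrow> matrix_functional e (A y) \<le> b" for e n x b
    unfolding a_def mf_a by (rule tail_weights_sum_le[OF w], rule av[OF x], rule le)
  show thesis
  proof (rule that[of a da DA])
    show "has_partial k (a n) (da n k x) x" for n k x
      by (intro has_partial_vec) (simp add: a_def da_def has_partial_weighted_sum hp)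
    show "continuous_on UNIV (a n)" for n
      unfolding a_def by (intro continuous_on_vec_lambda continuous_on_sum continuous_on_mult continuous_on_const ca)
    show "continuous_on UNIV (da n k)" for n k
      unfolding da_def by (intro continuous_on_vec_lambda continuous_on_sum continuous_on_mult continuous_on_const cda)
    show "elliptic \<theta> (a n x)" if x: "x \<in> ?B" for n x
    proof (intro allI conjI)
      fix \<xi>
      show "\<xi> \<bullet> (a n x *v \<xi>) \<le> \<theta> * (norm \<xi>)\<^sup>2" unfolding quadratic_form_functional
        by (rule a_le[OF x]) (use eA in \<open>simp add: quadratic_form_functional[symmetric]\<close>)
      have "matrix_functional (\<lambda>i j. - (\<xi> $ i * \<xi> $ j)) (a n x) \<le> - (inverse \<theta> * (norm \<xi>)\<^sup>2)"
        by (rule a_le[OF x]) (use eA in \<open>simp add: matrix_functional_minus quadratic_form_functional[symmetric]\<close>)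
      then show "inverse \<theta> * (norm \<xi>)\<^sup>2 \<le> \<xi> \<bullet> (a n x *v \<xi>)"
        unfolding matrix_functional_minus quadratic_form_functional by simp
    qed
    have AbS: "Ab i j = Ab j i" for i j using sA by (auto simp: Ab_def fun_eq_iff)
    show "sym_mat (a n x)" for n x
    proof (intro allI)
      fix i j show "a n x $ i $ j = a n x $ j $ i" unfolding a_def am_def using AbS[of i j] by simp
    qed
    show "sym_mat (da n k x)" for n k x
    proof (intro allI)
      fix i j show "da n k x $ i $ j = da n k x $ j $ i" unfolding da_def dam_def using AbS[of i j] by simp
    qed
    show "rows_le (\<theta>2 * norm x) (a n x - A 0)" if x: "x \<in> ?B" "\<delta> \<le> norm x" for n x
      unfolding rows_le_iff_functional
    proof (intro allI impI)
      fix i0 :: 'n and e :: "'n \<Rightarrow> real" assume e: "\<forall>j. \<bar>e j\<bar> \<le> 1"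
      let ?e = "\<lambda>i j. if i = i0 then e j else 0"
      have lin: "matrix_functional ?e (M - M') = matrix_functional ?e M - matrix_functional ?e M'" for M M'
        unfolding row_functional by (simp add: sum_subtractf right_diff_distrib)
      have "matrix_functional ?e (a n x) \<le> matrix_functional ?e (A 0) + \<theta>2 * norm x"
      proof (rule a_le[OF x(1)])
        fix m and y :: "real^'n" assume y: "y \<in> ?B" "norm y \<le> (1 - s m) * norm x + s m * \<delta>"
        have "matrix_functional ?e (A y - A 0) \<le> \<theta>2 * norm (y - 0)"
          using lA[OF y(1), of 0] \<rho> e unfolding rows_le_iff_functional by simp
        moreover have "norm y \<le> norm x"
        proof -
          have "s m * \<delta> \<le> s m * norm x" using x s[of m] by (intro mult_left_mono) auto
          then show ?thesis using y(2) by (simp add: algebra_simps)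
        qed
        then have "\<theta>2 * norm y \<le> \<theta>2 * norm x" using \<theta>2 by (intro mult_left_mono) auto
        ultimately show "matrix_functional ?e (A y) \<le> matrix_functional ?e (A 0) + \<theta>2 * norm x" unfolding lin by simp
      qed
      then show "matrix_functional ?e (a n x - A 0) \<le> \<theta>2 * norm x" unfolding lin by simp
    qed
    show "rows_le \<theta>2 (da n k x)" if x: "x \<in> ?B" for n k x
      unfolding rows_le_iff_functional da_def mf_a
      by (intro allI impI tail_weights_sum_le[OF w]) (use dav[OF x] in blast)
    show "(\<lambda>n. a n x) \<longlonglongrightarrow> A x" if x: "x \<in> ?B" for x
    proof (intro vec_tendstoI)
      fix i j
      have b: "matrix_functional (\<lambda>i' j'. e * (if i' = i \<and> j' = j then 1 else 0)) M = e * M $ i $ j" for e and M :: "real^'n^'n"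
      proof -
        have "(\<Sum>j'\<in>UNIV. e * (if i' = i \<and> j' = j then 1 else 0) * M $ i' $ j') = (if i' = i then e * M $ i $ j else 0)" for i'
          by (cases "i' = i") (auto simp: if_distrib[of "\<lambda>x. _ * x"] if_distrib[of "\<lambda>x. x * _"] cong: if_cong)
        then show ?thesis by (simp add: matrix_functional_def)
      qed
      have bound: "\<bar>am m x $ i $ j - A x $ i $ j\<bar> \<le> \<theta>2 * (2 * \<rho> * s m)" for m
      proof -
        have "e * am m x $ i $ j \<le> e * A x $ i $ j + \<theta>2 * (2 * \<rho> * s m)" if "\<bar>e\<bar> = 1" for e :: real
          unfolding b[symmetric]
        proof (rule av[OF x])
          fix y assume y: "y \<in> ?B" "norm (y - x) \<le> 2 * \<rho> * s m"
          have "e * (A y $ i $ j - A x $ i $ j) \<le> \<bar>e\<bar> * \<bar>A y $ i $ j - A x $ i $ j\<bar>" by (simp add: abs_mult[symmetric])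
          also have "\<dots> \<le> \<theta>2 * norm (y - x)" using entry[OF y(1) x] that by simp
          also have "\<dots> \<le> \<theta>2 * (2 * \<rho> * s m)" using y \<theta>2 by (intro mult_left_mono) auto
          finally show "matrix_functional (\<lambda>i' j'. e * (if i' = i \<and> j' = j then 1 else 0)) (A y)
             \<le> matrix_functional (\<lambda>i' j'. e * (if i' = i \<and> j' = j then 1 else 0)) (A x) + \<theta>2 * (2 * \<rho> * s m)"
            unfolding b by (simp add: right_diff_distrib)
        qed
        from this[of 1] this[of "-1"] show ?thesis by (simp add: abs_le_iff)
      qed
      have "(\<lambda>m. \<theta>2 * (2 * \<rho> * s m)) \<longlonglongrightarrow> \<theta>2 * (2 * \<rho> * 0)" by (intro tendsto_intros s0)
      then have z: "(\<lambda>m. \<theta>2 * (2 * \<rho> * s m)) \<longlonglongrightarrow> 0" by simp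
      have "(\<lambda>m. am m x $ i $ j - A x $ i $ j) \<longlonglongrightarrow> 0"
        by (rule Lim_null_comparison[OF always_eventually z]) (use bound in simp)
      then have "(\<lambda>m. am m x $ i $ j) \<longlonglongrightarrow> A x $ i $ j" by (simp add: LIM_zero_iff)
      then show "(\<lambda>n. a n x $ i $ j) \<longlonglongrightarrow> A x $ i $ j" unfolding a_def by (simp add: tail_weights_tendsto[OF w])
    qed
    show "(\<lambda>x. DA k x $ i $ j) \<in> borel_measurable borel" for k i j
      unfolding DA_def vec_lambda_beta
      by (rule borel_measurable_lim_metric) (intro borel_measurable_sum borel_measurable_times borel_measurable_const zm)
    show "AE x in lborel. x \<in> ?B \<longrightarrow> (\<forall>k. (\<lambda>n. da n k x) \<longlonglongrightarrow> DA k x)"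
      using ae
    proof eventually_elim
      case (elim x)
      show ?case
      proof (intro impI allI vec_tendstoI)
        fix k i j assume x: "x \<in> ?B"
        have "(\<lambda>n. \<Sum>m\<le>N n. c n m * z m (k, i, j) x) \<longlonglongrightarrow> DA k x $ i $ j"
          using elim by (simp add: DA_def convergent_LIMSEQ_iff[symmetric])
        then show "(\<lambda>n. da n k x $ i $ j) \<longlonglongrightarrow> DA k x $ i $ j" using x by (simp add: da_def z_def)
      qed
    qed
  qed
qed

section \<open>Approximation of functions with weak derivatives\<close>

text \<open>\<open>G\<close> and \<open>H\<close> are the first and second weak derivatives of \<open>U\<close> on the whole space, in real form.\<close>

definition weak_partials :: "(real^'n \<Rightarrow> real) \<Rightarrow> ('n \<Rightarrow> real^'n \<Rightarrow> real) \<Rightarrow> ('n \<Rightarrow> 'n \<Rightarrow> real^'n \<Rightarrow> real) \<Rightarrow> bool" where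
  "weak_partials U G H \<longleftrightarrow> (\<forall>\<phi>. test_fun UNIV \<phi> \<longrightarrow>
     (\<forall>k. (\<integral>y. partial_deriv k \<phi> y * U y \<partial>lborel) = - (\<integral>y. \<phi> y * G k y \<partial>lborel)) \<and>
     (\<forall>k l. (\<integral>y. partial_deriv k \<phi> y * G l y \<partial>lborel) = - (\<integral>y. \<phi> y * H k l y \<partial>lborel)))"

definition square_integrable_on :: "(real^'n) set \<Rightarrow> (real^'n \<Rightarrow> real) \<Rightarrow> bool" where
  "square_integrable_on K f \<longleftrightarrow> f \<in> borel_measurable borel \<and> integrable lborel (\<lambda>x. (f x)\<^sup>2) \<and> (\<forall>x. x \<notin> K \<longrightarrow> f x = 0)"

text \<open>The function and all its first and second derivatives form one finite family, which is mollified with common kernels and common weights.\<close>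

lemma smooth_approximation:
  fixes U :: "real^'n \<Rightarrow> real" and G :: "'n \<Rightarrow> real^'n \<Rightarrow> real" and H :: "'n \<Rightarrow> 'n \<Rightarrow> real^'n \<Rightarrow> real"
  assumes K: "compact K" and \<delta>: "\<delta> > 0"
    and L2: "square_integrable_on K U" "\<And>k. square_integrable_on K (G k)" "\<And>k l. square_integrable_on K (H k l)"
    and w: "weak_partials U G H"
  obtains u u1 u2 Hh where
    "\<And>n k x. has_partial k (u n) (u1 n x $ k) x" "\<And>n k x. has_partial k (u1 n) (u2 n k x :: real^'n) x"
    "\<And>n k l x. u2 n k x $ l = u2 n l x $ k"
    "\<And>n. continuous_on UNIV (u n)" "\<And>n. continuous_on UNIV (u1 n)" "\<And>n k. continuous_on UNIV (u2 n k)"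
    "\<And>n x. (\<And>y. y \<in> K \<Longrightarrow> \<delta> \<le> norm (x - y)) \<Longrightarrow> u n x = 0 \<and> u1 n x = 0 \<and> (\<forall>k. u2 n k x = 0)"
    "integrable lborel Hh"
    "AE x in lborel. (\<lambda>n. u n x) \<longlonglongrightarrow> U x \<and> (\<lambda>n. u1 n x) \<longlonglongrightarrow> (\<chi> k. G k x) \<and> (\<forall>k. (\<lambda>n. u2 n k x) \<longlonglongrightarrow> (\<chi> l. H k l x))"
    "AE x in lborel. \<forall>n. (u n x)\<^sup>2 \<le> Hh x \<and> (norm (u1 n x))\<^sup>2 \<le> Hh x \<and> (\<forall>k. (norm (u2 n k x))\<^sup>2 \<le> Hh x)"
proof -
  define F :: "'n option \<times> 'n option \<Rightarrow> real^'n \<Rightarrow> real" where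
    "F p = (case p of (None, _) \<Rightarrow> U | (Some k, None) \<Rightarrow> G k | (Some k, Some l) \<Rightarrow> H k l)" for p
  have F: "F p \<in> borel_measurable borel" "integrable lborel (\<lambda>x. (F p x)\<^sup>2)" "\<And>x. x \<notin> K \<Longrightarrow> F p x = 0" for p
    using L2 by (auto simp: F_def square_integrable_on_def split: option.splits prod.splits)
  obtain \<kappa> c N Hh where \<kappa>: "\<And>m. mollifier \<delta> (\<kappa> m)" and c: "\<And>n. tail_weights n (N n) (c n)" and Hh: "integrable lborel Hh"
    and ae: "AE x in lborel. \<forall>i. (\<forall>n. (\<Sum>m\<le>N n. c n m * conv (\<kappa> m) (F i) x)\<^sup>2 \<le> Hh x) \<and> (\<lambda>n. \<Sum>m\<le>N n. c n m * conv (\<kappa> m) (F i) x) \<longlonglongrightarrow> F i x"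
  proof (rule mollify_family[OF K \<delta>, of F])
    show "F p \<in> borel_measurable borel" "integrable lborel (\<lambda>x. (F p x)\<^sup>2)" for p by (fact F(1) F(2))+
    show "F p x = 0" if "x \<notin> K" for p x by (rule F(3)[OF that])
  qed (rule that)
  have t: "test_fun UNIV (\<kappa> m)" for m using \<kappa> by (simp add: mollifier_def)
  have t': "test_fun UNIV (partial_deriv k (\<kappa> m))" for m k by (rule test_fun_partial_deriv[OF t])
  have Fi: "integrable lborel (F p)" for p
    by (rule integrable_if_square_bounded_support[OF F(1) F(2) _ K]) (use F(3) in auto)
  define v where "v n p x = (\<Sum>m\<le>N n. c n m * conv (\<kappa> m) (F p) x)" for n p x
  have cv: "continuous_on UNIV (v n p)" for n p
    unfolding v_def[abs_def] by (intro continuous_intros conv_continuous[OF t Fi])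
  have cp: "conv (partial_deriv k (\<kappa> m)) (F (None, q)) x = conv (\<kappa> m) (F (Some k, None)) x" for k m x q
    by (rule conv_weak_partial[OF t]) (use w in \<open>simp add: weak_partials_def F_def\<close>)
  have cp2: "conv (partial_deriv k \<psi>) (F (Some l, None)) x = conv \<psi> (F (Some k, Some l)) x" if "test_fun UNIV \<psi>" for k l x and \<psi> :: "real^'n \<Rightarrow> real"
    by (rule conv_weak_partial[OF that]) (use w in \<open>simp add: weak_partials_def F_def\<close>)
  have cp1: "conv (partial_deriv l (partial_deriv k (\<kappa> m))) (F (None, None)) x = conv (partial_deriv k (\<kappa> m)) (F (Some l, None)) x" for k l m x
    by (rule conv_weak_partial[OF t']) (use w in \<open>simp add: weak_partials_def F_def\<close>)
  have sym: "conv (\<kappa> m) (F (Some k, Some l)) x = conv (\<kappa> m) (F (Some l, Some k)) x" for m k l x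
  proof -
    have "partial_deriv l (partial_deriv k (\<kappa> m)) = partial_deriv k (partial_deriv l (\<kappa> m))" using \<kappa>[of m] by (auto simp: mollifier_def)
    then show ?thesis using cp1[of l k m x] cp1[of k l m x] cp2[OF t, of k m l x] cp2[OF t, of l m k x] by simp
  qed
  define u where "u n = v n (None, None)" for n
  define u1 :: "nat \<Rightarrow> real^'n \<Rightarrow> real^'n" where "u1 n x = (\<chi> k. v n (Some k, None) x)" for n x
  define u2 :: "nat \<Rightarrow> 'n \<Rightarrow> real^'n \<Rightarrow> real^'n" where "u2 n k x = (\<chi> l. v n (Some k, Some l) x)" for n k x
  define C where "C = 1 + real CARD('n)"
  have nb: "(norm (\<chi> k. f k :: real^'n))\<^sup>2 \<le> C * b" if "\<And>k. (f k)\<^sup>2 \<le> b" for f :: "'n \<Rightarrow> real" and b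
  proof -
    have "(norm (\<chi> k. f k :: real^'n))\<^sup>2 = (\<Sum>k\<in>UNIV. (f k)\<^sup>2)"
      by (simp only: power2_norm_eq_inner inner_vec_def) (simp add: power2_eq_square)
    also have "\<dots> \<le> (\<Sum>k\<in>(UNIV::'n set). b)" by (intro sum_mono that)
    also have "\<dots> \<le> C * b" using order_trans[OF zero_le_power2 that] by (simp add: C_def algebra_simps)
    finally show ?thesis .
  qed
  have hv: "has_partial k (v n p) (\<Sum>m\<le>N n. c n m * conv (partial_deriv k (\<kappa> m)) (F p) x) x" for k n p x
    unfolding v_def[abs_def] by (intro has_partial_weighted_sum conv_has_partial t Fi)
  show thesis
  proof (rule that[of u u1 u2 "\<lambda>x. C * Hh x"])
    show "has_partial k (u n) (u1 n x $ k) x" for n k x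
    proof -
      have "u1 n x $ k = (\<Sum>m\<le>N n. c n m * conv (partial_deriv k (\<kappa> m)) (F (None, None)) x)"
        by (simp add: u1_def v_def cp)
      then show ?thesis using hv[of k n "(None, None)" x] by (simp only: u_def)
    qed
    show "has_partial k (u1 n) (u2 n k x) x" for n k x
    proof (rule has_partial_vec)
      fix l
      have "u2 n k x $ l = (\<Sum>m\<le>N n. c n m * conv (partial_deriv k (\<kappa> m)) (F (Some l, None)) x)"
        by (simp add: u2_def v_def cp2[OF t])
      moreover have "(\<lambda>x. u1 n x $ l) = v n (Some l, None)" by (simp add: u1_def fun_eq_iff)
      ultimately show "has_partial k (\<lambda>x. u1 n x $ l) (u2 n k x $ l) x" using hv[of k n "(Some l, None)" x] by (simp only:)
    qed
    show "u2 n k x $ l = u2 n l x $ k" for n k l x by (simp add: u2_def v_def sym[of _ k l])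
    show "continuous_on UNIV (u n)" "continuous_on UNIV (u1 n)" "continuous_on UNIV (u2 n k)" for n k
      unfolding u_def u1_def u2_def by (intro cv continuous_intros)+
    show "u n x = 0 \<and> u1 n x = 0 \<and> (\<forall>k. u2 n k x = 0)" if far: "\<And>y. y \<in> K \<Longrightarrow> \<delta> \<le> norm (x - y)" for n x
    proof -
      have "conv (\<kappa> m) (F p) x = 0" for m p
        by (rule conv_support[OF \<kappa>]) (use far F(3) in blast)
      then have "v n p x = 0" for p by (simp add: v_def)
      then show ?thesis by (simp add: u_def u1_def u2_def vec_eq_iff)
    qed
    show "integrable lborel (\<lambda>x. C * Hh x)" using Hh by simp
    show "AE x in lborel. (\<lambda>n. u n x) \<longlonglongrightarrow> U x \<and> (\<lambda>n. u1 n x) \<longlonglongrightarrow> (\<chi> k. G k x) \<and> (\<forall>k. (\<lambda>n. u2 n k x) \<longlonglongrightarrow> (\<chi> l. H k l x))"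
      using ae
    proof eventually_elim
      case (elim x)
      have l: "(\<lambda>n. v n p x) \<longlonglongrightarrow> F p x" for p using conjunct2[OF spec[OF elim, of p]] unfolding v_def .
      show ?case
      proof (intro conjI allI vec_tendstoI)
        show "(\<lambda>n. u n x) \<longlonglongrightarrow> U x" using l[of "(None, None)"] by (simp add: u_def F_def)
        show "(\<lambda>n. u1 n x $ k) \<longlonglongrightarrow> (\<chi> k. G k x) $ k" for k using l[of "(Some k, None)"] by (simp add: u1_def F_def)
        show "(\<lambda>n. u2 n k x $ i) \<longlonglongrightarrow> (\<chi> l. H k l x) $ i" for k i using l[of "(Some k, Some i)"] by (simp add: u2_def F_def)
      qed
    qed
    show "AE x in lborel. \<forall>n. (u n x)\<^sup>2 \<le> C * Hh x \<and> (norm (u1 n x))\<^sup>2 \<le> C * Hh x \<and> (\<forall>k. (norm (u2 n k x))\<^sup>2 \<le> C * Hh x)"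
      using ae
    proof eventually_elim
      case (elim x)
      have l: "(v n p x)\<^sup>2 \<le> Hh x" for n p using conjunct1[OF spec[OF elim, of p], THEN spec, of n] unfolding v_def .
      have "Hh x \<le> C * Hh x" using order_trans[OF zero_le_power2 l] by (simp add: C_def algebra_simps)
      then show ?case
        unfolding u_def u1_def u2_def by (intro allI conjI nb l order_trans[OF l])
    qed
  qed
qed

section \<open>The principal part for real functions\<close>

lemma elliptic_norm_bound:
  fixes M :: "real^'n^'n"
  assumes \<theta>: "\<theta> \<ge> 1" and e: "elliptic \<theta> M" and s: "sym_mat M"
  shows "norm (M *v v) \<le> \<theta> * norm v"
proof (rule power2_le_imp_le)
  have "(norm (M *v v))\<^sup>2 \<le> \<theta> * (v \<bullet> (M *v v))" by (rule elliptic_bounds(2)[OF \<theta> e s])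
  also have "\<dots> \<le> \<theta> * (\<theta> * (norm v)\<^sup>2)" using e \<theta> by (intro mult_left_mono) auto
  finally show "(norm (M *v v))\<^sup>2 \<le> (\<theta> * norm v)\<^sup>2" by (simp add: power_mult_distrib power2_eq_square mult_ac)
qed (use \<theta> in simp)

lemmas tendsto_matvec = bounded_bilinear.tendsto[OF bounded_bilinear_matrix_vector]

text \<open>One real component of the solution together with its weak derivatives and with smooth approximations of the coefficients. The essential
support lies in \<open>K0\<close>; the slightly larger annulus \<open>K\<close> contains the supports of the mollified functions. Real and
imaginary part are two instances with the same coefficients.\<close>

locale approximated =
  fixes \<rho> \<theta> \<theta>2 \<delta> :: real and A :: "real^'n \<Rightarrow> real^'n^'n"
    and a :: "nat \<Rightarrow> real^'n \<Rightarrow> real^'n^'n" and da :: "nat \<Rightarrow> 'n \<Rightarrow> real^'n \<Rightarrow> real^'n^'n"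
    and DA :: "'n \<Rightarrow> real^'n \<Rightarrow> real^'n^'n" and K0 K :: "(real^'n) set"
    and U :: "real^'n \<Rightarrow> real" and G :: "'n \<Rightarrow> real^'n \<Rightarrow> real" and H :: "'n \<Rightarrow> 'n \<Rightarrow> real^'n \<Rightarrow> real"
  assumes \<rho>: "\<rho> > 0" and \<theta>: "\<theta> \<ge> 1" and \<theta>2: "\<theta>2 \<ge> 0" and \<delta>: "\<delta> > 0"
    and a1: "\<And>n k x. has_partial k (a n) (da n k x) x" "\<And>n. continuous_on UNIV (a n)" "\<And>n k. continuous_on UNIV (da n k)"
    and a2: "\<And>n x. x \<in> ball 0 \<rho> \<Longrightarrow> elliptic \<theta> (a n x)" "\<And>n x. sym_mat (a n x)"
    and a3: "\<And>n x. x \<in> ball 0 \<rho> \<Longrightarrow> \<delta> \<le> norm x \<Longrightarrow> rows_le (\<theta>2 * norm x) (a n x - A 0)"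
    and a4: "\<And>n k x. sym_mat (da n k x)" "\<And>n k x. x \<in> ball 0 \<rho> \<Longrightarrow> rows_le \<theta>2 (da n k x)"
    and a5: "\<And>x. x \<in> ball 0 \<rho> \<Longrightarrow> (\<lambda>n. a n x) \<longlonglongrightarrow> A x"
    and DAm: "\<And>k i j. (\<lambda>x. DA k x $ i $ j :: real) \<in> borel_measurable borel"
    and DAl: "AE x in lborel. x \<in> ball 0 \<rho> \<longrightarrow> (\<forall>k. (\<lambda>n. da n k x) \<longlonglongrightarrow> DA k x)"
    and K_def: "K = cball 0 (\<rho> - \<delta>) - ball 0 \<delta>"
    and K0: "compact K0" "\<And>y. y \<in> K0 \<Longrightarrow> 2 * \<delta> \<le> norm y \<and> norm y \<le> \<rho> - 2 * \<delta>"
    and L2: "square_integrable_on K0 U" "\<And>k. square_integrable_on K0 (G k)" "\<And>k l. square_integrable_on K0 (H k l)"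
    and w: "weak_partials U G H"
begin

definition g :: "real^'n \<Rightarrow> real^'n" where "g x = (\<chi> k. G k x)"
definition h :: "'n \<Rightarrow> real^'n \<Rightarrow> real^'n" where "h k x = (\<chi> l. H k l x)"

lemma K: "compact K" "K \<subseteq> ball 0 \<rho> - {0}" "K0 \<subseteq> K" "K \<in> sets borel" "\<And>x. x \<in> K \<Longrightarrow> \<delta> \<le> norm x"
proof -
  have "K = cball 0 (\<rho> - \<delta>) \<inter> - ball 0 \<delta>" by (auto simp: K_def)
  then show c: "compact K" by (simp add: compact_Int_closed closed_Compl)
  then show "K \<in> sets borel" by (rule borel_compact)
  show "K \<subseteq> ball 0 \<rho> - {0}" "\<And>x. x \<in> K \<Longrightarrow> \<delta> \<le> norm x" using \<delta> by (auto simp: K_def)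
  show "K0 \<subseteq> K" using K0(2) \<delta> by (force simp: K_def)
qed

lemma zero_off_K: "x \<notin> K \<Longrightarrow> U x = 0" "x \<notin> K \<Longrightarrow> g x = 0" "x \<notin> K \<Longrightarrow> h k x = 0"
proof -
  have z: "f x = 0" if "square_integrable_on K0 f" "x \<notin> K" for f x
    using that K(3) by (auto simp: square_integrable_on_def)
  show "x \<notin> K \<Longrightarrow> U x = 0" "x \<notin> K \<Longrightarrow> g x = 0" "x \<notin> K \<Longrightarrow> h k x = 0"
    using z[OF L2(1)] z[OF L2(2)] z[OF L2(3)] by (simp_all add: g_def h_def vec_eq_iff)
qed

lemma measurable_parts:
  "U \<in> borel_measurable borel" "(\<lambda>x. g x $ i) \<in> borel_measurable borel" "(\<lambda>x. h k x $ i) \<in> borel_measurable borel"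
  "(\<lambda>x. (A x *v g x) $ i) \<in> borel_measurable borel" "(\<lambda>x. (DA k x *v g x + A x *v h k x) $ i) \<in> borel_measurable borel"
proof -
  show U: "U \<in> borel_measurable borel" and g: "(\<lambda>x. g x $ i) \<in> borel_measurable borel" and h: "(\<lambda>x. h k x $ i) \<in> borel_measurable borel" for i k
    using L2 by (auto simp: square_integrable_on_def g_def h_def)
  define AK where "AK i j x = indicator K x * A x $ i $ j" for i j x
  have AK: "AK i j \<in> borel_measurable borel" for i j
  proof (rule borel_measurable_LIMSEQ_real)
    show "(\<lambda>n. indicator K x * a n x $ i $ j) \<longlonglongrightarrow> AK i j x" for x
      using K(2) a5[of x] by (cases "x \<in> K") (auto simp: AK_def intro!: tendsto_intros)
    show "(\<lambda>x. indicator K x * a n x $ i $ j) \<in> borel_measurable borel" for n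
      using K(4) borel_measurable_continuous_onI[OF continuous_on_component[OF continuous_on_component[OF a1(2)]]]
      by (intro borel_measurable_times) auto
  qed
  have eq: "(A x *v v) $ i = (\<Sum>j\<in>UNIV. AK i j x * v $ j)" if "x \<notin> K \<Longrightarrow> v = 0" for x v i
    using that by (cases "x \<in> K") (auto simp: AK_def matrix_vector_mult_def)
  show "(\<lambda>x. (A x *v g x) $ i) \<in> borel_measurable borel" for i
  proof -
    have "(\<lambda>x. (A x *v g x) $ i) = (\<lambda>x. \<Sum>j\<in>UNIV. AK i j x * g x $ j)"
      by (rule ext, rule eq, rule zero_off_K(2))
    then show ?thesis by (simp only:) (intro borel_measurable_sum borel_measurable_times AK g)
  qed
  have "(\<lambda>x. (DA k x *v g x + A x *v h k x) $ i) = (\<lambda>x. (\<Sum>j\<in>UNIV. DA k x $ i $ j * g x $ j) + (\<Sum>j\<in>UNIV. AK i j x * h k x $ j))"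
    using eq[OF zero_off_K(3)] by (auto simp: fun_eq_iff matrix_vector_mult_def)
  then show "(\<lambda>x. (DA k x *v g x + A x *v h k x) $ i) \<in> borel_measurable borel"
    using AK g h DAm by simp
qed

text \<open>All quadratic expressions below are dominated by one integrable function, on \<open>K\<close>.\<close>

lemma approximation:
  obtains u u1 u2 Hh where
    "\<And>n k x. has_partial k (u n) (u1 n x $ k) x" "\<And>n k x. has_partial k (u1 n) (u2 n k x :: real^'n) x"
    "\<And>n k l x. u2 n k x $ l = u2 n l x $ k"
    "\<And>n. continuous_on UNIV (u n)" "\<And>n. continuous_on UNIV (u1 n)" "\<And>n k. continuous_on UNIV (u2 n k)"
    "\<And>n x. x \<notin> K \<Longrightarrow> u n x = 0 \<and> u1 n x = 0 \<and> (\<forall>k. u2 n k x = 0)"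
    "integrable lborel Hh" "AE x in lborel. 0 \<le> Hh x"
    "AE x in lborel. (\<lambda>n. u n x) \<longlonglongrightarrow> U x \<and> (\<lambda>n. u1 n x) \<longlonglongrightarrow> g x \<and> (\<forall>k. (\<lambda>n. u2 n k x) \<longlonglongrightarrow> h k x)"
    "AE x in lborel. \<forall>n. (u n x)\<^sup>2 \<le> Hh x"
    "AE x in lborel. x \<in> K \<longrightarrow> (\<forall>n. norm (a n x *v u1 n x) \<le> sqrt (Hh x) \<and> \<bar>u1 n x \<bullet> (a n x *v u1 n x)\<bar> \<le> Hh x
        \<and> (\<forall>k. norm (da n k x *v u1 n x + a n x *v u2 n k x) \<le> sqrt (Hh x)))"
proof -
  obtain u u1 u2 Hh where
    u: "\<And>n k x. has_partial k (u n) (u1 n x $ k) x" "\<And>n k x. has_partial k (u1 n) (u2 n k x :: real^'n) x"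
    "\<And>n k l x. u2 n k x $ l = u2 n l x $ k"
    "\<And>n. continuous_on UNIV (u n)" "\<And>n. continuous_on UNIV (u1 n)" "\<And>n k. continuous_on UNIV (u2 n k)"
    "\<And>n x. (\<And>y. y \<in> K0 \<Longrightarrow> \<delta> \<le> norm (x - y)) \<Longrightarrow> u n x = 0 \<and> u1 n x = 0 \<and> (\<forall>k. u2 n k x = 0)"
    and Hh: "integrable lborel Hh"
    and ul: "AE x in lborel. (\<lambda>n. u n x) \<longlonglongrightarrow> U x \<and> (\<lambda>n. u1 n x) \<longlonglongrightarrow> (\<chi> k. G k x) \<and> (\<forall>k. (\<lambda>n. u2 n k x) \<longlonglongrightarrow> (\<chi> l. H k l x))"
    and ub: "AE x in lborel. \<forall>n. (u n x)\<^sup>2 \<le> Hh x \<and> (norm (u1 n x))\<^sup>2 \<le> Hh x \<and> (\<forall>k. (norm (u2 n k x))\<^sup>2 \<le> Hh x)"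
    using smooth_approximation[OF K0(1) \<delta> L2 w] by blast
  define C where "C = \<theta>2 + \<theta>"
  have C: "C \<ge> 1" "C \<ge> \<theta>" using \<theta> \<theta>2 by (auto simp: C_def)
  have C2: "C \<le> C\<^sup>2" using C(1) by (simp add: power2_eq_square)
  have Hh0: "AE x in lborel. 0 \<le> Hh x" using ub by eventually_elim (meson order_trans zero_le_power2)
  show thesis
  proof (rule that[of u u1 u2 "\<lambda>x. C\<^sup>2 * Hh x"])
    show "u n x = 0 \<and> u1 n x = 0 \<and> (\<forall>k. u2 n k x = 0)" if x: "x \<notin> K" for n x
    proof (rule u(7))
      fix y assume y: "y \<in> K0"
      have "norm x > \<rho> - \<delta> \<or> norm x < \<delta>" using x by (auto simp: K_def)
      moreover have "norm x \<le> norm y + norm (x - y)" "norm y \<le> norm x + norm (x - y)"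
        using norm_triangle_ineq[of y "x - y"] norm_triangle_ineq[of x "y - x"] by (simp_all add: norm_minus_commute)
      ultimately show "\<delta> \<le> norm (x - y)" using K0(2)[OF y] by linarith
    qed
    show "integrable lborel (\<lambda>x. C\<^sup>2 * Hh x)" using Hh by simp
    show "AE x in lborel. 0 \<le> C\<^sup>2 * Hh x" using Hh0 by eventually_elim simp
    show "AE x in lborel. (\<lambda>n. u n x) \<longlonglongrightarrow> U x \<and> (\<lambda>n. u1 n x) \<longlonglongrightarrow> g x \<and> (\<forall>k. (\<lambda>n. u2 n k x) \<longlonglongrightarrow> h k x)"
      using ul by (simp add: g_def h_def)
    show "AE x in lborel. \<forall>n. (u n x)\<^sup>2 \<le> C\<^sup>2 * Hh x"
      using ub Hh0
    proof eventually_elim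
      case (elim x)
      have "1 * Hh x \<le> C\<^sup>2 * Hh x" using C C2 elim by (intro mult_right_mono) auto
      then show ?case using elim order_trans by fastforce
    qed
    show "AE x in lborel. x \<in> K \<longrightarrow> (\<forall>n. norm (a n x *v u1 n x) \<le> sqrt (C\<^sup>2 * Hh x) \<and> \<bar>u1 n x \<bullet> (a n x *v u1 n x)\<bar> \<le> C\<^sup>2 * Hh x
        \<and> (\<forall>k. norm (da n k x *v u1 n x + a n x *v u2 n k x) \<le> sqrt (C\<^sup>2 * Hh x)))"
      using ub Hh0
    proof eventually_elim
      case (elim x)
      show ?case
      proof (intro impI allI conjI)
        fix n assume x: "x \<in> K"
        then have xb: "x \<in> ball 0 \<rho>" using K(2) by blast
        have sq: "sqrt (C\<^sup>2 * Hh x) = C * sqrt (Hh x)" using C by (simp add: real_sqrt_mult)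
        have n1: "norm (u1 n x) \<le> sqrt (Hh x)" using elim by (simp add: real_le_rsqrt)
        have n2: "norm (u2 n k x) \<le> sqrt (Hh x)" for k using elim by (simp add: real_le_rsqrt)
        have an: "norm (a n x *v v) \<le> \<theta> * norm v" for v by (rule elliptic_norm_bound[OF \<theta> a2(1)[OF xb] a2(2)])
        have dn: "norm (da n k x *v v) \<le> \<theta>2 * norm v" for v k by (rule rows_le_norm_bound[OF a4(1) a4(2)[OF xb]])
        have "norm (a n x *v u1 n x) \<le> \<theta> * sqrt (Hh x)" using an[of "u1 n x"] n1 \<theta> by (meson mult_left_mono order_trans zero_le_one)
        also have "\<dots> \<le> C * sqrt (Hh x)" using C elim by (intro mult_right_mono) auto
        finally show b1: "norm (a n x *v u1 n x) \<le> sqrt (C\<^sup>2 * Hh x)" unfolding sq .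
        have "\<bar>u1 n x \<bullet> (a n x *v u1 n x)\<bar> \<le> norm (u1 n x) * norm (a n x *v u1 n x)" by (rule Cauchy_Schwarz_ineq2)
        also have "\<dots> \<le> sqrt (Hh x) * (C * sqrt (Hh x))" using n1 b1 elim unfolding sq by (intro mult_mono) auto
        also have "\<dots> = C * Hh x" using elim by simp
        also have "\<dots> \<le> C\<^sup>2 * Hh x" using C2 elim by (intro mult_right_mono) auto
        finally show "\<bar>u1 n x \<bullet> (a n x *v u1 n x)\<bar> \<le> C\<^sup>2 * Hh x" .
        fix k
        have "norm (da n k x *v u1 n x + a n x *v u2 n k x) \<le> \<theta>2 * norm (u1 n x) + \<theta> * norm (u2 n k x)"
          by (intro norm_triangle_le add_mono an dn)
        also have "\<dots> \<le> \<theta>2 * sqrt (Hh x) + \<theta> * sqrt (Hh x)" using n1 n2 \<theta> \<theta>2 by (intro add_mono mult_left_mono) auto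
        finally show "norm (da n k x *v u1 n x + a n x *v u2 n k x) \<le> sqrt (C\<^sup>2 * Hh x)" unfolding sq unfolding C_def by (simp add: distrib_right)
      qed
    qed
  qed (use u in auto)
qed

text \<open>Both sides of the estimate for smooth data converge by dominated convergence, the weight being bounded above and below on \<open>K\<close>.\<close>

lemma carleman_real:
  fixes \<mu> \<alpha> :: real
  defines "wt \<equiv> weight A \<rho> \<mu>" and "s \<equiv> sqrt \<theta> * \<mu>"
    and "c \<equiv> \<mu> / \<rho> - 33 * (real CARD('n) * (\<theta>^5 * sqrt \<theta>) * \<theta>2)"
    and "Hc \<equiv> (\<theta> * mu1 \<theta> \<mu>)\<^sup>2 * exp (2 * \<mu> * sqrt \<theta>)"
  defines "dens \<equiv> \<lambda>x. \<alpha> * \<rho>\<^sup>2 * wt x powr (1 - 2 * \<alpha>) * (g x \<bullet> (A x *v g x)) + \<alpha>^3 * wt x powr (- 1 - 2 * \<alpha>) * (U x)\<^sup>2"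
    and "rhs \<equiv> \<lambda>x. wt x powr (2 - 2 * \<alpha>) * (\<Sum>k\<in>UNIV. (DA k x *v g x + A x *v h k x) $ k)\<^sup>2"
  assumes c: "c > 0" and \<alpha>: "\<alpha> > 0" and A0: "elliptic \<theta> (A 0)" "sym_mat (A 0)"
    and e: "s * exp s \<le> \<alpha> / 60" and b: "\<theta>\<^sup>2 * \<bar>real CARD('n) - 2\<bar> * exp s \<le> \<alpha> / 2"
  shows "integrable lborel dens" "integrable lborel rhs"
    "(\<integral>x. dens x \<partial>lborel) \<le> (2 * Hc\<^sup>2 * \<rho>^3 / c) * (\<integral>x. rhs x \<partial>lborel)"
proof -
  obtain u u1 u2 Hh where
    u: "\<And>n k x. has_partial k (u n) (u1 n x $ k) x" "\<And>n k x. has_partial k (u1 n) (u2 n k x :: real^'n) x"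
    "\<And>n k l x. u2 n k x $ l = u2 n l x $ k"
    "\<And>n. continuous_on UNIV (u n)" "\<And>n. continuous_on UNIV (u1 n)" "\<And>n k. continuous_on UNIV (u2 n k)"
    and uK: "\<And>n x. x \<notin> K \<Longrightarrow> u n x = 0 \<and> u1 n x = 0 \<and> (\<forall>k. u2 n k x = 0)"
    and Hh: "integrable lborel Hh" "AE x in lborel. 0 \<le> Hh x"
    and ul: "AE x in lborel. (\<lambda>n. u n x) \<longlonglongrightarrow> U x \<and> (\<lambda>n. u1 n x) \<longlonglongrightarrow> g x \<and> (\<forall>k. (\<lambda>n. u2 n k x) \<longlonglongrightarrow> h k x)"
    and ub: "AE x in lborel. \<forall>n. (u n x)\<^sup>2 \<le> Hh x"
    and ub2: "AE x in lborel. x \<in> K \<longrightarrow> (\<forall>n. norm (a n x *v u1 n x) \<le> sqrt (Hh x) \<and> \<bar>u1 n x \<bullet> (a n x *v u1 n x)\<bar> \<le> Hh x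
        \<and> (\<forall>k. norm (da n k x *v u1 n x + a n x *v u2 n k x) \<le> sqrt (Hh x)))"
    using approximation by blast
  define densn where "densn n x = \<alpha> * \<rho>\<^sup>2 * wt x powr (1 - 2 * \<alpha>) * (u1 n x \<bullet> (a n x *v u1 n x)) + \<alpha>^3 * wt x powr (- 1 - 2 * \<alpha>) * (u n x)\<^sup>2" for n x
  define rhsn where "rhsn n x = wt x powr (2 - 2 * \<alpha>) * (\<Sum>k\<in>UNIV. (da n k x *v u1 n x + a n x *v u2 n k x) $ k)\<^sup>2" for n x
  have K00: "0 \<notin> K" using K(2) by blast
  have cw: "continuous_on K wt" unfolding wt_def by (rule continuous_on_weight[where A = A, OF \<theta> A0 \<rho> K00])
  have wp: "wt x > 0" if "x \<in> K" for x
    using weight_pos[of \<theta> A x, OF \<theta> A0 _ \<rho>] that K00 unfolding wt_def by metis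
  have cpw: "continuous_on K (\<lambda>x. wt x powr t)" for t
    by (intro continuous_on_powr cw continuous_on_const) (use wp in force)
  have wm: "(\<lambda>x. indicator K x * wt x powr t) \<in> borel_measurable borel" for t
    using borel_measurable_continuous_on_indicator[OF K(4) cpw[of t]] by simp
  have "\<exists>B. \<forall>x\<in>K. \<bar>wt x powr t\<bar> \<le> B" for t
    using compact_imp_bounded[OF compact_continuous_image[OF cpw[of t] K(1)]] unfolding bounded_iff by auto
  then obtain B where B: "\<And>t x. x \<in> K \<Longrightarrow> wt x powr t \<le> B t" by (metis abs_le_D1)
  have B0: "B t \<ge> 0" if "x \<in> K" for x t using B[OF that, of t] powr_ge_zero order_trans by blast
  have ck: "continuous_on K (a n)" "continuous_on K (da n k)" "continuous_on K (u n)" "continuous_on K (u1 n)" "continuous_on K (u2 n k)" for n k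
    by (rule continuous_on_subset[OF a1(2) subset_UNIV] continuous_on_subset[OF a1(3) subset_UNIV] continuous_on_subset[OF u(4) subset_UNIV]
        continuous_on_subset[OF u(5) subset_UNIV] continuous_on_subset[OF u(6) subset_UNIV])+
  have ineq: "(\<integral>x. densn n x \<partial>lborel) \<le> (2 * Hc\<^sup>2 * \<rho>^3 / c) * (\<integral>x. rhsn n x \<partial>lborel)" for n
    unfolding densn_def rhsn_def Hc_def c_def wt_def
  proof (rule carleman_smooth[where K = K and ?\<theta>2.0 = \<theta>2])
    show "\<And>x. x \<in> K \<Longrightarrow> rows_le (\<theta>2 * norm x) (a n x - A 0)" using a3 K by blast
  qed (use \<rho> \<theta> \<theta>2 c \<alpha> A0 K a1(1) a2 a4 u(1-3) ck uK e b in \<open>auto simp: c_def s_def\<close>)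
  have densn_m: "densn n \<in> borel_measurable borel" for n
  proof -
    have "integrable lborel (densn n)"
      by (rule integrable_compact_support[OF K(1)]) (use uK in \<open>auto simp: densn_def intro!: continuous_intros cpw continuous_on_matvec continuous_on_subset[OF u(4)] continuous_on_subset[OF u(5)] continuous_on_subset[OF a1(2)]\<close>)
    then show ?thesis by auto
  qed
  have rhsn_m: "rhsn n \<in> borel_measurable borel" for n
  proof -
    have "integrable lborel (rhsn n)"
      by (rule integrable_compact_support[OF K(1)]) (use uK in \<open>auto simp: rhsn_def intro!: continuous_intros cpw continuous_on_matvec continuous_on_subset[OF u(5)] continuous_on_subset[OF u(6)] continuous_on_subset[OF a1(2)] continuous_on_subset[OF a1(3)]\<close>)
    then show ?thesis by auto
  qed
  have dens_m: "dens \<in> borel_measurable borel"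
  proof -
    have "dens = (\<lambda>x. \<alpha> * \<rho>\<^sup>2 * (indicator K x * wt x powr (1 - 2 * \<alpha>)) * (\<Sum>i\<in>UNIV. g x $ i * (A x *v g x) $ i)
        + \<alpha>^3 * (indicator K x * wt x powr (- 1 - 2 * \<alpha>)) * (U x)\<^sup>2)"
      using zero_off_K by (auto simp: dens_def fun_eq_iff indicator_def inner_vec_def)
    then show ?thesis using wm measurable_parts by simp
  qed
  have rhs_m: "rhs \<in> borel_measurable borel"
  proof -
    have "rhs = (\<lambda>x. (indicator K x * wt x powr (2 - 2 * \<alpha>)) * (\<Sum>k\<in>UNIV. (DA k x *v g x + A x *v h k x) $ k)\<^sup>2)"
      using zero_off_K by (auto simp: rhs_def fun_eq_iff indicator_def)
    then show ?thesis using wm[of "2 - 2 * \<alpha>"] measurable_parts(5)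
      by (simp only:) (rule borel_measurable_times[OF wm], rule borel_measurable_power, rule borel_measurable_sum, rule measurable_parts(5))
  qed
  have lim: "AE x in lborel. (\<lambda>n. densn n x) \<longlonglongrightarrow> dens x \<and> (\<lambda>n. rhsn n x) \<longlonglongrightarrow> rhs x"
    using ul DAl
  proof eventually_elim
    case (elim x)
    show ?case
    proof (cases "x \<in> K")
      case True
      then have xb: "x \<in> ball 0 \<rho>" using K(2) by blast
      have u1l: "(\<lambda>n. u1 n x) \<longlonglongrightarrow> g x" and u2l: "\<And>k. (\<lambda>n. u2 n k x) \<longlonglongrightarrow> h k x" and dl: "\<And>k. (\<lambda>n. da n k x) \<longlonglongrightarrow> DA k x"
        using elim xb by auto
      show ?thesis unfolding densn_def dens_def rhsn_def rhs_def
        by (intro conjI tendsto_intros tendsto_matvec a5[OF xb] u1l u2l dl) (use elim in auto)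
    next
      case False
      then show ?thesis using uK zero_off_K by (simp add: densn_def dens_def rhsn_def rhs_def)
    qed
  qed
  define C1 where "C1 = \<bar>\<alpha> * \<rho>\<^sup>2 * B (1 - 2 * \<alpha>)\<bar> + \<bar>\<alpha>^3 * B (- 1 - 2 * \<alpha>)\<bar>"
  define C2 where "C2 = \<bar>B (2 - 2 * \<alpha>)\<bar> * (real CARD('n))\<^sup>2"
  have densb: "AE x in lborel. norm (densn n x) \<le> C1 * Hh x" for n
    using ub ub2 Hh(2)
  proof eventually_elim
    case (elim x)
    show ?case
    proof (cases "x \<in> K")
      case True
      have "\<bar>densn n x\<bar> \<le> \<alpha> * \<rho>\<^sup>2 * wt x powr (1 - 2 * \<alpha>) * \<bar>u1 n x \<bullet> (a n x *v u1 n x)\<bar> + \<alpha>^3 * wt x powr (- 1 - 2 * \<alpha>) * (u n x)\<^sup>2"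
        unfolding densn_def using \<alpha> by (intro order_trans[OF abs_triangle_ineq]) (simp add: abs_mult)
      also have "\<dots> \<le> \<alpha> * \<rho>\<^sup>2 * B (1 - 2 * \<alpha>) * Hh x + \<alpha>^3 * B (- 1 - 2 * \<alpha>) * Hh x"
        using True elim \<alpha> B[OF True] B0[OF True] by (intro add_mono mult_mono mult_nonneg_nonneg) auto
      also have "\<dots> \<le> C1 * Hh x" unfolding C1_def using elim by (simp add: distrib_right add_mono mult_right_mono)
      finally show ?thesis by simp
    next
      case False
      then show ?thesis using uK elim by (simp add: densn_def C1_def)
    qed
  qed
  have rhsb: "AE x in lborel. norm (rhsn n x) \<le> C2 * Hh x" for n
    using ub2 Hh(2)
  proof eventually_elim
    case (elim x)
    show ?case
    proof (cases "x \<in> K")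
      case True
      let ?S = "\<Sum>k\<in>UNIV. (da n k x *v u1 n x + a n x *v u2 n k x) $ k"
      have "\<bar>?S\<bar> \<le> (\<Sum>k\<in>(UNIV::'n set). sqrt (Hh x))"
      proof (intro order_trans[OF sum_abs] sum_mono)
        fix k
        show "\<bar>(da n k x *v u1 n x + a n x *v u2 n k x) $ k\<bar> \<le> sqrt (Hh x)"
          using component_le_norm_cart[of "da n k x *v u1 n x + a n x *v u2 n k x" k] elim True order_trans by blast
      qed
      then have "\<bar>?S\<bar>\<^sup>2 \<le> (real CARD('n) * sqrt (Hh x))\<^sup>2" by (intro power_mono) auto
      then have "?S\<^sup>2 \<le> (real CARD('n))\<^sup>2 * Hh x" using elim by (simp add: power_mult_distrib)
      then have "wt x powr (2 - 2 * \<alpha>) * ?S\<^sup>2 \<le> \<bar>B (2 - 2 * \<alpha>)\<bar> * ((real CARD('n))\<^sup>2 * Hh x)"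
        using B[OF True, of "2 - 2 * \<alpha>"] by (intro mult_mono) auto
      then show ?thesis by (simp add: rhsn_def C2_def mult.assoc)
    next
      case False
      then show ?thesis using uK elim by (simp add: rhsn_def C2_def)
    qed
  qed
  have dc: "integrable lborel dens" "(\<lambda>n. \<integral>x. densn n x \<partial>lborel) \<longlonglongrightarrow> (\<integral>x. dens x \<partial>lborel)"
    by (rule integrable_dominated_convergence[where w = "\<lambda>x. C1 * Hh x" and s = densn]
          integral_dominated_convergence[where w = "\<lambda>x. C1 * Hh x" and s = densn];
        use dens_m densn_m Hh lim densb in \<open>auto elim: eventually_mono\<close>)+
  have rc: "integrable lborel rhs" "(\<lambda>n. \<integral>x. rhsn n x \<partial>lborel) \<longlonglongrightarrow> (\<integral>x. rhs x \<partial>lborel)"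
    by (rule integrable_dominated_convergence[where w = "\<lambda>x. C2 * Hh x" and s = rhsn]
          integral_dominated_convergence[where w = "\<lambda>x. C2 * Hh x" and s = rhsn];
        use rhs_m rhsn_m Hh lim rhsb in \<open>auto elim: eventually_mono\<close>)+
  show "integrable lborel dens" "integrable lborel rhs" by (fact dc rc)+
  show "(\<integral>x. dens x \<partial>lborel) \<le> (2 * Hc\<^sup>2 * \<rho>^3 / c) * (\<integral>x. rhs x \<partial>lborel)"
    by (rule LIMSEQ_le[OF dc(2) tendsto_mult[OF tendsto_const rc(2)]]) (use ineq in blast)
qed

text \<open>The product rule holds for the approximations, where the integration by parts is classical, and both sides
converge. This identifies \<open>DA\<close> as the derivative of the coefficients.\<close>

lemma product_weak_partial:
  shows "test_fun (ball 0 \<rho>) \<phi> \<Longrightarrow>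
      (\<integral>x. partial_deriv k \<phi> x * (A x *v g x) $ i \<partial>lborel) = - (\<integral>x. \<phi> x * (DA k x *v g x + A x *v h k x) $ i \<partial>lborel)"
    and "integrable lborel (\<lambda>x. (A x *v g x) $ i)" "integrable lborel (\<lambda>x. (DA k x *v g x + A x *v h k x) $ i)"
proof -
  obtain u u1 u2 Hh where
    u: "\<And>n k x. has_partial k (u n) (u1 n x $ k) x" "\<And>n k x. has_partial k (u1 n) (u2 n k x :: real^'n) x"
    "\<And>n k l x. u2 n k x $ l = u2 n l x $ k"
    "\<And>n. continuous_on UNIV (u n)" "\<And>n. continuous_on UNIV (u1 n)" "\<And>n k. continuous_on UNIV (u2 n k)"
    and uK: "\<And>n x. x \<notin> K \<Longrightarrow> u n x = 0 \<and> u1 n x = 0 \<and> (\<forall>k. u2 n k x = 0)"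
    and Hh: "integrable lborel Hh" "AE x in lborel. 0 \<le> Hh x"
    and ul: "AE x in lborel. (\<lambda>n. u n x) \<longlonglongrightarrow> U x \<and> (\<lambda>n. u1 n x) \<longlonglongrightarrow> g x \<and> (\<forall>k. (\<lambda>n. u2 n k x) \<longlonglongrightarrow> h k x)"
    and "AE x in lborel. \<forall>n. (u n x)\<^sup>2 \<le> Hh x"
    and ub2: "AE x in lborel. x \<in> K \<longrightarrow> (\<forall>n. norm (a n x *v u1 n x) \<le> sqrt (Hh x) \<and> \<bar>u1 n x \<bullet> (a n x *v u1 n x)\<bar> \<le> Hh x
        \<and> (\<forall>k. norm (da n k x *v u1 n x + a n x *v u2 n k x) \<le> sqrt (Hh x)))"
    using approximation by blast
  define bd where "bd x = indicator K x + Hh x" for x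
  have bdi: "integrable lborel bd" unfolding bd_def
    using Hh(1) emeasure_compact_finite[OF K(1)] K(4) by (intro Bochner_Integration.integrable_add integrable_real_indicator) auto
  have sq: "sqrt y \<le> 1 + y" if "y \<ge> 0" for y :: real
    using zero_le_power2[of "sqrt y - 1/2"] that by (simp add: power2_eq_square algebra_simps)
  define P where "P n x = (a n x *v u1 n x) $ i" for n x
  define Q where "Q n x = (da n k x *v u1 n x + a n x *v u2 n k x) $ i" for n x
  have PQb: "AE x in lborel. \<forall>n. \<bar>P n x\<bar> \<le> bd x \<and> \<bar>Q n x\<bar> \<le> bd x"
    using ub2 Hh(2)
  proof eventually_elim
    case (elim x)
    show ?case
    proof (cases "x \<in> K")
      case True
      have "\<bar>P n x\<bar> \<le> sqrt (Hh x)" "\<bar>Q n x\<bar> \<le> sqrt (Hh x)" for n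
        unfolding P_def Q_def
        using component_le_norm_cart[of "a n x *v u1 n x" i] component_le_norm_cart[of "da n k x *v u1 n x + a n x *v u2 n k x" i] elim True
        by (meson order_trans)+
      then show ?thesis using sq[of "Hh x"] elim(2) True unfolding bd_def by (auto intro: order_trans)
    next
      case False
      then show ?thesis using uK elim by (simp add: P_def Q_def bd_def)
    qed
  qed
  have PQl: "AE x in lborel. (\<lambda>n. P n x) \<longlonglongrightarrow> (A x *v g x) $ i \<and> (\<lambda>n. Q n x) \<longlonglongrightarrow> (DA k x *v g x + A x *v h k x) $ i"
    using ul DAl
  proof eventually_elim
    case (elim x)
    show ?case
    proof (cases "x \<in> K")
      case True
      then have xb: "x \<in> ball 0 \<rho>" using K(2) by blast
      have u1l: "(\<lambda>n. u1 n x) \<longlonglongrightarrow> g x" and u2l: "\<And>k. (\<lambda>n. u2 n k x) \<longlonglongrightarrow> h k x" and dl: "\<And>k. (\<lambda>n. da n k x) \<longlonglongrightarrow> DA k x"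
        using elim xb by auto
      show ?thesis unfolding P_def Q_def
        by (intro conjI tendsto_vec_nth tendsto_add tendsto_matvec a5[OF xb] u1l u2l dl)
    next
      case False
      then show ?thesis using uK zero_off_K by (simp add: P_def Q_def)
    qed
  qed
  have cP: "continuous_on UNIV (P n)" for n unfolding P_def[abs_def]
    by (intro continuous_on_component continuous_on_matvec a1 u)
  have cQ: "continuous_on UNIV (Q n)" for n unfolding Q_def[abs_def]
    by (intro continuous_on_component continuous_on_add continuous_on_matvec a1 u)
  have hP: "has_partial k (P n) (Q n x) x" for n x
    unfolding P_def[abs_def] Q_def using has_partial_nth[OF has_partial_matvec[OF a1(1) u(2)]] by (simp add: add.commute)
  have mP: "P n \<in> borel_measurable borel" "Q n \<in> borel_measurable borel" for n
    using cP cQ by (auto intro: borel_measurable_continuous_onI)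
  have PK: "P n x = 0" "Q n x = 0" if "x \<notin> K" for n x using uK[OF that] by (auto simp: P_def Q_def)
  {
  assume t: "test_fun (ball 0 \<rho>) \<phi>"
  note \<phi>p = test_fun_has_partial(1)[OF t] and c\<phi> = test_fun_has_partial(2,3)[OF t]
  obtain M where M: "M \<ge> 0" "\<And>x. \<bar>\<phi> x\<bar> \<le> M" using test_fun_bounded[OF t] by blast
  obtain M' where M': "M' \<ge> 0" "\<And>x. \<bar>partial_deriv k \<phi> x\<bar> \<le> M'" using test_fun_bounded[OF test_fun_partial_deriv[OF t]] by blast
  note m\<phi> = test_fun_borel[OF t] test_fun_borel[OF test_fun_partial_deriv[OF t]]
  have ibp: "(\<integral>x. partial_deriv k \<phi> x * P n x + \<phi> x * Q n x \<partial>lborel) = 0" for n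
  proof (rule integral_partial_eq_0(2)[where F = "\<lambda>x. \<phi> x * P n x" and W = "\<lambda>x. partial_deriv k \<phi> x * P n x + \<phi> x * Q n x" and k = k, OF K(1)])
    fix x
    have "has_partial k \<phi> (partial_deriv k \<phi> x) x" by (rule test_fun_has_partial(1)[OF t])
    from has_partial_mult[OF this hP[of n x]]
    show "has_partial k (\<lambda>x. \<phi> x * P n x) (partial_deriv k \<phi> x * P n x + \<phi> x * Q n x) x" by (simp add: add.commute)
    show "\<phi> x * P n x = 0" "partial_deriv k \<phi> x * P n x + \<phi> x * Q n x = 0" if "x \<notin> K" using PK[OF that] by simp_all
  next
    have "continuous_on UNIV (\<lambda>x. partial_deriv k \<phi> x * P n x + \<phi> x * Q n x)"
      by (intro continuous_on_add continuous_on_mult c\<phi> cP cQ)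
    then show "continuous_on K (\<lambda>x. partial_deriv k \<phi> x * P n x + \<phi> x * Q n x)" by (rule continuous_on_subset) simp
    show "(\<lambda>x. \<phi> x * P n x) \<in> borel_measurable borel" by (rule borel_measurable_times[OF m\<phi>(1) mP(1)])
  qed
  have mul: "\<bar>p * q\<bar> \<le> m * b" if "\<bar>p\<bar> \<le> m" "\<bar>q\<bar> \<le> b" for p q m b :: real
    unfolding abs_mult using that by (intro mult_mono) (auto intro: order_trans[OF abs_ge_zero])
  have l1: "(\<lambda>n. \<integral>x. partial_deriv k \<phi> x * P n x \<partial>lborel) \<longlonglongrightarrow> (\<integral>x. partial_deriv k \<phi> x * (A x *v g x) $ i \<partial>lborel)"
    and i1: "\<And>n. integrable lborel (\<lambda>x. partial_deriv k \<phi> x * P n x)"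
  proof -
    have d: "AE x in lborel. norm (partial_deriv k \<phi> x * P n x) \<le> M' * bd x" for n
      using PQb by eventually_elim (simp add: mul[OF M'(2)])
    have l: "AE x in lborel. (\<lambda>n. partial_deriv k \<phi> x * P n x) \<longlonglongrightarrow> partial_deriv k \<phi> x * (A x *v g x) $ i"
      using PQl by eventually_elim (auto intro!: tendsto_intros)
    show "(\<lambda>n. \<integral>x. partial_deriv k \<phi> x * P n x \<partial>lborel) \<longlonglongrightarrow> (\<integral>x. partial_deriv k \<phi> x * (A x *v g x) $ i \<partial>lborel)"
      by (rule integral_dominated_convergence[where w = "\<lambda>x. M' * bd x"]) (use m\<phi> mP measurable_parts bdi d l in auto)
    show "integrable lborel (\<lambda>x. partial_deriv k \<phi> x * P n x)" for n
      by (rule Bochner_Integration.integrable_bound[where f = "\<lambda>x. M' * bd x"])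
        (use m\<phi> mP bdi d[of n] in \<open>auto elim!: eventually_mono intro: order_trans[OF _ abs_ge_self]\<close>)
  qed
  have l2: "(\<lambda>n. \<integral>x. \<phi> x * Q n x \<partial>lborel) \<longlonglongrightarrow> (\<integral>x. \<phi> x * (DA k x *v g x + A x *v h k x) $ i \<partial>lborel)"
    and i2: "\<And>n. integrable lborel (\<lambda>x. \<phi> x * Q n x)"
  proof -
    have d: "AE x in lborel. norm (\<phi> x * Q n x) \<le> M * bd x" for n
      using PQb by eventually_elim (simp add: mul[OF M(2)])
    have l: "AE x in lborel. (\<lambda>n. \<phi> x * Q n x) \<longlonglongrightarrow> \<phi> x * (DA k x *v g x + A x *v h k x) $ i"
      using PQl by eventually_elim (intro tendsto_mult tendsto_const, blast)
    show "(\<lambda>n. \<integral>x. \<phi> x * Q n x \<partial>lborel) \<longlonglongrightarrow> (\<integral>x. \<phi> x * (DA k x *v g x + A x *v h k x) $ i \<partial>lborel)"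
      by (rule integral_dominated_convergence[where w = "\<lambda>x. M * bd x"])
        (use m\<phi> mP bdi d l in \<open>auto intro!: borel_measurable_times measurable_parts(5)[unfolded vector_add_component]\<close>)
    show "integrable lborel (\<lambda>x. \<phi> x * Q n x)" for n
      by (rule Bochner_Integration.integrable_bound[where f = "\<lambda>x. M * bd x"])
        (use m\<phi> mP bdi d[of n] in \<open>auto elim!: eventually_mono intro: order_trans[OF _ abs_ge_self]\<close>)
  qed
  have "(\<lambda>n. (\<integral>x. partial_deriv k \<phi> x * P n x \<partial>lborel) + (\<integral>x. \<phi> x * Q n x \<partial>lborel)) \<longlonglongrightarrow>
     (\<integral>x. partial_deriv k \<phi> x * (A x *v g x) $ i \<partial>lborel) + (\<integral>x. \<phi> x * (DA k x *v g x + A x *v h k x) $ i \<partial>lborel)"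
    by (intro tendsto_add l1 l2)
  moreover have "(\<integral>x. partial_deriv k \<phi> x * P n x \<partial>lborel) + (\<integral>x. \<phi> x * Q n x \<partial>lborel) = 0" for n
    using ibp[of n] i1 i2 by simp
  ultimately show "(\<integral>x. partial_deriv k \<phi> x * (A x *v g x) $ i \<partial>lborel) = - (\<integral>x. \<phi> x * (DA k x *v g x + A x *v h k x) $ i \<partial>lborel)"
    by (simp add: LIMSEQ_const_iff)
  }
  show "integrable lborel (\<lambda>x. (A x *v g x) $ i)"
    by (rule integrable_dominated_convergence[where w = bd and s = P])
      (use measurable_parts mP bdi PQl PQb in \<open>auto elim!: eventually_mono\<close>)
  show "integrable lborel (\<lambda>x. (DA k x *v g x + A x *v h k x) $ i)"
    by (rule integrable_dominated_convergence[where w = bd and s = Q])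
      (use measurable_parts(5) mP bdi PQl PQb in \<open>auto elim!: eventually_mono\<close>)
qed

end

section \<open>Essential supports and real parts\<close>

lemma closed_ess_support: "closed (ess_support u)"
  unfolding ess_support_def by (intro closed_Compl open_Union) auto

text \<open>The complement is a union of open sets on which the function vanishes almost everywhere; by Lindelof's theorem countably many suffice.\<close>

lemma AE_zero_off_ess_support: "AE x in lebesgue. x \<notin> ess_support u \<longrightarrow> u x = 0"
proof -
  let ?F = "{U. open U \<and> (AE x in lebesgue. x \<in> U \<longrightarrow> u x = 0)}"
  obtain F' where F': "F' \<subseteq> ?F" "countable F'" "\<Union>F' = \<Union>?F"
    using Lindelof[of ?F] by auto
  have "AE x in lebesgue. \<forall>U\<in>F'. x \<in> U \<longrightarrow> u x = 0"
    using F'(1) by (subst AE_ball_countable[OF F'(2)]) auto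
  then show ?thesis
  proof eventually_elim
    case (elim x)
    show ?case
    proof
      assume "x \<notin> ess_support u"
      then have "x \<in> \<Union>F'" unfolding F'(3) ess_support_def by (simp only: Compl_iff not_not)
      then show "u x = 0" using elim by blast
    qed
  qed
qed

lemma test_fun_zero_off: "test_fun \<Omega> \<phi> \<Longrightarrow> x \<notin> \<Omega> \<Longrightarrow> \<phi> x = 0"
  using closure_subset[of "{x. \<phi> x \<noteq> 0}"] by (auto simp: test_fun_def)

lemma set_integral_test_fun:
  fixes f :: "real^'n \<Rightarrow> complex"
  assumes "test_fun \<Omega> \<psi>" "\<Omega> \<subseteq> \<Omega>'"
  shows "(LINT x:\<Omega>'|lebesgue. \<psi> x *\<^sub>R f x) = (\<integral>x. \<psi> x *\<^sub>R f x \<partial>lebesgue)"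
  unfolding set_lebesgue_integral_def
proof (rule Bochner_Integration.integral_cong[OF refl])
  fix x show "indicat_real \<Omega>' x *\<^sub>R (\<psi> x *\<^sub>R f x) = \<psi> x *\<^sub>R f x"
    using test_fun_zero_off[OF assms(1), of x] assms(2) by (cases "x \<in> \<Omega>'") auto
qed

lemma test_fun_UNIV: "test_fun \<Omega> \<phi> \<Longrightarrow> test_fun UNIV \<phi>"
  by (auto simp: test_fun_def)

lemma weak_partial_vanishes:
  assumes w: "has_weak_partial UNIV i u g" and \<Omega>: "open \<Omega>" and z: "AE x in lebesgue. x \<in> \<Omega> \<longrightarrow> u x = 0"
  shows "AE x in lebesgue. x \<in> \<Omega> \<longrightarrow> g x = 0"
proof (rule fundamental_lemma_lebesgue[OF \<Omega>])
  show "locally_integrable \<Omega> g" using w by (auto simp: has_weak_partial_def locally_integrable_def)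
  fix \<phi> assume t: "test_fun \<Omega> \<phi>"
  note t' = test_fun_partial_deriv[OF t]
  have "(\<integral>x. partial_deriv i \<phi> x *\<^sub>R u x \<partial>lebesgue) = 0"
  proof (rule integral_eq_zero_AE)
    show "AE x in lebesgue. partial_deriv i \<phi> x *\<^sub>R u x = 0" using z
    proof eventually_elim
      case (elim x)
      then show ?case using test_fun_zero_off[OF t'] by (cases "x \<in> \<Omega>") auto
    qed
  qed
  moreover have "(LINT x:UNIV|lebesgue. partial_deriv i \<phi> x *\<^sub>R u x) = - (LINT x:UNIV|lebesgue. \<phi> x *\<^sub>R g x)"
    using w test_fun_UNIV[OF t] by (simp add: has_weak_partial_def)
  ultimately show "(LINT x:\<Omega>|lebesgue. \<phi> x *\<^sub>R g x) = 0"
    unfolding set_integral_test_fun[OF t subset_UNIV] set_integral_test_fun[OF t' subset_UNIV] set_integral_test_fun[OF t order_refl] by simp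
qed

text \<open>Transfers a complex integral with respect to the completed measure to a real integral of a Borel function.\<close>

lemma test_fun_integral_linear:
  fixes f :: "real^'n \<Rightarrow> complex" and T :: "complex \<Rightarrow> real"
  assumes t: "test_fun \<Omega> \<psi>" and l: "locally_integrable \<Omega> f" and T: "bounded_linear T"
    and V: "V \<in> borel_measurable borel" "AE x in lborel. V x = T (f x)"
  shows "T (LINT x:\<Omega>|lebesgue. \<psi> x *\<^sub>R f x) = (\<integral>x. \<psi> x * V x \<partial>lborel)"
proof -
  let ?k = "\<lambda>x. indicat_real \<Omega> x *\<^sub>R (\<psi> x *\<^sub>R f x)"
  have i: "integrable lebesgue ?k" using test_fun_set_integrable[OF t l] by (simp add: set_integrable_def)
  have "T (LINT x:\<Omega>|lebesgue. \<psi> x *\<^sub>R f x) = (\<integral>x. T (?k x) \<partial>lebesgue)"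
    unfolding set_lebesgue_integral_def by (rule integral_bounded_linear[OF T i, symmetric])
  also have "\<dots> = (\<integral>x. \<psi> x * V x \<partial>lborel)"
  proof (rule integral_lebesgue_cong_lborel(2))
    show "(\<lambda>x. T (?k x)) \<in> borel_measurable lebesgue"
      using integrable_bounded_linear[OF T i] by (rule borel_measurable_integrable)
    show "(\<lambda>x. \<psi> x * V x) \<in> borel_measurable borel" using test_fun_borel[OF t] V(1) by (rule borel_measurable_times)
    show "AE x in lborel. T (?k x) = \<psi> x * V x" using V(2)
    proof eventually_elim
      case (elim x)
      have s: "T (c *\<^sub>R z) = c * T z" for c z using bounded_linear.linear[OF T] by (simp add: linear_scale)
      show ?case unfolding s using elim test_fun_zero_off[OF t] by (cases "x \<in> \<Omega>") auto
    qed
  qed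
  finally show ?thesis .
qed

lemma locally_integrable_if_integrable:
  fixes f :: "real^'n \<Rightarrow> complex"
  assumes "integrable lebesgue f"
  shows "locally_integrable \<Omega> f"
  unfolding locally_integrable_def set_integrable_def
proof (intro allI impI integrable_mult_indicator assms)
  fix S :: "(real^'n) set" assume "compact S \<and> S \<subseteq> \<Omega>"
  then show "S \<in> sets lebesgue" using lmeasurable_compact by blast
qed

text \<open>Needed in this generality because the flux is built from a chosen representative of the weak gradient, which equals a
Borel function only almost everywhere.\<close>

lemma has_weak_partial_Complex:
  fixes f v :: "real^'n \<Rightarrow> complex"
  assumes i: "integrable lborel P" "integrable lborel Q" "integrable lborel P'" "integrable lborel Q'"
    and w: "\<And>\<phi>. test_fun \<Omega> \<phi> \<Longrightarrow> (\<integral>x. partial_deriv k \<phi> x * P x \<partial>lborel) = - (\<integral>x. \<phi> x * P' x \<partial>lborel)"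
      "\<And>\<phi>. test_fun \<Omega> \<phi> \<Longrightarrow> (\<integral>x. partial_deriv k \<phi> x * Q x \<partial>lborel) = - (\<integral>x. \<phi> x * Q' x \<partial>lborel)"
    and f: "AE x in lborel. f x = Complex (P x) (Q x)" and v: "\<And>x. v x = Complex (P' x) (Q' x)"
  shows "has_weak_partial \<Omega> k f v"
proof -
  have ic: "integrable lebesgue (\<lambda>x. Complex (p x) (q x))" if "integrable lborel p" "integrable lborel q" for p q :: "real^'n \<Rightarrow> real"
  proof -
    have "integrable lborel (\<lambda>x. complex_of_real (p x) + \<i> * complex_of_real (q x))"
      using that by (intro Bochner_Integration.integrable_add integrable_mult_right integrable_of_real)
    then have "integrable lborel (\<lambda>x. Complex (p x) (q x))" by (simp only: Complex_eq)
    then show ?thesis by (subst integrable_completion) auto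
  qed
  have fi: "integrable lebesgue f"
  proof -
    have ae: "AE x in lebesgue. Complex (P x) (Q x) = f x" using AE_completion[OF f] by eventually_elim simp
    have m: "f \<in> borel_measurable lebesgue" by (rule borel_measurable_AE[OF borel_measurable_integrable[OF ic[OF i(1,2)]] ae])
    show ?thesis by (rule integrable_cong_AE_imp[OF ic[OF i(1,2)] m ae])
  qed
  have vi: "integrable lebesgue v" unfolding v[abs_def] by (rule ic[OF i(3,4)])
  note l = locally_integrable_if_integrable[OF fi, of \<Omega>] locally_integrable_if_integrable[OF vi, of \<Omega>]
  have b: "P \<in> borel_measurable borel" "Q \<in> borel_measurable borel" "P' \<in> borel_measurable borel" "Q' \<in> borel_measurable borel"
    using i[THEN borel_measurable_integrable] by simp_all
  show ?thesis unfolding has_weak_partial_def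
  proof (intro conjI l allI impI)
    fix \<phi> assume t: "test_fun \<Omega> \<phi>"
    note t' = test_fun_partial_deriv[OF t]
    have fR: "AE x in lborel. P x = Re (f x)" and fI: "AE x in lborel. Q x = Im (f x)"
      using f by (eventually_elim, simp)+
    have vR: "AE x in lborel. P' x = Re (v x)" and vI: "AE x in lborel. Q' x = Im (v x)" by (simp_all add: v)
    show "(LINT x:\<Omega>|lebesgue. partial_deriv k \<phi> x *\<^sub>R f x) = - (LINT x:\<Omega>|lebesgue. \<phi> x *\<^sub>R v x)"
    proof (rule complex_eqI)
      show "Re (LINT x:\<Omega>|lebesgue. partial_deriv k \<phi> x *\<^sub>R f x) = Re (- (LINT x:\<Omega>|lebesgue. \<phi> x *\<^sub>R v x))"
        unfolding uminus_complex.sel test_fun_integral_linear[OF t' l(1) bounded_linear_Re b(1) fR]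
          test_fun_integral_linear[OF t l(2) bounded_linear_Re b(3) vR] by (rule w(1)[OF t])
      show "Im (LINT x:\<Omega>|lebesgue. partial_deriv k \<phi> x *\<^sub>R f x) = Im (- (LINT x:\<Omega>|lebesgue. \<phi> x *\<^sub>R v x))"
        unfolding uminus_complex.sel test_fun_integral_linear[OF t' l(1) bounded_linear_Im b(2) fI]
          test_fun_integral_linear[OF t l(2) bounded_linear_Im b(4) vI] by (rule w(2)[OF t])
    qed
  qed
qed

lemma square_integrable_representative:
  fixes f :: "real^'n \<Rightarrow> complex" and T :: "complex \<Rightarrow> real"
  assumes f: "in_L2 f" and T: "bounded_linear T" and K0: "closed K0" and z: "AE x in lebesgue. x \<notin> K0 \<longrightarrow> f x = 0"
  obtains V where "square_integrable_on K0 V" "AE x in lborel. V x = T (f x)"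
proof -
  have Tm: "T \<in> borel_measurable borel" by (intro borel_measurable_continuous_onI linear_continuous_on T)
  have fm: "f \<in> borel_measurable lebesgue" using f by (simp add: in_L2_def)
  have m: "(\<lambda>x. T (f x)) \<in> borel_measurable lebesgue" by (rule measurable_compose[OF fm Tm])
  obtain V' where V': "V' \<in> borel_measurable borel" "AE x in lborel. T (f x) = V' x"
    by (rule lebesgue_integrable_borel_rep[OF m]) (rule that)
  define V where "V x = indicator K0 x * V' x" for x
  have Vm: "V \<in> borel_measurable borel" unfolding V_def[abs_def]
    using V'(1) borel_closed[OF K0] by (intro borel_measurable_times borel_measurable_indicator)
  have ae: "AE x in lborel. V x = T (f x)"
    using V'(2) z[unfolded AE_completion_iff]
  proof eventually_elim
    case (elim x)
    then show ?case using bounded_linear.linear[OF T] by (cases "x \<in> K0") (auto simp: V_def linear_0)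
  qed
  obtain B where B: "\<And>z. \<bar>T z\<bar> \<le> norm z * B" using bounded_linear.bounded[OF T] by auto
  have "integrable lebesgue (\<lambda>x. (T (f x))\<^sup>2)"
  proof (rule Bochner_Integration.integrable_bound[where f = "\<lambda>x. B\<^sup>2 * (norm (f x))\<^sup>2"])
    show "integrable lebesgue (\<lambda>x. B\<^sup>2 * (norm (f x))\<^sup>2)" using f by (simp add: in_L2_def)
    show "(\<lambda>x. (T (f x))\<^sup>2) \<in> borel_measurable lebesgue" using m by (rule borel_measurable_power)
    show "AE x in lebesgue. norm ((T (f x))\<^sup>2) \<le> norm (B\<^sup>2 * (norm (f x))\<^sup>2)"
    proof (rule AE_I2)
      fix x
      have "\<bar>T (f x)\<bar>\<^sup>2 \<le> (norm (f x) * B)\<^sup>2" using B by (rule power_mono) simp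
      then show "norm ((T (f x))\<^sup>2) \<le> norm (B\<^sup>2 * (norm (f x))\<^sup>2)" by (simp add: power_mult_distrib mult.commute)
    qed
  qed
  moreover have "AE x in lborel. (T (f x))\<^sup>2 = (V x)\<^sup>2" using ae by eventually_elim simp
  ultimately have "integrable lborel (\<lambda>x. (V x)\<^sup>2)"
    using integral_lebesgue_cong_lborel(1)[OF borel_measurable_power[OF m] borel_measurable_power[OF Vm]] by blast
  then have "square_integrable_on K0 V" using Vm by (auto simp: square_integrable_on_def V_def)
  then show thesis using ae by (rule that)
qed

text \<open>The derivatives vanish almost everywhere off the support, so Borel representatives can be chosen to vanish there everywhere.\<close>

lemma real_part_representatives:
  fixes u :: "real^'n \<Rightarrow> complex" and T :: "complex \<Rightarrow> real"
  assumes T: "bounded_linear T" and K0: "closed K0"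
    and L2: "in_L2 u" "\<And>i. in_L2 (g i)" "\<And>i j. in_L2 (h i j)"
    and w: "\<And>i. has_weak_partial UNIV i u (g i)" "\<And>i j. has_weak_partial UNIV j (g i) (h i j)"
    and z: "AE x in lebesgue. x \<notin> K0 \<longrightarrow> u x = 0"
  obtains U G H where "square_integrable_on K0 U" "\<And>k. square_integrable_on K0 (G k)" "\<And>k l. square_integrable_on K0 (H k l)"
    "weak_partials U G H" "AE x in lborel. U x = T (u x) \<and> (\<forall>k. G k x = T (g k x))"
proof -
  have op: "open (- K0)" using K0 by (rule open_Compl)
  have z0: "AE x in lebesgue. x \<in> - K0 \<longrightarrow> u x = 0" using z by simp
  have z1: "AE x in lebesgue. x \<in> - K0 \<longrightarrow> g i x = 0" for i by (rule weak_partial_vanishes[OF w(1) op z0])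
  have z2: "AE x in lebesgue. x \<in> - K0 \<longrightarrow> h i j x = 0" for i j by (rule weak_partial_vanishes[OF w(2) op z1])
  have r: "\<exists>V. square_integrable_on K0 V \<and> (AE x in lborel. V x = T (f x))"
    if f: "in_L2 f" and a: "AE x in lebesgue. x \<in> - K0 \<longrightarrow> f x = 0" for f
  proof -
    have "AE x in lebesgue. x \<notin> K0 \<longrightarrow> f x = 0" using a by simp
    from square_integrable_representative[OF f T K0 this] show ?thesis by blast
  qed
  obtain U where U: "square_integrable_on K0 U" "AE x in lborel. U x = T (u x)" using r[OF L2(1) z0] by blast
  have "\<forall>k. \<exists>V. square_integrable_on K0 V \<and> (AE x in lborel. V x = T (g k x))" using r[OF L2(2) z1] by blast
  from choice[OF this] obtain G where G: "\<And>k. square_integrable_on K0 (G k)" "\<And>k. AE x in lborel. G k x = T (g k x)" by blast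
  have "\<forall>p. \<exists>V. square_integrable_on K0 V \<and> (AE x in lborel. V x = T (h (snd p) (fst p) x))" using r[OF L2(3) z2] by blast
  from choice[OF this] obtain H' where H': "\<And>p. square_integrable_on K0 (H' p)" "\<And>p. AE x in lborel. H' p x = T (h (snd p) (fst p) x)" by blast
  define H where "H k l = H' (k, l)" for k l
  have H: "square_integrable_on K0 (H k l)" "AE x in lborel. H k l x = T (h l k x)" for k l
    using H'[of "(k, l)"] by (simp_all add: H_def)
  have neg: "T (- y) = - T y" for y using bounded_linear.linear[OF T] by (rule linear_neg)
  have wp: "(\<integral>y. partial_deriv k \<phi> y * V y \<partial>lborel) = - (\<integral>y. \<phi> y * W y \<partial>lborel)"
    if hw: "has_weak_partial UNIV k f f'" and t: "test_fun UNIV \<phi>" and V: "square_integrable_on K0 V" "AE x in lborel. V x = T (f x)"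
      and W: "square_integrable_on K0 W" "AE x in lborel. W x = T (f' x)" for k f f' \<phi> V W
  proof -
    have l: "locally_integrable UNIV f" "locally_integrable UNIV f'" using hw by (auto simp: has_weak_partial_def)
    have m: "V \<in> borel_measurable borel" "W \<in> borel_measurable borel" using V W by (auto simp: square_integrable_on_def)
    have "(LINT x:UNIV|lebesgue. partial_deriv k \<phi> x *\<^sub>R f x) = - (LINT x:UNIV|lebesgue. \<phi> x *\<^sub>R f' x)"
      using hw t unfolding has_weak_partial_def by blast
    then have "T (LINT x:UNIV|lebesgue. partial_deriv k \<phi> x *\<^sub>R f x) = - T (LINT x:UNIV|lebesgue. \<phi> x *\<^sub>R f' x)"
      by (simp only: neg)
    then show ?thesis
      unfolding test_fun_integral_linear[OF test_fun_partial_deriv[OF t] l(1) T m(1) V(2)] test_fun_integral_linear[OF t l(2) T m(2) W(2)] .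
  qed
  have "weak_partials U G H"
    unfolding weak_partials_def using wp[OF w(1) _ U G] wp[OF w(2) _ G H] by blast
  moreover have "AE x in lborel. U x = T (u x) \<and> (\<forall>k. G k x = T (g k x))"
    using U(2) eventually_all_finite[OF G(2)] by eventually_elim simp
  ultimately show thesis using that[of U G H] U(1) G(1) H(1) by blast
qed

section \<open>The constants\<close>

lemma powr_half_integers:
  assumes "(\<theta>::real) \<ge> 1"
  shows "\<theta> powr (11/2) = \<theta>^5 * sqrt \<theta>" "\<theta> powr (3/2) = \<theta> * sqrt \<theta>"
proof -
  have t: "\<theta> powr (1/2) = sqrt \<theta>" using assms by (simp add: powr_half_sqrt)
  have "\<theta> powr (11/2) = \<theta> powr (real 5 + 1/2)" by simp
  also have "\<dots> = \<theta> powr real 5 * \<theta> powr (1/2)" by (rule powr_add)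
  also have "\<theta> powr real 5 = \<theta>^5" using assms by (intro powr_realpow) simp
  finally show "\<theta> powr (11/2) = \<theta>^5 * sqrt \<theta>" unfolding t .
  have "\<theta> powr (3/2) = \<theta> powr (1 + 1/2)" by simp
  also have "\<dots> = \<theta> powr 1 * \<theta> powr (1/2)" by (rule powr_add)
  also have "\<theta> powr 1 = \<theta>" using assms by simp
  finally show "\<theta> powr (3/2) = \<theta> * sqrt \<theta>" unfolding t .
qed

text \<open>With \<open>s = sqrt \<theta> * \<mu>\<close>, \<open>p = Cmu / Hc\<close> and \<open>Hc \<ge> (1 + s)^4\<close>. The threshold \<^const>\<open>alpha2\<close> is at least \<open>2 * q / p\<close>, and the part
\<open>K * sqrt \<theta> / 2\<close> of \<open>q\<close> already makes this at least \<open>6 * (1 + s)^5 * exp s\<close>, which gives the first condition on \<open>\<alpha>\<close>. It is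
also at least \<open>sqrt (2 * r / p)\<close>, and the part of \<open>r\<close> with \<^const>\<open>CF\<close> makes this at least \<open>2 * \<theta>\<^sup>2 * CF\<close>, which gives the second.\<close>

lemma constants_bounds:
  fixes \<theta> \<kappa> \<mu> :: real and d :: nat
  assumes \<theta>: "\<theta> \<ge> 1" and \<kappa>: "\<kappa> \<ge> 0" and d: "d \<ge> 1" and \<mu>: "\<mu> > 33 * real d * \<theta> powr (11/2) * \<kappa>"
  defines "s \<equiv> sqrt \<theta> * \<mu>" and "Hc \<equiv> (\<theta> * mu1 \<theta> \<mu>)\<^sup>2 * exp (2 * \<mu> * sqrt \<theta>)"
  shows "0 < Cmu d \<theta> \<kappa> \<mu>" "0 < const_C d \<theta> \<kappa> \<mu>" "12 * Hc\<^sup>2 / Cmu d \<theta> \<kappa> \<mu> \<le> const_C d \<theta> \<kappa> \<mu>"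
    and "alpha0_tilde d \<theta> \<kappa> \<mu> \<le> \<alpha> \<Longrightarrow> 0 < \<alpha>"
    and "alpha0_tilde d \<theta> \<kappa> \<mu> \<le> \<alpha> \<Longrightarrow> s * exp s \<le> \<alpha> / 60"
    and "alpha0_tilde d \<theta> \<kappa> \<mu> \<le> \<alpha> \<Longrightarrow> \<theta>\<^sup>2 * \<bar>real d - 2\<bar> * exp s \<le> \<alpha> / 2"
proof -
  define m C K E where "m = mu1 \<theta> \<mu>" and "C = Cmu d \<theta> \<kappa> \<mu>" and "K = const_K d \<theta> \<kappa> \<mu>" and "E = CF d \<theta> \<kappa> \<mu>"
  have X: "0 \<le> 33 * real d * \<theta> powr (11/2) * \<kappa>" using \<kappa> by simp
  then have \<mu>0: "\<mu> > 0" using \<mu> by linarith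
  have C': "C = \<mu> - 33 * real d * \<theta> powr (11/2) * \<kappa>" by (simp add: C_def Cmu_def CM_def)
  have C: "0 < C" "C \<le> \<mu>" using \<mu> X unfolding C' by linarith+
  then show "0 < Cmu d \<theta> \<kappa> \<mu>" by (simp add: C_def)
  have s: "0 < s" using \<theta> \<mu>0 by (simp add: s_def)
  have m: "1 + s \<le> m" unfolding m_def s_def by (rule mu1_ge[OF \<theta> \<mu>0])
  have es: "exp (\<mu> * sqrt \<theta>) = exp s" "exp (2 * \<mu> * sqrt \<theta>) = (exp s)\<^sup>2" "exp (- 2 * \<mu> * sqrt \<theta>) = 1 / (exp s)\<^sup>2"
  proof -
    show e1: "exp (\<mu> * sqrt \<theta>) = exp s" by (simp add: s_def mult.commute)
    have ss: "2 * \<mu> * sqrt \<theta> = s + s" by (simp add: s_def)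
    show e2: "exp (2 * \<mu> * sqrt \<theta>) = (exp s)\<^sup>2" by (simp only: ss exp_add power2_eq_square)
    have "exp (- 2 * \<mu> * sqrt \<theta>) = 1 / exp (2 * \<mu> * sqrt \<theta>)" by (simp add: exp_minus inverse_eq_divide)
    then show "exp (- 2 * \<mu> * sqrt \<theta>) = 1 / (exp s)\<^sup>2" unfolding e2 .
  qed
  have es1: "1 + s \<le> exp s" by (rule exp_ge_add_one_self)
  have Hc: "Hc = \<theta>\<^sup>2 * m\<^sup>2 * (exp s)\<^sup>2" by (simp add: Hc_def m_def es power_mult_distrib)
  have Hr: "exp (- 2 * \<mu> * sqrt \<theta>) / (\<theta> * mu1 \<theta> \<mu>)\<^sup>2 = 1 / Hc"
    unfolding es Hc m_def[symmetric] by (simp add: power_mult_distrib mult.commute)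
  have \<theta>2: "1 \<le> \<theta>\<^sup>2" using \<theta> by (simp add: one_le_power)
  have H1: "(1 + s)^4 \<le> Hc"
  proof -
    have a: "(1 + s)\<^sup>2 \<le> m\<^sup>2" "(1 + s)\<^sup>2 \<le> (exp s)\<^sup>2" using m es1 s by (auto intro!: power_mono)
    have "(1 + s)^4 = 1 * (1 + s)\<^sup>2 * (1 + s)\<^sup>2" by (simp add: power4_eq_xxxx power2_eq_square)
    also have "\<dots> \<le> \<theta>\<^sup>2 * m\<^sup>2 * (exp s)\<^sup>2" using a \<theta>2 by (intro mult_mono) auto
    finally show ?thesis unfolding Hc .
  qed
  have H2: "1 \<le> Hc" using H1 s one_le_power[of "1 + s" 4] by linarith
  have sq\<theta>: "1 \<le> sqrt \<theta>" using \<theta> by simp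
  have K: "6 * \<mu> * m * exp s * \<theta>\<^sup>2 \<le> K" unfolding K_def const_K_def es m_def by simp
  have K0: "0 < 6 * \<mu> * m * exp s * \<theta>\<^sup>2" using \<mu>0 m s \<theta> by simp
  have Kp: "0 < K" using K K0 by linarith
  have E0: "exp s * \<bar>real d - 2\<bar> \<le> E"
  proof -
    have "0 \<le> sqrt \<theta> * (CF' d \<theta> \<kappa> + \<mu>)" using \<theta> \<kappa> \<mu>0 by (simp add: CF'_def)
    then show ?thesis unfolding E_def CF_def es by (intro mult_left_mono) auto
  qed
  have E1: "0 \<le> E" using E0 by (meson abs_ge_zero exp_ge_zero mult_nonneg_nonneg order_trans)
  have p: "const_p d \<theta> \<kappa> \<mu> = C / Hc" unfolding const_p_def Hr C_def by simp
  have K5: "const_K5 d \<theta> \<kappa> \<mu> = C / (2 * Hc)" unfolding const_K5_def Hr C_def by simp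
  have K1: "const_K1 d \<theta> \<kappa> \<mu> = K / 2 + Hc" unfolding const_K1_def K_def Hc_def ..
  have "const_C d \<theta> \<kappa> \<mu> = 12 * Hc * (K / 2 + Hc) / C" unfolding const_C_def C_tilde_def K5 K1 using H2 by simp
  moreover have "12 * Hc * Hc / C \<le> 12 * Hc * (K / 2 + Hc) / C" using H2 Kp C by (intro divide_right_mono mult_left_mono) auto
  ultimately show cc: "12 * Hc\<^sup>2 / Cmu d \<theta> \<kappa> \<mu> \<le> const_C d \<theta> \<kappa> \<mu>" unfolding C_def[symmetric] by (simp add: power2_eq_square)
  have "0 < 12 * Hc\<^sup>2 / Cmu d \<theta> \<kappa> \<mu>" using H2 C by (simp add: C_def)
  then show "0 < const_C d \<theta> \<kappa> \<mu>" using cc by linarith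
  have t1: "0 \<le> const_t1 d \<theta> \<kappa> \<mu>" unfolding const_t1_def K_def[symmetric] using Kp by simp
  have q: "K * sqrt \<theta> / 2 \<le> const_q d \<theta> \<kappa> \<mu>"
  proof -
    have "0 \<le> C * E * (1 / Hc)" using C E1 H2 by simp
    moreover have "0 \<le> K * const_t1 d \<theta> \<kappa> \<mu>" using Kp t1 by simp
    ultimately show ?thesis unfolding const_q_def Hr C_def[symmetric] E_def[symmetric] K_def[symmetric] distrib_left times_divide_eq_right by linarith
  qed
  have q0: "0 \<le> const_q d \<theta> \<kappa> \<mu>" using q Kp \<theta> by (meson divide_nonneg_pos less_imp_le mult_nonneg_nonneg order_trans real_sqrt_ge_zero zero_le_one zero_less_numeral)
  have r: "K * E\<^sup>2 * \<theta>\<^sup>2 / 2 \<le> const_r d \<theta> \<kappa> \<mu>"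
    unfolding const_r_def K_def[symmetric] E_def[symmetric] using Kp by (simp add: algebra_simps)
  define P Q R where "P = C / Hc" and "Q = const_q d \<theta> \<kappa> \<mu>" and "R = const_r d \<theta> \<kappa> \<mu>"
  have P0: "0 < P" using C H2 by (simp add: P_def)
  have R0: "0 \<le> R" using r Kp unfolding R_def by (meson divide_nonneg_pos less_imp_le mult_nonneg_nonneg order_trans zero_le_power2 zero_less_numeral)
  have Q0: "0 \<le> Q" using q0 by (simp add: Q_def)
  have KC: "6 * m * exp s * \<theta>\<^sup>2 * Hc \<le> K / P"
  proof -
    have "6 * m * exp s * \<theta>\<^sup>2 * C \<le> 6 * m * exp s * \<theta>\<^sup>2 * \<mu>" using C m s by (intro mult_left_mono) auto
    also have "\<dots> \<le> K" using K by (simp add: mult_ac)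
    finally show ?thesis using C H2 unfolding P_def by (simp add: field_simps)
  qed
  {
    assume "alpha0_tilde d \<theta> \<kappa> \<mu> \<le> \<alpha>"
    then have al: "Q / P + sqrt (Q\<^sup>2 / P\<^sup>2 + 2 * R / P) \<le> \<alpha>"
      unfolding alpha0_tilde_def alpha2_def p P_def[symmetric] Q_def[symmetric] R_def[symmetric] by simp
    have "sqrt ((Q / P)\<^sup>2) \<le> sqrt (Q\<^sup>2 / P\<^sup>2 + 2 * R / P)" using P0 R0 by (intro real_sqrt_le_mono) (simp add: power_divide)
    then have a1: "2 * (Q / P) \<le> \<alpha>" using al Q0 P0 by simp
    have a2: "sqrt (2 * R / P) \<le> \<alpha>"
    proof -
      have "sqrt (2 * R / P) \<le> sqrt (Q\<^sup>2 / P\<^sup>2 + 2 * R / P)" by (intro real_sqrt_le_mono) simp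
      moreover have "0 \<le> Q / P" using Q0 P0 by simp
      ultimately show ?thesis using al by linarith
    qed
    have "60 * (s * exp s) \<le> \<alpha>"
    proof -
      have "10 * s \<le> (1 + s)^5"
      proof -
        have "0 \<le> 10 * (s - 1/4)\<^sup>2" by simp
        then have "10 * s \<le> 1 + 5 * s + 10 * s\<^sup>2" by (simp add: power2_eq_square algebra_simps)
        also have "\<dots> \<le> 1 + 5 * s + 10 * s\<^sup>2 + 10 * s^3 + 5 * s^4 + s^5" using s by simp
        also have "\<dots> = (1 + s)^5" by (simp add: power2_eq_square power3_eq_cube power4_eq_xxxx eval_nat_numeral algebra_simps)
        finally show ?thesis .
      qed
      moreover have "(1 + s)^5 = (1 + s)^4 * (1 + s)" using power_add[of "1 + s" 4 1] by simp
      ultimately have p5: "10 * s \<le> (1 + s)^4 * (1 + s)" by simp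
      have "60 * (s * exp s) = 6 * exp s * (10 * s)" by simp
      also have "\<dots> \<le> 6 * exp s * ((1 + s)^4 * (1 + s))" by (rule mult_left_mono[OF p5]) simp
      also have "\<dots> = 6 * ((1 + s)^4 * (1 + s)) * exp s * 1" by (simp only: mult_ac mult_1_right)
      also have "\<dots> \<le> 6 * (Hc * m) * exp s * \<theta>\<^sup>2"
        using H1 m s \<theta>2 H2 by (intro mult_mono mult_nonneg_nonneg) auto
      also have "\<dots> = 6 * m * exp s * \<theta>\<^sup>2 * Hc" by simp
      also have "\<dots> \<le> K / P * 1" using KC by simp
      also have "\<dots> \<le> K / P * sqrt \<theta>" using Kp P0 sq\<theta> by (intro mult_left_mono) auto
      also have "\<dots> = 2 * (K * sqrt \<theta> / 2 / P)" by simp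
      also have "\<dots> \<le> 2 * (Q / P)" using q P0 unfolding Q_def by (intro mult_left_mono divide_right_mono) auto
      finally show ?thesis using a1 by linarith
    qed
    then show g1: "s * exp s \<le> \<alpha> / 60" by simp
    have "0 < s * exp s" using s by simp
    then show "0 < \<alpha>" using g1 by linarith
    have "2 * \<theta>\<^sup>2 * E \<le> sqrt (2 * R / P)"
    proof (rule real_le_rsqrt)
      have "(2 * \<theta>\<^sup>2 * E)\<^sup>2 = 4 * 1 * 1 * \<theta>\<^sup>2 * 1 * (E\<^sup>2 * \<theta>\<^sup>2)" by (simp add: power2_eq_square mult_ac)
      also have "\<dots> \<le> 6 * m * exp s * \<theta>\<^sup>2 * Hc * (E\<^sup>2 * \<theta>\<^sup>2)"
        using m s es1 H2 by (intro mult_right_mono mult_mono) auto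
      also have "\<dots> \<le> K / P * (E\<^sup>2 * \<theta>\<^sup>2)" by (rule mult_right_mono[OF KC]) simp
      also have "\<dots> = 2 * (K * E\<^sup>2 * \<theta>\<^sup>2 / 2) / P" by simp
      also have "\<dots> \<le> 2 * R / P" using r P0 unfolding R_def by (intro mult_left_mono divide_right_mono) auto
      finally show "(2 * \<theta>\<^sup>2 * E)\<^sup>2 \<le> 2 * R / P" .
    qed
    moreover have "2 * \<theta>\<^sup>2 * (exp s * \<bar>real d - 2\<bar>) \<le> 2 * \<theta>\<^sup>2 * E" by (rule mult_left_mono[OF E0]) simp
    ultimately have "2 * (\<theta>\<^sup>2 * \<bar>real d - 2\<bar> * exp s) \<le> \<alpha>" using a2 by (simp add: mult_ac)
    then show "\<theta>\<^sup>2 * \<bar>real d - 2\<bar> * exp s \<le> \<alpha> / 2" by simp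
  }
qed

section \<open>Lower-order terms\<close>

lemma grad_form_Complex:
  fixes M :: "real^'n^'n"
  shows "grad_form M (\<chi> i. Complex (p $ i) (q $ i)) = p \<bullet> (M *v p) + q \<bullet> (M *v q)"
  by (simp add: grad_form_def inner_vec_def matrix_vector_mult_def sum_distrib_left sum.distrib[symmetric] algebra_simps)

lemma grad_form_ge:
  fixes M :: "real^'n^'n"
  assumes \<theta>: "\<theta> \<ge> 1" and e: "elliptic \<theta> M"
  shows "(norm z)\<^sup>2 \<le> \<theta> * grad_form M z" "0 \<le> grad_form M z"
proof -
  define p q where "p = (\<chi> i. Re (z $ i))" and "q = (\<chi> i. Im (z $ i))"
  have z: "z = (\<chi> i. Complex (p $ i) (q $ i))" by (simp add: p_def q_def vec_eq_iff)
  have "(norm z)\<^sup>2 = (\<Sum>i\<in>UNIV. (norm (z $ i))\<^sup>2)" by (simp add: norm_vec_def L2_set_def sum_nonneg)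
  also have "\<dots> = (\<Sum>i\<in>UNIV. (p $ i)\<^sup>2) + (\<Sum>i\<in>UNIV. (q $ i)\<^sup>2)" by (simp add: p_def q_def cmod_power2 sum.distrib)
  also have "\<dots> = (norm p)\<^sup>2 + (norm q)\<^sup>2" by (simp add: norm_vec_def L2_set_def sum_nonneg)
  finally have n: "(norm z)\<^sup>2 = (norm p)\<^sup>2 + (norm q)\<^sup>2" .
  have b: "(norm v)\<^sup>2 \<le> \<theta> * (v \<bullet> (M *v v))" for v
  proof -
    have "inverse \<theta> * (norm v)\<^sup>2 \<le> v \<bullet> (M *v v)" using e by blast
    then have "\<theta> * (inverse \<theta> * (norm v)\<^sup>2) \<le> \<theta> * (v \<bullet> (M *v v))" using \<theta> by (intro mult_left_mono) auto
    moreover have "\<theta> * (inverse \<theta> * (norm v)\<^sup>2) = (norm v)\<^sup>2" using \<theta> by (subst mult.assoc[symmetric]) simp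
    ultimately show ?thesis by simp
  qed
  have g: "grad_form M z = p \<bullet> (M *v p) + q \<bullet> (M *v q)" by (subst z) (rule grad_form_Complex)
  show 1: "(norm z)\<^sup>2 \<le> \<theta> * grad_form M z" unfolding n g using b[of p] b[of q] by (simp add: distrib_left)
  have "0 \<le> \<theta> * grad_form M z" using order_trans[OF zero_le_power2 1] .
  then show "0 \<le> grad_form M z" using \<theta> by (simp add: zero_le_mult_iff)
qed

lemma norm_sum_mult_le:
  fixes b z :: "complex^'n"
  shows "norm (\<Sum>i\<in>UNIV. b $ i * z $ i) \<le> norm b * norm z"
proof -
  have "norm (\<Sum>i\<in>UNIV. b $ i * z $ i) \<le> (\<Sum>i\<in>UNIV. \<bar>norm (b $ i)\<bar> * \<bar>norm (z $ i)\<bar>)"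
    by (rule order_trans[OF norm_sum]) (simp add: norm_mult)
  also have "\<dots> \<le> L2_set (\<lambda>i. norm (b $ i)) UNIV * L2_set (\<lambda>i. norm (z $ i)) UNIV" by (rule L2_set_mult_ineq)
  finally show ?thesis by (simp add: norm_vec_def)
qed

lemma Linfty_norm_bound:
  assumes "in_Linfty (ball 0 \<rho>) f"
  shows "AE x in lborel. x \<in> ball 0 \<rho> \<longrightarrow> norm (f x) \<le> Linfty_norm (ball 0 \<rho>) f"
proof -
  let ?B = "ball (0::real^'n) \<rho>"
  have m: "(\<lambda>x. ereal (norm (f x))) \<in> borel_measurable (lebesgue_on ?B)" and fin: "ess_norm ?B f < \<infinity>"
    using assms by (auto simp: in_Linfty_def)
  have "AE x in lebesgue_on ?B. ereal (norm (f x)) \<le> ess_norm ?B f"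
    unfolding ess_norm_def by (rule esssup_AE)
  then have "AE x in lebesgue. x \<in> ?B \<longrightarrow> ereal (norm (f x)) \<le> ess_norm ?B f"
    by (subst (asm) AE_restrict_space_iff) auto
  then have "AE x in lborel. x \<in> ?B \<longrightarrow> ereal (norm (f x)) \<le> ess_norm ?B f" by (simp add: AE_completion_iff)
  then show ?thesis
  proof eventually_elim
    case (elim x)
    then show ?case using fin unfolding Linfty_norm_def by (cases "ess_norm ?B f") auto
  qed
qed

text \<open>The exponents of the weight differ by 1 and by 3, and the weight is at most \<open>sqrt \<theta>\<close>; this explains the powers of \<open>\<theta>\<close> in the two conditions on \<open>\<alpha>\<close>.\<close>

lemma lower_order_absorbed:
  fixes bx z :: "complex^'n" and v c u :: complex and M :: "real^'n^'n"
  assumes \<theta>: "\<theta> \<ge> 1" and e: "elliptic \<theta> M" and \<rho>: "\<rho> > 0" and w: "0 < w" "w \<le> sqrt \<theta>" and \<alpha>: "\<alpha> > 0" and C: "C > 0"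
    and b: "norm bx \<le> \<beta>" and c: "norm c \<le> \<gamma>"
    and \<alpha>b: "C * \<rho>\<^sup>2 * \<beta>\<^sup>2 * (\<theta> * sqrt \<theta>) \<le> \<alpha>" and \<alpha>c: "C * \<rho>^4 * \<gamma>\<^sup>2 * (\<theta> * sqrt \<theta>) \<le> \<alpha>^3"
  shows "w powr (2 - 2 * \<alpha>) * (norm v)\<^sup>2
     \<le> 3 * (w powr (2 - 2 * \<alpha>) * (norm (- v + (\<Sum>i\<in>UNIV. bx $ i * z $ i) + c * u))\<^sup>2)
      + 3 * (\<alpha> * \<rho>\<^sup>2 * w powr (1 - 2 * \<alpha>) * grad_form M z + \<alpha>^3 * w powr (- 1 - 2 * \<alpha>) * (norm u)\<^sup>2) / (C * \<rho>^4)"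
proof -
  define L where "L = - v + (\<Sum>i\<in>UNIV. bx $ i * z $ i) + c * u"
  define S where "S = (\<Sum>i\<in>UNIV. bx $ i * z $ i)"
  define W where "W = w powr (- 1 - 2 * \<alpha>)"
  define GF where "GF = grad_form M z"
  have GF: "(norm z)\<^sup>2 \<le> \<theta> * GF" "0 \<le> GF" unfolding GF_def by (rule grad_form_ge[OF \<theta> e])+
  have W0: "0 < W" using w by (simp add: W_def)
  have W2: "w powr (2 - 2 * \<alpha>) = w^3 * W" and W1: "w powr (1 - 2 * \<alpha>) = w\<^sup>2 * W"
  proof -
    have "w powr (2 - 2 * \<alpha>) = w powr (real 3 + (- 1 - 2 * \<alpha>))" "w powr (1 - 2 * \<alpha>) = w powr (real 2 + (- 1 - 2 * \<alpha>))" by simp_all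
    then show "w powr (2 - 2 * \<alpha>) = w^3 * W" "w powr (1 - 2 * \<alpha>) = w\<^sup>2 * W"
      using w unfolding powr_add W_def[symmetric] by (simp_all only: powr_realpow)
  qed
  have n: "norm v \<le> norm L + norm S + norm (c * u)"
  proof -
    have "v = S + c * u - L" by (simp add: L_def S_def)
    then have "norm v \<le> norm (S + c * u) + norm L" using norm_triangle_ineq4 by metis
    then show ?thesis using norm_triangle_ineq[of S "c * u"] by linarith
  qed
  have three: "(x + y + t)\<^sup>2 \<le> 3 * (x\<^sup>2 + y\<^sup>2 + t\<^sup>2)" for x y t :: real
    using zero_le_power2[of "x - y"] zero_le_power2[of "x - t"] zero_le_power2[of "y - t"] by (simp add: power2_eq_square algebra_simps)
  have nS: "(norm S)\<^sup>2 \<le> \<beta>\<^sup>2 * (\<theta> * GF)"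
  proof -
    have "norm S \<le> \<beta> * norm z" unfolding S_def by (rule order_trans[OF norm_sum_mult_le mult_right_mono[OF b]]) simp
    then have "(norm S)\<^sup>2 \<le> (\<beta> * norm z)\<^sup>2" by (rule power_mono) simp
    also have "\<dots> \<le> \<beta>\<^sup>2 * (\<theta> * GF)" unfolding power_mult_distrib by (rule mult_left_mono[OF GF(1)]) simp
    finally show ?thesis .
  qed
  have nc: "(norm (c * u))\<^sup>2 \<le> \<gamma>\<^sup>2 * (norm u)\<^sup>2"
    unfolding norm_mult power_mult_distrib using c by (intro mult_right_mono power_mono) auto
  have "(norm v)\<^sup>2 \<le> (norm L + norm S + norm (c * u))\<^sup>2" using n by (rule power_mono) simp
  also have "\<dots> \<le> 3 * ((norm L)\<^sup>2 + (norm S)\<^sup>2 + (norm (c * u))\<^sup>2)" by (rule three)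
  also have "\<dots> \<le> 3 * ((norm L)\<^sup>2 + \<beta>\<^sup>2 * (\<theta> * GF) + \<gamma>\<^sup>2 * (norm u)\<^sup>2)" using nS nc by simp
  finally have v: "(norm v)\<^sup>2 \<le> 3 * ((norm L)\<^sup>2 + \<beta>\<^sup>2 * (\<theta> * GF) + \<gamma>\<^sup>2 * (norm u)\<^sup>2)" .
  have M: "0 < C * \<rho>^4" using C \<rho> by simp
  have t1: "w * \<beta>\<^sup>2 * \<theta> \<le> \<alpha> * \<rho>\<^sup>2 / (C * \<rho>^4)"
  proof -
    have "w * \<beta>\<^sup>2 * \<theta> * (C * \<rho>^4) \<le> sqrt \<theta> * \<beta>\<^sup>2 * \<theta> * (C * \<rho>^4)" using w M \<theta> by (intro mult_right_mono) auto
    also have "\<dots> = \<rho>\<^sup>2 * (C * \<rho>\<^sup>2 * \<beta>\<^sup>2 * (\<theta> * sqrt \<theta>))" by (simp add: power4_eq_xxxx power2_eq_square)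
    also have "\<dots> \<le> \<rho>\<^sup>2 * \<alpha>" by (rule mult_left_mono[OF \<alpha>b]) simp
    finally show ?thesis using M by (simp add: pos_le_divide_eq mult.commute)
  qed
  have t2: "w^3 * \<gamma>\<^sup>2 \<le> \<alpha>^3 / (C * \<rho>^4)"
  proof -
    have "w^3 \<le> (sqrt \<theta>)^3" using w by (intro power_mono) auto
    also have "(sqrt \<theta>)^3 = \<theta> * sqrt \<theta>" using \<theta> by (simp add: power3_eq_cube)
    finally have "w^3 * \<gamma>\<^sup>2 * (C * \<rho>^4) \<le> \<theta> * sqrt \<theta> * \<gamma>\<^sup>2 * (C * \<rho>^4)" using M by (intro mult_right_mono) auto
    also have "\<dots> = C * \<rho>^4 * \<gamma>\<^sup>2 * (\<theta> * sqrt \<theta>)" by simp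
    finally show ?thesis using M \<alpha>c by (simp add: pos_le_divide_eq)
  qed
  have "w powr (2 - 2 * \<alpha>) * (norm v)\<^sup>2 \<le> w^3 * W * (3 * ((norm L)\<^sup>2 + \<beta>\<^sup>2 * (\<theta> * GF) + \<gamma>\<^sup>2 * (norm u)\<^sup>2))"
    unfolding W2 using w W0 by (intro mult_left_mono[OF v]) auto
  also have "\<dots> = 3 * (w^3 * W * (norm L)\<^sup>2) + 3 * ((w * \<beta>\<^sup>2 * \<theta>) * (w\<^sup>2 * W * GF) + (w^3 * \<gamma>\<^sup>2) * (W * (norm u)\<^sup>2))"
    by (simp add: algebra_simps power2_eq_square power3_eq_cube)
  also have "\<dots> \<le> 3 * (w^3 * W * (norm L)\<^sup>2) + 3 * ((\<alpha> * \<rho>\<^sup>2 / (C * \<rho>^4)) * (w\<^sup>2 * W * GF) + (\<alpha>^3 / (C * \<rho>^4)) * (W * (norm u)\<^sup>2))"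
    using t1 t2 W0 GF by (intro add_left_mono mult_left_mono add_mono mult_right_mono) auto
  also have "\<dots> = 3 * (w^3 * W * (norm L)\<^sup>2) + 3 * (\<alpha> * \<rho>\<^sup>2 * (w\<^sup>2 * W) * GF + \<alpha>^3 * W * (norm u)\<^sup>2) / (C * \<rho>^4)"
    by (simp add: add_divide_distrib distrib_left mult_ac)
  finally show ?thesis unfolding W2[symmetric] W1[symmetric] unfolding W_def GF_def L_def .
qed

text \<open>The last entry of \<^const>\<open>alpha0\<close> is the cube root of what absorbing the zeroth-order term requires.\<close>

lemma cube_root_threshold:
  assumes C: "C > 0" and \<rho>: "\<rho> > 0" and \<gamma>: "\<gamma> \<ge> 0" and \<theta>: "\<theta> \<ge> 1"
    and \<alpha>: "C powr (1/3) * \<rho> powr (4/3) * \<gamma> powr (2/3) * sqrt \<theta> \<le> \<alpha>"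
  shows "C * \<rho>^4 * \<gamma>\<^sup>2 * (\<theta> * sqrt \<theta>) \<le> \<alpha>^3"
proof -
  have cube: "(x powr t)^3 = x powr (3 * t)" for x t :: real
  proof -
    have "(x powr t)^3 = x powr (t + t + t)" by (simp only: powr_add power3_eq_cube)
    then show ?thesis by (simp only: add.assoc) (simp add: algebra_simps)
  qed
  have "(C powr (1/3) * \<rho> powr (4/3) * \<gamma> powr (2/3) * sqrt \<theta>)^3 = C powr 1 * \<rho> powr 4 * \<gamma> powr 2 * (sqrt \<theta>)^3"
    unfolding power_mult_distrib cube by simp
  also have "\<dots> = C * \<rho>^4 * \<gamma>\<^sup>2 * (\<theta> * sqrt \<theta>)" using C \<rho> \<gamma> \<theta> by (simp add: power3_eq_cube powr_numeral)
  finally have "C * \<rho>^4 * \<gamma>\<^sup>2 * (\<theta> * sqrt \<theta>) = (C powr (1/3) * \<rho> powr (4/3) * \<gamma> powr (2/3) * sqrt \<theta>)^3" ..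
  also have "\<dots> \<le> \<alpha>^3" using \<alpha> \<theta> by (intro power_mono) auto
  finally show ?thesis .
qed

lemma row_sum_norm_rows_le: "row_sum_norm M \<le> c \<Longrightarrow> rows_le c M"
proof
  fix i assume "row_sum_norm M \<le> c"
  moreover have "(\<Sum>j\<in>UNIV. \<bar>M $ i $ j\<bar>) \<le> row_sum_norm M" unfolding row_sum_norm_def by (rule Max_ge) auto
  ultimately show "(\<Sum>j\<in>UNIV. \<bar>M $ i $ j\<bar>) \<le> c" by simp
qed

section \<open>The principal part for complex functions\<close>

text \<open>The margin is taken twice, once for the mollification of the solution and once for the coefficients.\<close>

lemma compact_annulus:
  assumes K0: "compact K0" "K0 \<subseteq> ball 0 \<rho> - {0::real^'n}" and \<rho>: "\<rho> > 0"
  obtains \<delta> where "0 < \<delta>" "\<delta> \<le> \<rho>" "\<And>y. y \<in> K0 \<Longrightarrow> 2 * \<delta> \<le> norm y \<and> norm y \<le> \<rho> - 2 * \<delta>"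
proof (cases "K0 = {}")
  case True
  then show thesis using that[of \<rho>] \<rho> by simp
next
  case False
  have "continuous_on K0 (\<lambda>y. min (norm y) (\<rho> - norm y))" by (intro continuous_intros)
  from continuous_attains_inf[OF K0(1) False this]
  obtain z where z: "z \<in> K0" "\<And>y. y \<in> K0 \<Longrightarrow> min (norm z) (\<rho> - norm z) \<le> min (norm y) (\<rho> - norm y)" by blast
  define \<delta> where "\<delta> = min (norm z) (\<rho> - norm z) / 2"
  have "0 < norm z" "norm z < \<rho>" using z(1) K0(2) by auto
  then have "0 < \<delta>" unfolding \<delta>_def by simp
  moreover have "\<delta> \<le> \<rho>"
  proof -
    have "min (norm z) (\<rho> - norm z) \<le> \<rho> * 2"
      by (rule order_trans[OF min.cobounded1]) (use \<open>norm z < \<rho>\<close> \<rho> in linarith)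
    then show ?thesis unfolding \<delta>_def by simp
  qed
  moreover have "2 * \<delta> \<le> norm y \<and> norm y \<le> \<rho> - 2 * \<delta>" if "y \<in> K0" for y
    using z(2)[OF that] unfolding \<delta>_def by auto
  ultimately show thesis by (rule that)
qed

text \<open>The estimates for real and imaginary part are added. \<open>D\<close> and \<open>R\<close> are Borel functions standing for the two densities, which themselves involve
arbitrary representatives of weak derivatives.\<close>

lemma principal_part_estimate:
  fixes A :: "real^'n \<Rightarrow> real^'n^'n" and u :: "real^'n \<Rightarrow> complex" and \<rho> \<theta> \<theta>2 \<mu> \<alpha> :: real
  defines "wt \<equiv> weight A \<rho> \<mu>" and "s \<equiv> sqrt \<theta> * \<mu>"
    and "c \<equiv> \<mu> / \<rho> - 33 * (real CARD('n) * (\<theta>^5 * sqrt \<theta>) * \<theta>2)"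
    and "Hc \<equiv> (\<theta> * mu1 \<theta> \<mu>)\<^sup>2 * exp (2 * \<mu> * sqrt \<theta>)"
  assumes \<rho>: "\<rho> > 0" and \<theta>: "\<theta> \<ge> 1" and \<theta>2: "\<theta>2 \<ge> 0"
    and sA: "\<And>x. sym_mat (A x)" and eA: "\<And>x. x \<in> ball 0 \<rho> \<Longrightarrow> elliptic \<theta> (A x)"
    and lA: "\<And>x y. x \<in> ball 0 \<rho> \<Longrightarrow> y \<in> ball 0 \<rho> \<Longrightarrow> rows_le (\<theta>2 * norm (x - y)) (A x - A y)"
    and c: "c > 0" and \<alpha>: "\<alpha> > 0"
    and e: "s * exp s \<le> \<alpha> / 60" and b: "\<theta>\<^sup>2 * \<bar>real CARD('n) - 2\<bar> * exp s \<le> \<alpha> / 2"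
    and u: "in_W22 u" and supp: "ess_support u \<subseteq> ball 0 \<rho> - {0}"
  obtains D R :: "real^'n \<Rightarrow> real" where "integrable lborel D" "integrable lborel R"
    "(\<integral>x. D x \<partial>lborel) \<le> (2 * Hc\<^sup>2 * \<rho>^3 / c) * (\<integral>x. R x \<partial>lborel)"
    "\<And>x. x \<notin> ess_support u \<Longrightarrow> D x = 0 \<and> R x = 0"
    "AE x in lborel. x \<in> ess_support u \<longrightarrow>
       D x = \<alpha> * \<rho>\<^sup>2 * wt x powr (1 - 2 * \<alpha>) * grad_form (A x) (weak_grad UNIV u x) + \<alpha>^3 * wt x powr (- 1 - 2 * \<alpha>) * (norm (u x))\<^sup>2"
    "AE x in lborel. x \<in> ess_support u \<longrightarrow>
       R x = wt x powr (2 - 2 * \<alpha>) * (norm (weak_div (ball 0 \<rho>) (\<lambda>y. map_matrix complex_of_real (A y) *v weak_grad UNIV u y) x))\<^sup>2"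
proof -
  define K0 where "K0 = ess_support u"
  have clK: "closed K0" unfolding K0_def by (rule closed_ess_support)
  have K0: "compact K0" using supp bounded_subset[OF bounded_ball[of 0 \<rho>], of K0] clK by (auto simp: compact_eq_bounded_closed K0_def)
  have K0s: "K0 \<subseteq> ball 0 \<rho> - {0}" using supp by (simp add: K0_def)
  obtain \<delta> where \<delta>: "0 < \<delta>" "\<delta> \<le> \<rho>" "\<And>y. y \<in> K0 \<Longrightarrow> 2 * \<delta> \<le> norm y \<and> norm y \<le> \<rho> - 2 * \<delta>"
    by (rule compact_annulus[OF K0 K0s \<rho>]) (rule that)
  obtain g h where w: "\<And>i. has_weak_partial UNIV i u (g i)" "\<And>i j. has_weak_partial UNIV j (g i) (h i j)"
    and L2: "in_L2 u" "\<And>i. in_L2 (g i)" "\<And>i j. in_L2 (h i j)"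
    using u unfolding in_W22_def by blast
  have z: "AE x in lebesgue. x \<notin> K0 \<longrightarrow> u x = 0" unfolding K0_def by (rule AE_zero_off_ess_support)
  obtain Ur Gr Hr where r: "square_integrable_on K0 Ur" "\<And>k. square_integrable_on K0 (Gr k)" "\<And>k l. square_integrable_on K0 (Hr k l)"
    "weak_partials Ur Gr Hr" and rae: "AE x in lborel. Ur x = Re (u x) \<and> (\<forall>k. Gr k x = Re (g k x))"
    by (rule real_part_representatives[OF bounded_linear_Re clK L2 w z]) (rule that)
  obtain Ui Gi Hi where i: "square_integrable_on K0 Ui" "\<And>k. square_integrable_on K0 (Gi k)" "\<And>k l. square_integrable_on K0 (Hi k l)"
    "weak_partials Ui Gi Hi" and iae: "AE x in lborel. Ui x = Im (u x) \<and> (\<forall>k. Gi k x = Im (g k x))"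
    by (rule real_part_representatives[OF bounded_linear_Im clK L2 w z]) (rule that)
  obtain a da DA where
    a: "\<And>n k x. has_partial k (a n) (da n k x) x" "\<And>n. continuous_on UNIV (a n)" "\<And>n k. continuous_on UNIV (da n k)"
    "\<And>n x. x \<in> ball 0 \<rho> \<Longrightarrow> elliptic \<theta> (a n x)" "\<And>n x. sym_mat (a n x)"
    "\<And>n x. x \<in> ball 0 \<rho> \<Longrightarrow> \<delta> \<le> norm x \<Longrightarrow> rows_le (\<theta>2 * norm x) (a n x - A 0)"
    "\<And>n k x. sym_mat (da n k x)" "\<And>n k x. x \<in> ball 0 \<rho> \<Longrightarrow> rows_le \<theta>2 (da n k x)"
    "\<And>x. x \<in> ball 0 \<rho> \<Longrightarrow> (\<lambda>n. a n x) \<longlonglongrightarrow> A x"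
    "\<And>k i j. (\<lambda>x. DA k x $ i $ j :: real) \<in> borel_measurable borel"
    "AE x in lborel. x \<in> ball 0 \<rho> \<longrightarrow> (\<forall>k. (\<lambda>n. da n k x) \<longlonglongrightarrow> DA k x)"
    by (rule coefficient_approximation[where A = A and \<rho> = \<rho> and \<theta> = \<theta>, OF \<theta>2 \<delta>(1,2) sA eA lA]) (assumption | rule that)+
  define K where "K = cball 0 (\<rho> - \<delta>) - ball (0::real^'n) \<delta>"
  interpret re: approximated \<rho> \<theta> \<theta>2 \<delta> A a da DA K0 K Ur Gr Hr
    by (unfold_locales; (fact \<rho> \<theta> \<theta>2 \<delta>(1) a K_def K0 r | (rule \<delta>(3); assumption)))
  interpret im: approximated \<rho> \<theta> \<theta>2 \<delta> A a da DA K0 K Ui Gi Hi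
    by (unfold_locales; (fact \<rho> \<theta> \<theta>2 \<delta>(1) a K_def K0 i | (rule \<delta>(3); assumption)))
  have A0: "elliptic \<theta> (A 0)" "sym_mat (A 0)" using eA[of 0] sA[of 0] \<rho> by auto
  define Dr Di where "Dr x = \<alpha> * \<rho>\<^sup>2 * wt x powr (1 - 2 * \<alpha>) * (re.g x \<bullet> (A x *v re.g x)) + \<alpha>^3 * wt x powr (- 1 - 2 * \<alpha>) * (Ur x)\<^sup>2"
    and "Di x = \<alpha> * \<rho>\<^sup>2 * wt x powr (1 - 2 * \<alpha>) * (im.g x \<bullet> (A x *v im.g x)) + \<alpha>^3 * wt x powr (- 1 - 2 * \<alpha>) * (Ui x)\<^sup>2" for x
  define vr vi where "vr x = (\<Sum>k\<in>UNIV. (DA k x *v re.g x + A x *v re.h k x) $ k)"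
    and "vi x = (\<Sum>k\<in>UNIV. (DA k x *v im.g x + A x *v im.h k x) $ k)" for x
  define Rr Ri where "Rr x = wt x powr (2 - 2 * \<alpha>) * (vr x)\<^sup>2" and "Ri x = wt x powr (2 - 2 * \<alpha>) * (vi x)\<^sup>2" for x
  note cr = re.carleman_real[of \<mu> \<alpha>, folded wt_def s_def, folded c_def Hc_def, OF c \<alpha> A0 e b, folded vr_def, folded Dr_def Rr_def]
  note ci = im.carleman_real[of \<mu> \<alpha>, folded wt_def s_def, folded c_def Hc_def, OF c \<alpha> A0 e b, folded vi_def, folded Di_def Ri_def]
  have grad: "AE x in lborel. u x = Complex (Ur x) (Ui x) \<and> weak_grad UNIV u x = (\<chi> k. Complex (re.g x $ k) (im.g x $ k))"
  proof -
    have "AE x in lebesgue. x \<in> UNIV \<longrightarrow> weak_partial UNIV k u x = g k x" for k by (rule weak_partial_eq[OF open_UNIV w(1)])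
    then have "AE x in lborel. weak_partial UNIV k u x = g k x" for k by (simp add: AE_completion_iff)
    from eventually_all_finite[where P = "\<lambda>x k. weak_partial UNIV k u x = g k x", OF this] rae iae show ?thesis
    proof eventually_elim
      case (elim x)
      then show ?case by (simp add: weak_grad_def re.g_def im.g_def vec_eq_iff complex_eq_iff)
    qed
  qed
  have map_Complex: "(map_matrix complex_of_real M *v (\<chi> k. Complex (p $ k) (q $ k))) $ l = Complex ((M *v p) $ l) ((M *v q) $ l)"
    for M :: "real^'n^'n" and p q l
    by (simp add: matrix_vector_mult_def map_matrix_def complex_eq_iff)
  have div: "AE x in lborel. x \<in> ball 0 \<rho> \<longrightarrow> weak_div (ball 0 \<rho>) (\<lambda>y. map_matrix complex_of_real (A y) *v weak_grad UNIV u y) x = Complex (vr x) (vi x)"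
  proof -
    let ?F = "\<lambda>y. map_matrix complex_of_real (A y) *v weak_grad UNIV u y"
    define v where "v k x = Complex ((DA k x *v re.g x + A x *v re.h k x) $ k) ((DA k x *v im.g x + A x *v im.h k x) $ k)" for k x
    have "has_weak_partial (ball 0 \<rho>) k (\<lambda>y. ?F y $ k) (v k)" for k
    proof (rule has_weak_partial_Complex)
      show "AE x in lborel. ?F x $ k = Complex ((A x *v re.g x) $ k) ((A x *v im.g x) $ k)"
        using grad by eventually_elim (simp only: map_Complex)
      show "v k x = Complex ((DA k x *v re.g x + A x *v re.h k x) $ k) ((DA k x *v im.g x + A x *v im.h k x) $ k)" for x
        by (rule v_def)
    qed (rule re.product_weak_partial im.product_weak_partial, assumption?)+
    from weak_partial_eq[OF open_ball this]
    have "AE x in lborel. x \<in> ball 0 \<rho> \<longrightarrow> weak_partial (ball 0 \<rho>) k (\<lambda>y. ?F y $ k) x = v k x" for k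
      by (simp add: AE_completion_iff)
    from eventually_all_finite[where P = "\<lambda>x k. x \<in> ball 0 \<rho> \<longrightarrow> weak_partial (ball 0 \<rho>) k (\<lambda>y. ?F y $ k) x = v k x", OF this] show ?thesis
    proof eventually_elim
      case (elim x)
      then show ?case by (simp add: weak_div_def vr_def vi_def v_def complex_eq_iff)
    qed
  qed
  show thesis
  proof (rule that[of "\<lambda>x. Dr x + Di x" "\<lambda>x. Rr x + Ri x"])
    show "integrable lborel (\<lambda>x. Dr x + Di x)" "integrable lborel (\<lambda>x. Rr x + Ri x)"
      by (rule Bochner_Integration.integrable_add[OF cr(1) ci(1)] Bochner_Integration.integrable_add[OF cr(2) ci(2)])+
    have "(\<integral>x. Dr x + Di x \<partial>lborel) = (\<integral>x. Dr x \<partial>lborel) + (\<integral>x. Di x \<partial>lborel)"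
      by (rule Bochner_Integration.integral_add[OF cr(1) ci(1)])
    moreover have "(\<integral>x. Rr x + Ri x \<partial>lborel) = (\<integral>x. Rr x \<partial>lborel) + (\<integral>x. Ri x \<partial>lborel)"
      by (rule Bochner_Integration.integral_add[OF cr(2) ci(2)])
    ultimately show "(\<integral>x. Dr x + Di x \<partial>lborel) \<le> (2 * Hc\<^sup>2 * \<rho>^3 / c) * (\<integral>x. Rr x + Ri x \<partial>lborel)"
      using cr(3) ci(3) by (simp only: distrib_left)
    show "Dr x + Di x = 0 \<and> Rr x + Ri x = 0" if "x \<notin> ess_support u" for x
    proof -
      have x: "x \<notin> K0" using that by (simp add: K0_def)
      then have "Ur x = 0" "Ui x = 0" "re.g x = 0" "im.g x = 0" "re.h k x = 0" "im.h k x = 0" for k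
        using r i by (auto simp: square_integrable_on_def re.g_def im.g_def re.h_def im.h_def vec_eq_iff)
      then show ?thesis by (simp add: Dr_def Di_def Rr_def Ri_def vr_def vi_def)
    qed
    show "AE x in lborel. x \<in> ess_support u \<longrightarrow>
       Dr x + Di x = \<alpha> * \<rho>\<^sup>2 * wt x powr (1 - 2 * \<alpha>) * grad_form (A x) (weak_grad UNIV u x) + \<alpha>^3 * wt x powr (- 1 - 2 * \<alpha>) * (norm (u x))\<^sup>2"
      using grad
    proof eventually_elim
      case (elim x)
      have 1: "grad_form (A x) (weak_grad UNIV u x) = re.g x \<bullet> (A x *v re.g x) + im.g x \<bullet> (A x *v im.g x)"
        by (simp only: elim grad_form_Complex)
      have 2: "(norm (u x))\<^sup>2 = (Ur x)\<^sup>2 + (Ui x)\<^sup>2" by (simp add: elim cmod_power2)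
      show ?case unfolding Dr_def Di_def 1 2 by (simp only: distrib_left add_ac simp_thms)
    qed
    show "AE x in lborel. x \<in> ess_support u \<longrightarrow>
       Rr x + Ri x = wt x powr (2 - 2 * \<alpha>) * (norm (weak_div (ball 0 \<rho>) (\<lambda>y. map_matrix complex_of_real (A y) *v weak_grad UNIV u y) x))\<^sup>2"
      using div
    proof eventually_elim
      case (elim x)
      show ?case
      proof
        assume "x \<in> ess_support u"
        then have "x \<in> ball 0 \<rho>" using supp by blast
        with elim show "Rr x + Ri x = wt x powr (2 - 2 * \<alpha>) * (norm (weak_div (ball 0 \<rho>) (\<lambda>y. map_matrix complex_of_real (A y) *v weak_grad UNIV u y) x))\<^sup>2"
          by (simp add: Rr_def Ri_def cmod_power2 distrib_left)
      qed
    qed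
  qed
qed

section \<open>The Carleman estimate\<close>

theorem theorem2p1:
  fixes \<rho> \<theta>1 \<theta>2 \<mu> :: real
    and A :: "real^'n \<Rightarrow> real^'n^'n"
    and b :: "real^'n \<Rightarrow> complex^'n"
    and c :: "real^'n \<Rightarrow> complex"
  assumes "\<rho> > 0" and "\<theta>1 \<ge> 1" and "\<theta>2 \<ge> 0"
    and "assumption_A \<rho> \<theta>1 \<theta>2 A b c"
    and "\<mu> > 33 * real CARD('n) * \<theta>1 powr (11/2) * \<theta>2 * \<rho>"
  shows "const_C CARD('n) \<theta>1 (\<rho> * \<theta>2) \<mu> > 0 \<and>
    (\<forall>\<alpha> \<ge> alpha0 CARD('n) \<rho> \<theta>1 \<theta>2 \<mu> (Linfty_norm (ball 0 \<rho>) b) (Linfty_norm (ball 0 \<rho>) c).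
     \<forall>u :: real^'n \<Rightarrow> complex. in_W22 u \<and> ess_support u \<subseteq> ball 0 \<rho> - {0} \<longrightarrow>
       (\<integral>\<^sup>+ x \<in> ess_support u. ennreal
           (\<alpha> * \<rho>\<^sup>2 * weight A \<rho> \<mu> x powr (1 - 2 * \<alpha>) * grad_form (A x) (weak_grad UNIV u x)
            + \<alpha> ^ 3 * weight A \<rho> \<mu> x powr (- 1 - 2 * \<alpha>) * (norm (u x))\<^sup>2) \<partial>lebesgue)
       \<le> ennreal (const_C CARD('n) \<theta>1 (\<rho> * \<theta>2) \<mu> * \<rho> ^ 4) *
         (\<integral>\<^sup>+ x \<in> ess_support u. ennreal
           (weight A \<rho> \<mu> x powr (2 - 2 * \<alpha>) * (norm (L_op \<rho> A b c u x))\<^sup>2) \<partial>lebesgue))"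
proof (intro conjI allI impI)
  note \<rho> = assms(1) and \<theta> = assms(2) and \<theta>2 = assms(3)
  have \<kappa>: "\<rho> * \<theta>2 \<ge> 0" using \<rho> \<theta>2 by simp
  have d: "1 \<le> CARD('n)" by (simp add: Suc_leI)
  have \<mu>: "\<mu> > 33 * real CARD('n) * \<theta>1 powr (11/2) * (\<rho> * \<theta>2)" using assms(5) by (simp add: mult_ac)
  define C where "C = const_C CARD('n) \<theta>1 (\<rho> * \<theta>2) \<mu>"
  define M where "M = C * \<rho>^4"
  define \<beta> \<gamma> where "\<beta> = Linfty_norm (ball 0 \<rho>) b" and "\<gamma> = Linfty_norm (ball 0 \<rho>) c"
  note k = constants_bounds[OF \<theta> \<kappa> d \<mu>]
  show C0: "const_C CARD('n) \<theta>1 (\<rho> * \<theta>2) \<mu> > 0" by (rule k(2))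
  then have C: "0 < C" by (simp add: C_def)
  have M0: "0 < M" using C \<rho> by (simp add: M_def)
  define Hc where "Hc = (\<theta>1 * mu1 \<theta>1 \<mu>)\<^sup>2 * exp (2 * \<mu> * sqrt \<theta>1)"
  define c0 where "c0 = \<mu> / \<rho> - 33 * (real CARD('n) * (\<theta>1^5 * sqrt \<theta>1) * \<theta>2)"
  have c0: "Cmu CARD('n) \<theta>1 (\<rho> * \<theta>2) \<mu> = \<rho> * c0"
    using \<rho> by (simp add: Cmu_def CM_def c0_def powr_half_integers(1)[OF \<theta>] right_diff_distrib)
  have c0p: "0 < c0" using k(1) \<rho> unfolding c0 by (simp add: zero_less_mult_iff)
  have Cst: "2 * Hc\<^sup>2 * \<rho>^3 / c0 \<le> M / 6"
  proof -
    have "2 * Hc\<^sup>2 * \<rho>^3 / c0 = \<rho>^4 / 6 * (12 * Hc\<^sup>2 / (\<rho> * c0))"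
      using \<rho> c0p by (simp add: field_simps power4_eq_xxxx power3_eq_cube)
    also have "\<dots> \<le> \<rho>^4 / 6 * C" using k(3) unfolding c0 Hc_def[symmetric] C_def[symmetric] by (intro mult_left_mono) auto
    finally show ?thesis by (simp add: M_def mult.commute)
  qed
  have sA: "sym_mat (A x)" for x using assms(4) by (simp add: assumption_A_def)
  have eA: "elliptic \<theta>1 (A x)" if "x \<in> ball 0 \<rho>" for x using assms(4) that unfolding assumption_A_def by blast
  have lA: "rows_le (\<theta>2 * norm (x - y)) (A x - A y)" if "x \<in> ball 0 \<rho>" "y \<in> ball 0 \<rho>" for x y
    by (rule row_sum_norm_rows_le) (use assms(4) that in \<open>unfold assumption_A_def, blast\<close>)
  have A0: "elliptic \<theta>1 (A 0)" "sym_mat (A 0)" using eA[of 0] sA[of 0] \<rho> by auto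
  have bae: "AE x in lborel. x \<in> ball 0 \<rho> \<longrightarrow> norm (b x) \<le> \<beta>" and cae: "AE x in lborel. x \<in> ball 0 \<rho> \<longrightarrow> norm (c x) \<le> \<gamma>"
    unfolding \<beta>_def \<gamma>_def by (rule Linfty_norm_bound; use assms(4) in \<open>simp add: assumption_A_def\<close>)+
  fix \<alpha> :: real and u :: "real^'n \<Rightarrow> complex"
  assume \<alpha>0: "alpha0 CARD('n) \<rho> \<theta>1 \<theta>2 \<mu> (Linfty_norm (ball 0 \<rho>) b) (Linfty_norm (ball 0 \<rho>) c) \<le> \<alpha>"
    and u: "in_W22 u \<and> ess_support u \<subseteq> ball 0 \<rho> - {0}"
  have a1: "alpha0_tilde CARD('n) \<theta>1 (\<rho> * \<theta>2) \<mu> \<le> \<alpha>"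
    and a2: "C * \<rho>\<^sup>2 * \<beta>\<^sup>2 * (\<theta>1 * sqrt \<theta>1) \<le> \<alpha>"
    and a3: "C powr (1/3) * \<rho> powr (4/3) * \<gamma> powr (2/3) * sqrt \<theta>1 \<le> \<alpha>"
    using \<alpha>0 unfolding alpha0_def powr_half_integers(2)[OF \<theta>] C_def[symmetric] \<beta>_def[symmetric] \<gamma>_def[symmetric] by simp_all
  note ka = k(4)[OF a1] k(5)[OF a1] k(6)[OF a1]
  define S where "S = ess_support u"
  have S: "S \<subseteq> ball 0 \<rho> - {0}" using u by (simp add: S_def)
  define wt where "wt = weight A \<rho> \<mu>"
  define dens where "dens x = \<alpha> * \<rho>\<^sup>2 * wt x powr (1 - 2 * \<alpha>) * grad_form (A x) (weak_grad UNIV u x) + \<alpha>^3 * wt x powr (- 1 - 2 * \<alpha>) * (norm (u x))\<^sup>2" for x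
  define v where "v = weak_div (ball 0 \<rho>) (\<lambda>y. map_matrix complex_of_real (A y) *v weak_grad UNIV u y)"
  define F where "F x = wt x powr (2 - 2 * \<alpha>) * (norm (L_op \<rho> A b c u x))\<^sup>2" for x
  obtain D R :: "real^'n \<Rightarrow> real" where D: "integrable lborel D" and R: "integrable lborel R"
    and DR: "(\<integral>x. D x \<partial>lborel) \<le> (2 * Hc\<^sup>2 * \<rho>^3 / c0) * (\<integral>x. R x \<partial>lborel)"
    and off: "\<And>x. x \<notin> ess_support u \<Longrightarrow> D x = 0 \<and> R x = 0"
    and Dae: "AE x in lborel. x \<in> ess_support u \<longrightarrow>
       D x = \<alpha> * \<rho>\<^sup>2 * weight A \<rho> \<mu> x powr (1 - 2 * \<alpha>) * grad_form (A x) (weak_grad UNIV u x) + \<alpha>^3 * weight A \<rho> \<mu> x powr (- 1 - 2 * \<alpha>) * (norm (u x))\<^sup>2"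
    and Rae: "AE x in lborel. x \<in> ess_support u \<longrightarrow>
       R x = weight A \<rho> \<mu> x powr (2 - 2 * \<alpha>) * (norm (weak_div (ball 0 \<rho>) (\<lambda>y. map_matrix complex_of_real (A y) *v weak_grad UNIV u y) x))\<^sup>2"
    by (rule principal_part_estimate[where A = A and u = u and \<rho> = \<rho> and \<theta> = \<theta>1 and ?\<theta>2.0 = \<theta>2 and \<mu> = \<mu> and \<alpha> = \<alpha>,
          OF \<rho> \<theta> \<theta>2 sA eA lA c0p[unfolded c0_def] ka conjunct1[OF u] conjunct2[OF u], folded c0_def Hc_def])
       (assumption | rule that)+
  note Dae = Dae[folded wt_def, folded dens_def, folded S_def] and Rae = Rae[folded wt_def, folded v_def, folded S_def] and off = off[folded S_def]
  have \<mu>0: "\<mu> > 0"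
  proof -
    have "0 \<le> 33 * real CARD('n) * \<theta>1 powr (11/2) * (\<rho> * \<theta>2)" using \<kappa> by simp
    then show ?thesis using \<mu> by linarith
  qed
  have w: "0 < wt x" "wt x \<le> sqrt \<theta>1" if "x \<in> S" for x
  proof -
    have x: "x \<noteq> 0" "norm x \<le> \<rho>" using that S by auto
    note wb = weight_bounds[where A = A, OF \<theta> A0 x \<rho> \<mu>0]
    show "0 < wt x" "wt x \<le> sqrt \<theta>1" unfolding wt_def using wb(1) order_trans[OF wb(2) wb(4)] by auto
  qed
  have dens0: "0 \<le> dens x" if "x \<in> S" for x
  proof -
    have "x \<in> ball 0 \<rho>" using that S by blast
    from grad_form_ge(2)[OF \<theta> eA[OF this]] show ?thesis using ka(1) unfolding dens_def by simp
  qed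
  have absorb: "AE x in lborel. x \<in> S \<longrightarrow> R x \<le> 3 * F x + 3 * D x / M"
    using Dae Rae bae cae
  proof eventually_elim
    case (elim x)
    show ?case
    proof
      assume x: "x \<in> S"
      then have xb: "x \<in> ball 0 \<rho>" using S by blast
      have bx: "norm (b x) \<le> \<beta>" and cx: "norm (c x) \<le> \<gamma>" using elim xb by blast+
      have g0: "0 \<le> \<gamma>" using cx norm_ge_zero order_trans by blast
      note a3' = cube_root_threshold[OF C \<rho> g0 \<theta> a3]
      have L: "L_op \<rho> A b c u x = - v x + (\<Sum>i\<in>UNIV. b x $ i * weak_grad UNIV u x $ i) + c x * u x"
        by (simp add: L_op_def v_def)
      have "wt x powr (2 - 2 * \<alpha>) * (norm (v x))\<^sup>2 \<le> 3 * F x + 3 * dens x / M"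
        unfolding F_def L dens_def M_def
        by (rule lower_order_absorbed[OF \<theta> eA[OF xb] \<rho> w[OF x] ka(1) C bx cx a2 a3'])
      then show "R x \<le> 3 * F x + 3 * D x / M" using elim x by simp
    qed
  qed
  \<comment> \<open>A measurable lower bound of the right-hand density. The operator is built from arbitrary representatives, so its
      density is only compared with \<open>f\<close> and never integrated by the rules for measurable functions.\<close>
  define f where "f x = max 0 ((R x - 3 * D x / M) / 3)" for x
  have fi: "integrable lborel f" unfolding f_def[abs_def] using D R by (intro integrable_max) auto
  have fF: "AE x in lborel. ennreal (f x) \<le> ennreal (F x) * indicator S x"
    using absorb
  proof eventually_elim
    case (elim x)
    show ?case
    proof (cases "x \<in> S")
      case True
      have "0 \<le> F x" by (simp add: F_def)
      then have "f x \<le> F x" using elim True by (simp add: f_def)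
      then show ?thesis using True by (simp add: ennreal_leI)
    next
      case False
      then show ?thesis using off[OF False] by (simp add: f_def)
    qed
  qed
  have D0: "AE x in lborel. 0 \<le> D x" using Dae
  proof eventually_elim
    case (elim x)
    then show ?case using dens0[of x] off[of x] by (cases "x \<in> S") auto
  qed
  have ID: "(\<integral>x. D x \<partial>lborel) \<le> M * (\<integral>x. f x \<partial>lborel)"
  proof -
    have Rf: "(\<integral>x. R x \<partial>lborel) \<le> (\<integral>x. 3 * f x + 3 / M * D x \<partial>lborel)"
    proof (rule integral_mono[OF R])
      show "integrable lborel (\<lambda>x. 3 * f x + 3 / M * D x)" using fi D by (intro Bochner_Integration.integrable_add integrable_mult_right)
      fix x
      have "(R x - 3 * D x / M) / 3 \<le> f x" by (simp add: f_def)
      then show "R x \<le> 3 * f x + 3 / M * D x" by (simp add: field_simps)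
    qed
    also have "\<dots> = 3 * (\<integral>x. f x \<partial>lborel) + 3 / M * (\<integral>x. D x \<partial>lborel)" using fi D by simp
    finally have Rf: "(\<integral>x. R x \<partial>lborel) \<le> 3 * (\<integral>x. f x \<partial>lborel) + 3 / M * (\<integral>x. D x \<partial>lborel)" .
    have "0 \<le> (\<integral>x. 3 * f x + 3 / M * D x \<partial>lborel)"
    proof (rule integral_nonneg_AE)
      show "AE x in lborel. 0 \<le> 3 * f x + 3 / M * D x" using D0
      proof eventually_elim
        case (elim x)
        then show ?case using M0 by (simp add: f_def)
      qed
    qed
    then have n0: "0 \<le> 3 * (\<integral>x. f x \<partial>lborel) + 3 / M * (\<integral>x. D x \<partial>lborel)" using fi D by simp
    have Hn: "0 \<le> 2 * Hc\<^sup>2 * \<rho>^3 / c0" using \<rho> c0p by simp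
    have "(\<integral>x. D x \<partial>lborel) \<le> (2 * Hc\<^sup>2 * \<rho>^3 / c0) * (3 * (\<integral>x. f x \<partial>lborel) + 3 / M * (\<integral>x. D x \<partial>lborel))"
      by (rule order_trans[OF DR mult_left_mono[OF Rf Hn]])
    also have "\<dots> \<le> M / 6 * (3 * (\<integral>x. f x \<partial>lborel) + 3 / M * (\<integral>x. D x \<partial>lborel))"
      by (rule mult_right_mono[OF Cst n0])
    also have "\<dots> = M / 2 * (\<integral>x. f x \<partial>lborel) + 1 / 2 * (\<integral>x. D x \<partial>lborel)" using M0 by (simp add: field_simps)
    finally show ?thesis by (simp add: field_simps)
  qed
  have "(\<integral>\<^sup>+ x \<in> S. ennreal (dens x) \<partial>lebesgue) = (\<integral>\<^sup>+ x. ennreal (D x) \<partial>lborel)"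
    unfolding nn_integral_completion
  proof (rule nn_integral_cong_AE)
    show "AE x in lborel. ennreal (dens x) * indicator S x = ennreal (D x)" using Dae
    proof eventually_elim
      case (elim x)
      then show ?case using off[of x] by (cases "x \<in> S") auto
    qed
  qed
  also have "\<dots> = ennreal (\<integral>x. D x \<partial>lborel)" by (rule nn_integral_eq_integral[OF D D0])
  also have "\<dots> \<le> ennreal (M * (\<integral>x. f x \<partial>lborel))" by (rule ennreal_leI[OF ID])
  also have "\<dots> = ennreal M * ennreal (\<integral>x. f x \<partial>lborel)" using M0 by (simp add: ennreal_mult')
  also have "ennreal (\<integral>x. f x \<partial>lborel) = (\<integral>\<^sup>+ x. ennreal (f x) \<partial>lborel)"
    by (rule nn_integral_eq_integral[OF fi, symmetric]) (simp add: f_def)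
  also have "ennreal M * (\<integral>\<^sup>+ x. ennreal (f x) \<partial>lborel) \<le> ennreal M * (\<integral>\<^sup>+ x \<in> S. ennreal (F x) \<partial>lebesgue)"
    unfolding nn_integral_completion by (intro mult_left_mono nn_integral_mono_AE fF) simp
  finally show "(\<integral>\<^sup>+ x \<in> ess_support u. ennreal
           (\<alpha> * \<rho>\<^sup>2 * weight A \<rho> \<mu> x powr (1 - 2 * \<alpha>) * grad_form (A x) (weak_grad UNIV u x)
            + \<alpha> ^ 3 * weight A \<rho> \<mu> x powr (- 1 - 2 * \<alpha>) * (norm (u x))\<^sup>2) \<partial>lebesgue)
       \<le> ennreal (const_C CARD('n) \<theta>1 (\<rho> * \<theta>2) \<mu> * \<rho> ^ 4) *
         (\<integral>\<^sup>+ x \<in> ess_support u. ennreal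
           (weight A \<rho> \<mu> x powr (2 - 2 * \<alpha>) * (norm (L_op \<rho> A b c u x))\<^sup>2) \<partial>lebesgue)"
    unfolding dens_def F_def wt_def S_def M_def C_def .
qed

end
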